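(* For each $n \in \mathbb{N}$ let $p_n \in \mathbb{N}$ with $p_n \to \infty$ as $n \to \infty$, and let $x_1, \ldots, x_n$ be a random sample from $\mathcal{N}_{p_n}(\mu_n, \Sigma_n)$, where $\mu_n \in \mathbb{R}^{p_n}$ and $\Sigma_n \in \mathbb{R}^{p_n \times p_n}$ is positive definite. Let $d \geq 1$ be a fixed integer (not depending on $n$) and $\sigma^2 > 0$ a fixed constant, and assume that the eigenvalues of $\Sigma_n$ are $\lambda_{n1} \geq \cdots \geq \lambda_{nd} > \sigma^2 = \cdots = \sigma^2$ (i.e. the $p_n - d$ smallest eigenvalues all equal $\sigma^2$), with $\lambda_{nk} \to \infty$ as $n \to \infty$ for each $k = 1, \ldots, d$. Let $S_n$ be the sample covariance matrix of $x_1, \ldots, x_n$ and define $$T_{n,j} := \frac{m_{2,p_n-j}(S_n)}{m_{1,p_n-j}(S_n)^2} - 1 .$$ Suppose that, as $n \to \infty$, either (i) $p_n/n \to 0$, or (ii) $p_n/n \to \infty$ and $p_n/(n\sqrt{\lambda_{nd}}) \to 0$. Then $$(n-d-1)\,T_{n,d} - (p_n - d) \rightsquigarrow \mathcal{N}(1,4)$$ as $n \to \infty$, where $\rightsquigarrow$ denotes convergence in distribution.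
   Context: For a symmetric $p \times p$ matrix $A$ with eigenvalues $\phi_1(A) \geq \cdots \geq \phi_p(A)$ and $1 \leq r \leq p$, $m_{\ell,r}(A) := \frac{1}{r}\sum_{i=p-r+1}^{p} \phi_i(A)^\ell$ denotes the $\ell$th sample moment of the $r$ smallest eigenvalues of $A$. The sample covariance matrix is $S_n = \frac{1}{n-1}\sum_{i=1}^n (x_i - \bar{x})(x_i - \bar{x})'$ with $\bar{x}$ the sample mean. $\mathcal{N}(1,4)$ is the normal distribution with mean 1 and variance 4. *)

theory Defs
  imports "HOL-Probability.Probability" "Jordan_Normal_Form.Char_Poly"
begin

text \<open>Conventions. Dimensions vary with n, so vectors in R^p are represented as
  functions nat => real (only indices < p matter) and p x p matrices as
  functions nat => nat => real (only indices < p matter).\<close>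

definition to_mat :: "nat \<Rightarrow> (nat \<Rightarrow> nat \<Rightarrow> real) \<Rightarrow> real mat" where
  "to_mat p A = mat p p (\<lambda>(i, j). A i j)"

definition symmetric_mat :: "nat \<Rightarrow> (nat \<Rightarrow> nat \<Rightarrow> real) \<Rightarrow> bool" where
  "symmetric_mat p A \<longleftrightarrow> (\<forall>i<p. \<forall>j<p. A i j = A j i)"

definition quad_form :: "nat \<Rightarrow> (nat \<Rightarrow> nat \<Rightarrow> real) \<Rightarrow> (nat \<Rightarrow> real) \<Rightarrow> real" where
  "quad_form p A a = (\<Sum>i<p. \<Sum>j<p. a i * A i j * a j)"

definition pos_def_mat :: "nat \<Rightarrow> (nat \<Rightarrow> nat \<Rightarrow> real) \<Rightarrow> bool" where
  "pos_def_mat p A \<longleftrightarrow> symmetric_mat p A \<and>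
     (\<forall>a. (\<exists>i<p. a i \<noteq> 0) \<longrightarrow> quad_form p A a > 0)"

text \<open>Eigenvalues (with multiplicity) of a p x p real matrix whose characteristic
  polynomial splits over the reals (e.g. a symmetric matrix), listed in
  decreasing order: phi_1(A) >= ... >= phi_p(A).  phi_i(A) = eigs_desc p A ! (i-1).\<close>

definition eigs_desc :: "nat \<Rightarrow> (nat \<Rightarrow> nat \<Rightarrow> real) \<Rightarrow> real list" where
  "eigs_desc p A = (THE xs. length xs = p \<and> sorted_wrt (\<ge>) xs \<and>
      char_poly (to_mat p A) = (\<Prod>x\<leftarrow>xs. [:-x, 1:]))"

definition moment_smallest :: "nat \<Rightarrow> nat \<Rightarrow> nat \<Rightarrow> (nat \<Rightarrow> nat \<Rightarrow> real) \<Rightarrow> real" where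
  "moment_smallest l r p A = (1 / real r) * (\<Sum>i\<in>{p-r+1..p}. (eigs_desc p A ! (i - 1)) ^ l)"

definition sample_mean :: "nat \<Rightarrow> (nat \<Rightarrow> nat \<Rightarrow> real) \<Rightarrow> nat \<Rightarrow> real" where
  "sample_mean n x k = (1 / real n) * (\<Sum>t<n. x t k)"

definition sample_cov :: "nat \<Rightarrow> (nat \<Rightarrow> nat \<Rightarrow> real) \<Rightarrow> nat \<Rightarrow> nat \<Rightarrow> real" where
  "sample_cov n x i j = (1 / (real n - 1)) *
     (\<Sum>t<n. (x t i - sample_mean n x i) * (x t j - sample_mean n x j))"

text \<open>A random vector Y (coordinates Y k, k < p) on a probability space M follows
  N_p(mu, Sig) (Sig positive definite): every nontrivial linear combination
  a'Y is normally distributed with mean a'mu and variance a'Sig a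
  (Cramer--Wold definition of the multivariate normal distribution).\<close>

definition mvnormal ::
  "'a measure \<Rightarrow> nat \<Rightarrow> (nat \<Rightarrow> real) \<Rightarrow> (nat \<Rightarrow> nat \<Rightarrow> real) \<Rightarrow> ('a \<Rightarrow> nat \<Rightarrow> real) \<Rightarrow> bool"
where
  "mvnormal M p mu Sig Y \<longleftrightarrow>
     (\<forall>k<p. (\<lambda>\<omega>. Y \<omega> k) \<in> borel_measurable M) \<and>
     (\<forall>a. (\<exists>i<p. a i \<noteq> 0) \<longrightarrow>
        distributed M lborel (\<lambda>\<omega>. \<Sum>k<p. a k * Y \<omega> k)
          (normal_density (\<Sum>k<p. a k * mu k) (sqrt (quad_form p Sig a))))"

definition normal_sample ::
  "'a measure \<Rightarrow> nat \<Rightarrow> nat \<Rightarrow> (nat \<Rightarrow> real) \<Rightarrow> (nat \<Rightarrow> nat \<Rightarrow> real) \<Rightarrow> (nat \<Rightarrow> 'a \<Rightarrow> nat \<Rightarrow> real) \<Rightarrow> bool"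
where
  "normal_sample M n p mu Sig X \<longleftrightarrow>
     (\<forall>t<n. mvnormal M p mu Sig (X t)) \<and>
     prob_space.indep_vars M (\<lambda>_. PiM {..<p} (\<lambda>_. borel))
        (\<lambda>t \<omega>. restrict (X t \<omega>) {..<p}) {..<n}"

end

theory Submission
  imports Defs
begin

text \<open>
  Diagonalising the covariance and rotating the sample by a Helmert matrix turns \<open>S\<close>, up to the
  factor \<open>\<sigma>\<^sup>2 / (n - 1)\<close> and conjugation, into the Gram matrix of a \<open>p \<times> N\<close> array of independent
  standard normal variables, \<open>N = n - 1\<close>, whose first \<open>d\<close> rows are multiplied by \<open>sqrt (\<lambda>\<^sub>i / \<sigma>\<^sup>2)\<close>.
  The statistic is invariant under that scaling.

  Fix the spike rows and rotate the columns so that these rows span the first \<open>d\<close> coordinates. The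
  eigenvector equations of the \<open>d\<close> large eigenvalues bound the leakage of their eigenvectors out of
  these coordinates; hence the trace and the squared Frobenius norm of the remaining spectrum differ
  negligibly from those of the Gram matrix \<open>W\<close> of the noise in the last \<open>m = N - d\<close> columns, as long
  as the noise has operator norm of order \<open>sqrt (N + p)\<close>. This last bound comes from a
  union bound over integer lattice points, to which unit vectors are rounded.

  With \<open>q = p - d\<close> it remains to treat \<open>tr (W\<^sup>2) / (q m) - (q + m) (tr W / (q m))\<^sup>2\<close>. It is, up to
  small errors, a martingale in the rows of the array whose increments are
  Gaussian quadratic forms conditionally on the earlier rows; diagonalising them and telescoping the
  characteristic functions gives the limit \<open>N (1, 4)\<close> when \<open>q / m\<close> tends to \<open>0\<close>. As the statistic is
  symmetric under transposition of the array, the case \<open>m / q\<close> tending to \<open>0\<close> follows.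
\<close>

text \<open>The statistic multiplies the relative errors of the spectral moments by about
  \<open>N + q\<close>, so the leakage bound must be sharp. The energy that leaks is at most a
  constant times the cross energy of the noise divided by \<open>\<lambda> N\<close>. The cross
  energy has mean \<open>d q m\<close>, so the relative error of the trace is of order
  \<open>1 / (\<lambda> N)\<close>, and what has to vanish is
  \<open>(N + p) / (\<lambda> N)\<close>; both regimes give this. The rotation depends on the spike
  rows. The noise is independent of them, so it may be rotated while they are frozen, and the
  rotated noise has the same law for each value of them; no measurable choice of the rotation is
  involved. The limiting mean is \<open>2 - 1\<close>: the fluctuation of the squared row norms
  contributes \<open>2\<close>, and \<open>- 1\<close> arises because only \<open>q (q - 1)\<close>
  products of rows are off the diagonal. The variance \<open>4\<close> is the limit of the sum over
  \<open>k < q\<close> of \<open>8 k / q^2\<close>, the typical conditional variance of the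
  increment due to row \<open>k\<close>. The error of the martingale approximation contains
  \<open>sqrt (q / m)\<close>, which is why each regime needs its own orientation of the
  array.\<close>

subsection \<open>Spectral theory of symmetric matrices\<close>

text \<open>Gaussian elimination, by induction on the equations: an equation either vanishes
  identically or has a pivot that removes one unknown. The dimension counts below are
  instances.\<close>

lemma homogeneous_system_nontrivial:
  fixes a :: "'i \<Rightarrow> 'j \<Rightarrow> real"
  assumes "finite I" "finite J" "card I < card J"
  shows "\<exists>c. (\<exists>j\<in>J. c j \<noteq> 0) \<and> (\<forall>i\<in>I. (\<Sum>j\<in>J. a i j * c j) = 0)"
  using assms
proof (induction I arbitrary: J a rule: finite_induct)
  case empty
  then obtain j where "j \<in> J" by fastforce
  then show ?case by (intro exI[of _ "\<lambda>_. 1"]) auto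
next
  case (insert i0 I)
  show ?case
  proof (cases "\<forall>j\<in>J. a i0 j = 0")
    case True
    have "card I < card J" using insert.prems insert.hyps by simp
    from insert.IH[OF insert.prems(1) this, of a] obtain c where
      c: "\<exists>j\<in>J. c j \<noteq> 0" "\<forall>i\<in>I. (\<Sum>j\<in>J. a i j * c j) = 0" by blast
    have "(\<Sum>j\<in>J. a i0 j * c j) = 0" using True by (intro sum.neutral) auto
    with c show ?thesis by (intro exI[of _ c]) auto
  next
    case False
    then obtain j0 where j0: "j0 \<in> J" "a i0 j0 \<noteq> 0" by auto
    define J' where "J' = J - {j0}"
    \<comment> \<open>The other equations after the pivot \<open>a i0 j0\<close> has cleared column
      \<open>j0\<close>.\<close>
    define a' where "a' i j = a i j - a i j0 * a i0 j / a i0 j0" for i j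
    have "finite J'" "card I < card J'"
      using insert.prems insert.hyps j0 by (auto simp: J'_def)
    from insert.IH[OF this, of a'] obtain c where
      c: "\<exists>j\<in>J'. c j \<noteq> 0" "\<forall>i\<in>I. (\<Sum>j\<in>J'. a' i j * c j) = 0" by blast
    define s where "s = (\<Sum>j\<in>J'. a i0 j * c j)"
    \<comment> \<open>Back substitution: equation \<open>i0\<close> forces the value at
      \<open>j0\<close>.\<close>
    define c' where "c' = c(j0 := - s / a i0 j0)"
    have split: "(\<Sum>j\<in>J. a i j * c' j) = (\<Sum>j\<in>J'. a i j * c j) - a i j0 * s / a i0 j0" for i
    proof -
      have "(\<Sum>j\<in>J. a i j * c' j) = a i j0 * c' j0 + (\<Sum>j\<in>J'. a i j * c' j)"
        unfolding J'_def using j0 insert.prems by (simp add: sum.remove)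
      also have "(\<Sum>j\<in>J'. a i j * c' j) = (\<Sum>j\<in>J'. a i j * c j)"
        by (intro sum.cong) (auto simp: c'_def J'_def)
      finally show ?thesis by (simp add: c'_def)
    qed
    have "(\<Sum>j\<in>J. a i0 j * c' j) = 0"
      unfolding split s_def[symmetric] using j0 by simp
    moreover have "(\<Sum>j\<in>J. a i j * c' j) = 0" if "i \<in> I" for i
    proof -
      have "0 = (\<Sum>j\<in>J'. a' i j * c j)" using c that by simp
      also have "\<dots> = (\<Sum>j\<in>J'. a i j * c j) - a i j0 * s / a i0 j0"
        unfolding a'_def s_def by (simp add: sum_subtractf sum_distrib_left sum_divide_distrib algebra_simps)
      finally show ?thesis unfolding split by simp
    qed
    moreover have "\<exists>j\<in>J. c' j \<noteq> 0"
      using c(1) by (auto simp: c'_def J'_def)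
    ultimately show ?thesis by (intro exI[of _ c']) auto
  qed
qed

section \<open>Inner products and matrix action on vectors of varying dimension\<close>

definition dotp :: "nat \<Rightarrow> (nat \<Rightarrow> real) \<Rightarrow> (nat \<Rightarrow> real) \<Rightarrow> real" where
  "dotp p u v = (\<Sum>i<p. u i * v i)"

definition mulv :: "nat \<Rightarrow> (nat \<Rightarrow> nat \<Rightarrow> real) \<Rightarrow> (nat \<Rightarrow> real) \<Rightarrow> nat \<Rightarrow> real" where
  "mulv p A u i = (\<Sum>j<p. A i j * u j)"

text \<open>\<open>V k\<close> is a vector and \<open>V k i\<close> its coordinate, so
  \<open>V\<close> read as a matrix has the vectors as rows.\<close>

definition orthonormal :: "nat \<Rightarrow> (nat \<Rightarrow> nat \<Rightarrow> real) \<Rightarrow> bool" where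
  "orthonormal p V \<longleftrightarrow> (\<forall>k<p. \<forall>l<p. dotp p (V k) (V l) = of_bool (k = l))"

lemma dotp_commute: "dotp p u v = dotp p v u"
  by (simp add: dotp_def mult.commute)

lemma dotp_nonneg: "0 \<le> dotp p u u"
  by (simp add: dotp_def sum_nonneg)

lemma dotp_eq_0_iff: "dotp p u u = 0 \<longleftrightarrow> (\<forall>i<p. u i = 0)"
  unfolding dotp_def by (subst sum_nonneg_eq_0_iff) auto

lemma dotp_add_left: "dotp p (\<lambda>i. u i + v i) w = dotp p u w + dotp p v w"
  and dotp_diff_left: "dotp p (\<lambda>i. u i - v i) w = dotp p u w - dotp p v w"
  and dotp_scale_left: "dotp p (\<lambda>i. c * u i) w = c * dotp p u w"
  and dotp_sum_left: "dotp p (\<lambda>i. \<Sum>k\<in>K. f k i) w = (\<Sum>k\<in>K. dotp p (f k) w)"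
     apply (simp_all add: dotp_def algebra_simps sum.distrib sum_subtractf sum_distrib_left)
  by (subst sum.swap) (simp add: sum_distrib_left)

lemma dotp_add_right: "dotp p w (\<lambda>i. u i + v i) = dotp p w u + dotp p w v"
  and dotp_diff_right: "dotp p w (\<lambda>i. u i - v i) = dotp p w u - dotp p w v"
  and dotp_scale_right: "dotp p w (\<lambda>i. c * u i) = c * dotp p w u"
  and dotp_sum_right: "dotp p w (\<lambda>i. \<Sum>k\<in>K. f k i) = (\<Sum>k\<in>K. dotp p w (f k))"
  by (simp_all add: dotp_commute[of p w] dotp_add_left dotp_diff_left dotp_scale_left dotp_sum_left)

lemmas dotp_linear = dotp_add_left dotp_diff_left dotp_scale_left dotp_sum_left
  dotp_add_right dotp_diff_right dotp_scale_right dotp_sum_right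

lemma dotp_cong: "(\<And>i. i < p \<Longrightarrow> u i = u' i) \<Longrightarrow> (\<And>i. i < p \<Longrightarrow> v i = v' i) \<Longrightarrow> dotp p u v = dotp p u' v'"
  by (simp add: dotp_def)

lemma dotp_Cauchy_Schwarz: "(dotp p u v)\<^sup>2 \<le> dotp p u u * dotp p v v"
  unfolding dotp_def using Cauchy_Schwarz_ineq_sum[of u v "{..<p}"]
  by (simp add: power2_eq_square)

lemma mulv_linear:
  "mulv p A (\<lambda>i. u i + v i) = (\<lambda>i. mulv p A u i + mulv p A v i)"
  "mulv p A (\<lambda>i. u i - v i) = (\<lambda>i. mulv p A u i - mulv p A v i)"
  "mulv p A (\<lambda>i. c * u i) = (\<lambda>i. c * mulv p A u i)"
  "mulv p A (\<lambda>i. \<Sum>k\<in>K. f k i) = (\<lambda>i. \<Sum>k\<in>K. mulv p A (f k) i)"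
     apply (simp_all add: mulv_def fun_eq_iff algebra_simps sum.distrib sum_subtractf sum_distrib_left)
  by (intro allI, subst sum.swap) (simp add: sum_distrib_left)

lemma mulv_symmetric:
  assumes "symmetric_mat p A"
  shows "dotp p u (mulv p A v) = dotp p (mulv p A u) v"
proof -
  have "dotp p u (mulv p A v) = (\<Sum>i<p. \<Sum>j<p. u i * A i j * v j)"
    by (simp add: dotp_def mulv_def sum_distrib_left mult.assoc)
  also have "\<dots> = (\<Sum>j<p. \<Sum>i<p. u i * A i j * v j)" by (rule sum.swap)
  also have "\<dots> = (\<Sum>j<p. \<Sum>i<p. A j i * u i * v j)"
    using assms by (intro sum.cong refl) (auto simp: symmetric_mat_def)
  also have "\<dots> = dotp p (mulv p A u) v"
    by (simp add: dotp_def mulv_def sum_distrib_right)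
  finally show ?thesis .
qed

section \<open>Diagonalisation by successive maximisation of the quadratic form\<close>

text \<open>Vectors are functions on all of \<open>nat\<close>, and \<open>dotp p u u = 1\<close>
  leaves the coordinates from \<open>p\<close> on free, so the sphere is not compact in the product
  topology. Pinning these coordinates to \<open>0\<close> restores compactness by Tychonoff's
  theorem.\<close>

lemma compact_box_nat_fun: "compact (Pi\<^sub>E UNIV (\<lambda>i. if i < (p::nat) then {-1..1::real} else {0}))"
proof -
  have "compactin (product_topology (\<lambda>i. euclidean) UNIV) (Pi\<^sub>E UNIV (\<lambda>i. if i < p then {-1..1::real} else {0}))"
    by (subst compactin_PiE) auto
  then show ?thesis
    by (simp add: euclidean_product_topology)
qed

lemma continuous_on_coord [continuous_intros]: "continuous_on S (\<lambda>u :: nat \<Rightarrow> real. u i)"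
  by (rule continuous_on_subset[OF continuous_on_product_coordinates]) simp

lemma ex_max_quadratic_on_sphere:
  fixes V :: "nat \<Rightarrow> nat \<Rightarrow> real"
  assumes "k < p"
  shows "\<exists>u. dotp p u u = 1 \<and> (\<forall>j<k. dotp p (V j) u = 0) \<and>
     (\<forall>v. dotp p v v = 1 \<longrightarrow> (\<forall>j<k. dotp p (V j) v = 0) \<longrightarrow> dotp p v (mulv p A v) \<le> dotp p u (mulv p A u))"
proof -
  define S where "S = Pi\<^sub>E UNIV (\<lambda>i. if i < p then {-1..1::real} else {0}) \<inter>
      ({u. dotp p u u = 1} \<inter> (\<Inter>j<k. {u. dotp p (V j) u = 0}))"
  \<comment> \<open>Neither the constraints nor the quadratic form see the coordinates from
    \<open>p\<close> on, so every competitor can be truncated into the compact set.\<close>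
  have trunc: "(\<lambda>i. if i < p then v i else 0) \<in> S"
    if v: "dotp p v v = 1" "\<forall>j<k. dotp p (V j) v = 0" for v
  proof -
    have "(v i)\<^sup>2 \<le> 1" if "i < p" for i
      unfolding v(1)[symmetric] dotp_def power2_eq_square using that
      by (intro member_le_sum) auto
    then have "\<bar>v i\<bar> \<le> 1" if "i < p" for i using that abs_square_le_1 by blast
    then have "v i \<le> 1" "-1 \<le> v i" if "i < p" for i
      using that by (meson abs_le_D1, smt (verit))
    with v show ?thesis by (auto simp: S_def dotp_def PiE_def extensional_def)
  qed
  have "compact S" unfolding S_def dotp_def
    by (intro compact_Int_closed[OF compact_box_nat_fun] closed_Int closed_INT closed_Collect_eq)
       (auto intro!: continuous_intros closed_Collect_eq)
  moreover have "S \<noteq> {}"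
  proof -
    \<comment> \<open>Fewer constraints than coordinates: some nonzero vector satisfies all of them
      and can be normalised.\<close>
    have "card {..<k} < card {..<p}" using assms by simp
    from homogeneous_system_nontrivial[OF _ _ this, of V] obtain c where
      c: "\<exists>i<p. c i \<noteq> 0" "\<forall>j<k. dotp p (V j) c = 0"
      by (auto simp: dotp_def)
    define s where "s = sqrt (dotp p c c)"
    have "dotp p c c \<noteq> 0" using c(1) by (auto simp: dotp_eq_0_iff)
    with dotp_nonneg[of p c] have s: "s > 0" "s\<^sup>2 = dotp p c c" by (auto simp: s_def)
    then have "dotp p (\<lambda>i. (1/s) * c i) (\<lambda>i. (1/s) * c i) = 1"
      unfolding dotp_linear using s by (simp add: s(2)[symmetric] power2_eq_square)
    moreover have "\<forall>j<k. dotp p (V j) (\<lambda>i. (1/s) * c i) = 0"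
      using c(2) unfolding dotp_linear by simp
    ultimately show ?thesis using trunc by blast
  qed
  moreover have "continuous_on S (\<lambda>u. dotp p u (mulv p A u))"
    unfolding dotp_def mulv_def by (intro continuous_intros)
  ultimately obtain u where u: "u \<in> S" "\<forall>v\<in>S. dotp p v (mulv p A v) \<le> dotp p u (mulv p A u)"
    using continuous_attains_sup by blast
  have "dotp p v (mulv p A v) \<le> dotp p u (mulv p A u)"
    if "dotp p v v = 1" "\<forall>j<k. dotp p (V j) v = 0" for v
  proof -
    have "dotp p v (mulv p A v) = dotp p (\<lambda>i. if i < p then v i else 0) (mulv p A (\<lambda>i. if i < p then v i else 0))"
      by (simp add: dotp_def mulv_def)
    also have "\<dots> \<le> dotp p u (mulv p A u)" using u(2) trunc[OF that] by blast
    finally show ?thesis .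
  qed
  with u(1) show ?thesis unfolding S_def by blast
qed

text \<open>First-order condition: a maximiser of the quadratic form on the unit sphere of an
  invariant subspace is an eigenvector.\<close>

lemma ex_max_eigenvector:
  assumes sym: "symmetric_mat p A" and k: "k < p"
    and ev: "\<And>j i. j < k \<Longrightarrow> i < p \<Longrightarrow> mulv p A (V j) i = \<phi> j * V j i"
  shows "\<exists>u f. dotp p u u = 1 \<and> (\<forall>j<k. dotp p (V j) u = 0) \<and>
     (\<forall>i<p. mulv p A u i = f * u i) \<and>
     (\<forall>v. dotp p v v = 1 \<longrightarrow> (\<forall>j<k. dotp p (V j) v = 0) \<longrightarrow> dotp p v (mulv p A v) \<le> f)"
proof -
  from ex_max_quadratic_on_sphere[OF k, of V A] obtain u where
    u1: "dotp p u u = 1" and u2: "\<forall>j<k. dotp p (V j) u = 0" and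
    u3: "\<And>v. dotp p v v = 1 \<Longrightarrow> \<forall>j<k. dotp p (V j) v = 0 \<Longrightarrow> dotp p v (mulv p A v) \<le> dotp p u (mulv p A u)"
    by blast
  define f where "f = dotp p u (mulv p A u)"
  \<comment> \<open>The residual of the eigenvector equation. It is orthogonal to \<open>u\<close>
    and to the earlier eigenvectors, so \<open>u + t * g\<close> satisfies the constraints.\<close>
  define g where "g i = mulv p A u i - f * u i" for i
  have Vg: "dotp p (V j) g = 0" if "j < k" for j
  proof -
    have "dotp p (V j) (mulv p A u) = dotp p (mulv p A (V j)) u"
      by (rule mulv_symmetric[OF sym])
    also have "\<dots> = dotp p (\<lambda>i. \<phi> j * V j i) u"
      using ev that by (intro dotp_cong) auto
    also have "\<dots> = 0" unfolding dotp_linear using u2 that by simp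
    finally show ?thesis unfolding g_def dotp_linear using u2 that by simp
  qed
  have scaled: "dotp p v (mulv p A v) \<le> f * dotp p v v" if "\<forall>j<k. dotp p (V j) v = 0" for v
  proof (cases "dotp p v v = 0")
    case True
    then have "\<forall>i<p. v i = 0" by (simp add: dotp_eq_0_iff)
    then have "dotp p v (mulv p A v) = 0" by (simp add: dotp_def)
    with True show ?thesis by simp
  next
    case False
    define s where "s = sqrt (dotp p v v)"
    have s: "s > 0" "s * s = dotp p v v" using False dotp_nonneg[of p v] by (auto simp: s_def)
    let ?w = "\<lambda>i. (1/s) * v i"
    have "dotp p ?w ?w = 1" unfolding dotp_linear using s(1) by (simp add: s(2)[symmetric])
    moreover have "\<forall>j<k. dotp p (V j) ?w = 0" unfolding dotp_linear using that by simp
    ultimately have "dotp p ?w (mulv p A ?w) \<le> f" unfolding f_def by (rule u3)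
    then have "dotp p v (mulv p A v) / (s * s) \<le> f"
      unfolding mulv_linear dotp_linear by (simp add: field_simps)
    moreover have "dotp p v v > 0" using False dotp_nonneg[of p v] by simp
    ultimately show ?thesis unfolding s(2) by (simp add: pos_divide_le_eq)
  qed
  have ug: "dotp p u g = 0" unfolding g_def dotp_linear u1 by (simp add: f_def)
  have Aug: "dotp p u (mulv p A g) = dotp p g g"
  proof -
    have "dotp p u (mulv p A g) = dotp p (mulv p A u) g" by (rule mulv_symmetric[OF sym])
    also have "\<dots> = dotp p (\<lambda>i. g i + f * u i) g" by (intro dotp_cong) (simp_all add: g_def)
    also have "\<dots> = dotp p g g" unfolding dotp_linear ug by simp
    finally show ?thesis .
  qed
  have Agu: "dotp p g (mulv p A u) = dotp p g g"
    using Aug mulv_symmetric[OF sym, of g u] dotp_commute by metis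
  define a where "a = dotp p g g"
  define b where "b = dotp p g (mulv p A g)"
  \<comment> \<open>Along \<open>u + t * g\<close> the gain is linear in \<open>t\<close> and the
    loss quadratic, so a nonzero residual would contradict maximality for small
    \<open>t\<close>.\<close>
  have ineq: "2 * t * a \<le> t\<^sup>2 * (f * a - b)" for t
  proof -
    let ?w = "\<lambda>i. u i + t * g i"
    have "\<forall>j<k. dotp p (V j) ?w = 0" unfolding dotp_linear using u2 Vg by simp
    from scaled[OF this]
    have "f + 2 * t * a + t\<^sup>2 * b \<le> f * (1 + t\<^sup>2 * a)"
      unfolding mulv_linear dotp_linear u1 ug Aug Agu dotp_commute[of p g u] ug a_def[symmetric] b_def[symmetric]
        f_def[symmetric]
      by (simp add: algebra_simps power2_eq_square)
    then show ?thesis by (simp add: algebra_simps)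
  qed
  have "a = 0"
  proof (rule ccontr)
    assume "a \<noteq> 0"
    then have a: "a > 0" using dotp_nonneg[of p g] by (simp add: a_def)
    \<comment> \<open>Any positive number above \<open>f * a - b\<close> serves: with
      \<open>t = a / c\<close> the inequality becomes \<open>2 * a \<le> a\<close>.\<close>
    define c where "c = \<bar>f * a - b\<bar> + 1"
    define t where "t = a / c"
    have c: "c > 0" "f * a - b \<le> c" "f * a - b < c" by (auto simp: c_def)
    have t: "t > 0" using a c by (simp add: t_def)
    have "2 * a \<le> t * (f * a - b)" using ineq[of t] t by (simp add: power2_eq_square)
    also have "\<dots> \<le> t * c" using c t by (intro mult_left_mono) auto
    also have "\<dots> = a" using c by (simp add: t_def)
    finally show False using a by simp
  qed
  then have "\<forall>i<p. mulv p A u i = f * u i" by (simp add: a_def dotp_eq_0_iff g_def)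
  with u1 u2 u3 show ?thesis unfolding f_def by blast
qed

text \<open>Deflation: each new eigenvector maximises the quadratic form on the orthogonal
  complement of the earlier ones. The induction also carries the maximality of every
  \<open>\<phi> k\<close>, because that is what orders the eigenvalues: the new vector was a
  competitor at each earlier stage.\<close>

theorem spectral_theorem:
  assumes sym: "symmetric_mat p A"
  shows "\<exists>V \<phi>. orthonormal p V \<and> (\<forall>k<p. \<forall>i<p. mulv p A (V k) i = \<phi> k * V k i) \<and>
     (\<forall>k l. k \<le> l \<longrightarrow> l < p \<longrightarrow> \<phi> l \<le> \<phi> k)"
proof -
  have "\<exists>V \<phi>. (\<forall>k<m. \<forall>l<m. dotp p (V k) (V l) = of_bool (k = l)) \<and>
      (\<forall>k<m. \<forall>i<p. mulv p A (V k) i = \<phi> k * V k i) \<and>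
      (\<forall>k l. k \<le> l \<longrightarrow> l < m \<longrightarrow> \<phi> l \<le> \<phi> k) \<and>
      (\<forall>k<m. \<forall>v. dotp p v v = 1 \<longrightarrow> (\<forall>j<k. dotp p (V j) v = 0) \<longrightarrow> dotp p v (mulv p A v) \<le> \<phi> k)"
    if "m \<le> p" for m using that
  proof (induction m)
    case 0 show ?case by simp
  next
    case (Suc m)
    then obtain V \<phi> where
      V: "\<And>k l. k < m \<Longrightarrow> l < m \<Longrightarrow> dotp p (V k) (V l) = of_bool (k = l)" and
      ev: "\<And>k i. k < m \<Longrightarrow> i < p \<Longrightarrow> mulv p A (V k) i = \<phi> k * V k i" and
      mono: "\<And>k l. k \<le> l \<Longrightarrow> l < m \<Longrightarrow> \<phi> l \<le> \<phi> k" and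
      mx: "\<And>k v. k < m \<Longrightarrow> dotp p v v = 1 \<Longrightarrow> (\<forall>j<k. dotp p (V j) v = 0) \<Longrightarrow> dotp p v (mulv p A v) \<le> \<phi> k"
      by (auto dest: Suc_leD) blast
    have "m < p" using Suc.prems by simp
    from ex_max_eigenvector[OF sym this, of V \<phi>] ev obtain u f where
      u: "dotp p u u = 1" "\<forall>j<m. dotp p (V j) u = 0" "\<forall>i<p. mulv p A u i = f * u i"
        "\<forall>v. dotp p v v = 1 \<longrightarrow> (\<forall>j<m. dotp p (V j) v = 0) \<longrightarrow> dotp p v (mulv p A v) \<le> f"
      by blast
    have fu: "dotp p u (mulv p A u) = f"
    proof -
      have "dotp p u (mulv p A u) = dotp p u (\<lambda>i. f * u i)" using u by (intro dotp_cong) auto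
      then show ?thesis unfolding dotp_linear using u by simp
    qed
    have f: "f \<le> \<phi> k" if "k < m" for k
      using mx[OF that u(1)] u(2) that fu by auto
    have uV: "\<forall>j<m. dotp p u (V j) = 0" using u(2) by (simp add: dotp_commute[of p u])
    show ?case
      by (rule exI[of _ "V(m := u)"], rule exI[of _ "\<phi>(m := f)"])
         (use V ev mono mx u uV f in \<open>auto simp: less_Suc_eq\<close>)
  qed
  from this[of p] show ?thesis unfolding orthonormal_def by blast
qed

text \<open>A relation, since eigenvectors are not unique. Indices start at \<open>0\<close>, so
  \<open>\<phi> 0\<close> is the largest eigenvalue.\<close>

definition eigensystem :: "nat \<Rightarrow> (nat \<Rightarrow> nat \<Rightarrow> real) \<Rightarrow> (nat \<Rightarrow> nat \<Rightarrow> real) \<Rightarrow> (nat \<Rightarrow> real) \<Rightarrow> bool" where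
  "eigensystem p A V \<phi> \<longleftrightarrow> orthonormal p V \<and>
     (\<forall>k<p. \<forall>i<p. mulv p A (V k) i = \<phi> k * V k i) \<and> (\<forall>k l. k \<le> l \<longrightarrow> l < p \<longrightarrow> \<phi> l \<le> \<phi> k)"

lemma ex_eigensystem: "symmetric_mat p A \<Longrightarrow> \<exists>V \<phi>. eigensystem p A V \<phi>"
  unfolding eigensystem_def by (rule spectral_theorem)

text \<open>For square matrices a right inverse is a left inverse, so orthonormal rows force
  orthonormal columns.\<close>

lemma orthonormal_columns:
  assumes "orthonormal p V" "i < p" "j < p"
  shows "(\<Sum>k<p. V k i * V k j) = of_bool (i = j)"
proof -
  let ?A = "mat p p (\<lambda>(k, i). V k i)" and ?B = "mat p p (\<lambda>(i, k). V k i)"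
  have "?A * ?B = 1\<^sub>m p"
    using assms(1) by (intro eq_matI) (auto simp: scalar_prod_def orthonormal_def dotp_def atLeast0LessThan)
  then have "?B * ?A = 1\<^sub>m p" by (rule mat_mult_left_right_inverse[rotated 2]) auto
  then have "(?B * ?A) $$ (i, j) = 1\<^sub>m p $$ (i, j)" by simp
  then show ?thesis using assms(2,3) by (simp add: scalar_prod_def atLeast0LessThan)
qed

lemma orthonormal_expand:
  assumes "orthonormal p V" "i < p"
  shows "u i = (\<Sum>k<p. dotp p (V k) u * V k i)"
proof -
  have "(\<Sum>k<p. dotp p (V k) u * V k i) = (\<Sum>j<p. (\<Sum>k<p. V k j * V k i) * u j)"
    unfolding dotp_def sum_distrib_right by (subst sum.swap) (simp add: mult_ac)
  also have "\<dots> = (\<Sum>j<p. of_bool (j = i) * u j)"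
    using assms by (intro sum.cong) (auto simp: orthonormal_columns)
  also have "\<dots> = u i" using assms(2) by (simp add: of_bool_def if_distrib[where f="\<lambda>x. x * _"] cong: if_cong)
  finally show ?thesis by simp
qed

lemma orthonormal_Parseval:
  assumes "orthonormal p V"
  shows "dotp p u v = (\<Sum>k<p. dotp p (V k) u * dotp p (V k) v)"
proof -
  have "dotp p u v = dotp p (\<lambda>i. \<Sum>k<p. dotp p (V k) u * V k i) v"
    using orthonormal_expand[OF assms] by (intro dotp_cong) auto
  then show ?thesis unfolding dotp_linear .
qed

lemma eigensystem_matrix:
  assumes "eigensystem p A V \<phi>" "i < p" "j < p"
  shows "A i j = (\<Sum>k<p. \<phi> k * V k i * V k j)"
proof -
  have V: "orthonormal p V" using assms(1) by (simp add: eigensystem_def)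
  have "(\<Sum>k<p. \<phi> k * V k i * V k j) = (\<Sum>k<p. mulv p A (V k) i * V k j)"
    using assms by (intro sum.cong) (auto simp: eigensystem_def)
  also have "\<dots> = (\<Sum>l<p. A i l * (\<Sum>k<p. V k l * V k j))"
    unfolding mulv_def sum_distrib_right sum_distrib_left by (subst sum.swap) (simp add: mult_ac)
  also have "\<dots> = (\<Sum>l<p. A i l * of_bool (l = j))"
    using V assms by (intro sum.cong) (auto simp: orthonormal_columns)
  also have "\<dots> = A i j" using assms(3) by (simp add: of_bool_def if_distrib cong: if_cong)
  finally show ?thesis by simp
qed

lemma eigensystem_quadratic:
  assumes "eigensystem p A V \<phi>"
  shows "dotp p u (mulv p A u) = (\<Sum>k<p. \<phi> k * (dotp p (V k) u)\<^sup>2)"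
proof -
  have V: "orthonormal p V" using assms(1) by (simp add: eigensystem_def)
  have "dotp p u (mulv p A u) = dotp p u (\<lambda>i. \<Sum>k<p. \<phi> k * (dotp p (V k) u * V k i))"
  proof (rule dotp_cong, simp)
    fix i assume i: "i < p"
    have "mulv p A u i = (\<Sum>j<p. \<Sum>k<p. \<phi> k * V k i * V k j * u j)"
      using assms i by (auto simp: mulv_def eigensystem_matrix[OF assms i] sum_distrib_right intro!: sum.cong)
    also have "\<dots> = (\<Sum>k<p. \<phi> k * (dotp p (V k) u * V k i))"
      by (subst sum.swap) (simp add: dotp_def sum_distrib_left sum_distrib_right mult_ac)
    finally show "mulv p A u i = (\<Sum>k<p. \<phi> k * (dotp p (V k) u * V k i))" .
  qed
  also have "\<dots> = (\<Sum>k<p. \<phi> k * (dotp p (V k) u)\<^sup>2)"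
    unfolding dotp_linear by (simp add: power2_eq_square dotp_commute mult_ac)
  finally show ?thesis .
qed

section \<open>Identification of the ordered list of eigenvalues\<close>

text \<open>The multiplicity of a root counts its occurrences in the list. Hence the polynomial
  determines the multiset of roots, and sorting gives the definite description in
  \<open>eigs_desc\<close> a unique value.\<close>

lemma order_prod_list_linear:
  "Polynomial.order (a::real) (\<Prod>x\<leftarrow>xs. [:-x, 1:]) = count (mset xs) a"
proof (induction xs)
  case Nil
  then show ?case by (simp add: order_1_eq_0)
next
  case (Cons x xs)
  have nz: "[:-x, 1:] * (\<Prod>x\<leftarrow>xs. [:-x, 1:]) \<noteq> 0"
    by (simp only: mult_eq_0_iff prod_list_zero_iff) auto
  have "Polynomial.order a [:-x, 1:] = of_bool (a = x)"
    using order_linear_power'[of a x 1] by (auto simp: order_0I order_linear)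
  then show ?case using order_mult[OF nz, of a] Cons.IH by auto
qed

lemma sorted_desc_roots_unique:
  fixes xs ys :: "real list"
  assumes "sorted_wrt (\<ge>) xs" "sorted_wrt (\<ge>) ys"
    "(\<Prod>x\<leftarrow>xs. [:-x, 1:]) = (\<Prod>x\<leftarrow>ys. [:-x, 1:])"
  shows "xs = ys"
proof -
  have "mset xs = mset ys"
    using assms(3) by (intro multiset_eqI) (simp flip: order_prod_list_linear)
  moreover have "sorted (rev xs)" "sorted (rev ys)" using assms by (simp_all add: sorted_wrt_rev)
  ultimately have "rev xs = rev ys" by (metis mset_rev properties_for_sort)
  then show ?thesis by simp
qed

text \<open>The eigenvectors conjugate \<open>A\<close> to a diagonal matrix, whose characteristic
  polynomial is visible. Arguments on \<open>eigs_desc\<close> can thus be carried out with any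
  eigensystem.\<close>

lemma eigs_desc_eq:
  assumes "eigensystem p A V \<phi>"
  shows "eigs_desc p A = map \<phi> [0..<p]"
proof -
  have V: "orthonormal p V" using assms(1) by (simp add: eigensystem_def)
  let ?P = "mat p p (\<lambda>(i, k). V k i)" and ?Q = "mat p p (\<lambda>(k, i). V k i)"
    and ?D = "mat p p (\<lambda>(k, l). if k = l then \<phi> k else 0)"
  have QP: "?Q * ?P = 1\<^sub>m p"
    using V by (intro eq_matI) (auto simp: scalar_prod_def orthonormal_def dotp_def atLeast0LessThan)
  then have PQ: "?P * ?Q = 1\<^sub>m p" by (rule mat_mult_left_right_inverse[rotated 2]) auto
  have DQ: "?D * ?Q = mat p p (\<lambda>(k, j). \<phi> k * V k j)"
    by (intro eq_matI) (auto simp: scalar_prod_def if_distrib[where f="\<lambda>x. x * _"] cong: if_cong)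
  have "to_mat p A = ?P * (?D * ?Q)" unfolding DQ
    by (intro eq_matI) (auto simp: scalar_prod_def to_mat_def eigensystem_matrix[OF assms] atLeast0LessThan mult_ac)
  also have "\<dots> = ?P * ?D * ?Q" by (rule assoc_mult_mat[symmetric]) auto
  finally have "similar_mat (to_mat p A) ?D"
    by (intro similar_matI[OF _ PQ QP]) (auto simp: to_mat_def)
  then have "char_poly (to_mat p A) = char_poly ?D" by (rule char_poly_similar)
  also have "\<dots> = (\<Prod>a\<leftarrow>diag_mat ?D. [:-a, 1:])"
    by (rule char_poly_upper_triangular[of _ p]) auto
  also have "diag_mat ?D = map \<phi> [0..<p]"
    by (auto simp: diag_mat_def intro!: map_cong)
  finally have cp: "char_poly (to_mat p A) = (\<Prod>x\<leftarrow>map \<phi> [0..<p]. [:-x, 1:])" .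
  have so: "sorted_wrt (\<ge>) (map \<phi> [0..<p])"
    using assms by (auto simp: eigensystem_def sorted_wrt_iff_nth_less)
  show ?thesis unfolding eigs_desc_def
  proof (rule the_equality)
    show "length (map \<phi> [0..<p]) = p \<and> sorted_wrt (\<ge>) (map \<phi> [0..<p]) \<and>
      char_poly (to_mat p A) = (\<Prod>x\<leftarrow>map \<phi> [0..<p]. [:-x, 1:])" using cp so by simp
    fix xs assume "length xs = p \<and> sorted_wrt (\<ge>) xs \<and> char_poly (to_mat p A) = (\<Prod>x\<leftarrow>xs. [:-x, 1:])"
    then show "xs = map \<phi> [0..<p]" using so cp by (intro sorted_desc_roots_unique) auto
  qed
qed

section \<open>Courant-Fischer bounds, Weyl's inequality and measurability of eigenvalues\<close>

lemma eigensystem_lower: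
  assumes "eigensystem p A V \<phi>" "k < p" "\<And>j. k < j \<Longrightarrow> j < p \<Longrightarrow> dotp p (V j) u = 0"
  shows "\<phi> k * dotp p u u \<le> dotp p u (mulv p A u)"
proof -
  have V: "orthonormal p V" using assms(1) by (simp add: eigensystem_def)
  show ?thesis
    unfolding eigensystem_quadratic[OF assms(1)] orthonormal_Parseval[OF V, of u u] sum_distrib_left
  proof (intro sum_mono)
    fix j assume "j \<in> {..<p}"
    with assms show "\<phi> k * (dotp p (V j) u * dotp p (V j) u) \<le> \<phi> j * (dotp p (V j) u)\<^sup>2"
      by (cases "k < j") (auto simp: eigensystem_def power2_eq_square intro!: mult_right_mono)
  qed
qed

lemma eigensystem_upper:
  assumes "eigensystem p A V \<phi>" "k < p" "\<And>j. j < k \<Longrightarrow> dotp p (V j) u = 0"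
  shows "dotp p u (mulv p A u) \<le> \<phi> k * dotp p u u"
proof -
  have V: "orthonormal p V" using assms(1) by (simp add: eigensystem_def)
  show ?thesis
    unfolding eigensystem_quadratic[OF assms(1)] orthonormal_Parseval[OF V, of u u] sum_distrib_left
  proof (intro sum_mono)
    fix j assume "j \<in> {..<p}"
    with assms show "\<phi> j * (dotp p (V j) u)\<^sup>2 \<le> \<phi> k * (dotp p (V j) u * dotp p (V j) u)"
      by (cases "j < k") (auto simp: eigensystem_def power2_eq_square intro!: mult_right_mono)
  qed
qed

text \<open>The span of \<open>V 0, ..., V k\<close> has dimension \<open>k + 1\<close> and so meets
  the common kernel of \<open>k\<close> linear functionals: the intersection step of the
  Courant-Fischer principle.\<close>

lemma ex_vector_in_top_span:
  assumes V: "orthonormal p V" and k: "k < p"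
  shows "\<exists>u. dotp p u u > 0 \<and> (\<forall>j. k < j \<longrightarrow> j < p \<longrightarrow> dotp p (V j) u = 0) \<and> (\<forall>i<k. dotp p (a i) u = 0)"
proof -
  have "card {..<k} < card {..k}" by simp
  from homogeneous_system_nontrivial[OF _ _ this, of "\<lambda>i j. dotp p (a i) (V j)"] obtain c where
    c: "\<exists>j\<le>k. c j \<noteq> 0" "\<forall>i<k. (\<Sum>j\<le>k. dotp p (a i) (V j) * c j) = 0" by auto
  define u where "u i = (\<Sum>j\<le>k. c j * V j i)" for i
  have Vu: "dotp p (V j) u = (if j \<le> k then c j else 0)" if "j < p" for j
  proof -
    have "dotp p (V j) u = (\<Sum>l\<le>k. c l * dotp p (V j) (V l))" unfolding u_def dotp_linear ..
    also have "\<dots> = (\<Sum>l\<le>k. c l * of_bool (j = l))"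
      using V that k by (intro sum.cong) (auto simp: orthonormal_def)
    also have "\<dots> = (if j \<le> k then c j else 0)"
      by (simp add: of_bool_def if_distrib cong: if_cong)
    finally show ?thesis .
  qed
  have "\<forall>i<k. dotp p (a i) u = 0"
    using c(2) unfolding u_def dotp_linear by (simp add: mult.commute)
  moreover have "dotp p u u > 0"
  proof -
    obtain j where j: "j \<le> k" "c j \<noteq> 0" using c by blast
    have "0 < (dotp p (V j) u)\<^sup>2" using Vu[of j] j k by simp
    also have "\<dots> \<le> dotp p (V j) (V j) * dotp p u u" by (rule dotp_Cauchy_Schwarz)
    also have "dotp p (V j) (V j) = 1" using V j k by (simp add: orthonormal_def)
    finally show ?thesis by simp
  qed
  ultimately show ?thesis using Vu k by (intro exI[of _ u]) auto
qed

text \<open>Weyl's inequality. The test vector lies in the span of the top \<open>k + 1\<close>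
  eigenvectors of \<open>A\<close> and is orthogonal to the top \<open>k\<close> eigenvectors of
  \<open>B\<close>, so a Rayleigh bound applies on each side.\<close>

lemma eigenvalue_mono_perturb:
  assumes A: "eigensystem p A V \<phi>" and B: "eigensystem p B W \<psi>" and k: "k < p"
    and le: "\<And>u. dotp p u (mulv p A u) \<le> dotp p u (mulv p B u) + \<Delta> * dotp p u u"
  shows "\<phi> k \<le> \<psi> k + \<Delta>"
proof -
  have "orthonormal p V" using A by (simp add: eigensystem_def)
  from ex_vector_in_top_span[OF this k, of W] obtain u where
    u: "dotp p u u > 0" "\<And>j. k < j \<Longrightarrow> j < p \<Longrightarrow> dotp p (V j) u = 0" "\<And>i. i < k \<Longrightarrow> dotp p (W i) u = 0" by blast
  have "\<phi> k * dotp p u u \<le> dotp p u (mulv p A u)" by (rule eigensystem_lower[OF A k u(2)])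
  also have "\<dots> \<le> dotp p u (mulv p B u) + \<Delta> * dotp p u u" by (rule le)
  also have "dotp p u (mulv p B u) \<le> \<psi> k * dotp p u u" by (rule eigensystem_upper[OF B k u(3)])
  finally have "\<phi> k * dotp p u u \<le> (\<psi> k + \<Delta>) * dotp p u u" by (simp add: algebra_simps)
  then show ?thesis using u(1) by simp
qed

lemma eigs_desc_nth:
  "eigensystem p A V \<phi> \<Longrightarrow> k < p \<Longrightarrow> eigs_desc p A ! k = \<phi> k"
  by (simp add: eigs_desc_eq)

text \<open>Weyl's inequality in both directions, with the entrywise sum as a crude operator norm.
  Its purpose is continuity, and through it measurability, of the ordered eigenvalues.\<close>

lemma eigs_desc_Lipschitz:
  assumes "symmetric_mat p A" "symmetric_mat p B" "k < p"
  shows "\<bar>eigs_desc p A ! k - eigs_desc p B ! k\<bar> \<le> (\<Sum>i<p. \<Sum>j<p. \<bar>A i j - B i j\<bar>)"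
proof -
  have *: "dotp p u (mulv p A u) \<le> dotp p u (mulv p B u) + (\<Sum>i<p. \<Sum>j<p. \<bar>A i j - B i j\<bar>) * dotp p u u"
    for A B :: "nat \<Rightarrow> nat \<Rightarrow> real" and u
  proof -
    have "dotp p u (mulv p A u) - dotp p u (mulv p B u) = (\<Sum>i<p. \<Sum>j<p. (A i j - B i j) * (u i * u j))"
      by (simp add: dotp_def mulv_def sum_distrib_left sum_subtractf[symmetric] algebra_simps)
    also have "\<dots> \<le> (\<Sum>i<p. \<Sum>j<p. \<bar>A i j - B i j\<bar> * dotp p u u)"
    proof (intro sum_mono)
      fix i j assume "i \<in> {..<p}" "j \<in> {..<p}"
      then have "(u i)\<^sup>2 \<le> dotp p u u" "(u j)\<^sup>2 \<le> dotp p u u"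
        unfolding dotp_def power2_eq_square by (auto intro!: member_le_sum)
      then have "\<bar>u i * u j\<bar> \<le> dotp p u u"
        using sum_squares_bound[of "\<bar>u i\<bar>" "\<bar>u j\<bar>"] by (simp add: abs_mult)
      then have "\<bar>A i j - B i j\<bar> * \<bar>u i * u j\<bar> \<le> \<bar>A i j - B i j\<bar> * dotp p u u"
        by (intro mult_left_mono) auto
      then show "(A i j - B i j) * (u i * u j) \<le> \<bar>A i j - B i j\<bar> * dotp p u u"
        by (metis abs_le_D1 abs_mult)
    qed
    finally show ?thesis by (simp add: sum_distrib_right)
  qed
  obtain V \<phi> W \<psi> where AB: "eigensystem p A V \<phi>" "eigensystem p B W \<psi>"
    using ex_eigensystem assms by blast
  have "\<phi> k \<le> \<psi> k + (\<Sum>i<p. \<Sum>j<p. \<bar>A i j - B i j\<bar>)"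
    by (rule eigenvalue_mono_perturb[OF AB assms(3) *])
  moreover have "\<psi> k \<le> \<phi> k + (\<Sum>i<p. \<Sum>j<p. \<bar>B i j - A i j\<bar>)"
    by (rule eigenvalue_mono_perturb[OF AB(2,1) assms(3) *])
  ultimately show ?thesis using AB assms(3) by (simp add: eigs_desc_nth abs_le_iff abs_minus_commute)
qed

lemma continuous_on_eigs_desc:
  assumes "k < p"
  shows "continuous_on {A. symmetric_mat p A} (\<lambda>A. eigs_desc p A ! k)"
  unfolding continuous_on_def
proof
  fix A assume A: "A \<in> {A. symmetric_mat p A}"
  let ?F = "at A within {A. symmetric_mat p A}"
  have coord: "((\<lambda>B. B i j) \<longlongrightarrow> A i j) ?F" for i j
  proof -
    have "continuous_on UNIV (\<lambda>B :: nat \<Rightarrow> nat \<Rightarrow> real. B i j)"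
      using continuous_on_compose2[OF continuous_on_product_coordinates[of j] continuous_on_product_coordinates[of i]] by simp
    then show ?thesis by (auto simp: continuous_on_def intro: tendsto_within_subset)
  qed
  have "((\<lambda>B. \<Sum>i<p. \<Sum>j<p. \<bar>B i j - A i j\<bar>) \<longlongrightarrow> (\<Sum>i<p. \<Sum>j<p. \<bar>A i j - A i j\<bar>)) ?F"
    by (intro tendsto_intros coord)
  then have lim: "((\<lambda>B. \<Sum>i<p. \<Sum>j<p. \<bar>B i j - A i j\<bar>) \<longlongrightarrow> 0) ?F" by simp
  have "\<forall>\<^sub>F B in ?F. norm (eigs_desc p B ! k - eigs_desc p A ! k) \<le> (\<Sum>i<p. \<Sum>j<p. \<bar>B i j - A i j\<bar>)"
    using A assms unfolding eventually_at_filter by (auto intro!: always_eventually eigs_desc_Lipschitz)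
  from Lim_null_comparison[OF this lim] show "((\<lambda>A. eigs_desc p A ! k) \<longlongrightarrow> eigs_desc p A ! k) ?F"
    by (simp add: LIM_zero_iff)
qed

text \<open>Continuity is available on the closed set of symmetric matrices, hence the passage
  through \<open>restrict_space\<close>.\<close>

lemma measurable_eigs_desc:
  assumes S: "\<And>i j. (\<lambda>\<omega>. S \<omega> i j) \<in> borel_measurable M"
    and sym: "\<And>\<omega>. \<omega> \<in> space M \<Longrightarrow> symmetric_mat p (S \<omega>)" and k: "k < p"
  shows "(\<lambda>\<omega>. eigs_desc p (S \<omega>) ! k) \<in> borel_measurable M"
proof -
  have coord: "continuous_on UNIV (\<lambda>B :: nat \<Rightarrow> nat \<Rightarrow> real. B i j)" for i j
    using continuous_on_compose2[OF continuous_on_product_coordinates[of j] continuous_on_product_coordinates[of i]] by simp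
  have "{A :: nat \<Rightarrow> nat \<Rightarrow> real. symmetric_mat p A} = (\<Inter>i\<in>{..<p}. \<Inter>j\<in>{..<p}. {A. A i j = A j i})"
    by (auto simp: symmetric_mat_def)
  also have "closed \<dots>" by (intro closed_INT ballI closed_Collect_eq coord)
  finally have cl: "{A. symmetric_mat p A} \<in> sets borel" by (rule borel_closed)
  have "(\<lambda>\<omega>. S \<omega>) \<in> M \<rightarrow>\<^sub>M borel"
    by (intro measurable_coordinatewise_then_product S)
  then have "S \<in> M \<rightarrow>\<^sub>M restrict_space borel {A. symmetric_mat p A}"
    using sym by (intro measurable_restrict_space2) auto
  from measurable_compose[OF this borel_measurable_continuous_on_restrict[OF continuous_on_eigs_desc[OF k]]]
  show ?thesis .
qed

subsection \<open>Perturbation of spiked Gram matrices\<close>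

lemma dotp_split: "d \<le> p \<Longrightarrow> dotp p u v = (\<Sum>i<d. u i * v i) + (\<Sum>i=d..<p. u i * v i)"
  by (simp add: dotp_def lessThan_atLeast0 sum.atLeastLessThan_concat)

text \<open>The sum of the rank one matrices of the \<open>y k\<close> has rank at most
  \<open>d\<close>, so its eigenvectors from index \<open>d\<close> on annihilate every
  \<open>y k\<close>. An eigenbasis works even if the \<open>y k\<close> are dependent. With the
  vector of ones as only \<open>y k\<close> the result is a Helmert matrix.\<close>

lemma ex_orthonormal_adapted:
  fixes y :: "nat \<Rightarrow> nat \<Rightarrow> real"
  shows "\<exists>W. orthonormal N W \<and> (\<forall>k<d. \<forall>t. d \<le> t \<longrightarrow> t < N \<longrightarrow> dotp N (W t) (y k) = 0)"
proof -
  define A where "A s t = (\<Sum>k<d. y k s * y k t)" for s t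
  have quad: "dotp N u (mulv N A u) = (\<Sum>k<d. (dotp N (y k) u)\<^sup>2)" for u
  proof -
    have "dotp N u (mulv N A u) = (\<Sum>s<N. \<Sum>t<N. \<Sum>k<d. (y k s * u s) * (y k t * u t))"
      by (simp add: dotp_def mulv_def A_def sum_distrib_left sum_distrib_right mult_ac)
    also have "\<dots> = (\<Sum>k<d. \<Sum>s<N. \<Sum>t<N. (y k s * u s) * (y k t * u t))"
      by (subst sum.swap, subst (2) sum.swap) (simp add: sum.swap[of _ "{..<d}"])
    finally show ?thesis by (simp add: dotp_def power2_eq_square sum_product)
  qed
  have "symmetric_mat N A" by (simp add: symmetric_mat_def A_def mult.commute)
  then obtain W \<phi> where es: "eigensystem N A W \<phi>" using ex_eigensystem by blast
  then have W: "orthonormal N W" by (simp add: eigensystem_def)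
  have "dotp N (W t) (y k) = 0" if "k < d" "d \<le> t" "t < N" for k t
  proof -
    have "d < N" using that by simp
    \<comment> \<open>A vector in the span of the first \<open>d + 1\<close> eigenvectors that is
      orthogonal to all \<open>y k\<close> shows \<open>\<phi> d \<le> 0\<close>. As the form is a
      sum of squares, it vanishes on the later eigenvectors.\<close>
    from ex_vector_in_top_span[OF W this, of y] obtain u where
      u: "dotp N u u > 0" "\<And>j. d < j \<Longrightarrow> j < N \<Longrightarrow> dotp N (W j) u = 0" "\<forall>i<d. dotp N (y i) u = 0" by blast
    have "\<phi> d * dotp N u u \<le> 0"
      using eigensystem_lower[OF es \<open>d < N\<close> u(2)] u(3) by (simp add: quad)
    then have "\<phi> d \<le> 0" using u(1) by (simp add: mult_le_0_iff)
    moreover have "\<phi> t \<le> \<phi> d" using es that by (auto simp: eigensystem_def)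
    moreover have "dotp N (W t) (mulv N A (W t)) = \<phi> t"
    proof -
      have "dotp N (W t) (mulv N A (W t)) = dotp N (W t) (\<lambda>i. \<phi> t * W t i)"
        using es that by (intro dotp_cong) (auto simp: eigensystem_def)
      then show ?thesis unfolding dotp_linear using W that by (simp add: orthonormal_def)
    qed
    ultimately have "(\<Sum>k<d. (dotp N (y k) (W t))\<^sup>2) \<le> 0" by (simp add: quad)
    moreover have "0 \<le> (\<Sum>k<d. (dotp N (y k) (W t))\<^sup>2)" by (simp add: sum_nonneg)
    ultimately have "(\<Sum>k<d. (dotp N (y k) (W t))\<^sup>2) = 0" by simp
    then have "\<forall>k\<in>{..<d}. (dotp N (y k) (W t))\<^sup>2 = 0"
      by (subst (asm) sum_nonneg_eq_0_iff) auto
    then show ?thesis using that by (simp add: dotp_commute)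
  qed
  with W show ?thesis by blast
qed

text \<open>Both sides are the trace of the square of a Gram matrix, and \<open>w w'\<close> and
  \<open>w' w\<close> share it.\<close>

lemma sum_gram_squares_swap:
  fixes w :: "nat \<Rightarrow> nat \<Rightarrow> real"
  assumes "finite K" "finite T"
  shows "(\<Sum>s\<in>T. \<Sum>t\<in>T. (\<Sum>k\<in>K. w k s * w k t)\<^sup>2) = (\<Sum>k\<in>K. \<Sum>l\<in>K. (\<Sum>t\<in>T. w k t * w l t)\<^sup>2)"
proof -
  have "(\<Sum>s\<in>T. \<Sum>t\<in>T. (\<Sum>k\<in>K. w k s * w k t)\<^sup>2) =
      (\<Sum>s\<in>T. \<Sum>t\<in>T. \<Sum>k\<in>K. \<Sum>l\<in>K. (w k s * w l s) * (w k t * w l t))"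
    by (simp add: power2_eq_square sum_product mult_ac)
  also have "\<dots> = (\<Sum>s\<in>T. \<Sum>k\<in>K. \<Sum>l\<in>K. \<Sum>t\<in>T. (w k s * w l s) * (w k t * w l t))"
    by (subst (2) sum.swap) (simp add: sum.swap[of _ K T])
  also have "\<dots> = (\<Sum>k\<in>K. \<Sum>l\<in>K. \<Sum>s\<in>T. \<Sum>t\<in>T. (w k s * w l s) * (w k t * w l t))"
    by (subst sum.swap) (simp add: sum.swap[of _ T K])
  finally show ?thesis by (simp add: power2_eq_square sum_product)
qed

text \<open>The first \<open>d\<close> rows are spikes supported on the first \<open>d\<close>
  columns, the other rows are noise. If \<open>e k\<close> is the energy that the vector of a large
  eigenvalue leaks to the other columns, its eigenvector equation gives
  \<open>\<phi> k * e k \<le> z * e k + sqrt (C2 * e k * \<phi> k)\<close>, and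
  \<open>z \<le> \<phi> k / 2\<close> turns this into \<open>\<phi> k * e k \<le> 4 * C2\<close>.
  The total leakage \<open>\<eta>\<close> then controls every error term.\<close>

lemma spiked_gram_perturbation:
  fixes X :: "nat \<Rightarrow> nat \<Rightarrow> real"
  assumes es: "eigensystem p A V \<phi>"
    and A: "\<And>i j. i < p \<Longrightarrow> j < p \<Longrightarrow> A i j = (\<Sum>t<N. X i t * X j t)"
    and d: "0 < d" "d < p" "d \<le> N"
    and X0: "\<And>k t. k < d \<Longrightarrow> d \<le> t \<Longrightarrow> t < N \<Longrightarrow> X k t = 0"
    and opn: "\<And>w. (\<Sum>i=d..<p. (\<Sum>t<N. X i t * w t)\<^sup>2) \<le> z * dotp N w w"
    and low: "\<And>u. lw * (\<Sum>k<d. (u k)\<^sup>2) \<le> (\<Sum>t<N. (\<Sum>k<d. u k * X k t)\<^sup>2)"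
    and zl: "0 \<le> z" "2 * z \<le> lw" "0 < lw"
  defines "C2 \<equiv> \<Sum>s<d. \<Sum>t=d..<N. (\<Sum>i=d..<p. X i s * X i t)\<^sup>2"
  obtains \<eta> where "0 \<le> \<eta>" "\<eta> \<le> 4 * real d * C2 / lw"
    "\<bar>(\<Sum>k=d..<p. \<phi> k) - (\<Sum>i=d..<p. \<Sum>t=d..<N. (X i t)\<^sup>2)\<bar> \<le> \<eta>"
    "\<bar>(\<Sum>k=d..<p. (\<phi> k)\<^sup>2) - (\<Sum>s=d..<N. \<Sum>t=d..<N. (\<Sum>i=d..<p. X i s * X i t)\<^sup>2)\<bar> \<le> 4 * z * \<eta> + \<eta>\<^sup>2"
proof -
  have V: "orthonormal p V" using es by (simp add: eigensystem_def)
  have mono: "\<phi> l \<le> \<phi> k" if "k \<le> l" "l < p" for k l using es that by (simp add: eigensystem_def)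
  \<comment> \<open>The transpose of \<open>X\<close> applied to \<open>V k\<close>: a right
    singular vector, scaled to squared norm \<open>\<phi> k\<close>.\<close>
  define x where "x k t = (\<Sum>i<p. V k i * X i t)" for k t
  have quadA: "dotp p u (mulv p A v) = dotp N (\<lambda>t. \<Sum>i<p. u i * X i t) (\<lambda>t. \<Sum>i<p. v i * X i t)" for u v
  proof -
    have "dotp p u (mulv p A v) = (\<Sum>i<p. \<Sum>j<p. \<Sum>t<N. (u i * X i t) * (v j * X j t))"
      by (simp add: dotp_def mulv_def A sum_distrib_left sum_distrib_right mult_ac)
    also have "\<dots> = (\<Sum>t<N. \<Sum>i<p. \<Sum>j<p. (u i * X i t) * (v j * X j t))"
      by (subst sum.swap, subst (2) sum.swap, subst sum.swap) (simp add: sum.swap[of _ "{..<N}"])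
    finally show ?thesis by (simp add: dotp_def sum_product)
  qed
  have xx: "dotp N (x k) (x l) = (if k = l then \<phi> k else 0)" if "k < p" "l < p" for k l
  proof -
    have "dotp N (x k) (x l) = dotp p (V k) (mulv p A (V l))" unfolding quadA x_def ..
    also have "\<dots> = dotp p (V k) (\<lambda>i. \<phi> l * V l i)"
      using es that by (intro dotp_cong) (auto simp: eigensystem_def)
    also have "\<dots> = (if k = l then \<phi> k else 0)"
      unfolding dotp_linear using V that by (simp add: orthonormal_def)
    finally show ?thesis .
  qed
  have phi_nn: "0 \<le> \<phi> k" if "k < p" for k using xx[OF that that] dotp_nonneg[of N "x k"] by simp
  have BX: "(\<Sum>i<p. X i s * X i t) = (\<Sum>k<p. x k s * x k t)" for s t
    using orthonormal_Parseval[OF V, of "\<lambda>i. X i s" "\<lambda>i. X i t"] by (simp add: dotp_def x_def)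
  \<comment> \<open>For a column index \<open>s \<ge> d\<close> the spikes contribute nothing, so
    row \<open>s\<close> of the column Gram matrix comes from the noise alone.\<close>
  have BZ: "(\<Sum>i=d..<p. X i s * X i t) = (\<Sum>k<p. x k s * x k t)" if "d \<le> s" "s < N" for s t
  proof -
    have "(\<Sum>i<p. X i s * X i t) = (\<Sum>i<d. X i s * X i t) + (\<Sum>i=d..<p. X i s * X i t)"
      using d dotp_split[of d p "\<lambda>i. X i s" "\<lambda>i. X i t"] by (simp add: dotp_def)
    moreover have "(\<Sum>i<d. X i s * X i t) = 0" using X0 that by (intro sum.neutral) auto
    ultimately show ?thesis using BX[of s t] by simp
  qed
  text \<open>The largest \<open>d\<close> eigenvalues dominate \<open>lw\<close>, the others are at most \<open>z\<close>.\<close>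
  have top: "lw \<le> \<phi> k" if "k < d" for k
  proof -
    \<comment> \<open>Some combination of the \<open>d\<close> spike coordinates is orthogonal to
      the first \<open>d - 1\<close> eigenvectors; its Rayleigh quotient is at least
      \<open>lw\<close> and at most \<open>\<phi> (d - 1)\<close>.\<close>
    have "card {..<d - 1} < card {..<d}" using d by simp
    from homogeneous_system_nontrivial[OF _ _ this, of V] obtain c where
      c: "\<exists>i<d. c i \<noteq> 0" "\<forall>j<d-1. (\<Sum>i<d. V j i * c i) = 0" by auto
    define u where "u i = (if i < d then c i else 0)" for i
    have ud: "(\<Sum>i<p. f i * u i) = (\<Sum>i<d. f i * c i)" for f
    proof -
      have "{..<p} = {..<d} \<union> {d..<p}" using d by auto
      moreover have "sum (\<lambda>i. f i * u i) ({..<d} \<union> {d..<p}) = (\<Sum>i<d. f i * u i) + (\<Sum>i=d..<p. f i * u i)"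
        by (rule sum.union_disjoint) auto
      ultimately show ?thesis by (simp add: u_def)
    qed
    have uu: "dotp p u u = (\<Sum>i<d. (c i)\<^sup>2)"
      unfolding dotp_def ud by (simp add: u_def power2_eq_square)
    obtain i where "i < d" "0 < (c i)\<^sup>2" using c by auto
    then have pos: "0 < (\<Sum>i<d. (c i)\<^sup>2)" by (intro sum_pos2[of _ i]) auto
    have "lw * (\<Sum>i<d. (c i)\<^sup>2) \<le> (\<Sum>t<N. (\<Sum>k<d. c k * X k t)\<^sup>2)" by (rule low)
    also have "\<dots> = dotp p u (mulv p A u)" unfolding quadA
      using ud[of "\<lambda>i. X i _"] by (simp add: dotp_def power2_eq_square mult.commute)
    also have "\<dots> \<le> \<phi> (d - 1) * dotp p u u"
      using c d ud[of "V _"] by (intro eigensystem_upper[OF es]) (auto simp: dotp_def)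
    finally have "lw \<le> \<phi> (d - 1)" using pos by (simp add: uu)
    also have "\<dots> \<le> \<phi> k" using that d by (intro mono) auto
    finally show ?thesis .
  qed
  have hz: "\<phi> d \<le> z"
  proof -
    \<comment> \<open>The functionals are the first \<open>d\<close> coordinates, so
      \<open>u\<close> involves noise rows only.\<close>
    from ex_vector_in_top_span[OF V d(2), of "\<lambda>i j. of_bool (i = j)"] obtain u where
      u: "dotp p u u > 0" "\<And>j. d < j \<Longrightarrow> j < p \<Longrightarrow> dotp p (V j) u = 0"
        "\<And>i. i < d \<Longrightarrow> dotp p (\<lambda>j. of_bool (i = j)) u = 0" by blast
    have u0: "u i = 0" if "i < d" for i
    proof -
      have "dotp p (\<lambda>j. of_bool (i = j)) u = (\<Sum>j<p. if j = i then u j else 0)"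
        unfolding dotp_def by (intro sum.cong) auto
      also have "\<dots> = u i" using that d by simp
      finally show ?thesis using u(3)[OF that] by simp
    qed
    have ud: "(\<Sum>i<p. f i * u i) = (\<Sum>i=d..<p. f i * u i)" for f
      using d dotp_split[of d p f u] u0 by (simp add: dotp_def)
    define w where "w t = (\<Sum>i<p. u i * X i t)" for t
    have w: "w t = (\<Sum>i=d..<p. X i t * u i)" for t
      unfolding w_def using ud[of "\<lambda>i. X i t"] by (simp add: mult.commute)
    have uAu: "dotp p u (mulv p A u) = dotp N w w" unfolding quadA w_def ..
    have "dotp N w w = (\<Sum>i=d..<p. u i * (\<Sum>t<N. X i t * w t))"
      unfolding dotp_def by (subst w) (simp add: sum_distrib_right sum_distrib_left sum.swap[of _ "{..<N}"] mult_ac)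
    \<comment> \<open>Duality: the bound on the noise block transfers to its transpose by
      Cauchy-Schwarz and cancellation of \<open>dotp N w w\<close>.\<close>
    then have "(dotp N w w)\<^sup>2 \<le> (\<Sum>i=d..<p. (u i)\<^sup>2) * (\<Sum>i=d..<p. (\<Sum>t<N. X i t * w t)\<^sup>2)"
      by (simp add: Cauchy_Schwarz_ineq_sum)
    also have "\<dots> \<le> (\<Sum>i=d..<p. (u i)\<^sup>2) * (z * dotp N w w)"
      by (intro mult_left_mono opn sum_nonneg) auto
    also have "(\<Sum>i=d..<p. (u i)\<^sup>2) = dotp p u u"
      unfolding dotp_def ud by (simp add: power2_eq_square)
    finally have sq: "dotp N w w * dotp N w w \<le> (z * dotp p u u) * dotp N w w"
      by (simp add: power2_eq_square mult_ac)
    have "dotp N w w \<le> z * dotp p u u"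
    proof (cases "dotp N w w = 0")
      case False
      then have "dotp N w w > 0" using dotp_nonneg[of N w] by simp
      with sq show ?thesis by simp
    qed (use zl dotp_nonneg in simp)
    moreover have "\<phi> d * dotp p u u \<le> dotp p u (mulv p A u)" using u d by (intro eigensystem_lower[OF es]) auto
    ultimately have "\<phi> d * dotp p u u \<le> z * dotp p u u" by (simp add: uAu)
    then show ?thesis using u by simp
  qed
  have lz: "\<phi> k \<le> z" "0 \<le> \<phi> k" if "d \<le> k" "k < p" for k using mono[OF that] hz phi_nn that by auto
  \<comment> \<open>Two leakages: \<open>\<eta>\<close> is the energy of the spike vectors in the
    columns from \<open>d\<close> on, \<open>\<zeta>\<close> that of the noise vectors in the first
    \<open>d\<close> columns.\<close>
  define e where "e k = (\<Sum>t=d..<N. (x k t)\<^sup>2)" for k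
  define \<eta> where "\<eta> = (\<Sum>k<d. e k)"
  define \<zeta> where "\<zeta> = (\<Sum>k=d..<p. \<Sum>t<d. (x k t)\<^sup>2)"
  have e_nn: "0 \<le> e k" for k by (simp add: e_def sum_nonneg)
  have eta_nn: "0 \<le> \<eta>" by (simp add: \<eta>_def e_nn sum_nonneg)
  have zeta_nn: "0 \<le> \<zeta>" by (simp add: \<zeta>_def sum_nonneg)
  have C2_nn: "0 \<le> C2" by (simp add: C2_def sum_nonneg)
  text \<open>The eigenvector equation, projected to the coordinates \<open>t \<ge> d\<close>, controls the leakage \<open>e k\<close>.\<close>
  have e_bound: "e k \<le> 4 * C2 / lw" if k: "k < d" for k
  proof -
    have kp: "k < p" using k d by simp
    have eig: "\<phi> k * x k s = (\<Sum>t<N. (\<Sum>l<p. x l s * x l t) * x k t)" for s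
    proof -
      have "(\<Sum>t<N. (\<Sum>l<p. x l s * x l t) * x k t) = (\<Sum>l<p. x l s * dotp N (x l) (x k))"
        by (simp add: dotp_def sum_distrib_left sum_distrib_right sum.swap[of _ "{..<N}"] mult_ac)
      also have "\<dots> = (\<Sum>l<p. if l = k then x l s * \<phi> l else 0)"
        using kp by (intro sum.cong) (auto simp: xx)
      finally show ?thesis using kp by simp
    qed
    \<comment> \<open>The pairing of row \<open>i\<close> with \<open>x k\<close>, split into the
      columns from \<open>d\<close> on (\<open>g\<close>) and the first \<open>d\<close> columns
      (\<open>a\<close>).\<close>
    define g where "g i = (\<Sum>s=d..<N. X i s * x k s)" for i
    define a where "a i = (\<Sum>t<d. X i t * x k t)" for i
    have "\<phi> k * e k = (\<Sum>s=d..<N. x k s * (\<phi> k * x k s))"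
      by (simp add: e_def sum_distrib_left power2_eq_square mult_ac)
    also have "\<dots> = (\<Sum>s=d..<N. x k s * (\<Sum>t<N. (\<Sum>i=d..<p. X i s * X i t) * x k t))"
      using BZ by (intro sum.cong) (auto simp: eig)
    also have "\<dots> = (\<Sum>i=d..<p. \<Sum>s=d..<N. \<Sum>t<N. (X i s * x k s) * (X i t * x k t))"
      by (simp add: sum_distrib_left sum_distrib_right sum.swap[of _ "{d..<p}"] mult_ac)
    also have "\<dots> = (\<Sum>i=d..<p. g i * (a i + g i))"
    proof (intro sum.cong refl)
      fix i
      have "(\<Sum>t<N. X i t * x k t) = a i + g i"
        using d dotp_split[of d N "X i" "x k"] by (simp add: dotp_def a_def g_def)
      then show "(\<Sum>s=d..<N. \<Sum>t<N. (X i s * x k s) * (X i t * x k t)) = g i * (a i + g i)"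
        by (simp add: g_def sum_product[symmetric])
    qed
    finally have 1: "\<phi> k * e k = (\<Sum>i=d..<p. (g i)\<^sup>2) + (\<Sum>i=d..<p. g i * a i)"
      by (simp add: algebra_simps power2_eq_square sum.distrib)
    have 2: "(\<Sum>i=d..<p. (g i)\<^sup>2) \<le> z * e k"
    proof -
      let ?w = "\<lambda>t. if d \<le> t then x k t else 0"
      have "(\<Sum>t<N. X i t * ?w t) = g i" for i
        using d dotp_split[of d N "X i" ?w] by (simp add: dotp_def g_def)
      moreover have "dotp N ?w ?w = e k"
        using d dotp_split[of d N ?w ?w] by (simp add: e_def power2_eq_square)
      ultimately show ?thesis using opn[of ?w] by simp
    qed
    \<comment> \<open>The mixed term meets only the off-diagonal block of the noise Gram matrix,
      whose squared Frobenius norm is \<open>C2\<close>.\<close>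
    have 3: "(\<Sum>i=d..<p. g i * a i)\<^sup>2 \<le> C2 * (e k * \<phi> k)"
    proof -
      have "(\<Sum>i=d..<p. g i * a i) = (\<Sum>s<d. \<Sum>t=d..<N. (\<Sum>i=d..<p. X i s * X i t) * (x k s * x k t))"
        unfolding g_def a_def sum_product
        by (simp add: sum_distrib_left sum_distrib_right sum.swap[of _ "{d..<p}"] sum.swap[of _ "{d..<N}" "{..<d}"] mult_ac)
      also have "\<dots> = (\<Sum>(s,t)\<in>{..<d}\<times>{d..<N}. (\<Sum>i=d..<p. X i s * X i t) * (x k s * x k t))"
        by (simp add: sum.cartesian_product)
      finally have "(\<Sum>i=d..<p. g i * a i)\<^sup>2 \<le> (\<Sum>st\<in>{..<d}\<times>{d..<N}. (\<Sum>i=d..<p. X i (fst st) * X i (snd st))\<^sup>2) *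
          (\<Sum>st\<in>{..<d}\<times>{d..<N}. (x k (fst st) * x k (snd st))\<^sup>2)"
        using Cauchy_Schwarz_ineq_sum[of "\<lambda>st. \<Sum>i=d..<p. X i (fst st) * X i (snd st)" "\<lambda>st. x k (fst st) * x k (snd st)"]
        by (simp add: case_prod_beta)
      also have "(\<Sum>st\<in>{..<d}\<times>{d..<N}. (\<Sum>i=d..<p. X i (fst st) * X i (snd st))\<^sup>2) = C2"
        unfolding C2_def by (simp add: sum.cartesian_product case_prod_beta)
      also have "(\<Sum>st\<in>{..<d}\<times>{d..<N}. (x k (fst st) * x k (snd st))\<^sup>2) = (\<Sum>s<d. (x k s)\<^sup>2) * e k"
        unfolding e_def sum_product by (simp add: sum.cartesian_product case_prod_beta power_mult_distrib)
      also have "C2 * ((\<Sum>s<d. (x k s)\<^sup>2) * e k) \<le> C2 * (\<phi> k * e k)"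
      proof (intro mult_left_mono mult_right_mono e_nn C2_nn)
        have "\<phi> k = (\<Sum>s<d. (x k s)\<^sup>2) + e k"
          using xx[OF kp kp] dotp_split[OF d(3), of "x k" "x k"] by (simp add: e_def power2_eq_square)
        then show "(\<Sum>s<d. (x k s)\<^sup>2) \<le> \<phi> k" using e_nn[of k] by simp
      qed
      finally show ?thesis by (simp add: mult_ac)
    qed
    have phi: "lw \<le> \<phi> k" "0 < \<phi> k" using top[OF k] zl by auto
    \<comment> \<open>Since \<open>2 * z \<le> lw \<le> \<phi> k\<close>, the term
      \<open>z * e k\<close> is absorbed by the left-hand side.\<close>
    have "\<phi> k / 2 * e k \<le> (\<phi> k - z) * e k" using phi zl e_nn by (intro mult_right_mono) auto
    also have "\<dots> \<le> (\<Sum>i=d..<p. g i * a i)" using 1 2 by (simp add: algebra_simps)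
    finally have "(\<phi> k / 2 * e k)\<^sup>2 \<le> (\<Sum>i=d..<p. g i * a i)\<^sup>2"
      using phi e_nn by (intro power_mono) auto
    with 3 have 4: "\<phi> k * e k * (\<phi> k * e k) \<le> 4 * C2 * (\<phi> k * e k)"
      by (simp add: power2_eq_square mult_ac)
    have "\<phi> k * e k \<le> 4 * C2"
    proof (cases "e k = 0")
      case False
      then have "0 < \<phi> k * e k" using phi e_nn[of k] by simp
      with 4 show ?thesis by (rule mult_right_le_imp_le)
    qed (use C2_nn in simp)
    then have "lw * e k \<le> 4 * C2" using phi e_nn[of k] by (meson mult_right_mono order_trans)
    then show ?thesis using zl by (simp add: field_simps)
  qed
  have eta_bound: "\<eta> \<le> 4 * real d * C2 / lw"
  proof -
    have "\<eta> \<le> (\<Sum>k<d. 4 * C2 / lw)" unfolding \<eta>_def by (intro sum_mono e_bound) auto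
    then show ?thesis by (simp add: mult_ac)
  qed
  \<comment> \<open>The \<open>x k\<close> with \<open>k \<ge> d\<close> are orthogonal with squared
    norms at most \<open>z\<close>, so Bessel's inequality holds with the factor
    \<open>z\<close>.\<close>
  have Bessel: "(\<Sum>k=d..<p. (dotp N (x k) w)\<^sup>2) \<le> z * dotp N w w" for w
  proof -
    define y where "y k = dotp N (x k) w" for k
    define v where "v t = (\<Sum>k=d..<p. y k * x k t)" for t
    let ?Y = "\<Sum>k=d..<p. (y k)\<^sup>2"
    have vw: "dotp N v w = ?Y" unfolding v_def dotp_linear by (simp add: y_def power2_eq_square)
    have "dotp N v v = (\<Sum>k=d..<p. y k * (\<Sum>l=d..<p. y l * dotp N (x k) (x l)))"
      unfolding v_def dotp_linear ..
    also have "\<dots> = (\<Sum>k=d..<p. y k * (\<Sum>l=d..<p. if l = k then y l * \<phi> l else 0))"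
      by (intro sum.cong arg_cong2[where f="(*)"] refl) (auto simp: xx)
    also have "\<dots> = (\<Sum>k=d..<p. \<phi> k * (y k)\<^sup>2)" by (simp add: power2_eq_square mult_ac)
    also have "\<dots> \<le> (\<Sum>k=d..<p. z * (y k)\<^sup>2)"
      using lz by (intro sum_mono mult_right_mono) auto
    finally have vv: "dotp N v v \<le> z * ?Y" by (simp add: sum_distrib_left)
    have "?Y * ?Y \<le> dotp N v v * dotp N w w"
      using dotp_Cauchy_Schwarz[of N v w] unfolding vw by (simp add: power2_eq_square)
    also have "\<dots> \<le> z * ?Y * dotp N w w" using vv dotp_nonneg by (rule mult_right_mono)
    finally have "?Y * ?Y \<le> (z * dotp N w w) * ?Y" by (simp add: mult_ac)
    moreover have "0 \<le> ?Y" by (simp add: sum_nonneg)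
    ultimately have "?Y \<le> z * dotp N w w"
      using zl dotp_nonneg[of N w] by (cases "?Y = 0") auto
    then show ?thesis by (simp add: y_def)
  qed
  have zeta_eta: "\<zeta> \<le> \<eta>"
  proof -
    have "(\<Sum>k=d..<p. (x k t)\<^sup>2) \<le> z * (1 - (\<Sum>k<d. (x k t)\<^sup>2 / \<phi> k))" if t: "t < d" for t
    proof -
      define \<delta> :: "nat \<Rightarrow> real" where "\<delta> s = of_bool (s = t)" for s
      have d\<delta>: "dotp N w \<delta> = w t" for w
        using t d by (simp add: dotp_def \<delta>_def of_bool_def if_distrib cong: if_cong)
      \<comment> \<open>The projection of \<open>\<delta>\<close> onto the complement of the spike
        vectors. The noise vectors pair with it as with \<open>\<delta>\<close>, and summed over
        \<open>t < d\<close> its squared length is governed by the leakages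
        \<open>e k\<close>.\<close>
      define w where "w s = \<delta> s - (\<Sum>k<d. (x k t / \<phi> k) * x k s)" for s
      have sm: "(\<Sum>k<d. (x k t / \<phi> k) * dotp N (x l) (x k)) = (if l < d then x l t else 0)" if "l < p" for l
      proof -
        have "(\<Sum>k<d. (x k t / \<phi> k) * dotp N (x l) (x k)) = (\<Sum>k<d. if k = l then x k t else 0)"
          using that d top zl by (intro sum.cong) (auto simp: xx dest!: top)
        then show ?thesis by simp
      qed
      have 1: "dotp N (x l) w = (if l < d then 0 else x l t)" if "l < p" for l
        unfolding w_def dotp_linear d\<delta> sm[OF that] by simp
      have "dotp N w v = dotp N \<delta> v - (\<Sum>k<d. (x k t / \<phi> k) * dotp N (x k) v)" for v
        unfolding w_def dotp_linear ..
      then have "dotp N w w = dotp N \<delta> w - (\<Sum>k<d. (x k t / \<phi> k) * dotp N (x k) w)" .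
      also have "\<dots> = dotp N \<delta> w" using 1 d by simp
      also have "\<dots> = 1 - (\<Sum>k<d. (x k t / \<phi> k) * x k t)"
        unfolding dotp_commute[of N \<delta>] d\<delta> by (simp add: w_def \<delta>_def)
      finally have 2: "dotp N w w = 1 - (\<Sum>k<d. (x k t)\<^sup>2 / \<phi> k)" by (simp add: power2_eq_square)
      have "(\<Sum>k=d..<p. (x k t)\<^sup>2) = (\<Sum>k=d..<p. (dotp N (x k) w)\<^sup>2)" using 1 by (intro sum.cong) auto
      with Bessel[of w] 2 show ?thesis by simp
    qed
    then have "\<zeta> \<le> (\<Sum>t<d. z * (1 - (\<Sum>k<d. (x k t)\<^sup>2 / \<phi> k)))"
      unfolding \<zeta>_def by (subst sum.swap) (intro sum_mono, auto)
    also have "\<dots> = z * (\<Sum>k<d. 1 - (\<Sum>t<d. (x k t)\<^sup>2) / \<phi> k)"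
    proof -
      have "(\<Sum>t<d. \<Sum>k<d. (x k t)\<^sup>2 / \<phi> k) = (\<Sum>k<d. (\<Sum>t<d. (x k t)\<^sup>2) / \<phi> k)"
        by (subst sum.swap) (simp add: sum_divide_distrib)
      then show ?thesis by (simp add: sum_distrib_left[symmetric] sum_subtractf)
    qed
    also have "\<dots> = z * (\<Sum>k<d. e k / \<phi> k)"
    proof (intro arg_cong2[where f="(*)"] sum.cong refl)
      fix k assume "k \<in> {..<d}"
      then have k: "k < p" "0 < \<phi> k" using d top[of k] zl by auto
      have "\<phi> k = (\<Sum>s<d. (x k s)\<^sup>2) + e k"
        using xx[OF k(1) k(1)] dotp_split[OF d(3), of "x k" "x k"] by (simp add: e_def power2_eq_square)
      then show "1 - (\<Sum>t<d. (x k t)\<^sup>2) / \<phi> k = e k / \<phi> k" using k by (simp add: field_simps)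
    qed
    also have "\<dots> \<le> (\<Sum>k<d. e k)" unfolding sum_distrib_left
    proof (intro sum_mono)
      fix k assume "k \<in> {..<d}"
      then have "z \<le> \<phi> k" "0 < \<phi> k" using top[of k] zl by auto
      then show "z * (e k / \<phi> k) \<le> e k" using e_nn[of k] by (simp add: field_simps mult_right_mono)
    qed
    finally show ?thesis by (simp add: \<eta>_def)
  qed
  have tr1: "(\<Sum>i=d..<p. \<Sum>t=d..<N. (X i t)\<^sup>2) = \<eta> + (\<Sum>k=d..<p. \<phi> k) - \<zeta>"
  proof -
    have "(\<Sum>i=d..<p. \<Sum>t=d..<N. (X i t)\<^sup>2) = (\<Sum>t=d..<N. \<Sum>k<p. (x k t)\<^sup>2)"
      by (subst sum.swap) (use BZ in \<open>auto simp: power2_eq_square intro!: sum.cong\<close>)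
    also have "\<dots> = (\<Sum>k<p. e k)" unfolding e_def by (rule sum.swap)
    also have "\<dots> = \<eta> + (\<Sum>k=d..<p. e k)"
      unfolding \<eta>_def using d by (simp add: lessThan_atLeast0 sum.atLeastLessThan_concat)
    also have "(\<Sum>k=d..<p. e k) = (\<Sum>k=d..<p. \<phi> k - (\<Sum>t<d. (x k t)\<^sup>2))"
    proof (intro sum.cong refl)
      fix k assume "k \<in> {d..<p}"
      then show "e k = \<phi> k - (\<Sum>t<d. (x k t)\<^sup>2)"
        using xx[of k k] dotp_split[OF d(3), of "x k" "x k"] by (simp add: e_def power2_eq_square)
    qed
    finally show ?thesis by (simp add: sum_subtractf \<zeta>_def)
  qed
  \<comment> \<open>Spike part and noise part of the column Gram matrix. On the columns from
    \<open>d\<close> on \<open>K\<close> has Frobenius norm at most \<open>\<eta>\<close>, while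
    that of the full \<open>H\<close>, squared, is the sum of the squared small eigenvalues.\<close>
  define K where "K s t = (\<Sum>k<d. x k s * x k t)" for s t
  define H where "H s t = (\<Sum>k=d..<p. x k s * x k t)" for s t
  have KH: "(\<Sum>i=d..<p. X i s * X i t) = K s t + H s t" if "d \<le> s" "s < N" for s t
    using BZ[OF that] d by (simp add: K_def H_def lessThan_atLeast0 sum.atLeastLessThan_concat)
  have KK: "(\<Sum>s=d..<N. \<Sum>t=d..<N. (K s t)\<^sup>2) \<le> \<eta>\<^sup>2"
  proof -
    have "(\<Sum>s=d..<N. \<Sum>t=d..<N. (K s t)\<^sup>2) = (\<Sum>k<d. \<Sum>l<d. (\<Sum>t=d..<N. x k t * x l t)\<^sup>2)"
      unfolding K_def by (rule sum_gram_squares_swap) auto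
    also have "\<dots> \<le> (\<Sum>k<d. \<Sum>l<d. e k * e l)"
      unfolding e_def by (intro sum_mono Cauchy_Schwarz_ineq_sum)
    also have "\<dots> = \<eta>\<^sup>2" by (simp add: \<eta>_def power2_eq_square sum_product)
    finally show ?thesis .
  qed
  have KH2: "(\<Sum>s=d..<N. \<Sum>t=d..<N. K s t * H s t) = (\<Sum>k<d. \<Sum>l=d..<p. (\<Sum>t=d..<N. x k t * x l t)\<^sup>2)"
  proof -
    have "(\<Sum>s=d..<N. \<Sum>t=d..<N. K s t * H s t) =
      (\<Sum>s=d..<N. \<Sum>t=d..<N. \<Sum>k<d. \<Sum>l=d..<p. (x k s * x l s) * (x k t * x l t))"
      by (simp add: K_def H_def sum_product mult_ac)
    also have "\<dots> = (\<Sum>s=d..<N. \<Sum>k<d. \<Sum>l=d..<p. \<Sum>t=d..<N. (x k s * x l s) * (x k t * x l t))"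
      by (subst (2) sum.swap) (simp add: sum.swap[of _ "{d..<p}" "{d..<N}"])
    also have "\<dots> = (\<Sum>k<d. \<Sum>l=d..<p. \<Sum>s=d..<N. \<Sum>t=d..<N. (x k s * x l s) * (x k t * x l t))"
      by (subst sum.swap) (simp add: sum.swap[of _ "{d..<N}" "{d..<p}"])
    finally show ?thesis by (simp add: power2_eq_square sum_product)
  qed
  have KH3: "0 \<le> (\<Sum>s=d..<N. \<Sum>t=d..<N. K s t * H s t)" "(\<Sum>s=d..<N. \<Sum>t=d..<N. K s t * H s t) \<le> z * \<eta>"
  proof -
    show "0 \<le> (\<Sum>s=d..<N. \<Sum>t=d..<N. K s t * H s t)" unfolding KH2 by (simp add: sum_nonneg)
    show "(\<Sum>s=d..<N. \<Sum>t=d..<N. K s t * H s t) \<le> z * \<eta>"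
      unfolding KH2 \<eta>_def sum_distrib_left
    proof (intro sum_mono)
      fix k
      let ?w = "\<lambda>t. if d \<le> t then x k t else 0"
      have "dotp N (x l) ?w = (\<Sum>t=d..<N. x k t * x l t)" for l
        using d dotp_split[of d N "x l" ?w] by (simp add: mult.commute)
      moreover have "dotp N ?w ?w = e k"
        using d dotp_split[of d N ?w ?w] by (simp add: e_def power2_eq_square)
      ultimately show "(\<Sum>l=d..<p. (\<Sum>t=d..<N. x k t * x l t)\<^sup>2) \<le> z * e k" using Bessel[of ?w] by simp
    qed
  qed
  have L2: "(\<Sum>k=d..<p. (\<phi> k)\<^sup>2) = (\<Sum>s<N. \<Sum>t<N. (H s t)\<^sup>2)"
  proof -
    have "(\<Sum>s<N. \<Sum>t<N. (H s t)\<^sup>2) = (\<Sum>k=d..<p. \<Sum>l=d..<p. (dotp N (x k) (x l))\<^sup>2)"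
      unfolding H_def dotp_def by (rule sum_gram_squares_swap) auto
    also have "\<dots> = (\<Sum>k=d..<p. \<Sum>l=d..<p. if l = k then (\<phi> l)\<^sup>2 else 0)"
      by (intro sum.cong refl) (auto simp: xx)
    finally show ?thesis by simp
  qed
  \<comment> \<open>The loss when the first \<open>d\<close> rows of \<open>H\<close> are deleted;
    by symmetry the columns lose no more than that.\<close>
  have HHrow: "(\<Sum>s<d. \<Sum>t<N. (H s t)\<^sup>2) \<le> z * \<zeta>"
  proof -
    have "(\<Sum>t<N. (H s t)\<^sup>2) \<le> z * (\<Sum>k=d..<p. (x k s)\<^sup>2)" for s
    proof -
      have "(\<Sum>t<N. (H s t)\<^sup>2) = (\<Sum>t<N. \<Sum>k=d..<p. \<Sum>l=d..<p. (x k s * x l s) * (x k t * x l t))"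
        by (simp add: H_def power2_eq_square sum_product mult_ac)
      also have "\<dots> = (\<Sum>k=d..<p. \<Sum>l=d..<p. \<Sum>t<N. (x k s * x l s) * (x k t * x l t))"
        by (subst sum.swap) (simp add: sum.swap[of _ "{..<N}" "{d..<p}"])
      also have "\<dots> = (\<Sum>k=d..<p. \<Sum>l=d..<p. x k s * x l s * dotp N (x k) (x l))"
        by (simp add: dotp_def sum_distrib_left)
      also have "\<dots> = (\<Sum>k=d..<p. \<Sum>l=d..<p. if l = k then (x l s)\<^sup>2 * \<phi> l else 0)"
        by (intro sum.cong refl) (auto simp: xx power2_eq_square)
      also have "\<dots> = (\<Sum>k=d..<p. (x k s)\<^sup>2 * \<phi> k)" by simp
      also have "\<dots> \<le> (\<Sum>k=d..<p. (x k s)\<^sup>2 * z)"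
        using lz by (intro sum_mono mult_left_mono) auto
      finally show ?thesis by (simp add: sum_distrib_left mult.commute)
    qed
    then have "(\<Sum>s<d. \<Sum>t<N. (H s t)\<^sup>2) \<le> (\<Sum>s<d. z * (\<Sum>k=d..<p. (x k s)\<^sup>2))" by (intro sum_mono)
    also have "\<dots> = z * \<zeta>" by (simp add: \<zeta>_def sum_distrib_left[symmetric] sum.swap[of _ "{..<d}"])
    finally show ?thesis .
  qed
  have splitN: "(\<Sum>t<N. f t) = (\<Sum>t<d. f t) + (\<Sum>t=d..<N. f t)" for f :: "nat \<Rightarrow> real"
    using d by (simp add: lessThan_atLeast0 sum.atLeastLessThan_concat)
  have HH: "(\<Sum>s=d..<N. \<Sum>t=d..<N. (H s t)\<^sup>2) \<le> (\<Sum>k=d..<p. (\<phi> k)\<^sup>2)"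
    "(\<Sum>k=d..<p. (\<phi> k)\<^sup>2) \<le> (\<Sum>s=d..<N. \<Sum>t=d..<N. (H s t)\<^sup>2) + 2 * z * \<zeta>"
  proof -
    have eq: "(\<Sum>k=d..<p. (\<phi> k)\<^sup>2) = (\<Sum>s<d. \<Sum>t<N. (H s t)\<^sup>2) +
       ((\<Sum>s=d..<N. \<Sum>t<d. (H s t)\<^sup>2) + (\<Sum>s=d..<N. \<Sum>t=d..<N. (H s t)\<^sup>2))"
      unfolding L2 by (subst splitN) (simp add: splitN[of "\<lambda>t. (H _ t)\<^sup>2"] sum.distrib)
    have "(\<Sum>s=d..<N. \<Sum>t<d. (H s t)\<^sup>2) = (\<Sum>t<d. \<Sum>s=d..<N. (H t s)\<^sup>2)"
      by (subst sum.swap) (simp add: H_def mult.commute)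
    also have "\<dots> \<le> (\<Sum>s<d. \<Sum>t<N. (H s t)\<^sup>2)"
      unfolding splitN[of "\<lambda>t. (H _ t)\<^sup>2"] by (intro sum_mono) (simp add: sum_nonneg)
    finally have "(\<Sum>s=d..<N. \<Sum>t<d. (H s t)\<^sup>2) \<le> z * \<zeta>" using HHrow by simp
    moreover have "0 \<le> (\<Sum>s=d..<N. \<Sum>t<d. (H s t)\<^sup>2)" "0 \<le> (\<Sum>s<d. \<Sum>t<N. (H s t)\<^sup>2)"
      by (simp_all add: sum_nonneg)
    ultimately show "(\<Sum>s=d..<N. \<Sum>t=d..<N. (H s t)\<^sup>2) \<le> (\<Sum>k=d..<p. (\<phi> k)\<^sup>2)"
      "(\<Sum>k=d..<p. (\<phi> k)\<^sup>2) \<le> (\<Sum>s=d..<N. \<Sum>t=d..<N. (H s t)\<^sup>2) + 2 * z * \<zeta>"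
      using eq HHrow by auto
  qed
  have tr2: "(\<Sum>s=d..<N. \<Sum>t=d..<N. (\<Sum>i=d..<p. X i s * X i t)\<^sup>2) =
      (\<Sum>s=d..<N. \<Sum>t=d..<N. (K s t)\<^sup>2) + 2 * (\<Sum>s=d..<N. \<Sum>t=d..<N. K s t * H s t) +
      (\<Sum>s=d..<N. \<Sum>t=d..<N. (H s t)\<^sup>2)"
  proof -
    have "(\<Sum>s=d..<N. \<Sum>t=d..<N. (\<Sum>i=d..<p. X i s * X i t)\<^sup>2) =
       (\<Sum>s=d..<N. \<Sum>t=d..<N. (K s t)\<^sup>2 + 2 * (K s t * H s t) + (H s t)\<^sup>2)"
      using KH by (intro sum.cong refl) (auto simp: power2_sum)
    then show ?thesis by (simp add: sum.distrib sum_distrib_left)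
  qed
  show ?thesis
  proof (rule that[OF eta_nn eta_bound])
    show "\<bar>(\<Sum>k=d..<p. \<phi> k) - (\<Sum>i=d..<p. \<Sum>t=d..<N. (X i t)\<^sup>2)\<bar> \<le> \<eta>"
      using tr1 zeta_eta zeta_nn eta_nn by linarith
    have "0 \<le> z * \<eta>" "z * \<zeta> \<le> z * \<eta>" "0 \<le> \<eta>\<^sup>2" "0 \<le> z * \<zeta>"
      using zl eta_nn zeta_eta zeta_nn by (auto intro: mult_left_mono)
    moreover have "0 \<le> (\<Sum>s=d..<N. \<Sum>t=d..<N. (K s t)\<^sup>2)" by (simp add: sum_nonneg)
    ultimately show "\<bar>(\<Sum>k=d..<p. (\<phi> k)\<^sup>2) - (\<Sum>s=d..<N. \<Sum>t=d..<N. (\<Sum>i=d..<p. X i s * X i t)\<^sup>2)\<bar> \<le> 4 * z * \<eta> + \<eta>\<^sup>2"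
      unfolding tr2 using KK KH3 HH by linarith
  qed
qed

subsection \<open>Families of independent standard normal variables\<close>

text \<open>A positive density \<open>2 + cos (V + \<theta>)\<close> turns the one-dimensional uniqueness theorem
  into a statement on the joint characteristic function of \<open>U\<close> and \<open>V\<close>.\<close>

lemma (in prob_space) gaussian_factor_of_char:
  fixes U V :: "'a \<Rightarrow> real"
  assumes [measurable]: "U \<in> borel_measurable M" "V \<in> borel_measurable M"
    and cU: "\<And>t. (CLINT \<omega>|M. iexp (t * U \<omega>)) = complex_of_real (exp (- (t\<^sup>2) / 2))"
    and cUV: "\<And>t. (CLINT \<omega>|M. iexp (t * U \<omega> + V \<omega>)) = complex_of_real (exp (- (t\<^sup>2) / 2)) * (CLINT \<omega>|M. iexp (V \<omega>))"
    and A[measurable]: "A \<in> sets borel"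
  shows "(CLINT \<omega>|M. indicator A (U \<omega>) * iexp (V \<omega>)) = complex_of_real (measure std_normal_distribution A) * (CLINT \<omega>|M. iexp (V \<omega>))"
proof -
  let ?\<nu> = "measure std_normal_distribution A"
  have int_iexp[simp]: "integrable M (\<lambda>\<omega>. iexp (f \<omega>))" if "f \<in> borel_measurable M" for f :: "'a \<Rightarrow> real"
    using that by (intro integrable_iexp) auto
  have int_cos[simp]: "integrable M (\<lambda>\<omega>. cos (f \<omega>))" if [measurable]: "f \<in> borel_measurable M" for f :: "'a \<Rightarrow> real"
    by (rule integrable_const_bound[of _ 1]) auto
  \<comment> \<open>Under the probability density proportional to
    \<open>2 + cos (V + \<theta>)\<close> the variable \<open>U\<close> keeps the standard normal
    characteristic function, hence its law.\<close>
  have key: "(LINT \<omega>|M. indicator A (U \<omega>) * (2 + cos (V \<omega> + \<theta>))) = ?\<nu> * (LINT \<omega>|M. 2 + cos (V \<omega> + \<theta>))" for \<theta>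
  proof -
    define c where "c = (LINT \<omega>|M. 2 + cos (V \<omega> + \<theta>))"
    have wpos: "1 \<le> 2 + cos x" for x :: real using cos_ge_minus_one[of x] by linarith
    have int_w: "integrable M (\<lambda>\<omega>. 2 + cos (V \<omega> + \<theta>))" by (intro Bochner_Integration.integrable_add) auto
    have "(LINT \<omega>|M. 1) \<le> c" unfolding c_def using wpos by (intro integral_mono int_w) auto
    then have c: "1 \<le> c" by (simp add: prob_space)
    define w where "w \<omega> = (2 + cos (V \<omega> + \<theta>)) / c" for \<omega>
    have w_nn: "0 \<le> w \<omega>" for \<omega> unfolding w_def using wpos[of "V \<omega> + \<theta>"] c by (intro divide_nonneg_nonneg) linarith+
    have [measurable]: "w \<in> borel_measurable M" unfolding w_def by measurable
    have int_w': "integrable M w" unfolding w_def using int_w by (intro integrable_divide_zero) auto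
    define D where "D = density M (\<lambda>\<omega>. ennreal (w \<omega>))"
    have Dint: "(LINT x|D. f x) = (LINT x|M. w x *\<^sub>R f x)" if "f \<in> borel_measurable M" for f :: "'a \<Rightarrow> 'b::{banach,second_countable_topology}"
      unfolding D_def using that w_nn by (intro integral_density) auto
    have "emeasure D (space D) = (\<integral>\<^sup>+x. ennreal (w x) \<partial>M)" unfolding D_def
      by (simp add: emeasure_density)
    also have "\<dots> = ennreal (LINT x|M. w x)" using int_w' w_nn by (intro nn_integral_eq_integral) auto
    also have "(LINT x|M. w x) = 1" unfolding w_def using c by (simp add: c_def)
    finally interpret D: prob_space D by (intro prob_spaceI) simp
    have [measurable]: "U \<in> borel_measurable D" "V \<in> borel_measurable D" by (simp_all add: D_def)
    have cosE: "complex_of_real (cos x) = (iexp x + iexp (- x)) / 2" for x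
      by (simp add: cos_of_real[symmetric] cos_exp_eq)
    \<comment> \<open>Complex conjugation transfers the hypothesis from \<open>V\<close> to
      \<open>- V\<close>; both are needed to write the cosine by exponentials.\<close>
    have minus: "(CLINT \<omega>|M. iexp (t * U \<omega> - V \<omega>)) = complex_of_real (exp (- (t\<^sup>2) / 2)) * (CLINT \<omega>|M. iexp (- V \<omega>))" for t
    proof -
      define f where "f \<omega> = iexp ((-t) * U \<omega> + V \<omega>)" for \<omega>
      have "(CLINT \<omega>|M. iexp (t * U \<omega> - V \<omega>)) = (CLINT \<omega>|M. cnj (f \<omega>))"
        by (simp add: f_def exp_cnj algebra_simps)
      also have "\<dots> = cnj (CLINT \<omega>|M. f \<omega>)" by (rule Bochner_Integration.integral_cnj)
      also have "\<dots> = cnj (CLINT \<omega>|M. iexp ((-t) * U \<omega> + V \<omega>))" unfolding f_def ..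
      also have "\<dots> = complex_of_real (exp (- (t\<^sup>2) / 2)) * cnj (CLINT \<omega>|M. iexp (V \<omega>))" unfolding cUV by simp
      also have "cnj (CLINT \<omega>|M. iexp (V \<omega>)) = (CLINT \<omega>|M. cnj (iexp (V \<omega>)))" by (rule Bochner_Integration.integral_cnj[symmetric])
      also have "\<dots> = (CLINT \<omega>|M. iexp (- V \<omega>))" by (simp add: exp_cnj)
      finally show ?thesis .
    qed
    have "char (distr D borel U) t = complex_of_real (exp (- (t\<^sup>2) / 2))" for t
    proof -
      have lin: "(CLINT \<omega>|M. 2 * f \<omega> + (a * g \<omega> + b * h \<omega>) / 2) =
          2 * (CLINT \<omega>|M. f \<omega>) + (a * (CLINT \<omega>|M. g \<omega>) + b * (CLINT \<omega>|M. h \<omega>)) / 2"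
        if "integrable M f" "integrable M g" "integrable M h" for f g h :: "'a \<Rightarrow> complex" and a b
        using that by simp
      have mix: "(CLINT \<omega>|M. iexp (t * U \<omega>) * (2 + cos (V \<omega> + \<theta>))) =
        2 * (CLINT \<omega>|M. iexp (t * U \<omega>)) + (iexp \<theta> * (CLINT \<omega>|M. iexp (t * U \<omega> + V \<omega>)) + iexp (-\<theta>) * (CLINT \<omega>|M. iexp (t * U \<omega> - V \<omega>))) / 2" for t
      proof -
        have ring: "a * (2 + (b * u + b' * u') / 2) = 2 * a + (u * (a * b) + u' * (a * b')) / 2" for a b u b' u' :: complex
          by (simp add: algebra_simps add_divide_distrib)
        have iexp_add: "iexp (a + b) = iexp a * iexp b" for a b
          by (simp add: distrib_left exp_add)
        have neg: "t * U \<omega> - V \<omega> = t * U \<omega> + (- V \<omega>)" "- (V \<omega> + \<theta>) = (- V \<omega>) + (- \<theta>)" for \<omega> by auto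
        have "iexp (t * U \<omega>) * (2 + cos (V \<omega> + \<theta>)) = 2 * iexp (t * U \<omega>) + (iexp \<theta> * iexp (t * U \<omega> + V \<omega>) + iexp (-\<theta>) * iexp (t * U \<omega> - V \<omega>)) / 2" for \<omega>
          unfolding of_real_add[of 2 "cos _"] of_real_numeral cosE neg iexp_add by (rule ring)
        then have "(CLINT \<omega>|M. iexp (t * U \<omega>) * (2 + cos (V \<omega> + \<theta>))) =
           (CLINT \<omega>|M. 2 * iexp (t * U \<omega>) + (iexp \<theta> * iexp (t * U \<omega> + V \<omega>) + iexp (-\<theta>) * iexp (t * U \<omega> - V \<omega>)) / 2)" by (simp only:)
        also have "\<dots> = 2 * (CLINT \<omega>|M. iexp (t * U \<omega>)) + (iexp \<theta> * (CLINT \<omega>|M. iexp (t * U \<omega> + V \<omega>)) + iexp (-\<theta>) * (CLINT \<omega>|M. iexp (t * U \<omega> - V \<omega>))) / 2"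
          by (rule lin) (rule int_iexp, measurable)+
        finally show ?thesis .
      qed
      have c_eq: "complex_of_real c = 2 + (iexp \<theta> * (CLINT \<omega>|M. iexp (V \<omega>)) + iexp (-\<theta>) * (CLINT \<omega>|M. iexp (- V \<omega>))) / 2"
      proof -
        have "complex_of_real c = (CLINT \<omega>|M. complex_of_real (2 + cos (V \<omega> + \<theta>)))"
          unfolding c_def by (rule integral_complex_of_real[symmetric])
        also have "\<dots> = (CLINT \<omega>|M. iexp (0 * U \<omega>) * (2 + cos (V \<omega> + \<theta>)))" by simp
        also have "\<dots> = 2 + (iexp \<theta> * (CLINT \<omega>|M. iexp (V \<omega>)) + iexp (-\<theta>) * (CLINT \<omega>|M. iexp (- V \<omega>))) / 2"
          by (subst mix) (simp add: prob_space)
        finally show ?thesis .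
      qed
      have "char (distr D borel U) t = (CLINT \<omega>|D. iexp (t * U \<omega>))"
        unfolding char_def by (subst integral_distr) (auto simp: D_def)
      also have "\<dots> = (CLINT \<omega>|M. w \<omega> *\<^sub>R iexp (t * U \<omega>))" by (rule Dint) measurable
      also have "\<dots> = (CLINT \<omega>|M. (iexp (t * U \<omega>) * (2 + cos (V \<omega> + \<theta>))) / c)"
        by (intro Bochner_Integration.integral_cong) (auto simp: w_def scaleR_conv_of_real)
      also have "\<dots> = (CLINT \<omega>|M. (iexp (t * U \<omega>) * (2 + cos (V \<omega> + \<theta>)))) / c"
        by (rule integral_divide_zero)
      also have "\<dots> = complex_of_real (exp (- (t\<^sup>2) / 2)) * c / c"
      proof -
        have ring: "2 * E + (u * (E * B) + u' * (E * B')) / 2 = E * (2 + (u * B + u' * B') / 2)" for E u B u' B' :: complex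
          by (simp add: algebra_simps add_divide_distrib)
        show ?thesis unfolding mix cU cUV minus ring c_eq[symmetric] by (simp only: of_real_mult of_real_divide)
      qed
      also have "\<dots> = complex_of_real (exp (- (t\<^sup>2) / 2))" using c by simp
      finally show ?thesis .
    qed
    then have "distr D borel U = std_normal_distribution"
      by (intro Levy_uniqueness real_dist_normal_dist D.real_distribution_distr)
         (auto simp: char_std_normal_distribution fun_eq_iff)
    then have "?\<nu> = measure (distr D borel U) A" by simp
    also have "\<dots> = (LINT x|distr D borel U. indicator A x)" by simp
    also have "\<dots> = (LINT x|D. indicator A (U x))" by (rule integral_distr) auto
    also have "\<dots> = (LINT \<omega>|M. w \<omega> *\<^sub>R indicator A (U \<omega>))" by (rule Dint) measurable
    also have "\<dots> = (LINT \<omega>|M. (indicator A (U \<omega>) * (2 + cos (V \<omega> + \<theta>))) / c)"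
      by (intro Bochner_Integration.integral_cong) (auto simp: w_def)
    also have "\<dots> = (LINT \<omega>|M. indicator A (U \<omega>) * (2 + cos (V \<omega> + \<theta>))) / c" by (rule integral_divide_zero)
    finally show ?thesis using c by (simp add: c_def[symmetric])
  qed
  have int_ind: "integrable M (\<lambda>\<omega>. indicator A (U \<omega>) :: real)"
    by (rule integrable_const_bound[of _ 1]) (auto simp: indicator_def)
  have int_ind_cos: "integrable M (\<lambda>\<omega>. indicator A (U \<omega>) * cos (V \<omega> + \<theta>))" for \<theta>
    by (rule integrable_const_bound[of _ 1]) (auto simp: indicator_def)
  define P where "P = (LINT \<omega>|M. indicator A (U \<omega>) :: real)"
  define C where "C \<theta> = (LINT \<omega>|M. indicator A (U \<omega>) * cos (V \<omega> + \<theta>))" for \<theta>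
  have k2: "2 * P + C \<theta> = ?\<nu> * (2 + (LINT \<omega>|M. cos (V \<omega> + \<theta>)))" for \<theta>
  proof -
    have "(LINT \<omega>|M. indicator A (U \<omega>) * (2 + cos (V \<omega> + \<theta>))) = (LINT \<omega>|M. 2 * indicator A (U \<omega>) + indicator A (U \<omega>) * cos (V \<omega> + \<theta>))"
      by (simp add: algebra_simps)
    also have "\<dots> = 2 * P + C \<theta>" unfolding P_def C_def
      by (subst Bochner_Integration.integral_add) (auto simp: int_ind int_ind_cos)
    finally have "2 * P + C \<theta> = ?\<nu> * (LINT \<omega>|M. 2 + cos (V \<omega> + \<theta>))" using key[of \<theta>] by simp
    also have "(LINT \<omega>|M. 2 + cos (V \<omega> + \<theta>)) = 2 + (LINT \<omega>|M. cos (V \<omega> + \<theta>))"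
      by (subst Bochner_Integration.integral_add) (auto simp: prob_space)
    finally show ?thesis .
  qed
  \<comment> \<open>Shifting \<open>\<theta>\<close> by \<open>pi\<close> flips the sign of the
    cosine part only; comparing both shifts separates it from the constant \<open>2\<close>.\<close>
  have Cpi: "C (\<theta> + pi) = - C \<theta>" for \<theta>
  proof -
    have "C (\<theta> + pi) = (LINT \<omega>|M. - (indicator A (U \<omega>) * cos (V \<omega> + \<theta>)))"
      unfolding C_def by (simp add: add.assoc[symmetric])
    then show ?thesis by (simp add: C_def)
  qed
  have Epi: "(LINT \<omega>|M. cos (V \<omega> + (\<theta> + pi))) = - (LINT \<omega>|M. cos (V \<omega> + \<theta>))" for \<theta>
    by (simp add: add.assoc[symmetric])
  have C: "C \<theta> = ?\<nu> * (LINT \<omega>|M. cos (V \<omega> + \<theta>))" for \<theta>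
    using k2[of \<theta>] k2[of "\<theta> + pi"] unfolding Cpi Epi by (simp add: algebra_simps)
  \<comment> \<open>The shifts \<open>0\<close> and \<open>- pi / 2\<close> recover the real and the
    imaginary part.\<close>
  have iexp_cos: "iexp x = complex_of_real (cos (x + 0)) + \<i> * complex_of_real (cos (x + - (pi / 2)))" for x
  proof -
    have "cos (x + - (pi / 2)) = sin x" by (simp add: cos_diff)
    then show ?thesis by (simp add: exp_Euler cos_of_real sin_of_real)
  qed
  have lin: "(CLINT \<omega>|M. complex_of_real (f \<omega>) + \<i> * complex_of_real (g \<omega>)) = complex_of_real (LINT \<omega>|M. f \<omega>) + \<i> * complex_of_real (LINT \<omega>|M. g \<omega>)"
    if "integrable M f" "integrable M g" for f g :: "'a \<Rightarrow> real"
    using that by simp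
  have "(CLINT \<omega>|M. indicator A (U \<omega>) * iexp (V \<omega>)) = complex_of_real (C 0) + \<i> * complex_of_real (C (- (pi / 2)))"
  proof -
    have "(CLINT \<omega>|M. indicator A (U \<omega>) * iexp (V \<omega>)) =
      (CLINT \<omega>|M. complex_of_real (indicator A (U \<omega>) * cos (V \<omega> + 0)) + \<i> * complex_of_real (indicator A (U \<omega>) * cos (V \<omega> + - (pi / 2))))"
      unfolding iexp_cos by (intro Bochner_Integration.integral_cong refl) (simp add: indicator_def)
    also have "\<dots> = complex_of_real (C 0) + \<i> * complex_of_real (C (- (pi / 2)))"
      unfolding C_def by (rule lin[OF int_ind_cos int_ind_cos])
    finally show ?thesis .
  qed
  moreover have "(CLINT \<omega>|M. iexp (V \<omega>)) = complex_of_real (LINT \<omega>|M. cos (V \<omega> + 0)) + \<i> * complex_of_real (LINT \<omega>|M. cos (V \<omega> + - (pi / 2)))"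
    unfolding iexp_cos by (rule lin) (rule int_cos, measurable)+
  ultimately show ?thesis unfolding C by (simp only: of_real_mult distrib_left mult.left_commute)
qed

text \<open>Conditioning on \<open>Z j \<in> A j\<close> is a change of measure under which, by the
  factorisation above, the remaining variables keep their characteristic function. This is why
  \<open>M\<close> varies in the induction.\<close>

lemma gaussian_rectangles_of_char:
  fixes Z :: "'i \<Rightarrow> 'a \<Rightarrow> real"
  assumes "finite I" "prob_space M" "\<And>i. i \<in> I \<Longrightarrow> Z i \<in> borel_measurable M"
    and "\<And>s. (CLINT \<omega>|M. iexp (\<Sum>i\<in>I. s i * Z i \<omega>)) = complex_of_real (exp (- (\<Sum>i\<in>I. (s i)\<^sup>2) / 2))"
    and "\<And>i. i \<in> I \<Longrightarrow> A i \<in> sets borel"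
  shows "measure M {\<omega>\<in>space M. \<forall>i\<in>I. Z i \<omega> \<in> A i} = (\<Prod>i\<in>I. measure std_normal_distribution (A i))"
  using assms
proof (induction I arbitrary: M rule: finite_induct)
  case empty
  then interpret prob_space M by simp
  show ?case by (simp add: prob_space)
next
  case (insert j I)
  interpret prob_space M by fact
  have [measurable]: "Z j \<in> borel_measurable M" "\<And>i. i \<in> I \<Longrightarrow> Z i \<in> borel_measurable M"
    "A j \<in> sets borel" "\<And>i. i \<in> I \<Longrightarrow> A i \<in> sets borel"
    using insert.prems by auto
  have cs: "(CLINT \<omega>|M. iexp (t * Z j \<omega> + (\<Sum>i\<in>I. s i * Z i \<omega>))) = complex_of_real (exp (- (t\<^sup>2 + (\<Sum>i\<in>I. (s i)\<^sup>2)) / 2))" for t s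
  proof -
    have "(\<Sum>i\<in>I. (s(j := t)) i * Z i \<omega>) = (\<Sum>i\<in>I. s i * Z i \<omega>)" for \<omega>
      using insert.hyps by (intro sum.cong) auto
    moreover have "(\<Sum>i\<in>I. ((s(j := t)) i)\<^sup>2) = (\<Sum>i\<in>I. (s i)\<^sup>2)"
      using insert.hyps by (intro sum.cong) auto
    ultimately show ?thesis using insert.prems(3)[of "s(j := t)"] insert.hyps by simp
  qed
  have cV: "(CLINT \<omega>|M. iexp (\<Sum>i\<in>I. s i * Z i \<omega>)) = complex_of_real (exp (- (\<Sum>i\<in>I. (s i)\<^sup>2) / 2))" for s
    using cs[of 0 s] by simp
  have factor: "(CLINT \<omega>|M. indicator (A j) (Z j \<omega>) * iexp (\<Sum>i\<in>I. s i * Z i \<omega>)) =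
      complex_of_real (measure std_normal_distribution (A j)) * complex_of_real (exp (- (\<Sum>i\<in>I. (s i)\<^sup>2) / 2))" for s
    unfolding cV[symmetric]
  proof (rule gaussian_factor_of_char)
    show "(CLINT \<omega>|M. iexp (t * Z j \<omega>)) = complex_of_real (exp (- (t\<^sup>2) / 2))" for t
      using cs[of t "\<lambda>_. 0"] by simp
    show "(CLINT \<omega>|M. iexp (t * Z j \<omega> + (\<Sum>i\<in>I. s i * Z i \<omega>))) = complex_of_real (exp (- (t\<^sup>2) / 2)) * (CLINT \<omega>|M. iexp (\<Sum>i\<in>I. s i * Z i \<omega>))" for t
      unfolding cV cs by (simp add: exp_add[symmetric] exp_of_real add_divide_distrib flip: of_real_mult)
  qed auto
  define \<nu> where "\<nu> = measure std_normal_distribution (A j)"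
  have P: "measure M {\<omega>\<in>space M. Z j \<omega> \<in> A j} = \<nu>"
  proof -
    have "complex_of_real (LINT \<omega>|M. indicator (A j) (Z j \<omega>)) = (CLINT \<omega>|M. indicator (A j) (Z j \<omega>))"
      by (subst integral_complex_of_real[symmetric]) (intro Bochner_Integration.integral_cong, auto simp: indicator_def)
    also have "\<dots> = \<nu>" using factor[of "\<lambda>_. 0"] by (simp add: \<nu>_def)
    finally have "(LINT \<omega>|M. indicator (A j) (Z j \<omega>)) = \<nu>" by simp
    moreover have "(LINT \<omega>|M. indicator (A j) (Z j \<omega>)) = (LINT \<omega>|M. indicat_real {\<omega>\<in>space M. Z j \<omega> \<in> A j} \<omega>)"
      by (intro Bochner_Integration.integral_cong) (auto simp: indicator_def)
    ultimately show ?thesis by simp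
  qed
  let ?R = "{\<omega>\<in>space M. \<forall>i\<in>insert j I. Z i \<omega> \<in> A i}"
  show ?case
  \<comment> \<open>Conditioning on a null event is impossible, but then both sides vanish.\<close>
  proof (cases "\<nu> = 0")
    case True
    have "measure M ?R \<le> measure M {\<omega>\<in>space M. Z j \<omega> \<in> A j}"
      by (intro finite_measure_mono) auto
    then have "measure M ?R = 0" using True P measure_nonneg[of M ?R] by linarith
    then show ?thesis using True insert.hyps by (simp add: \<nu>_def)
  next
    case False
    then have \<nu>: "0 < \<nu>" using P measure_nonneg[of M "{\<omega>\<in>space M. Z j \<omega> \<in> A j}"] by linarith
    define w where "w \<omega> = indicator (A j) (Z j \<omega>) / \<nu>" for \<omega>
    have w_nn: "0 \<le> w \<omega>" for \<omega> using \<nu> by (auto simp: w_def indicator_def)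
    have [measurable]: "w \<in> borel_measurable M" unfolding w_def by measurable
    define D where "D = density M (\<lambda>\<omega>. ennreal (w \<omega>))"
    have meas: "measure D B = measure M ({\<omega>\<in>space M. Z j \<omega> \<in> A j} \<inter> B) / \<nu>" if B[measurable]: "B \<in> sets M" for B
    proof -
      have "emeasure D B = (\<integral>\<^sup>+\<omega>. ennreal (1 / \<nu>) * indicator ({\<omega>\<in>space M. Z j \<omega> \<in> A j} \<inter> B) \<omega> \<partial>M)"
        unfolding D_def using \<nu> by (subst emeasure_density) (auto intro!: nn_integral_cong simp: w_def indicator_def)
      also have "\<dots> = ennreal (1 / \<nu>) * emeasure M ({\<omega>\<in>space M. Z j \<omega> \<in> A j} \<inter> B)"
        by (rule nn_integral_cmult_indicator) measurable
      also have "\<dots> = ennreal (measure M ({\<omega>\<in>space M. Z j \<omega> \<in> A j} \<inter> B) / \<nu>)"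
        unfolding emeasure_eq_measure using \<nu> by (subst ennreal_mult[symmetric]) auto
      finally show ?thesis using \<nu> by (simp add: measure_def)
    qed
    have spD: "space D = space M" "sets D = sets M" by (simp_all add: D_def)
    have "emeasure D (space D) = (\<integral>\<^sup>+x. ennreal (w x) \<partial>M)" unfolding D_def
      by (simp add: emeasure_density)
    also have "\<dots> = (\<integral>\<^sup>+\<omega>. ennreal (1 / \<nu>) * indicator {\<omega>\<in>space M. Z j \<omega> \<in> A j} \<omega> \<partial>M)"
      using \<nu> by (intro nn_integral_cong) (auto simp: w_def indicator_def)
    also have "\<dots> = ennreal (1 / \<nu>) * emeasure M {\<omega>\<in>space M. Z j \<omega> \<in> A j}"
      by (rule nn_integral_cmult_indicator) measurable
    also have "\<dots> = 1" unfolding emeasure_eq_measure P using \<nu> by (subst ennreal_mult[symmetric]) auto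
    finally have D: "prob_space D" by (intro prob_spaceI) simp
    have "(CLINT \<omega>|D. iexp (\<Sum>i\<in>I. s i * Z i \<omega>)) = complex_of_real (exp (- (\<Sum>i\<in>I. (s i)\<^sup>2) / 2))" for s
    proof -
      have "(CLINT \<omega>|D. iexp (\<Sum>i\<in>I. s i * Z i \<omega>)) = (CLINT \<omega>|M. w \<omega> *\<^sub>R iexp (\<Sum>i\<in>I. s i * Z i \<omega>))"
        unfolding D_def using w_nn by (intro integral_density) auto
      also have "\<dots> = (CLINT \<omega>|M. (indicator (A j) (Z j \<omega>) * iexp (\<Sum>i\<in>I. s i * Z i \<omega>)) / \<nu>)"
        by (intro Bochner_Integration.integral_cong) (auto simp: w_def indicator_def scaleR_conv_of_real)
      also have "\<dots> = (CLINT \<omega>|M. (indicator (A j) (Z j \<omega>) * iexp (\<Sum>i\<in>I. s i * Z i \<omega>))) / \<nu>"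
        by (rule integral_divide_zero)
      also have "\<dots> = complex_of_real (exp (- (\<Sum>i\<in>I. (s i)\<^sup>2) / 2))" unfolding factor using \<nu> by (simp add: \<nu>_def)
      finally show ?thesis .
    qed
    from insert.IH[OF D _ this] have "measure D {\<omega>\<in>space D. \<forall>i\<in>I. Z i \<omega> \<in> A i} = (\<Prod>i\<in>I. measure std_normal_distribution (A i))"
      using insert.prems by (auto simp: D_def)
    moreover have "{\<omega>\<in>space M. Z j \<omega> \<in> A j} \<inter> {\<omega>\<in>space M. \<forall>i\<in>I. Z i \<omega> \<in> A i} = ?R" by auto
    moreover have "{\<omega>\<in>space M. \<forall>i\<in>I. Z i \<omega> \<in> A i} \<in> sets M"
      using insert.hyps by measurable
    ultimately have "measure M ?R / \<nu> = (\<Prod>i\<in>I. measure std_normal_distribution (A i))"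
      by (simp add: meas spD)
    then show ?thesis using \<nu> insert.hyps by (simp add: \<nu>_def field_simps)
  qed
qed

abbreviation gaussM :: "'i set \<Rightarrow> ('i \<Rightarrow> real) measure" where
  "gaussM I \<equiv> Pi\<^sub>M I (\<lambda>_. std_normal_distribution)"

text \<open>A predicate on \<open>M\<close> rather than a locale: the same facts are used on the
  sample space, on \<open>gaussM\<close>, and for several derived arrays on one space.\<close>

definition gauss_family :: "'a measure \<Rightarrow> 'i set \<Rightarrow> ('i \<Rightarrow> 'a \<Rightarrow> real) \<Rightarrow> bool" where
  "gauss_family M I Z \<longleftrightarrow> prob_space M \<and> finite I \<and>
     prob_space.indep_vars M (\<lambda>_. borel) Z I \<and> (\<forall>i\<in>I. distr M borel (Z i) = std_normal_distribution)"

interpretation std_normal: prob_space std_normal_distribution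
  by (rule prob_space_normal_density) simp

lemma sets_gaussM [measurable_cong]: "sets (gaussM I) = sets (Pi\<^sub>M I (\<lambda>_. borel))"
  by (intro sets_PiM_cong) auto

lemma prob_space_gaussM: "prob_space (gaussM I)"
  by (intro prob_space_PiM std_normal.prob_space_axioms)

lemma gauss_familyD:
  assumes "gauss_family M I Z"
  shows "prob_space M" "finite I" "\<And>i. i \<in> I \<Longrightarrow> Z i \<in> borel_measurable M"
    "prob_space.indep_vars M (\<lambda>_. borel) Z I" "\<And>i. i \<in> I \<Longrightarrow> distr M borel (Z i) = std_normal_distribution"
proof -
  show M: "prob_space M" "finite I" and iv: "prob_space.indep_vars M (\<lambda>_. borel) Z I"
    and "\<And>i. i \<in> I \<Longrightarrow> distr M borel (Z i) = std_normal_distribution"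
    using assms by (auto simp: gauss_family_def)
  show "\<And>i. i \<in> I \<Longrightarrow> Z i \<in> borel_measurable M"
    using iv by (auto simp: prob_space.indep_vars_def[OF M(1)])
qed

lemma measurable_restrict_family:
  assumes "\<And>i. i \<in> I \<Longrightarrow> Z i \<in> borel_measurable M"
  shows "(\<lambda>\<omega>. \<lambda>i\<in>I. Z i \<omega>) \<in> M \<rightarrow>\<^sub>M gaussM I"
  by (subst measurable_cong_sets[OF refl sets_gaussM]) (use assms in measurable)

lemma gauss_family_distr:
  assumes "gauss_family M I Z"
  shows "distr M (gaussM I) (\<lambda>\<omega>. \<lambda>i\<in>I. Z i \<omega>) = gaussM I"
proof (cases "I = {}")
  case True
  interpret prob_space M using gauss_familyD[OF assms] by simp
  show ?thesis unfolding True
  proof (rule measure_eqI)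
    fix A assume "A \<in> sets (distr M (gaussM ({} :: 'b set)) (\<lambda>\<omega>. \<lambda>i\<in>{}. Z i \<omega>))"
    then have "A \<subseteq> {\<lambda>_. undefined}" by (auto simp: PiM_empty)
    then consider "A = {}" | "A = {\<lambda>_. undefined}" by blast
    then show "emeasure (distr M (gaussM ({} :: 'b set)) (\<lambda>\<omega>. \<lambda>i\<in>{}. Z i \<omega>)) A = emeasure (gaussM {}) A"
    proof cases
      case 2
      have "(\<lambda>\<omega>. \<lambda>i\<in>{}. Z i \<omega>) \<in> M \<rightarrow>\<^sub>M gaussM {}" by (rule measurable_restrict_family) simp
      moreover have "{\<lambda>_. undefined} \<in> sets (gaussM ({} :: 'b set))" by (simp add: PiM_empty)
      ultimately have "emeasure (distr M (gaussM ({} :: 'b set)) (\<lambda>\<omega>. \<lambda>i\<in>{}. Z i \<omega>)) A = emeasure M ((\<lambda>\<omega>. \<lambda>i\<in>{}. Z i \<omega>) -` {\<lambda>_. undefined} \<inter> space M)"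
        unfolding 2 by (rule emeasure_distr)
      also have "(\<lambda>\<omega>. \<lambda>i\<in>{}. Z i \<omega>) -` {\<lambda>_. undefined} \<inter> space M = space M" by auto
      finally have "emeasure (distr M (gaussM ({} :: 'b set)) (\<lambda>\<omega>. \<lambda>i\<in>{}. Z i \<omega>)) A = 1"
        by (simp only: emeasure_space_1)
      moreover have "emeasure (gaussM ({} :: 'b set)) A = 1" by (simp add: 2 PiM_empty)
      ultimately show ?thesis by (simp only:)
    qed simp
  qed simp
next
  case False
  interpret prob_space M using gauss_familyD[OF assms] by simp
  have "distr M (gaussM I) (\<lambda>\<omega>. \<lambda>i\<in>I. Z i \<omega>) = distr M (Pi\<^sub>M I (\<lambda>_. borel)) (\<lambda>\<omega>. \<lambda>i\<in>I. Z i \<omega>)"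
    by (rule distr_cong) (auto simp: sets_gaussM)
  also have "\<dots> = Pi\<^sub>M I (\<lambda>i. distr M borel (Z i))"
    using indep_vars_iff_distr_eq_PiM'[OF False, of Z "\<lambda>_. borel"] gauss_familyD[OF assms] by auto
  also have "\<dots> = gaussM I"
    using gauss_familyD[OF assms] by (intro PiM_cong) auto
  finally show ?thesis .
qed

text \<open>Rectangles determine a finite product measure, so the joint characteristic function
  yields both the marginals and independence. Linear images and the whitened sample are recognised
  as Gaussian through this criterion.\<close>

lemma gauss_familyI_char:
  fixes Z :: "'i \<Rightarrow> 'a \<Rightarrow> real"
  assumes M: "prob_space M" and I: "finite I" and Z: "\<And>i. i \<in> I \<Longrightarrow> Z i \<in> borel_measurable M"
    and ch: "\<And>s. (CLINT \<omega>|M. iexp (\<Sum>i\<in>I. s i * Z i \<omega>)) = complex_of_real (exp (- (\<Sum>i\<in>I. (s i)\<^sup>2) / 2))"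
  shows "gauss_family M I Z"
proof -
  interpret prob_space M by fact
  note rect = gaussian_rectangles_of_char[OF I M Z ch]
  have "space std_normal_distribution = UNIV" by simp
  have distr1: "distr M borel (Z i) = std_normal_distribution" if i: "i \<in> I" for i
  proof (rule measure_eqI)
    fix A assume "A \<in> sets (distr M borel (Z i))"
    then have A: "A \<in> sets borel" by simp
    \<comment> \<open>A rectangle that constrains coordinate \<open>i\<close> alone gives its
      marginal law.\<close>
    have "measure M {\<omega>\<in>space M. \<forall>j\<in>I. Z j \<omega> \<in> (if j = i then A else UNIV)} = (\<Prod>j\<in>I. measure std_normal_distribution (if j = i then A else UNIV))"
      using A by (intro rect) auto
    also have "(\<Prod>j\<in>I. measure std_normal_distribution (if j = i then A else UNIV)) = (\<Prod>j\<in>I. if j = i then measure std_normal_distribution A else 1)"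
      using std_normal.prob_space by (intro prod.cong) auto
    also have "\<dots> = measure std_normal_distribution A" using i I by simp
    also have "{\<omega>\<in>space M. \<forall>j\<in>I. Z j \<omega> \<in> (if j = i then A else UNIV)} = Z i -` A \<inter> space M"
      using i by auto
    finally show "emeasure (distr M borel (Z i)) A = emeasure std_normal_distribution A"
      using A Z[OF i] by (simp add: emeasure_distr emeasure_eq_measure std_normal.emeasure_eq_measure)
  qed simp
  have "indep_vars (\<lambda>_. borel) Z I"
  proof (cases "I = {}")
    case True
    then show ?thesis by (simp add: indep_vars_def indep_sets_def)
  next
    case False
    interpret PS: product_prob_space "\<lambda>_::'i. std_normal_distribution" I by standard
    have "distr M (Pi\<^sub>M I (\<lambda>_. borel)) (\<lambda>\<omega>. \<lambda>i\<in>I. Z i \<omega>) = gaussM I"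
    proof (rule PS.PiM_eqI)
      show "finite I" by fact
      show "sets (distr M (Pi\<^sub>M I (\<lambda>_. borel)) (\<lambda>\<omega>. \<lambda>i\<in>I. Z i \<omega>)) = sets (gaussM I)" by (simp add: sets_gaussM)
      fix A assume A: "\<And>i. i \<in> I \<Longrightarrow> A i \<in> sets std_normal_distribution"
      have meas: "(\<lambda>\<omega>. \<lambda>i\<in>I. Z i \<omega>) \<in> M \<rightarrow>\<^sub>M Pi\<^sub>M I (\<lambda>_. borel)" using Z by measurable
      have "Pi\<^sub>E I A \<in> sets (Pi\<^sub>M I (\<lambda>_. borel))" using A I by (intro sets_PiM_I_finite) auto
      then have "emeasure (distr M (Pi\<^sub>M I (\<lambda>_. borel)) (\<lambda>\<omega>. \<lambda>i\<in>I. Z i \<omega>)) (Pi\<^sub>E I A) =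
         emeasure M ((\<lambda>\<omega>. \<lambda>i\<in>I. Z i \<omega>) -` Pi\<^sub>E I A \<inter> space M)"
        by (rule emeasure_distr[OF meas])
      also have "(\<lambda>\<omega>. \<lambda>i\<in>I. Z i \<omega>) -` Pi\<^sub>E I A \<inter> space M = {\<omega>\<in>space M. \<forall>i\<in>I. Z i \<omega> \<in> A i}"
        by (auto simp: PiE_iff)
      also have "emeasure M \<dots> = ennreal (\<Prod>i\<in>I. measure std_normal_distribution (A i))"
        unfolding emeasure_eq_measure using A by (subst rect) auto
      also have "\<dots> = (\<Prod>i\<in>I. emeasure std_normal_distribution (A i))"
        by (simp add: std_normal.emeasure_eq_measure prod_ennreal)
      finally show "emeasure (distr M (Pi\<^sub>M I (\<lambda>_. borel)) (\<lambda>\<omega>. \<lambda>i\<in>I. Z i \<omega>)) (Pi\<^sub>E I A) = (\<Prod>i\<in>I. emeasure std_normal_distribution (A i))" .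
    qed
    also have "gaussM I = Pi\<^sub>M I (\<lambda>i. distr M borel (Z i))" using distr1 by (intro PiM_cong) auto
    finally show ?thesis
      by (subst indep_vars_iff_distr_eq_PiM'[OF False]) (use Z in auto)
  qed
  with distr1 M I show ?thesis by (simp add: gauss_family_def)
qed

lemma gauss_family_char:
  fixes Z :: "'i \<Rightarrow> 'a \<Rightarrow> real"
  assumes "gauss_family M I Z"
  shows "(CLINT \<omega>|M. iexp (\<Sum>i\<in>I. s i * Z i \<omega>)) = complex_of_real (exp (- (\<Sum>i\<in>I. (s i)\<^sup>2) / 2))"
proof -
  note G = gauss_familyD[OF assms]
  interpret prob_space M by fact
  note [measurable] = G(3)
  have "indep_vars (\<lambda>_. borel) (\<lambda>i \<omega>. iexp (s i * Z i \<omega>)) I"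
    by (rule indep_vars_compose2[OF G(4)]) auto
  moreover have "(CLINT \<omega>|M. iexp (\<Sum>i\<in>I. s i * Z i \<omega>)) = (CLINT \<omega>|M. (\<Prod>i\<in>I. iexp (s i * Z i \<omega>)))"
    using G(2) by (simp add: sum_distrib_left exp_sum)
  ultimately have "(CLINT \<omega>|M. iexp (\<Sum>i\<in>I. s i * Z i \<omega>)) = (\<Prod>i\<in>I. CLINT \<omega>|M. iexp (s i * Z i \<omega>))"
    using G(2) by (subst indep_vars_lebesgue_integral[symmetric]) (auto intro: integrable_iexp)
  also have "\<dots> = (\<Prod>i\<in>I. complex_of_real (exp (- (s i)\<^sup>2 / 2)))"
  proof (intro prod.cong refl)
    fix i assume i: "i \<in> I"
    have "(CLINT \<omega>|M. iexp (s i * Z i \<omega>)) = char (distr M borel (Z i)) (s i)"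
      using i by (simp add: char_def integral_distr)
    then show "(CLINT \<omega>|M. iexp (s i * Z i \<omega>)) = complex_of_real (exp (- (s i)\<^sup>2 / 2))"
      using i by (simp add: G(5) char_std_normal_distribution)
  qed
  also have "\<dots> = complex_of_real (exp (- (\<Sum>i\<in>I. (s i)\<^sup>2) / 2))"
    using G(2) by (simp add: exp_sum[symmetric] sum_divide_distrib sum_negf flip: of_real_prod)
  finally show ?thesis .
qed

text \<open>Rotation invariance: the characteristic function depends only on the norm of the pulled
  back coefficient vector, which orthonormality preserves.\<close>

lemma gauss_family_linear:
  fixes Z :: "'i \<Rightarrow> 'a \<Rightarrow> real" and c :: "'j \<Rightarrow> 'i \<Rightarrow> real"
  assumes Z: "gauss_family M I Z" and J: "finite J"
    and c: "\<And>j l. j \<in> J \<Longrightarrow> l \<in> J \<Longrightarrow> (\<Sum>i\<in>I. c j i * c l i) = of_bool (j = l)"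
  shows "gauss_family M J (\<lambda>j \<omega>. \<Sum>i\<in>I. c j i * Z i \<omega>)"
proof (rule gauss_familyI_char)
  note G = gauss_familyD[OF Z]
  note [measurable] = G(3)
  show "prob_space M" "finite J" by fact+
  show "(\<lambda>\<omega>. \<Sum>i\<in>I. c j i * Z i \<omega>) \<in> borel_measurable M" for j by measurable
  fix s :: "'j \<Rightarrow> real"
  have "(\<Sum>i\<in>I. (\<Sum>j\<in>J. s j * c j i)\<^sup>2) = (\<Sum>i\<in>I. \<Sum>j\<in>J. \<Sum>l\<in>J. s j * s l * (c j i * c l i))"
    by (simp add: power2_eq_square sum_product mult_ac)
  also have "\<dots> = (\<Sum>j\<in>J. \<Sum>i\<in>I. \<Sum>l\<in>J. s j * s l * (c j i * c l i))" by (rule sum.swap)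
  also have "\<dots> = (\<Sum>j\<in>J. \<Sum>l\<in>J. \<Sum>i\<in>I. s j * s l * (c j i * c l i))" by (intro sum.cong refl sum.swap)
  also have "\<dots> = (\<Sum>j\<in>J. \<Sum>l\<in>J. if l = j then s j * s l else 0)"
    unfolding sum_distrib_left[symmetric] using c by (intro sum.cong refl) auto
  also have "\<dots> = (\<Sum>j\<in>J. (s j)\<^sup>2)" using J by (simp add: power2_eq_square)
  finally have sq: "(\<Sum>i\<in>I. (\<Sum>j\<in>J. s j * c j i)\<^sup>2) = (\<Sum>j\<in>J. (s j)\<^sup>2)" .
  have "(\<Sum>j\<in>J. s j * (\<Sum>i\<in>I. c j i * Z i \<omega>)) = (\<Sum>i\<in>I. (\<Sum>j\<in>J. s j * c j i) * Z i \<omega>)" for \<omega>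
    unfolding sum_distrib_left sum_distrib_right by (subst sum.swap) (simp add: mult_ac)
  then show "(CLINT \<omega>|M. iexp (\<Sum>j\<in>J. s j * (\<Sum>i\<in>I. c j i * Z i \<omega>))) = complex_of_real (exp (- (\<Sum>j\<in>J. (s j)\<^sup>2) / 2))"
    using gauss_family_char[OF Z, of "\<lambda>i. \<Sum>j\<in>J. s j * c j i"] by (simp only: sq)
qed

lemma gauss_family_cong:
  fixes Z Z' :: "'i \<Rightarrow> 'a \<Rightarrow> real"
  assumes "\<And>i \<omega>. i \<in> I \<Longrightarrow> \<omega> \<in> space M \<Longrightarrow> Z i \<omega> = Z' i \<omega>"
  shows "gauss_family M I Z \<longleftrightarrow> gauss_family M I Z'"
proof -
  have "gauss_family M I Z'" if gf: "gauss_family M I Z" and eq: "\<And>i \<omega>. i \<in> I \<Longrightarrow> \<omega> \<in> space M \<Longrightarrow> Z i \<omega> = Z' i \<omega>" for Z Z' :: "'i \<Rightarrow> 'a \<Rightarrow> real"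
  proof (rule gauss_familyI_char)
    show "prob_space M" "finite I" using gauss_familyD[OF gf] by auto
    show "Z' i \<in> borel_measurable M" if i: "i \<in> I" for i
      using gauss_familyD(3)[OF gf i] eq[OF i] by (subst measurable_cong[where g="Z i"]) auto
    fix s
    have "(CLINT \<omega>|M. iexp (\<Sum>i\<in>I. s i * Z' i \<omega>)) = (CLINT \<omega>|M. iexp (\<Sum>i\<in>I. s i * Z i \<omega>))"
      using eq by (intro Bochner_Integration.integral_cong refl) (simp cong: sum.cong)
    then show "(CLINT \<omega>|M. iexp (\<Sum>i\<in>I. s i * Z' i \<omega>)) = complex_of_real (exp (- (\<Sum>i\<in>I. (s i)\<^sup>2) / 2))"
      using gauss_family_char[OF gf] by simp
  qed
  with assms show ?thesis by (metis (no_types, lifting))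
qed

text \<open>Selecting distinct coordinates is a linear map with orthonormal zero-one
  coefficients.\<close>

lemma gauss_family_reindex:
  fixes Z :: "'i \<Rightarrow> 'a \<Rightarrow> real" and f :: "'j \<Rightarrow> 'i"
  assumes Z: "gauss_family M I Z" and J: "finite J" and f: "inj_on f J" "f ` J \<subseteq> I"
  shows "gauss_family M J (\<lambda>j. Z (f j))"
proof -
  have I: "finite I" using gauss_familyD[OF Z] by simp
  have sel: "(\<Sum>i\<in>I. of_bool (i = f j) * g i) = g (f j)" if "j \<in> J" for j and g :: "'i \<Rightarrow> real"
  proof -
    have "(\<Sum>i\<in>I. of_bool (i = f j) * g i) = (\<Sum>i\<in>I. if i = f j then g i else 0)"
      by (intro sum.cong) auto
    then show ?thesis using that f I by (auto simp: image_subset_iff)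
  qed
  have "gauss_family M J (\<lambda>j \<omega>. \<Sum>i\<in>I. of_bool (i = f j) * Z i \<omega>)"
  proof (rule gauss_family_linear[OF Z J])
    fix j l assume jl: "j \<in> J" "l \<in> J"
    then have "(f j = f l) = (j = l)" using f by (auto dest: inj_onD)
    then show "(\<Sum>i\<in>I. of_bool (i = f j) * of_bool (i = f l)) = (of_bool (j = l) :: real)"
      using sel[OF jl(1), of "\<lambda>i. of_bool (i = f l)"] by simp
  qed
  then show ?thesis by (subst (asm) gauss_family_cong[where Z'="\<lambda>j. Z (f j)"]) (auto simp: sel)
qed

lemma gauss_family_subset:
  "gauss_family M I Z \<Longrightarrow> J \<subseteq> I \<Longrightarrow> gauss_family M J Z"
  using gauss_family_reindex[of M I Z J "\<lambda>x. x"] gauss_familyD(2)[of M I Z] by (auto dest: finite_subset)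

lemma gauss_family_gaussM:
  assumes "finite I"
  shows "gauss_family (gaussM I) I (\<lambda>i \<omega>. \<omega> i)"
proof -
  interpret P: prob_space "gaussM I" by (rule prob_space_gaussM)
  have D: "distr (gaussM I) borel (\<lambda>\<omega>. \<omega> i) = std_normal_distribution" if "i \<in> I" for i
  proof -
    interpret PS: product_prob_space "\<lambda>_::'a. std_normal_distribution" I by standard
    have "distr (gaussM I) borel (\<lambda>\<omega>. \<omega> i) = distr (gaussM I) std_normal_distribution (\<lambda>\<omega>. \<omega> i)"
      by (rule distr_cong) auto
    also have "\<dots> = std_normal_distribution" using that by (rule PS.PiM_component)
    finally show ?thesis .
  qed
  have "P.indep_vars (\<lambda>_. borel) (\<lambda>i \<omega>. \<omega> i) I"
  proof (cases "I = {}")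
    case True
    show ?thesis unfolding P.indep_vars_def P.indep_sets_def by (auto simp: True)
  next
    case False
    have "distr (gaussM I) (Pi\<^sub>M I (\<lambda>_. borel)) (\<lambda>\<omega>. \<lambda>i\<in>I. \<omega> i) = distr (gaussM I) (gaussM I) (\<lambda>\<omega>. \<omega>)"
      by (rule distr_cong) (auto simp: sets_gaussM space_PiM)
    also have "\<dots> = gaussM I" by (rule distr_id)
    also have "\<dots> = Pi\<^sub>M I (\<lambda>i. distr (gaussM I) borel (\<lambda>\<omega>. \<omega> i))"
      using D by (intro PiM_cong) auto
    finally show ?thesis
      by (subst P.indep_vars_iff_distr_eq_PiM'[OF False]) auto
  qed
  with D assms P.prob_space_axioms show ?thesis by (simp add: gauss_family_def)
qed

text \<open>Disjoint blocks are independent, so their joint law is a product and one block can be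
  frozen while the other is integrated. Conditioning on rows of an array takes this form
  below.\<close>

lemma gauss_family_Fubini:
  fixes h :: "('i \<Rightarrow> real) \<times> ('i \<Rightarrow> real) \<Rightarrow> 'b::{banach,second_countable_topology}"
  assumes Z: "gauss_family M K Z" and IJ: "I \<subseteq> K" "J \<subseteq> K" "I \<inter> J = {}"
    and h: "h \<in> borel_measurable (gaussM I \<Otimes>\<^sub>M gaussM J)" and bd: "\<And>x. norm (h x) \<le> B"
  shows "(\<integral>\<omega>. h (\<lambda>i\<in>I. Z i \<omega>, \<lambda>j\<in>J. Z j \<omega>) \<partial>M) = (\<integral>x. (\<integral>y. h (x, y) \<partial>gaussM J) \<partial>gaussM I)"
proof -
  note G = gauss_familyD[OF Z]
  interpret prob_space M by fact
  note [measurable] = G(3)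
  interpret PI: prob_space "gaussM I" by (rule prob_space_gaussM)
  interpret PJ: prob_space "gaussM J" by (rule prob_space_gaussM)
  interpret PP: pair_prob_space "gaussM I" "gaussM J" ..
  have ZI: "gauss_family M I Z" "gauss_family M J Z" using gauss_family_subset[OF Z] IJ by auto
  have mI: "(\<lambda>\<omega>. \<lambda>i\<in>I. Z i \<omega>) \<in> M \<rightarrow>\<^sub>M gaussM I" "(\<lambda>\<omega>. \<lambda>i\<in>J. Z i \<omega>) \<in> M \<rightarrow>\<^sub>M gaussM J"
    using gauss_familyD(3)[OF ZI(1)] gauss_familyD(3)[OF ZI(2)] by (auto intro: measurable_restrict_family)
  have "indep_var (Pi\<^sub>M I (\<lambda>_. borel)) (\<lambda>\<omega>. restrict (\<lambda>i. Z i \<omega>) I) (Pi\<^sub>M J (\<lambda>_. borel)) (\<lambda>\<omega>. restrict (\<lambda>i. Z i \<omega>) J)"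
    using G(4) IJ(3,1,2) by (rule indep_var_restrict)
  then have "distr M (Pi\<^sub>M I (\<lambda>_. borel)) (\<lambda>\<omega>. \<lambda>i\<in>I. Z i \<omega>) \<Otimes>\<^sub>M distr M (Pi\<^sub>M J (\<lambda>_. borel)) (\<lambda>\<omega>. \<lambda>i\<in>J. Z i \<omega>) =
    distr M (Pi\<^sub>M I (\<lambda>_. borel) \<Otimes>\<^sub>M Pi\<^sub>M J (\<lambda>_. borel)) (\<lambda>\<omega>. (\<lambda>i\<in>I. Z i \<omega>, \<lambda>i\<in>J. Z i \<omega>))"
    unfolding indep_var_distribution_eq by simp
  moreover have "distr M (Pi\<^sub>M I (\<lambda>_. borel)) (\<lambda>\<omega>. \<lambda>i\<in>I. Z i \<omega>) = gaussM I"
    using gauss_family_distr[OF ZI(1)] by (simp add: sets_gaussM cong: distr_cong)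
  moreover have "distr M (Pi\<^sub>M J (\<lambda>_. borel)) (\<lambda>\<omega>. \<lambda>i\<in>J. Z i \<omega>) = gaussM J"
    using gauss_family_distr[OF ZI(2)] by (simp add: sets_gaussM cong: distr_cong)
  moreover have "distr M (Pi\<^sub>M I (\<lambda>_. borel) \<Otimes>\<^sub>M Pi\<^sub>M J (\<lambda>_. borel)) (\<lambda>\<omega>. (\<lambda>i\<in>I. Z i \<omega>, \<lambda>i\<in>J. Z i \<omega>)) =
      distr M (gaussM I \<Otimes>\<^sub>M gaussM J) (\<lambda>\<omega>. (\<lambda>i\<in>I. Z i \<omega>, \<lambda>i\<in>J. Z i \<omega>))"
    by (intro distr_cong refl) (simp add: sets_gaussM cong: sets_pair_measure_cong)
  ultimately have law: "distr M (gaussM I \<Otimes>\<^sub>M gaussM J) (\<lambda>\<omega>. (\<lambda>i\<in>I. Z i \<omega>, \<lambda>i\<in>J. Z i \<omega>)) = gaussM I \<Otimes>\<^sub>M gaussM J"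
    by simp
  have "(\<integral>\<omega>. h (\<lambda>i\<in>I. Z i \<omega>, \<lambda>j\<in>J. Z j \<omega>) \<partial>M) = (\<integral>z. h z \<partial>(gaussM I \<Otimes>\<^sub>M gaussM J))"
    using integral_distr[OF measurable_Pair[OF mI] h] unfolding law by simp
  also have "\<dots> = (\<integral>x. (\<integral>y. h (x, y) \<partial>gaussM J) \<partial>gaussM I)"
    using h bd by (intro PP.integral_fst'[symmetric] PP.P.integrable_const_bound[of _ B]) auto
  finally show ?thesis .
qed

lemma gauss_family_blocks:
  assumes Z: "gauss_family M I Z" and K: "\<And>j. j \<in> L \<Longrightarrow> K j \<subseteq> I" "disjoint_family_on K L"
    and f: "\<And>j. j \<in> L \<Longrightarrow> f j \<in> borel_measurable (Pi\<^sub>M (K j) (\<lambda>_. borel))"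
  shows "prob_space.indep_vars M (\<lambda>_. borel) (\<lambda>j \<omega>. f j (\<lambda>i\<in>K j. Z i \<omega>)) L"
proof -
  interpret prob_space M using gauss_familyD(1)[OF Z] .
  from indep_vars_restrict[OF gauss_familyD(4)[OF Z] K]
  have "indep_vars (\<lambda>j. Pi\<^sub>M (K j) (\<lambda>_. borel)) (\<lambda>j \<omega>. restrict (\<lambda>i. Z i \<omega>) (K j)) L" by blast
  from indep_vars_compose2[OF this f] show ?thesis by blast
qed

lemma gauss_family_expectation:
  fixes f :: "real \<Rightarrow> 'b::{banach,second_countable_topology}"
  assumes "gauss_family M I Z" "i \<in> I" "f \<in> borel_measurable borel"
  shows "(\<integral>\<omega>. f (Z i \<omega>) \<partial>M) = (\<integral>x. f x \<partial>std_normal_distribution)"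
    and "integrable M (\<lambda>\<omega>. f (Z i \<omega>)) \<longleftrightarrow> integrable std_normal_distribution f"
proof -
  note G = gauss_familyD[OF assms(1)]
  show "(\<integral>\<omega>. f (Z i \<omega>) \<partial>M) = (\<integral>x. f x \<partial>std_normal_distribution)"
    using G(3,5)[OF assms(2)] assms(3) by (metis integral_distr)
  show "integrable M (\<lambda>\<omega>. f (Z i \<omega>)) \<longleftrightarrow> integrable std_normal_distribution f"
    using G(3,5)[OF assms(2)] assms(3) by (metis integrable_distr_eq)
qed

subsection \<open>Moment bounds\<close>

lemma std_normal_moments:
  shows "(\<integral>x. x \<partial>std_normal_distribution) = 0" "(\<integral>x. x\<^sup>2 \<partial>std_normal_distribution) = 1"
    "(\<integral>x. x\<^sup>2 - 1 \<partial>std_normal_distribution) = 0" "(\<integral>x. (x\<^sup>2 - 1)\<^sup>2 \<partial>std_normal_distribution) = 2"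
    "integrable std_normal_distribution (\<lambda>x. x)" "integrable std_normal_distribution (\<lambda>x. x\<^sup>2)"
    "integrable std_normal_distribution (\<lambda>x. x\<^sup>2 - 1)"
    "integrable std_normal_distribution (\<lambda>x. (x\<^sup>2 - 1) ^ k)"
proof -
  note I = integrable_std_normal_distribution_moment
  show i1: "integrable std_normal_distribution (\<lambda>x. x)" using I[of 1] by simp
  show i2: "integrable std_normal_distribution (\<lambda>x. x\<^sup>2)" by (rule I)
  show "integrable std_normal_distribution (\<lambda>x. x\<^sup>2 - 1)" using i2 by simp
  have m2: "(\<integral>x. x\<^sup>2 \<partial>std_normal_distribution) = 1"
    using std_normal_distribution_even_moments(1)[of 1] by simp
  have m4: "(\<integral>x. x ^ 4 \<partial>std_normal_distribution) = 3"
    using std_normal_distribution_even_moments(1)[of 2] by (simp add: fact_numeral)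
  show "(\<integral>x. x \<partial>std_normal_distribution) = 0"
    using integral_std_normal_distribution_moment_odd[of 1] by simp
  show "(\<integral>x. x\<^sup>2 \<partial>std_normal_distribution) = 1" by (rule m2)
  show "(\<integral>x. x\<^sup>2 - 1 \<partial>std_normal_distribution) = 0"
    using i2 m2 std_normal.prob_space by simp
  have "(\<integral>x. (x\<^sup>2 - 1)\<^sup>2 \<partial>std_normal_distribution) = (\<integral>x. x ^ 4 - 2 * x\<^sup>2 + 1 \<partial>std_normal_distribution)"
    by (intro Bochner_Integration.integral_cong refl) (simp add: power2_eq_square power4_eq_xxxx algebra_simps)
  also have "\<dots> = 2" using i2 I[of 4] m2 m4 std_normal.prob_space by simp
  finally show "(\<integral>x. (x\<^sup>2 - 1)\<^sup>2 \<partial>std_normal_distribution) = 2" .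
  have "(x\<^sup>2 - 1) ^ k = (\<Sum>j\<le>k. of_nat (k choose j) * (x ^ (2 * j) * (-1) ^ (k - j)))" for x :: real
    using binomial_ring[of "x\<^sup>2" "-1" k] by (simp only: power_mult mult.assoc diff_conv_add_uminus)
  then show "integrable std_normal_distribution (\<lambda>x. (x\<^sup>2 - 1) ^ k)"
    using I by simp
qed

context prob_space
begin

lemma integrable_power_le_4:
  fixes W :: "'a \<Rightarrow> real"
  assumes [measurable]: "W \<in> borel_measurable M" and W: "integrable M (\<lambda>\<omega>. W \<omega> ^ 4)" and k: "k \<le> 4"
  shows "integrable M (\<lambda>\<omega>. W \<omega> ^ k)"
proof (rule Bochner_Integration.integrable_bound)
  show "integrable M (\<lambda>\<omega>. 1 + W \<omega> ^ 4)" using W by simp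
  have "\<bar>x\<bar> ^ k \<le> 1 + x ^ 4" for x :: real
  proof (cases "\<bar>x\<bar> \<le> 1")
    case True
    then have "\<bar>x\<bar> ^ k \<le> 1" by (simp add: power_le_one)
    moreover have "0 \<le> x ^ 4" by simp
    ultimately show ?thesis by linarith
  next
    case False
    then have "\<bar>x\<bar> ^ k \<le> \<bar>x\<bar> ^ 4" using k by (intro power_increasing) auto
    then show ?thesis by simp
  qed
  then show "AE \<omega> in M. norm (W \<omega> ^ k) \<le> norm (1 + W \<omega> ^ 4)"
    by (auto simp: power_abs intro: order_trans[OF _ abs_ge_self])
qed simp

lemma second_moment_indep_sum:
  fixes W :: "'i \<Rightarrow> 'a \<Rightarrow> real"
  assumes "finite I" "indep_vars (\<lambda>_. borel) W I"
    and "\<And>i. i \<in> I \<Longrightarrow> expectation (W i) = 0" "\<And>i. i \<in> I \<Longrightarrow> integrable M (\<lambda>\<omega>. (W i \<omega>)\<^sup>2)"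
  shows "integrable M (\<lambda>\<omega>. (\<Sum>i\<in>I. W i \<omega>)\<^sup>2) \<and> expectation (\<lambda>\<omega>. (\<Sum>i\<in>I. W i \<omega>)\<^sup>2) = (\<Sum>i\<in>I. expectation (\<lambda>\<omega>. (W i \<omega>)\<^sup>2))"
  using assms
proof (induction I rule: finite_induct)
  case empty
  then show ?case by simp
next
  case (insert i I)
  have mW[measurable]: "W j \<in> borel_measurable M" if "j \<in> insert i I" for j
    using insert.prems(1) that by (auto simp: indep_vars_def)
  have [measurable]: "W i \<in> borel_measurable M" "\<And>j. j \<in> I \<Longrightarrow> W j \<in> borel_measurable M" using mW by auto
  have IH: "integrable M (\<lambda>\<omega>. (\<Sum>i\<in>I. W i \<omega>)\<^sup>2)" "expectation (\<lambda>\<omega>. (\<Sum>i\<in>I. W i \<omega>)\<^sup>2) = (\<Sum>i\<in>I. expectation (\<lambda>\<omega>. (W i \<omega>)\<^sup>2))"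
    using insert.IH insert.prems indep_vars_subset[OF insert.prems(1), of I] by auto
  have iv: "indep_var borel (W i) borel (\<lambda>\<omega>. \<Sum>i\<in>I. W i \<omega>)"
    by (rule indep_vars_sum) (use insert in auto)
  have intW: "integrable M (W i)" "integrable M (\<lambda>\<omega>. \<Sum>i\<in>I. W i \<omega>)"
    using insert.prems(3)[of i] IH(1) by (auto intro!: square_integrable_imp_integrable)
  have cross: "integrable M (\<lambda>\<omega>. W i \<omega> * (\<Sum>i\<in>I. W i \<omega>))" "expectation (\<lambda>\<omega>. W i \<omega> * (\<Sum>i\<in>I. W i \<omega>)) = 0"
    using indep_var_integrable[OF iv intW] indep_var_lebesgue_integral[OF iv intW] insert.prems(2)[of i] by auto
  have eq: "(\<Sum>i\<in>insert i I. W i \<omega>)\<^sup>2 = (W i \<omega>)\<^sup>2 + 2 * (W i \<omega> * (\<Sum>i\<in>I. W i \<omega>)) + (\<Sum>i\<in>I. W i \<omega>)\<^sup>2" for \<omega>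
    using insert.hyps by (simp add: power2_sum)
  show ?case unfolding eq using insert.hyps insert.prems(3)[of i] IH cross by simp
qed

text \<open>In the expansion of \<open>(W + S)^4\<close> the terms with a first power vanish, as
  both summands are centred. The middle term adds at most \<open>6 * n * v^2\<close> for
  \<open>n = card I\<close>, and \<open>3 * n^2 + 6 * n \<le> 3 * (n + 1)^2\<close> closes the
  induction.\<close>

lemma fourth_moment_indep_sum:
  fixes W :: "'i \<Rightarrow> 'a \<Rightarrow> real"
  assumes "finite I" "indep_vars (\<lambda>_. borel) W I"
    and "\<And>i. i \<in> I \<Longrightarrow> expectation (W i) = 0" "\<And>i. i \<in> I \<Longrightarrow> integrable M (\<lambda>\<omega>. (W i \<omega>) ^ 4)"
    and "\<And>i. i \<in> I \<Longrightarrow> expectation (\<lambda>\<omega>. (W i \<omega>)\<^sup>2) \<le> v" "\<And>i. i \<in> I \<Longrightarrow> expectation (\<lambda>\<omega>. (W i \<omega>) ^ 4) \<le> \<kappa>"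
    and v: "0 \<le> v"
  shows "integrable M (\<lambda>\<omega>. (\<Sum>i\<in>I. W i \<omega>) ^ 4) \<and>
    expectation (\<lambda>\<omega>. (\<Sum>i\<in>I. W i \<omega>) ^ 4) \<le> real (card I) * \<kappa> + 3 * (real (card I))\<^sup>2 * v\<^sup>2"
  using assms(1-6)
proof (induction I rule: finite_induct)
  case empty
  then show ?case by simp
next
  case (insert i I)
  have [measurable]: "W i \<in> borel_measurable M" "\<And>j. j \<in> I \<Longrightarrow> W j \<in> borel_measurable M"
    using insert.prems(1) by (auto simp: indep_vars_def)
  define S where "S \<omega> = (\<Sum>i\<in>I. W i \<omega>)" for \<omega>
  have [measurable]: "S \<in> borel_measurable M" unfolding S_def by measurable
  have indI: "indep_vars (\<lambda>_. borel) W I" using indep_vars_subset[OF insert.prems(1), of I] by auto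
  have IH: "integrable M (\<lambda>\<omega>. S \<omega> ^ 4)" "expectation (\<lambda>\<omega>. S \<omega> ^ 4) \<le> real (card I) * \<kappa> + 3 * (real (card I))\<^sup>2 * v\<^sup>2"
    using insert.IH insert.prems indI unfolding S_def by auto
  have iW: "integrable M (\<lambda>\<omega>. W i \<omega> ^ k)" "integrable M (\<lambda>\<omega>. S \<omega> ^ k)" if "k \<le> 4" for k
    using that IH(1) insert.prems(3)[of i] by (auto intro!: integrable_power_le_4)
  have W2: "integrable M (\<lambda>\<omega>. (W j \<omega>)\<^sup>2)" if "j \<in> insert i I" for j
    using that insert.prems(3)[of j] by (auto intro!: integrable_power_le_4)
  have iv: "indep_var borel (W i) borel S"
    unfolding S_def by (rule indep_vars_sum) (use insert in auto)
  have ivp: "indep_var borel (\<lambda>\<omega>. W i \<omega> ^ k) borel (\<lambda>\<omega>. S \<omega> ^ l)" for k l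
    using indep_var_compose[OF iv, of "\<lambda>x. x ^ k" borel "\<lambda>x. x ^ l" borel] by (simp add: comp_def)
  have cross: "integrable M (\<lambda>\<omega>. W i \<omega> ^ k * S \<omega> ^ l)"
    "expectation (\<lambda>\<omega>. W i \<omega> ^ k * S \<omega> ^ l) = expectation (\<lambda>\<omega>. W i \<omega> ^ k) * expectation (\<lambda>\<omega>. S \<omega> ^ l)"
    if "k \<le> 4" "l \<le> 4" for k l
    using indep_var_integrable[OF ivp iW(1)[OF that(1)] iW(2)[OF that(2)]]
      indep_var_lebesgue_integral[OF ivp iW(1)[OF that(1)] iW(2)[OF that(2)]] by auto
  have S2: "expectation (\<lambda>\<omega>. S \<omega> ^ 2) \<le> real (card I) * v"
  proof -
    have "expectation (\<lambda>\<omega>. S \<omega> ^ 2) = (\<Sum>i\<in>I. expectation (\<lambda>\<omega>. (W i \<omega>)\<^sup>2))"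
      unfolding S_def using second_moment_indep_sum[OF insert.hyps(1) indI] insert.prems(2) W2 by simp
    also have "\<dots> \<le> (\<Sum>i\<in>I. v)" using insert.prems(4) by (intro sum_mono) auto
    finally show ?thesis by simp
  qed
  have S1: "expectation S = 0"
  proof -
    have W1: "integrable M (W j)" if "j \<in> I" for j
      using that W2[of j] by (auto intro: square_integrable_imp_integrable[of "W j"])
    have "expectation (\<lambda>\<omega>. \<Sum>i\<in>I. W i \<omega>) = (\<Sum>i\<in>I. expectation (W i))"
      by (rule Bochner_Integration.integral_sum) (rule W1)
    also have "\<dots> = 0" using insert.prems(2) by (intro sum.neutral) auto
    finally show ?thesis by (simp add: S_def[abs_def])
  qed
  have eq: "(\<Sum>i\<in>insert i I. W i \<omega>) ^ 4 = W i \<omega> ^ 4 + 4 * (W i \<omega> ^ 3 * S \<omega> ^ 1) + 6 * (W i \<omega> ^ 2 * S \<omega> ^ 2) + 4 * (W i \<omega> ^ 1 * S \<omega> ^ 3) + S \<omega> ^ 4" for \<omega>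
    using insert.hyps by (simp add: S_def[symmetric] power4_eq_xxxx power3_eq_cube power2_eq_square algebra_simps)
  have i: "integrable M (\<lambda>\<omega>. (\<Sum>i\<in>insert i I. W i \<omega>) ^ 4)"
    unfolding eq using iW(1)[of 4] iW(2)[of 4] cross(1)[of 3 1] cross(1)[of 2 2] cross(1)[of 1 3] by simp
  have "expectation (\<lambda>\<omega>. (\<Sum>i\<in>insert i I. W i \<omega>) ^ 4) = expectation (\<lambda>\<omega>. W i \<omega> ^ 4) +
     4 * expectation (\<lambda>\<omega>. W i \<omega> ^ 3 * S \<omega> ^ 1) + 6 * expectation (\<lambda>\<omega>. W i \<omega> ^ 2 * S \<omega> ^ 2) +
     4 * expectation (\<lambda>\<omega>. W i \<omega> ^ 1 * S \<omega> ^ 3) + expectation (\<lambda>\<omega>. S \<omega> ^ 4)"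
    unfolding eq using iW(1)[of 4] iW(2)[of 4] cross(1)[of 3 1] cross(1)[of 2 2] cross(1)[of 1 3] by simp
  also have "\<dots> = expectation (\<lambda>\<omega>. W i \<omega> ^ 4) + 6 * (expectation (\<lambda>\<omega>. W i \<omega> ^ 2) * expectation (\<lambda>\<omega>. S \<omega> ^ 2)) + expectation (\<lambda>\<omega>. S \<omega> ^ 4)"
    using cross(2)[of 3 1] cross(2)[of 2 2] cross(2)[of 1 3] S1 insert.prems(2)[of i] by simp
  also have "\<dots> \<le> \<kappa> + 6 * (v * (real (card I) * v)) + (real (card I) * \<kappa> + 3 * (real (card I))\<^sup>2 * v\<^sup>2)"
    using insert.prems(4,5)[of i] S2 IH(2) v
    by (intro add_mono mult_left_mono mult_mono) auto
  also have "\<dots> \<le> (real (card I) + 1) * \<kappa> + 3 * (real (card I) + 1)\<^sup>2 * v\<^sup>2"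
    by (simp add: power2_eq_square algebra_simps)
  finally show ?case using i insert.hyps by (simp add: add.commute)
qed

text \<open>Jensen's inequality, read off from the nonnegative variance of the absolute
  value.\<close>

lemma expectation_abs_le_sqrt:
  fixes f :: "'a \<Rightarrow> real"
  assumes [measurable]: "f \<in> borel_measurable M" and f2: "integrable M (\<lambda>\<omega>. (f \<omega>)\<^sup>2)"
  shows "integrable M f" "expectation (\<lambda>\<omega>. \<bar>f \<omega>\<bar>) \<le> sqrt (expectation (\<lambda>\<omega>. (f \<omega>)\<^sup>2))"
proof -
  show f: "integrable M f" using f2 by (rule square_integrable_imp_integrable[rotated]) simp
  have "0 \<le> variance (\<lambda>\<omega>. \<bar>f \<omega>\<bar>)" by (rule variance_positive)
  also have "variance (\<lambda>\<omega>. \<bar>f \<omega>\<bar>) = expectation (\<lambda>\<omega>. \<bar>f \<omega>\<bar>\<^sup>2) - (expectation (\<lambda>\<omega>. \<bar>f \<omega>\<bar>))\<^sup>2"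
    using f f2 by (intro variance_eq) auto
  finally show "expectation (\<lambda>\<omega>. \<bar>f \<omega>\<bar>) \<le> sqrt (expectation (\<lambda>\<omega>. (f \<omega>)\<^sup>2))"
    by (intro real_le_rsqrt) simp
qed

lemma prob_abs_ge_le:
  fixes f :: "'a \<Rightarrow> real"
  assumes [measurable]: "f \<in> borel_measurable M" and f: "integrable M f" and a: "0 < a"
  shows "prob {\<omega>\<in>space M. a \<le> \<bar>f \<omega>\<bar>} \<le> expectation (\<lambda>\<omega>. \<bar>f \<omega>\<bar>) / a"
proof -
  have "a * prob {\<omega>\<in>space M. a \<le> \<bar>f \<omega>\<bar>} = expectation (\<lambda>\<omega>. a * indicator {\<omega>\<in>space M. a \<le> \<bar>f \<omega>\<bar>} \<omega>)"
    by simp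
  also have "\<dots> \<le> expectation (\<lambda>\<omega>. \<bar>f \<omega>\<bar>)"
    using f a by (intro integral_mono integrable_mult_right integrable_real_indicator integrable_abs)
       (auto simp: indicator_def emeasure_eq_measure)
  finally show ?thesis using a by (simp add: field_simps)
qed

end

lemma gauss_family_chi_square:
  assumes Z: "gauss_family M I Z"
  shows "integrable M (\<lambda>\<omega>. (\<Sum>i\<in>I. c i * ((Z i \<omega>)\<^sup>2 - 1))\<^sup>2)"
    "(\<integral>\<omega>. (\<Sum>i\<in>I. c i * ((Z i \<omega>)\<^sup>2 - 1))\<^sup>2 \<partial>M) = 2 * (\<Sum>i\<in>I. (c i)\<^sup>2)"
proof -
  note G = gauss_familyD[OF Z]
  interpret prob_space M by fact
  define W where "W i \<omega> = c i * ((Z i \<omega>)\<^sup>2 - 1)" for i \<omega>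
  have iv: "indep_vars (\<lambda>_. borel) W I"
    unfolding W_def by (rule indep_vars_compose2[OF G(4)]) auto
  have E0: "expectation (W i) = 0" if "i \<in> I" for i
    using gauss_family_expectation(1)[OF Z that, of "\<lambda>x. c i * (x\<^sup>2 - 1)"] std_normal_moments(3)
    by (simp add: W_def[abs_def])
  have E2: "integrable M (\<lambda>\<omega>. (W i \<omega>)\<^sup>2)" "expectation (\<lambda>\<omega>. (W i \<omega>)\<^sup>2) = 2 * (c i)\<^sup>2" if "i \<in> I" for i
    using gauss_family_expectation[OF Z that, of "\<lambda>x. (c i * (x\<^sup>2 - 1))\<^sup>2"] std_normal_moments(4) std_normal_moments(8)[of 2]
    by (simp_all add: W_def[abs_def] power_mult_distrib)
  from second_moment_indep_sum[OF G(2) iv E0 E2(1)]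
  have "integrable M (\<lambda>\<omega>. (\<Sum>i\<in>I. W i \<omega>)\<^sup>2)" "expectation (\<lambda>\<omega>. (\<Sum>i\<in>I. W i \<omega>)\<^sup>2) = (\<Sum>i\<in>I. 2 * (c i)\<^sup>2)"
    using E2(2) by auto
  then show "integrable M (\<lambda>\<omega>. (\<Sum>i\<in>I. c i * ((Z i \<omega>)\<^sup>2 - 1))\<^sup>2)"
    "(\<integral>\<omega>. (\<Sum>i\<in>I. c i * ((Z i \<omega>)\<^sup>2 - 1))\<^sup>2 \<partial>M) = 2 * (\<Sum>i\<in>I. (c i)\<^sup>2)"
    by (simp_all add: W_def sum_distrib_left)
qed

text \<open>The summand \<open>12\<close> is \<open>3 * 2^2\<close>, from the fourth-moment bound
  with the variance \<open>2\<close> of a centred squared normal.\<close>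

definition chi4 :: real where
  "chi4 = (\<integral>x. (x\<^sup>2 - 1) ^ 4 \<partial>std_normal_distribution) + 12"

lemma gauss_family_chi_fourth:
  assumes Z: "gauss_family M I Z"
  shows "integrable M (\<lambda>\<omega>. (\<Sum>i\<in>I. (Z i \<omega>)\<^sup>2 - 1) ^ 4)"
    "(\<integral>\<omega>. (\<Sum>i\<in>I. (Z i \<omega>)\<^sup>2 - 1) ^ 4 \<partial>M) \<le> chi4 * (real (card I))\<^sup>2"
proof -
  note G = gauss_familyD[OF Z]
  interpret prob_space M by fact
  define W where "W i \<omega> = (Z i \<omega>)\<^sup>2 - 1" for i \<omega>
  let ?k = "\<integral>x. (x\<^sup>2 - 1) ^ 4 \<partial>std_normal_distribution"
  have k: "0 \<le> ?k" by (auto intro!: Bochner_Integration.integral_nonneg)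
  have iv: "indep_vars (\<lambda>_. borel) W I"
    unfolding W_def by (rule indep_vars_compose2[OF G(4)]) auto
  have E0: "expectation (W i) = 0" if "i \<in> I" for i
    using gauss_family_expectation(1)[OF Z that, of "\<lambda>x. x\<^sup>2 - 1"] std_normal_moments(3)
    by (simp add: W_def[abs_def])
  have E2: "expectation (\<lambda>\<omega>. (W i \<omega>)\<^sup>2) \<le> 2" if "i \<in> I" for i
    using gauss_family_expectation[OF Z that, of "\<lambda>x. (x\<^sup>2 - 1)\<^sup>2"] std_normal_moments(4)
    by (simp add: W_def[abs_def])
  have E4: "integrable M (\<lambda>\<omega>. (W i \<omega>) ^ 4)" "expectation (\<lambda>\<omega>. (W i \<omega>) ^ 4) \<le> ?k" if "i \<in> I" for i
    using gauss_family_expectation[OF Z that, of "\<lambda>x. (x\<^sup>2 - 1) ^ 4"] std_normal_moments(8)[of 4]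
    by (simp_all add: W_def[abs_def])
  from fourth_moment_indep_sum[OF G(2) iv E0 E4(1) E2 E4(2)]
  have *: "integrable M (\<lambda>\<omega>. (\<Sum>i\<in>I. W i \<omega>) ^ 4)"
    "expectation (\<lambda>\<omega>. (\<Sum>i\<in>I. W i \<omega>) ^ 4) \<le> real (card I) * ?k + 12 * (real (card I))\<^sup>2" by auto
  show "integrable M (\<lambda>\<omega>. (\<Sum>i\<in>I. (Z i \<omega>)\<^sup>2 - 1) ^ 4)" using *(1) by (simp add: W_def)
  have "real (card I) \<le> (real (card I))\<^sup>2"
    by (cases "card I") (auto simp: power2_eq_square)
  then have "real (card I) * ?k \<le> (real (card I))\<^sup>2 * ?k" using k by (rule mult_right_mono)
  with *(2) show "(\<integral>\<omega>. (\<Sum>i\<in>I. (Z i \<omega>)\<^sup>2 - 1) ^ 4 \<partial>M) \<le> chi4 * (real (card I))\<^sup>2"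
    by (simp add: W_def chi4_def algebra_simps)
qed

lemma gauss_family_pair:
  fixes f :: "real \<Rightarrow> real"
  assumes Z: "gauss_family M I Z" and ab: "a \<in> I" "b \<in> I" "a \<noteq> b"
    and f: "integrable std_normal_distribution f"
  shows "integrable M (\<lambda>\<omega>. f (Z a \<omega>) * f (Z b \<omega>))"
    "(\<integral>\<omega>. f (Z a \<omega>) * f (Z b \<omega>) \<partial>M) = (\<integral>x. f x \<partial>std_normal_distribution)\<^sup>2"
proof -
  note G = gauss_familyD[OF Z]
  interpret prob_space M by fact
  have [measurable]: "f \<in> borel_measurable borel" using borel_measurable_integrable[OF f] by simp
  have "indep_vars (\<lambda>_. borel) Z {a, b}" by (rule indep_vars_subset[OF G(4)]) (use ab in auto)
  then have iv: "indep_vars (\<lambda>_. borel) (\<lambda>i \<omega>. f (Z i \<omega>)) {a, b}"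
    by (rule indep_vars_compose2) auto
  have int: "integrable M (\<lambda>\<omega>. f (Z i \<omega>))" if "i \<in> {a, b}" for i
    using gauss_family_expectation(2)[OF Z, of i f] that ab f by auto
  show "integrable M (\<lambda>\<omega>. f (Z a \<omega>) * f (Z b \<omega>))"
    using indep_vars_integrable[OF _ iv int] ab by simp
  show "(\<integral>\<omega>. f (Z a \<omega>) * f (Z b \<omega>) \<partial>M) = (\<integral>x. f x \<partial>std_normal_distribution)\<^sup>2"
    using indep_vars_lebesgue_integral[OF _ iv int] ab gauss_family_expectation(1)[OF Z, of _ f]
    by (simp add: power2_eq_square)
qed

text \<open>The products \<open>Z (u t) * Z (v t)\<close> use disjoint pairs of variables, so they
  are independent, centred and of variance \<open>1\<close>. Applied to two rows of an array and to
  two columns.\<close>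

lemma gauss_family_inner_product:
  assumes Z: "gauss_family M I Z" and T: "finite T"
    and uv: "inj_on u T" "inj_on v T" "u ` T \<subseteq> I" "v ` T \<subseteq> I" "u ` T \<inter> v ` T = {}"
  shows "integrable M (\<lambda>\<omega>. (\<Sum>t\<in>T. Z (u t) \<omega> * Z (v t) \<omega>)\<^sup>2)"
    "(\<integral>\<omega>. (\<Sum>t\<in>T. Z (u t) \<omega> * Z (v t) \<omega>)\<^sup>2 \<partial>M) = real (card T)"
proof -
  note G = gauss_familyD[OF Z]
  interpret prob_space M by fact
  define W where "W t \<omega> = Z (u t) \<omega> * Z (v t) \<omega>" for t \<omega>
  have "indep_vars (\<lambda>_. borel) (\<lambda>t \<omega>. (\<lambda>x. x (u t) * x (v t)) (\<lambda>i\<in>{u t, v t}. Z i \<omega>)) T"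
  proof (rule gauss_family_blocks[OF Z])
    show "disjoint_family_on (\<lambda>t. {u t, v t}) T"
      unfolding disjoint_family_on_def
    proof (intro ballI impI)
      fix s t assume st: "s \<in> T" "t \<in> T" "s \<noteq> t"
      then have "u s \<noteq> u t" "v s \<noteq> v t" using uv(1,2) by (auto dest: inj_onD)
      moreover have "u s \<noteq> v t" "u t \<noteq> v s" using uv(5) st by blast+
      ultimately show "{u s, v s} \<inter> {u t, v t} = {}" by auto
    qed
  qed (use uv in auto)
  then have iv: "indep_vars (\<lambda>_. borel) W T" by (simp add: W_def[abs_def])
  have ne: "u t \<noteq> v t" "u t \<in> I" "v t \<in> I" if "t \<in> T" for t using uv that by auto
  have E0: "expectation (W t) = 0" if "t \<in> T" for t
    using gauss_family_pair(2)[OF Z ne(2,3,1)[OF that] std_normal_moments(5)] std_normal_moments(1)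
    by (simp add: W_def[abs_def])
  have E2: "integrable M (\<lambda>\<omega>. (W t \<omega>)\<^sup>2)" "expectation (\<lambda>\<omega>. (W t \<omega>)\<^sup>2) = 1" if "t \<in> T" for t
    using gauss_family_pair[OF Z ne(2,3,1)[OF that] std_normal_moments(6)] std_normal_moments(2)
    by (simp_all add: W_def[abs_def] power_mult_distrib)
  from second_moment_indep_sum[OF T iv E0 E2(1)] E2(2)
  show "integrable M (\<lambda>\<omega>. (\<Sum>t\<in>T. Z (u t) \<omega> * Z (v t) \<omega>)\<^sup>2)"
    "(\<integral>\<omega>. (\<Sum>t\<in>T. Z (u t) \<omega> * Z (v t) \<omega>)\<^sup>2 \<partial>M) = real (card T)"
    by (simp_all add: W_def)
qed

lemma gauss_array_row:
  fixes g :: "nat \<times> nat \<Rightarrow> 'a \<Rightarrow> real"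
  assumes "gauss_family M ({..<q} \<times> {..<m}) g" "a < q"
  shows "gauss_family M {..<m} (\<lambda>t. g (a, t))"
  using assms(2) by (intro gauss_family_reindex[OF assms(1)]) (auto simp: inj_on_def)

text \<open>The squares of the row deviations \<open>\<epsilon> a\<close> are independent with mean
  \<open>2 * m\<close>, and their variances are bounded by the fourth moments. Their sum thus
  fluctuates by order \<open>m * sqrt q\<close> only.\<close>

lemma gauss_array_row_norms:
  fixes g :: "nat \<times> nat \<Rightarrow> 'a \<Rightarrow> real"
  assumes Z: "gauss_family M ({..<q} \<times> {..<m}) g"
  defines "\<epsilon> \<equiv> \<lambda>a \<omega>. \<Sum>t<m. (g (a, t) \<omega>)\<^sup>2 - 1"
  shows "integrable M (\<lambda>\<omega>. (\<Sum>a<q. (\<epsilon> a \<omega>)\<^sup>2 - 2 * real m)\<^sup>2)"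
    "(\<integral>\<omega>. (\<Sum>a<q. (\<epsilon> a \<omega>)\<^sup>2 - 2 * real m)\<^sup>2 \<partial>M) \<le> chi4 * real q * (real m)\<^sup>2"
proof -
  note G = gauss_familyD[OF Z]
  interpret prob_space M by fact
  define W where "W a \<omega> = (\<epsilon> a \<omega>)\<^sup>2 - 2 * real m" for a \<omega>
  have "indep_vars (\<lambda>_. borel) (\<lambda>a \<omega>. (\<lambda>x. (\<Sum>t<m. (x (a, t))\<^sup>2 - 1)\<^sup>2 - 2 * real m) (\<lambda>i\<in>{a} \<times> {..<m}. g i \<omega>)) {..<q}"
  proof (rule gauss_family_blocks[OF Z])
    show "disjoint_family_on (\<lambda>a. {a} \<times> {..<m}) {..<q}" by (auto simp: disjoint_family_on_def)
  qed (auto intro!: borel_measurable_diff borel_measurable_power borel_measurable_sum)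
  then have iv: "indep_vars (\<lambda>_. borel) W {..<q}" by (simp add: W_def[abs_def] \<epsilon>_def)
  have row: "integrable M (\<lambda>\<omega>. (\<epsilon> a \<omega>)\<^sup>2)" "expectation (\<lambda>\<omega>. (\<epsilon> a \<omega>)\<^sup>2) = 2 * real m"
    "integrable M (\<lambda>\<omega>. (\<epsilon> a \<omega>) ^ 4)" "expectation (\<lambda>\<omega>. (\<epsilon> a \<omega>) ^ 4) \<le> chi4 * (real m)\<^sup>2" if "a < q" for a
    using gauss_family_chi_square[OF gauss_array_row[OF Z that], of "\<lambda>_. 1"]
      gauss_family_chi_fourth[OF gauss_array_row[OF Z that]] by (simp_all add: \<epsilon>_def)
  have E0: "expectation (W a) = 0" if "a \<in> {..<q}" for a
    using row(1,2)[of a] that by (simp add: W_def[abs_def] prob_space)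
  have eq: "(W a \<omega>)\<^sup>2 = \<epsilon> a \<omega> ^ 4 - 4 * real m * (\<epsilon> a \<omega>)\<^sup>2 + 4 * (real m)\<^sup>2" for a \<omega>
    by (simp add: W_def power2_eq_square power4_eq_xxxx algebra_simps)
  have E2: "integrable M (\<lambda>\<omega>. (W a \<omega>)\<^sup>2)" "expectation (\<lambda>\<omega>. (W a \<omega>)\<^sup>2) \<le> chi4 * (real m)\<^sup>2" if "a \<in> {..<q}" for a
  proof -
    have a: "a < q" using that by simp
    show "integrable M (\<lambda>\<omega>. (W a \<omega>)\<^sup>2)" unfolding eq using row[OF a] by simp
    have "expectation (\<lambda>\<omega>. (W a \<omega>)\<^sup>2) = expectation (\<lambda>\<omega>. \<epsilon> a \<omega> ^ 4) - 4 * (real m)\<^sup>2"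
      unfolding eq using row[OF a] by (simp add: prob_space power2_eq_square)
    then show "expectation (\<lambda>\<omega>. (W a \<omega>)\<^sup>2) \<le> chi4 * (real m)\<^sup>2"
      using row(4)[OF a] zero_le_power2[of "real m"] by linarith
  qed
  from second_moment_indep_sum[OF _ iv E0 E2(1)]
  have *: "integrable M (\<lambda>\<omega>. (\<Sum>a<q. W a \<omega>)\<^sup>2)" "expectation (\<lambda>\<omega>. (\<Sum>a<q. W a \<omega>)\<^sup>2) = (\<Sum>a<q. expectation (\<lambda>\<omega>. (W a \<omega>)\<^sup>2))"
    by auto
  show "integrable M (\<lambda>\<omega>. (\<Sum>a<q. (\<epsilon> a \<omega>)\<^sup>2 - 2 * real m)\<^sup>2)" using *(1) by (simp add: W_def)
  have "expectation (\<lambda>\<omega>. (\<Sum>a<q. W a \<omega>)\<^sup>2) \<le> (\<Sum>a<q. chi4 * (real m)\<^sup>2)"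
    unfolding *(2) by (intro sum_mono E2)
  then show "(\<integral>\<omega>. (\<Sum>a<q. (\<epsilon> a \<omega>)\<^sup>2 - 2 * real m)\<^sup>2 \<partial>M) \<le> chi4 * real q * (real m)\<^sup>2"
    by (simp add: W_def mult_ac)
qed

subsection \<open>Characteristic functions of Gaussian quadratic forms\<close>

text \<open>The product of \<open>1 + y + y^2 / 2\<close> and \<open>1 - y + y^2 / 2\<close> is
  \<open>1 + y^4 / 4\<close>, and the first factor is at most \<open>exp y\<close>.\<close>

lemma exp_minus_le_quadratic: "0 \<le> y \<Longrightarrow> exp (- y) \<le> 1 - y + y\<^sup>2 / 2" for y :: real
proof -
  assume y: "0 \<le> y"
  have pos: "0 < 1 - y + y\<^sup>2 / 2"
  proof -
    have "0 \<le> (1 - y)\<^sup>2" by simp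
    then show ?thesis by (simp add: power2_eq_square algebra_simps)
  qed
  have "1 \<le> (1 + y + y\<^sup>2 / 2) * (1 - y + y\<^sup>2 / 2)"
  proof -
    have "(1 + y + y\<^sup>2 / 2) * (1 - y + y\<^sup>2 / 2) = 1 + (y\<^sup>2)\<^sup>2 / 4" by (simp add: power2_eq_square algebra_simps)
    then show ?thesis by simp
  qed
  also have "\<dots> \<le> exp y * (1 - y + y\<^sup>2 / 2)"
    using exp_lower_Taylor_quadratic[OF y] pos by (intro mult_right_mono) auto
  finally show ?thesis by (simp add: exp_minus field_simps)
qed

lemma exp_minus_diff_le: "0 \<le> x \<Longrightarrow> 0 \<le> y \<Longrightarrow> \<bar>exp (- x) - exp (- y)\<bar> \<le> \<bar>x - y\<bar>" for x y :: real
proof (induction x y rule: linorder_wlog)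
  case (le x y)
  have "exp (- x) - exp (- y) = exp (- x) * (1 - exp (x - y))" by (simp add: right_diff_distrib exp_add[symmetric])
  also have "\<dots> \<le> 1 * (y - x)"
  proof (rule mult_mono)
    show "1 - exp (x - y) \<le> y - x" using exp_ge_add_one_self[of "x - y"] by linarith
  qed (use le in auto)
  finally show ?case using le by simp
next
  case (sym x y)
  then show ?case by (simp add: abs_minus_commute)
qed

text \<open>The third absolute moment over \<open>6\<close> is the Taylor remainder. The
  \<open>2\<close> absorbs the remainder of \<open>exp (- \<theta>^2)\<close> when
  \<open>\<bar>\<theta>\<bar> \<le> 1\<close>, and otherwise bounds the distance of two numbers of
  modulus at most \<open>1\<close>.\<close>

definition chi_char_const :: real where
  "chi_char_const = (\<integral>x. \<bar>x\<^sup>2 - 1\<bar> ^ 3 \<partial>std_normal_distribution) / 6 + 2"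

lemma chi_char_const_pos: "2 \<le> chi_char_const"
  by (auto simp: chi_char_const_def intro!: Bochner_Integration.integral_nonneg)

text \<open>A centred squared normal has mean \<open>0\<close> and variance \<open>2\<close>, so
  both functions are \<open>1 - \<theta>^2\<close> up to third order.\<close>

lemma char_centered_chi_square:
  "cmod ((CLINT x|std_normal_distribution. iexp (\<theta> * (x\<^sup>2 - 1))) - complex_of_real (exp (- \<theta>\<^sup>2))) \<le> chi_char_const * \<bar>\<theta>\<bar> ^ 3"
proof -
  let ?N = std_normal_distribution
  let ?\<mu> = "distr ?N borel (\<lambda>x::real. x\<^sup>2 - 1)"
  let ?K = "\<integral>x. \<bar>x\<^sup>2 - 1\<bar> ^ 3 \<partial>?N"
  have K: "0 \<le> ?K" by (auto intro!: Bochner_Integration.integral_nonneg)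
  have ch: "char ?\<mu> \<theta> = (CLINT x|?N. iexp (\<theta> * (x\<^sup>2 - 1)))"
    unfolding char_def by (subst integral_distr) auto
  show ?thesis
  proof (cases "\<bar>\<theta>\<bar> \<le> 1")
    case True
    have i3: "integrable ?N (\<lambda>x. \<bar>x\<^sup>2 - 1\<bar> ^ 3)"
      using integrable_abs[OF std_normal_moments(8)[of 3]] by (simp add: power_abs)
    have "cmod (char ?\<mu> \<theta> - (1 - \<theta>^2 * 2 / 2)) \<le>
      (\<theta>^2 / 6) * std_normal.expectation (\<lambda>x. min (6 * (x\<^sup>2 - 1)^2) (\<bar>\<theta>\<bar> * \<bar>x\<^sup>2 - 1\<bar>^3))"
    proof (rule std_normal.char_approx3')
      show "std_normal.variance (\<lambda>x. x\<^sup>2 - 1) = 2"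
        by (simp only: std_normal_moments(3,4) diff_0_right)
    qed (simp_all add: std_normal_moments(3,7) std_normal_moments(8)[of 2] del: Bochner_Integration.integral_diff)
    also have "\<dots> \<le> (\<theta>^2 / 6) * std_normal.expectation (\<lambda>x. \<bar>\<theta>\<bar> * \<bar>x\<^sup>2 - 1\<bar>^3)"
      using i3 by (intro mult_left_mono integral_mono' integrable_mult_right) auto
    also have "\<dots> = ?K / 6 * \<bar>\<theta>\<bar> ^ 3" by (simp add: power3_eq_cube power2_eq_square abs_mult[symmetric])
    finally have 1: "cmod (char ?\<mu> \<theta> - (1 - \<theta>^2)) \<le> ?K / 6 * \<bar>\<theta>\<bar> ^ 3" by simp
    have "\<bar>(1 - \<theta>\<^sup>2) - exp (- \<theta>\<^sup>2)\<bar> \<le> (\<theta>\<^sup>2)\<^sup>2 / 2"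
      using exp_minus_le_quadratic[of "\<theta>\<^sup>2"] exp_ge_add_one_self[of "- \<theta>\<^sup>2"] by (simp add: abs_if)
    moreover have "(\<theta>\<^sup>2)\<^sup>2 \<le> \<bar>\<theta>\<bar> ^ 3"
    proof -
      have "(\<theta>\<^sup>2)\<^sup>2 = \<bar>\<theta>\<bar> ^ 4" by simp
      also have "\<dots> \<le> \<bar>\<theta>\<bar> ^ 3" using True by (intro power_decreasing) auto
      finally show ?thesis .
    qed
    moreover have "0 \<le> \<bar>\<theta>\<bar> ^ 3" by simp
    ultimately have "\<bar>(1 - \<theta>\<^sup>2) - exp (- \<theta>\<^sup>2)\<bar> \<le> 2 * \<bar>\<theta>\<bar> ^ 3" by linarith
    then have 2: "cmod (complex_of_real ((1 - \<theta>\<^sup>2) - exp (- \<theta>\<^sup>2))) \<le> 2 * \<bar>\<theta>\<bar> ^ 3"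
      by (simp only: norm_of_real)
    have "cmod (char ?\<mu> \<theta> - complex_of_real (exp (- \<theta>\<^sup>2))) \<le>
      cmod (char ?\<mu> \<theta> - (1 - \<theta>^2)) + cmod (complex_of_real ((1 - \<theta>\<^sup>2) - exp (- \<theta>\<^sup>2)))"
      by (rule order_trans[OF _ norm_triangle_ineq]) simp
    with 1 2 show ?thesis unfolding ch chi_char_const_def by (simp add: algebra_simps)
  next
    case False
    have "real_distribution ?\<mu>" by (rule std_normal.real_distribution_distr) simp
    then have "cmod (char ?\<mu> \<theta>) \<le> 1" by (rule real_distribution.cmod_char_le_1)
    moreover have "cmod (complex_of_real (exp (- \<theta>\<^sup>2))) \<le> 1" unfolding norm_of_real by simp
    ultimately have "cmod (char ?\<mu> \<theta> - complex_of_real (exp (- \<theta>\<^sup>2))) \<le> 2"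
      by (intro order_trans[OF norm_triangle_ineq4]) linarith
    also have "\<dots> \<le> chi_char_const * 1" using chi_char_const_pos by simp
    also have "\<dots> \<le> chi_char_const * \<bar>\<theta>\<bar> ^ 3"
      using False chi_char_const_pos by (intro mult_left_mono one_le_power) auto
    finally show ?thesis unfolding ch .
  qed
qed

lemma eigensystem_trace:
  assumes "eigensystem p A V \<phi>"
  shows "(\<Sum>i<p. A i i) = (\<Sum>k<p. \<phi> k)"
    and "(\<Sum>i<p. \<Sum>j<p. (A i j)\<^sup>2) = (\<Sum>k<p. (\<phi> k)\<^sup>2)"
proof -
  have V: "orthonormal p V" using assms by (simp add: eigensystem_def)
  have one: "(\<Sum>i<p. V k i * V k i) = 1" if "k < p" for k
    using V that by (simp add: orthonormal_def dotp_def)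
  have "(\<Sum>i<p. A i i) = (\<Sum>i<p. \<Sum>k<p. \<phi> k * (V k i * V k i))"
    by (intro sum.cong refl) (simp add: eigensystem_matrix[OF assms] mult.assoc)
  also have "\<dots> = (\<Sum>k<p. \<phi> k * (\<Sum>i<p. V k i * V k i))"
    by (subst sum.swap) (simp add: sum_distrib_left)
  also have "\<dots> = (\<Sum>k<p. \<phi> k)" using one by (intro sum.cong) auto
  finally show "(\<Sum>i<p. A i i) = (\<Sum>k<p. \<phi> k)" .
  have "(\<Sum>i<p. \<Sum>j<p. (A i j)\<^sup>2) = (\<Sum>i<p. \<Sum>j<p. \<Sum>k<p. \<phi> k * (V k i * (A i j * V k j)))"
  proof (intro sum.cong refl)
    fix i j assume "i \<in> {..<p}" "j \<in> {..<p}"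
    then have "A i j = (\<Sum>k<p. \<phi> k * V k i * V k j)" by (intro eigensystem_matrix[OF assms]) auto
    then have "(A i j)\<^sup>2 = A i j * (\<Sum>k<p. \<phi> k * V k i * V k j)" by (simp add: power2_eq_square)
    then show "(A i j)\<^sup>2 = (\<Sum>k<p. \<phi> k * (V k i * (A i j * V k j)))"
      by (simp add: sum_distrib_left mult_ac)
  qed
  also have "\<dots> = (\<Sum>i<p. \<Sum>k<p. \<Sum>j<p. \<phi> k * (V k i * (A i j * V k j)))"
    by (intro sum.cong refl sum.swap)
  also have "\<dots> = (\<Sum>k<p. \<Sum>i<p. \<Sum>j<p. \<phi> k * (V k i * (A i j * V k j)))" by (rule sum.swap)
  also have "\<dots> = (\<Sum>k<p. \<phi> k * (\<Sum>i<p. V k i * mulv p A (V k) i))"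
    by (simp add: mulv_def sum_distrib_left)
  also have "\<dots> = (\<Sum>k<p. \<phi> k * (\<Sum>i<p. V k i * (\<phi> k * V k i)))"
    using assms by (intro sum.cong arg_cong2[where f="(*)"] refl) (auto simp: eigensystem_def)
  also have "\<dots> = (\<Sum>k<p. (\<phi> k)\<^sup>2 * (\<Sum>i<p. V k i * V k i))"
    by (simp add: sum_distrib_left power2_eq_square mult_ac)
  also have "\<dots> = (\<Sum>k<p. (\<phi> k)\<^sup>2)" using one by (intro sum.cong) auto
  finally show "(\<Sum>i<p. \<Sum>j<p. (A i j)\<^sup>2) = (\<Sum>k<p. (\<phi> k)\<^sup>2)" .
qed

text \<open>Rotating to an eigenbasis turns a Gaussian quadratic form into an independent sum of weighted
  chi-squares.\<close>

lemma char_gaussian_quadratic_form: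
  fixes r :: "nat \<Rightarrow> 'a \<Rightarrow> real"
  assumes r: "gauss_family M {..<m} r" and W: "symmetric_mat m W"
  shows "cmod ((CLINT \<omega>|M. iexp (c * ((\<Sum>s<m. \<Sum>t<m. W s t * r s \<omega> * r t \<omega>) - (\<Sum>t<m. W t t)))) -
     complex_of_real (exp (- (c\<^sup>2 * (\<Sum>s<m. \<Sum>t<m. (W s t)\<^sup>2))))) \<le>
    chi_char_const * sqrt (c\<^sup>2 * (\<Sum>s<m. \<Sum>t<m. (W s t)\<^sup>2)) ^ 3"
proof -
  obtain V \<phi> where es: "eigensystem m W V \<phi>" using ex_eigensystem[OF W] by blast
  have V: "orthonormal m V" using es by (simp add: eigensystem_def)
  define \<xi> where "\<xi> j \<omega> = (\<Sum>s<m. V j s * r s \<omega>)" for j \<omega>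
  have \<xi>: "gauss_family M {..<m} \<xi>" unfolding \<xi>_def
    using V by (intro gauss_family_linear[OF r]) (auto simp: orthonormal_def dotp_def)
  note G = gauss_familyD[OF \<xi>]
  interpret prob_space M by fact
  define Y where "Y j \<omega> = iexp (c * \<phi> j * ((\<xi> j \<omega>)\<^sup>2 - 1))" for j \<omega>
  have q: "(\<Sum>s<m. \<Sum>t<m. W s t * r s \<omega> * r t \<omega>) - (\<Sum>t<m. W t t) = (\<Sum>j<m. \<phi> j * ((\<xi> j \<omega>)\<^sup>2 - 1))" for \<omega>
  proof -
    have "(\<Sum>s<m. \<Sum>t<m. W s t * r s \<omega> * r t \<omega>) = dotp m (\<lambda>s. r s \<omega>) (mulv m W (\<lambda>s. r s \<omega>))"
      by (simp add: dotp_def mulv_def sum_distrib_left mult_ac)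
    also have "\<dots> = (\<Sum>j<m. \<phi> j * (\<xi> j \<omega>)\<^sup>2)"
      unfolding eigensystem_quadratic[OF es] by (simp add: \<xi>_def dotp_def)
    finally show ?thesis
      unfolding eigensystem_trace(1)[OF es] by (simp add: sum_subtractf[symmetric] algebra_simps)
  qed
  have iv: "indep_vars (\<lambda>_. borel) Y {..<m}"
    unfolding Y_def by (rule indep_vars_compose2[OF G(4)]) auto
  have [measurable]: "Y j \<in> borel_measurable M" if "j < m" for j
    using iv that by (auto simp: indep_vars_def)
  have nY: "cmod (Y j \<omega>) = 1" for j \<omega> by (simp add: Y_def)
  have intY: "integrable M (Y j)" if "j \<in> {..<m}" for j
    using that by (intro integrable_const_bound[of _ 1]) (auto simp: nY)
  have "(CLINT \<omega>|M. iexp (c * ((\<Sum>s<m. \<Sum>t<m. W s t * r s \<omega> * r t \<omega>) - (\<Sum>t<m. W t t)))) = (CLINT \<omega>|M. (\<Prod>j<m. Y j \<omega>))"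
    unfolding q Y_def by (simp add: sum_distrib_left exp_sum mult.assoc)
  also have "\<dots> = (\<Prod>j<m. expectation (Y j))" by (rule indep_vars_lebesgue_integral[OF _ iv intY]) auto
  finally have 1: "(CLINT \<omega>|M. iexp (c * ((\<Sum>s<m. \<Sum>t<m. W s t * r s \<omega> * r t \<omega>) - (\<Sum>t<m. W t t)))) = (\<Prod>j<m. expectation (Y j))" .
  have 2: "complex_of_real (exp (- (c\<^sup>2 * (\<Sum>k<m. (\<phi> k)\<^sup>2)))) = (\<Prod>j<m. complex_of_real (exp (- (c * \<phi> j)\<^sup>2)))"
    by (simp only: of_real_prod[symmetric] exp_sum[symmetric] finite_lessThan sum_negf sum_distrib_left power_mult_distrib)
  have "cmod ((\<Prod>j<m. expectation (Y j)) - (\<Prod>j<m. complex_of_real (exp (- (c * \<phi> j)\<^sup>2)))) \<le>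
     (\<Sum>j<m. cmod (expectation (Y j) - complex_of_real (exp (- (c * \<phi> j)\<^sup>2))))"
  proof (rule norm_prod_diff)
    show "cmod (expectation (Y j)) \<le> 1" if "j \<in> {..<m}" for j
    proof -
      have "cmod (expectation (Y j)) \<le> expectation (\<lambda>\<omega>. cmod (Y j \<omega>))" by (rule integral_norm_bound)
      then show ?thesis by (simp add: nY prob_space)
    qed
    show "cmod (complex_of_real (exp (- (c * \<phi> j)\<^sup>2))) \<le> 1" for j unfolding norm_of_real by simp
  qed
  also have "\<dots> \<le> (\<Sum>j<m. chi_char_const * \<bar>c * \<phi> j\<bar> ^ 3)"
  proof (intro sum_mono)
    fix j assume j: "j \<in> {..<m}"
    have "expectation (Y j) = (CLINT x|std_normal_distribution. iexp (c * \<phi> j * (x\<^sup>2 - 1)))"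
      unfolding Y_def by (rule gauss_family_expectation(1)[OF \<xi> j]) simp
    then show "cmod (expectation (Y j) - complex_of_real (exp (- (c * \<phi> j)\<^sup>2))) \<le> chi_char_const * \<bar>c * \<phi> j\<bar> ^ 3"
      using char_centered_chi_square[of "c * \<phi> j"] by simp
  qed
  \<comment> \<open>One factor of each cube is bounded by the Euclidean norm of all
    \<open>c * \<phi> j\<close>, so the error depends on the Frobenius norm of \<open>W\<close>
    alone.\<close>
  also have "\<dots> \<le> (\<Sum>j<m. chi_char_const * ((c * \<phi> j)\<^sup>2 * sqrt (c\<^sup>2 * (\<Sum>k<m. (\<phi> k)\<^sup>2))))"
  proof (intro sum_mono mult_left_mono)
    fix j assume j: "j \<in> {..<m}"
    have "(\<phi> j)\<^sup>2 \<le> (\<Sum>k<m. (\<phi> k)\<^sup>2)" using j by (intro member_le_sum) auto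
    then have "(c * \<phi> j)\<^sup>2 \<le> c\<^sup>2 * (\<Sum>k<m. (\<phi> k)\<^sup>2)" unfolding power_mult_distrib by (intro mult_left_mono) auto
    then have "\<bar>c * \<phi> j\<bar> \<le> sqrt (c\<^sup>2 * (\<Sum>k<m. (\<phi> k)\<^sup>2))" by (metis real_sqrt_abs real_sqrt_le_mono)
    then have "(c * \<phi> j)\<^sup>2 * \<bar>c * \<phi> j\<bar> \<le> (c * \<phi> j)\<^sup>2 * sqrt (c\<^sup>2 * (\<Sum>k<m. (\<phi> k)\<^sup>2))" by (intro mult_left_mono) auto
    moreover have "\<bar>c * \<phi> j\<bar> ^ 3 = (c * \<phi> j)\<^sup>2 * \<bar>c * \<phi> j\<bar>"
      unfolding power2_abs[of "c * \<phi> j", symmetric] by (simp only: power3_eq_cube power2_eq_square)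
    ultimately show "\<bar>c * \<phi> j\<bar> ^ 3 \<le> (c * \<phi> j)\<^sup>2 * sqrt (c\<^sup>2 * (\<Sum>k<m. (\<phi> k)\<^sup>2))" by simp
  qed (use chi_char_const_pos in auto)
  also have "\<dots> = chi_char_const * ((c\<^sup>2 * (\<Sum>k<m. (\<phi> k)\<^sup>2)) * sqrt (c\<^sup>2 * (\<Sum>k<m. (\<phi> k)\<^sup>2)))"
    by (simp add: power_mult_distrib sum_distrib_left sum_distrib_right mult_ac)
  also have "\<dots> = chi_char_const * sqrt (c\<^sup>2 * (\<Sum>k<m. (\<phi> k)\<^sup>2)) ^ 3"
  proof -
    have "0 \<le> c\<^sup>2 * (\<Sum>k<m. (\<phi> k)\<^sup>2)" by (simp add: sum_nonneg)
    then have "x = sqrt x * sqrt x" if "x = c\<^sup>2 * (\<Sum>k<m. (\<phi> k)\<^sup>2)" for x using that by simp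
    then show ?thesis by (simp only: power3_eq_cube)
  qed
  finally show ?thesis unfolding 1 eigensystem_trace(2)[OF es] 2 .
qed

text \<open>The case \<open>u \<le> 2 * v\<close> needs \<open>4\<close> copies of
  \<open>chi_char_const\<close>, the case \<open>u > 2 * v\<close> needs \<open>2\<close>, and
  replacing \<open>exp (- u)\<close> by \<open>exp (- v)\<close> costs the \<open>1\<close>.\<close>

definition quad_char_const :: real where "quad_char_const = 5 * chi_char_const + 1"

lemma quad_char_const_pos: "0 < quad_char_const"
  using chi_char_const_pos by (simp add: quad_char_const_def)

text \<open>In the application \<open>W\<close> comes from random rows, and for its scaled squared
  Frobenius norm \<open>u\<close> only the mean of \<open>\<bar>u - v\<bar>\<close> is controlled;
  so the error has to be linear in \<open>\<bar>u - v\<bar>\<close>. If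
  \<open>u \<le> 2 * v\<close>, the cubic error is of order \<open>v * sqrt v\<close>; otherwise
  \<open>u \<le> 2 * \<bar>u - v\<bar>\<close>, and a bound linear in \<open>u\<close>
  suffices.\<close>

lemma char_gaussian_quadratic_form':
  fixes r :: "nat \<Rightarrow> 'a \<Rightarrow> real"
  assumes r: "gauss_family M {..<m} r" and W: "symmetric_mat m W" and v: "0 \<le> v"
  shows "cmod ((CLINT \<omega>|M. iexp (c * ((\<Sum>s<m. \<Sum>t<m. W s t * r s \<omega> * r t \<omega>) - (\<Sum>t<m. W t t)))) -
     complex_of_real (exp (- v))) \<le>
    quad_char_const * (v * sqrt v + \<bar>c\<^sup>2 * (\<Sum>s<m. \<Sum>t<m. (W s t)\<^sup>2) - v\<bar>)"
proof -
  define E where "E = (CLINT \<omega>|M. iexp (c * ((\<Sum>s<m. \<Sum>t<m. W s t * r s \<omega> * r t \<omega>) - (\<Sum>t<m. W t t))))"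
  define u where "u = c\<^sup>2 * (\<Sum>s<m. \<Sum>t<m. (W s t)\<^sup>2)"
  have u: "0 \<le> u" by (simp add: u_def sum_nonneg)
  interpret prob_space M using gauss_familyD(1)[OF r] .
  let ?K = chi_char_const
  have "cmod E \<le> expectation (\<lambda>\<omega>. 1)" unfolding E_def
    by (rule order_trans[OF integral_norm_bound]) simp
  then have "cmod E \<le> 1" by (simp add: prob_space)
  moreover have "cmod (complex_of_real (exp (- u))) \<le> 1" using u unfolding norm_of_real by simp
  ultimately have b2: "cmod (E - complex_of_real (exp (- u))) \<le> 2"
    by (intro order_trans[OF norm_triangle_ineq4]) linarith
  have b3: "cmod (E - complex_of_real (exp (- u))) \<le> ?K * sqrt u ^ 3"
    unfolding E_def u_def by (rule char_gaussian_quadratic_form[OF r W])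
  have su: "sqrt u ^ 3 = u * sqrt u" using u by (simp add: power3_eq_cube)
  have K: "2 \<le> ?K" by (rule chi_char_const_pos)
  have vs: "0 \<le> v * sqrt v" using v by simp
  have main: "cmod (E - complex_of_real (exp (- u))) \<le> 4 * ?K * (v * sqrt v) + 2 * ?K * \<bar>u - v\<bar>"
  proof (cases "u \<le> 2 * v")
    case True
    have "u * sqrt u \<le> (2 * v) * (sqrt 4 * sqrt v)"
    proof (intro mult_mono True)
      have "sqrt u \<le> sqrt (4 * v)" using True v by (intro real_sqrt_le_mono) simp
      then show "sqrt u \<le> sqrt 4 * sqrt v" by (simp add: real_sqrt_mult)
    qed (use u v in auto)
    then have "?K * sqrt u ^ 3 \<le> ?K * (4 * (v * sqrt v))"
      unfolding su using K by (intro mult_left_mono) auto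
    with b3 have "cmod (E - complex_of_real (exp (- u))) \<le> 4 * ?K * (v * sqrt v)" by simp
    moreover have "0 \<le> 2 * ?K * \<bar>u - v\<bar>" using K by simp
    ultimately show ?thesis by linarith
  next
    case False
    \<comment> \<open>For \<open>u \<le> 1\<close> this is the cubic bound, for larger
      \<open>u\<close> the trivial bound \<open>2\<close>.\<close>
    have "cmod (E - complex_of_real (exp (- u))) \<le> ?K * u"
    proof (cases "u \<le> 1")
      case True
      have "?K * sqrt u ^ 3 \<le> ?K * (u * 1)" unfolding su using True u K
        by (intro mult_left_mono) auto
      with b3 show ?thesis by simp
    next
      case False
      then have "2 * 1 \<le> ?K * u" using K by (intro mult_mono) auto
      with b2 show ?thesis by simp
    qed
    also have "\<dots> \<le> ?K * (2 * \<bar>u - v\<bar>)"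
    proof (rule mult_left_mono)
      have "2 * v < u" using \<open>\<not> u \<le> 2 * v\<close> by simp
      then have "v \<le> u" "u \<le> 2 * (u - v)" using v by auto
      then show "u \<le> 2 * \<bar>u - v\<bar>" by simp
    qed (use K in simp)
    finally show ?thesis using K vs by (simp add: mult_ac add_increasing)
  qed
  have "\<bar>exp (- u) - exp (- v)\<bar> \<le> \<bar>u - v\<bar>" using u v by (rule exp_minus_diff_le)
  then have e: "cmod (complex_of_real (exp (- u) - exp (- v))) \<le> \<bar>u - v\<bar>" unfolding norm_of_real .
  have "cmod (E - complex_of_real (exp (- v))) \<le> cmod (E - complex_of_real (exp (- u))) + cmod (complex_of_real (exp (- u) - exp (- v)))"
    by (rule order_trans[OF _ norm_triangle_ineq]) simp
  also have "\<dots> \<le> (4 * ?K * (v * sqrt v) + 2 * ?K * \<bar>u - v\<bar>) + \<bar>u - v\<bar>" using main e by linarith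
  also have "\<dots> \<le> quad_char_const * (v * sqrt v + \<bar>u - v\<bar>)"
  proof -
    have "0 \<le> (?K + 1) * (v * sqrt v)" "0 \<le> 3 * ?K * \<bar>u - v\<bar>" using K vs by auto
    then show ?thesis unfolding quad_char_const_def by (simp add: algebra_simps)
  qed
  finally show ?thesis unfolding E_def u_def .
qed

subsection \<open>A central limit theorem for Gaussian Gram matrices\<close>

definition rdot :: "nat \<Rightarrow> (nat \<times> nat \<Rightarrow> real) \<Rightarrow> nat \<Rightarrow> nat \<Rightarrow> real" where
  "rdot m x a b = (\<Sum>t<m. x (a, t) * x (b, t))"

text \<open>Given row \<open>a\<close>, the squared inner product with an independent Gaussian row
  \<open>b\<close> has mean \<open>rdot m x a a\<close>. Subtracting it makes the partial sums in
  \<open>k\<close> a martingale.\<close>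

definition gram_mart :: "nat \<Rightarrow> nat \<Rightarrow> nat \<Rightarrow> (nat \<times> nat \<Rightarrow> real) \<Rightarrow> real" where
  "gram_mart q m k x = 2 / (real q * real m) * (\<Sum>b<k. \<Sum>a<b. (rdot m x a b)\<^sup>2 - rdot m x a a)"

lemma rdot_cong: "(\<And>t. t < m \<Longrightarrow> x (a, t) = y (a, t)) \<Longrightarrow> (\<And>t. t < m \<Longrightarrow> x (b, t) = y (b, t)) \<Longrightarrow> rdot m x a b = rdot m y a b"
  by (simp add: rdot_def)

lemma gauss_array_rdot:
  assumes Z: "gauss_family M ({..<q} \<times> {..<m}) g" and ab: "a < q" "b < q" "a \<noteq> b"
  shows "integrable M (\<lambda>\<omega>. (rdot m (\<lambda>i. g i \<omega>) a b)\<^sup>2)"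
    "(\<integral>\<omega>. (rdot m (\<lambda>i. g i \<omega>) a b)\<^sup>2 \<partial>M) = real m"
  using gauss_family_inner_product[OF Z, of "{..<m}" "\<lambda>t. (a, t)" "\<lambda>t. (b, t)"] ab
  by (auto simp: rdot_def inj_on_def)

text \<open>The double sum is the squared Frobenius norm of the Gram matrix of the first
  \<open>k\<close> rows, up to a factor the conditional variance of the next increment. Its diagonal
  part is close to \<open>m^2 * k\<close>; the off-diagonal terms are nonnegative with mean
  \<open>m\<close> each, at most \<open>k^2 * m\<close> in total.\<close>

lemma gram_second_moment:
  fixes g :: "nat \<times> nat \<Rightarrow> 'a \<Rightarrow> real"
  assumes Z: "gauss_family M ({..<k} \<times> {..<m}) g"
  defines "D \<equiv> \<lambda>\<omega>. \<bar>(\<Sum>a<k. \<Sum>b<k. (rdot m (\<lambda>i. g i \<omega>) a b)\<^sup>2) - (real m)\<^sup>2 * real k\<bar>"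
  shows "integrable M D"
    "(\<integral>\<omega>. D \<omega> \<partial>M) \<le> real k * (2 * real m * sqrt (2 * real m) + 2 * real m) + (real k)\<^sup>2 * real m"
proof -
  note G = gauss_familyD[OF Z]
  interpret prob_space M by fact
  define \<epsilon> where "\<epsilon> a \<omega> = (\<Sum>t<m. (g (a, t) \<omega>)\<^sup>2 - 1)" for a \<omega>
  define R where "R a b \<omega> = (if a = b then 0 else (rdot m (\<lambda>i. g i \<omega>) a b)\<^sup>2)" for a b \<omega>
  have \<epsilon>: "integrable M (\<lambda>\<omega>. (\<epsilon> a \<omega>)\<^sup>2)" "expectation (\<lambda>\<omega>. (\<epsilon> a \<omega>)\<^sup>2) = 2 * real m" if "a < k" for a
    using gauss_family_chi_square[OF gauss_array_row[OF Z that], of "\<lambda>_. 1"] by (simp_all add: \<epsilon>_def)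
  have m\<epsilon>: "\<epsilon> a \<in> borel_measurable M" if "a < k" for a
    unfolding \<epsilon>_def using G(3) that by (intro borel_measurable_sum borel_measurable_diff borel_measurable_power) auto
  have \<epsilon>1: "integrable M (\<epsilon> a)" "expectation (\<lambda>\<omega>. \<bar>\<epsilon> a \<omega>\<bar>) \<le> sqrt (2 * real m)" if "a < k" for a
    using expectation_abs_le_sqrt[OF m\<epsilon>[OF that] \<epsilon>(1)[OF that]] \<epsilon>(2)[OF that] by auto
  have R: "integrable M (R a b)" "expectation (R a b) \<le> real m" if "a < k" "b < k" for a b
    using gauss_array_rdot[OF Z that] by (cases "a = b"; simp add: R_def[abs_def])+
  have diag: "rdot m (\<lambda>i. g i \<omega>) a a = real m + \<epsilon> a \<omega>" for a \<omega>
    by (simp add: rdot_def \<epsilon>_def sum_subtractf power2_eq_square)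
  have eq: "(\<Sum>a<k. \<Sum>b<k. (rdot m (\<lambda>i. g i \<omega>) a b)\<^sup>2) - (real m)\<^sup>2 * real k =
      (\<Sum>a<k. 2 * real m * \<epsilon> a \<omega> + (\<epsilon> a \<omega>)\<^sup>2) + (\<Sum>a<k. \<Sum>b<k. R a b \<omega>)" for \<omega>
  proof -
    have "(\<Sum>b<k. (rdot m (\<lambda>i. g i \<omega>) a b)\<^sup>2) = (real m + \<epsilon> a \<omega>)\<^sup>2 + (\<Sum>b<k. R a b \<omega>)" if "a < k" for a
    proof -
      have "(\<Sum>b<k. (rdot m (\<lambda>i. g i \<omega>) a b)\<^sup>2) = (\<Sum>b<k. (if b = a then (real m + \<epsilon> a \<omega>)\<^sup>2 else 0) + R a b \<omega>)"
        by (intro sum.cong) (auto simp: R_def diag)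
      then show ?thesis using that by (simp add: sum.distrib)
    qed
    then have "(\<Sum>a<k. \<Sum>b<k. (rdot m (\<lambda>i. g i \<omega>) a b)\<^sup>2) = (\<Sum>a<k. (real m)\<^sup>2 + (2 * real m * \<epsilon> a \<omega> + (\<epsilon> a \<omega>)\<^sup>2) + (\<Sum>b<k. R a b \<omega>))"
      by (intro sum.cong) (auto simp: power2_sum)
    then show ?thesis by (simp add: sum.distrib)
  qed
  show intD: "integrable M D" unfolding D_def eq
    using \<epsilon>(1) \<epsilon>1(1) R(1) by (intro integrable_abs Bochner_Integration.integrable_add Bochner_Integration.integrable_sum integrable_mult_right) auto
  define U where "U \<omega> = (\<Sum>a<k. 2 * real m * \<bar>\<epsilon> a \<omega>\<bar> + (\<epsilon> a \<omega>)\<^sup>2) + (\<Sum>a<k. \<Sum>b<k. R a b \<omega>)" for \<omega>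
  have DU: "D \<omega> \<le> U \<omega>" for \<omega>
  proof -
    have "\<bar>2 * real m * \<epsilon> a \<omega> + (\<epsilon> a \<omega>)\<^sup>2\<bar> \<le> 2 * real m * \<bar>\<epsilon> a \<omega>\<bar> + (\<epsilon> a \<omega>)\<^sup>2" for a
      by (rule order_trans[OF abs_triangle_ineq]) (simp add: abs_mult)
    then have "\<bar>\<Sum>a<k. 2 * real m * \<epsilon> a \<omega> + (\<epsilon> a \<omega>)\<^sup>2\<bar> \<le> (\<Sum>a<k. 2 * real m * \<bar>\<epsilon> a \<omega>\<bar> + (\<epsilon> a \<omega>)\<^sup>2)"
      by (intro order_trans[OF sum_abs] sum_mono)
    moreover have "0 \<le> (\<Sum>a<k. \<Sum>b<k. R a b \<omega>)" by (intro sum_nonneg) (simp add: R_def)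
    ultimately show ?thesis unfolding D_def eq U_def by linarith
  qed
  have iU1: "integrable M (\<lambda>\<omega>. 2 * real m * \<bar>\<epsilon> a \<omega>\<bar> + (\<epsilon> a \<omega>)\<^sup>2)" if "a \<in> {..<k}" for a
    using \<epsilon>(1)[of a] \<epsilon>1(1)[of a] that by (intro Bochner_Integration.integrable_add integrable_mult_right integrable_abs) auto
  have iU2: "integrable M (\<lambda>\<omega>. \<Sum>b<k. R a b \<omega>)" if "a \<in> {..<k}" for a
    using that R(1) by (intro Bochner_Integration.integrable_sum) auto
  have s1: "integrable M (\<lambda>\<omega>. \<Sum>a<k. 2 * real m * \<bar>\<epsilon> a \<omega>\<bar> + (\<epsilon> a \<omega>)\<^sup>2)"
    "expectation (\<lambda>\<omega>. \<Sum>a<k. 2 * real m * \<bar>\<epsilon> a \<omega>\<bar> + (\<epsilon> a \<omega>)\<^sup>2) = (\<Sum>a<k. expectation (\<lambda>\<omega>. 2 * real m * \<bar>\<epsilon> a \<omega>\<bar> + (\<epsilon> a \<omega>)\<^sup>2))"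
    by (rule Bochner_Integration.integrable_sum Bochner_Integration.integral_sum, erule iU1)+
  have s2: "integrable M (\<lambda>\<omega>. \<Sum>a<k. \<Sum>b<k. R a b \<omega>)"
    "expectation (\<lambda>\<omega>. \<Sum>a<k. \<Sum>b<k. R a b \<omega>) = (\<Sum>a<k. expectation (\<lambda>\<omega>. \<Sum>b<k. R a b \<omega>))"
    by (rule Bochner_Integration.integrable_sum Bochner_Integration.integral_sum, erule iU2)+
  have iU: "integrable M U" unfolding U_def by (rule Bochner_Integration.integrable_add[OF s1(1) s2(1)])
  have "expectation D \<le> expectation U" using intD iU DU by (rule integral_mono)
  also have "expectation U = (\<Sum>a<k. expectation (\<lambda>\<omega>. 2 * real m * \<bar>\<epsilon> a \<omega>\<bar> + (\<epsilon> a \<omega>)\<^sup>2)) + (\<Sum>a<k. expectation (\<lambda>\<omega>. \<Sum>b<k. R a b \<omega>))"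
    unfolding U_def Bochner_Integration.integral_add[OF s1(1) s2(1)] s1(2) s2(2) ..
  also have "\<dots> \<le> (\<Sum>a<k. 2 * real m * sqrt (2 * real m) + 2 * real m) + (\<Sum>a<k. \<Sum>b<k. real m)"
  proof (intro add_mono sum_mono)
    fix a assume "a \<in> {..<k}"
    then have a: "a < k" by simp
    have "expectation (\<lambda>\<omega>. 2 * real m * \<bar>\<epsilon> a \<omega>\<bar> + (\<epsilon> a \<omega>)\<^sup>2) = 2 * real m * expectation (\<lambda>\<omega>. \<bar>\<epsilon> a \<omega>\<bar>) + 2 * real m"
      using \<epsilon>[OF a] \<epsilon>1(1)[OF a] by simp
    also have "\<dots> \<le> 2 * real m * sqrt (2 * real m) + 2 * real m"
      using \<epsilon>1(2)[OF a] by (intro add_mono mult_left_mono) auto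
    finally show "expectation (\<lambda>\<omega>. 2 * real m * \<bar>\<epsilon> a \<omega>\<bar> + (\<epsilon> a \<omega>)\<^sup>2) \<le> 2 * real m * sqrt (2 * real m) + 2 * real m" .
    have "expectation (\<lambda>\<omega>. \<Sum>b<k. R a b \<omega>) = (\<Sum>b<k. expectation (R a b))"
      using R(1) a by (intro Bochner_Integration.integral_sum) auto
    also have "\<dots> \<le> (\<Sum>b<k. real m)" using R(2) a by (intro sum_mono) auto
    finally show "expectation (\<lambda>\<omega>. \<Sum>b<k. R a b \<omega>) \<le> (\<Sum>b<k. real m)" .
  qed
  finally show "expectation D \<le> real k * (2 * real m * sqrt (2 * real m) + 2 * real m) + (real k)\<^sup>2 * real m"
    by (simp add: power2_eq_square algebra_simps)
qed

lemma measurable_gaussM_component: "i \<in> I \<Longrightarrow> (\<lambda>x. x i) \<in> borel_measurable (gaussM I)"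
  by measurable

lemma measurable_coord_pair:
  assumes "i \<in> I"
  shows "(\<lambda>z. fst z i) \<in> borel_measurable (gaussM I \<Otimes>\<^sub>M N)" "(\<lambda>z. snd z i) \<in> borel_measurable (L \<Otimes>\<^sub>M gaussM I)"
proof -
  note * = measurable_gaussM_component[OF assms]
  show "(\<lambda>z. fst z i) \<in> borel_measurable (gaussM I \<Otimes>\<^sub>M N)"
    by (rule measurable_compose[OF measurable_fst *])
  show "(\<lambda>z. snd z i) \<in> borel_measurable (L \<Otimes>\<^sub>M gaussM I)"
    by (rule measurable_compose[OF measurable_snd *])
qed

lemma measurable_rdot:
  assumes "\<And>t. t < m \<Longrightarrow> (\<lambda>\<omega>. x \<omega> (a, t)) \<in> borel_measurable N" "\<And>t. t < m \<Longrightarrow> (\<lambda>\<omega>. x \<omega> (b, t)) \<in> borel_measurable N"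
  shows "(\<lambda>\<omega>. rdot m (x \<omega>) a b) \<in> borel_measurable N"
  unfolding rdot_def using assms by (intro borel_measurable_sum borel_measurable_times) auto

lemma measurable_gram_mart:
  assumes "\<And>a t. a < k \<Longrightarrow> t < m \<Longrightarrow> (\<lambda>\<omega>. x \<omega> (a, t)) \<in> borel_measurable N"
  shows "(\<lambda>\<omega>. gram_mart q m k (x \<omega>)) \<in> borel_measurable N"
  unfolding gram_mart_def using assms
  by (intro borel_measurable_times borel_measurable_const borel_measurable_sum borel_measurable_diff borel_measurable_power measurable_rdot) auto

text \<open>With \<open>c = 2 * \<tau> / (q * m)\<close> this is \<open>c^2 * (m^2 * k)\<close>, the
  scaled squared Frobenius norm at its typical value.\<close>

definition step_var :: "nat \<Rightarrow> real \<Rightarrow> nat \<Rightarrow> real" where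
  "step_var q \<tau> k = \<tau>\<^sup>2 * (4 * real k / (real q)\<^sup>2)"

text \<open>The bound of \<open>char_gaussian_quadratic_form'\<close>, with the deviation of the
  conditional variance replaced by the bound on its mean from
  \<open>gram_second_moment\<close>.\<close>

definition step_err :: "nat \<Rightarrow> nat \<Rightarrow> real \<Rightarrow> nat \<Rightarrow> real" where
  "step_err q m \<tau> k = quad_char_const * (step_var q \<tau> k * sqrt (step_var q \<tau> k) +
     (\<tau> * (2 / (real q * real m)))\<^sup>2 * (real k * (2 * real m * sqrt (2 * real m) + 2 * real m) + (real k)\<^sup>2 * real m))"

text \<open>With the first \<open>k\<close> rows frozen the increment is a centred quadratic form in
  row \<open>k\<close>, whose characteristic function is close to \<open>exp (- v)\<close> for
  typical rows. The factor carried by the past has modulus \<open>1\<close>, so the error is at most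
  the mean of the conditional error.\<close>

lemma gram_mart_char_step:
  fixes g :: "nat \<times> nat \<Rightarrow> 'a \<Rightarrow> real"
  assumes Z: "gauss_family M ({..<q} \<times> {..<m}) g" and k: "k < q" and qm: "0 < m"
  shows "cmod ((CLINT \<omega>|M. iexp (\<tau> * gram_mart q m (Suc k) (\<lambda>i. g i \<omega>))) -
      complex_of_real (exp (- step_var q \<tau> k)) * (CLINT \<omega>|M. iexp (\<tau> * gram_mart q m k (\<lambda>i. g i \<omega>)))) \<le> step_err q m \<tau> k"
proof -
  note G = gauss_familyD[OF Z]
  interpret prob_space M by fact
  define I where "I = {..<k} \<times> {..<m}"
  define J where "J = {k} \<times> {..<m}"
  define v where "v = step_var q \<tau> k"
  define c where "c = \<tau> * (2 / (real q * real m))"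
  have "0 \<le> v" by (simp add: v_def step_var_def)
  moreover have "v = c\<^sup>2 * ((real m)\<^sup>2 * real k)"
    using k qm by (simp add: v_def c_def step_var_def power2_eq_square field_simps)
  ultimately have v: "0 \<le> v" "v = c\<^sup>2 * ((real m)\<^sup>2 * real k)" by blast+
  define inc where "inc x y = (\<Sum>a<k. (\<Sum>t<m. x (a, t) * y (k, t))\<^sup>2 - rdot m x a a)" for x y :: "nat \<times> nat \<Rightarrow> real"
  \<comment> \<open>The integral of \<open>h\<close> is the difference to be bounded; its inner
    integral is the conditional error times a number of modulus \<open>1\<close>.\<close>
  define h where "h z = iexp (\<tau> * gram_mart q m k (fst z)) * (iexp (c * inc (fst z) (snd z)) - complex_of_real (exp (- v)))"
    for z :: "(nat \<times> nat \<Rightarrow> real) \<times> (nat \<times> nat \<Rightarrow> real)"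
  have IJ: "I \<subseteq> {..<q} \<times> {..<m}" "J \<subseteq> {..<q} \<times> {..<m}" "I \<inter> J = {}" "finite I" "finite J"
    using k by (auto simp: I_def J_def)
  interpret PI: prob_space "gaussM I" by (rule prob_space_gaussM)
  interpret PJ: prob_space "gaussM J" by (rule prob_space_gaussM)
  let ?P = "gaussM I \<Otimes>\<^sub>M gaussM J"
  have mx: "(\<lambda>z. fst z (a, t)) \<in> borel_measurable ?P" if "a < k" "t < m" for a t
    using that by (intro measurable_coord_pair) (auto simp: I_def)
  have my: "(\<lambda>z. snd z (k, t)) \<in> borel_measurable ?P" if "t < m" for t
    using that by (intro measurable_coord_pair) (auto simp: J_def)
  have minc: "(\<lambda>z. inc (fst z) (snd z)) \<in> borel_measurable ?P"
    unfolding inc_def using mx my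
    by (intro borel_measurable_sum borel_measurable_diff borel_measurable_power borel_measurable_times measurable_rdot) auto
  have mmart: "(\<lambda>z. gram_mart q m k (fst z)) \<in> borel_measurable ?P" using mx by (rule measurable_gram_mart)
  have mh: "h \<in> borel_measurable ?P" unfolding h_def using mmart minc by measurable
  have bh: "cmod (h z) \<le> 2" for z
  proof -
    have "cmod (h z) = cmod (iexp (c * inc (fst z) (snd z)) - complex_of_real (exp (- v)))"
      by (simp add: h_def norm_mult)
    also have "\<dots> \<le> cmod (iexp (c * inc (fst z) (snd z))) + cmod (complex_of_real (exp (- v)))" by (rule norm_triangle_ineq4)
    also have "\<dots> \<le> 2" using v unfolding norm_of_real by simp
    finally show ?thesis .
  qed
  have mart_I: "gram_mart q m k (\<lambda>i\<in>I. g i \<omega>) = gram_mart q m k (\<lambda>i. g i \<omega>)" for \<omega>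
    unfolding gram_mart_def
    by (intro arg_cong2[where f="(*)"] sum.cong refl arg_cong2[where f="(-)"] arg_cong[where f="\<lambda>x. x\<^sup>2"] rdot_cong) (auto simp: I_def)
  have mart_Suc: "\<tau> * gram_mart q m (Suc k) (\<lambda>i. g i \<omega>) = \<tau> * gram_mart q m k (\<lambda>i. g i \<omega>) + c * inc (\<lambda>i\<in>I. g i \<omega>) (\<lambda>i\<in>J. g i \<omega>)" for \<omega>
  proof -
    have "inc (\<lambda>i\<in>I. g i \<omega>) (\<lambda>i\<in>J. g i \<omega>) = (\<Sum>a<k. (rdot m (\<lambda>i. g i \<omega>) a k)\<^sup>2 - rdot m (\<lambda>i. g i \<omega>) a a)"
      unfolding inc_def rdot_def by (intro sum.cong refl arg_cong2[where f="(-)"] arg_cong[where f="\<lambda>x. x\<^sup>2"]) (auto simp: I_def J_def)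
    then show ?thesis by (simp add: gram_mart_def c_def algebra_simps)
  qed
  have mg: "(\<lambda>\<omega>. gram_mart q m j (\<lambda>i. g i \<omega>)) \<in> borel_measurable M" if "j \<le> q" for j
    using G(3) that by (intro measurable_gram_mart) auto
  have "(CLINT \<omega>|M. h (\<lambda>i\<in>I. g i \<omega>, \<lambda>j\<in>J. g j \<omega>)) =
     (CLINT \<omega>|M. iexp (\<tau> * gram_mart q m (Suc k) (\<lambda>i. g i \<omega>)) - complex_of_real (exp (- v)) * iexp (\<tau> * gram_mart q m k (\<lambda>i. g i \<omega>)))"
    unfolding h_def fst_conv snd_conv mart_I mart_Suc
    by (intro Bochner_Integration.integral_cong refl) (simp add: algebra_simps exp_add)
  also have "\<dots> = (CLINT \<omega>|M. iexp (\<tau> * gram_mart q m (Suc k) (\<lambda>i. g i \<omega>))) -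
      complex_of_real (exp (- v)) * (CLINT \<omega>|M. iexp (\<tau> * gram_mart q m k (\<lambda>i. g i \<omega>)))"
    using mg[of k] mg[of "Suc k"] k
    by (subst Bochner_Integration.integral_diff) (auto intro!: integrable_iexp integrable_mult_right borel_measurable_times simp: integral_mult_right_zero)
  finally have "(CLINT \<omega>|M. iexp (\<tau> * gram_mart q m (Suc k) (\<lambda>i. g i \<omega>))) -
      complex_of_real (exp (- v)) * (CLINT \<omega>|M. iexp (\<tau> * gram_mart q m k (\<lambda>i. g i \<omega>))) =
      (\<integral>x. (\<integral>y. h (x, y) \<partial>gaussM J) \<partial>gaussM I)"
    using gauss_family_Fubini[OF Z IJ(1-3) mh bh] by simp
  also have "cmod \<dots> \<le> (\<integral>x. cmod (\<integral>y. h (x, y) \<partial>gaussM J) \<partial>gaussM I)" by (rule integral_norm_bound)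
  also have "\<dots> \<le> (\<integral>x. quad_char_const * (v * sqrt v + c\<^sup>2 * \<bar>(\<Sum>a<k. \<Sum>b<k. (rdot m x a b)\<^sup>2) - (real m)\<^sup>2 * real k\<bar>) \<partial>gaussM I)"
  proof (rule integral_mono')
    have ZI: "gauss_family (gaussM I) ({..<k} \<times> {..<m}) (\<lambda>i \<omega>. \<omega> i)"
      using gauss_family_gaussM[OF IJ(4)] by (simp add: I_def)
    note gm = gram_second_moment[OF ZI]
    show "integrable (gaussM I) (\<lambda>x. quad_char_const * (v * sqrt v + c\<^sup>2 * \<bar>(\<Sum>a<k. \<Sum>b<k. (rdot m x a b)\<^sup>2) - (real m)\<^sup>2 * real k\<bar>))"
      using gm(1) by (intro integrable_mult_right Bochner_Integration.integrable_add) auto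
  next
    fix x
    show "0 \<le> quad_char_const * (v * sqrt v + c\<^sup>2 * \<bar>(\<Sum>a<k. \<Sum>b<k. (rdot m x a b)\<^sup>2) - (real m)\<^sup>2 * real k\<bar>)"
      using quad_char_const_pos v by (intro mult_nonneg_nonneg add_nonneg_nonneg) auto
    define W where "W s t = (\<Sum>a<k. x (a, s) * x (a, t))" for s t
    have r: "gauss_family (gaussM J) {..<m} (\<lambda>t y. y (k, t))"
      using gauss_family_reindex[OF gauss_family_gaussM[OF IJ(5)], of "{..<m}" "\<lambda>t. (k, t)"]
      by (auto simp: J_def inj_on_def)
    have symW: "symmetric_mat m W" by (simp add: symmetric_mat_def W_def mult.commute)
    have 1: "(\<Sum>s<m. \<Sum>t<m. W s t * y (k, s) * y (k, t)) - (\<Sum>t<m. W t t) = inc x y" for y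
    proof -
      have "(\<Sum>s<m. \<Sum>t<m. W s t * y (k, s) * y (k, t)) = (\<Sum>s<m. \<Sum>t<m. \<Sum>a<k. (x (a, s) * y (k, s)) * (x (a, t) * y (k, t)))"
        by (simp add: W_def sum_distrib_left sum_distrib_right mult_ac)
      also have "\<dots> = (\<Sum>s<m. \<Sum>a<k. \<Sum>t<m. (x (a, s) * y (k, s)) * (x (a, t) * y (k, t)))"
        by (intro sum.cong refl sum.swap)
      also have "\<dots> = (\<Sum>a<k. \<Sum>s<m. \<Sum>t<m. (x (a, s) * y (k, s)) * (x (a, t) * y (k, t)))" by (rule sum.swap)
      also have "\<dots> = (\<Sum>a<k. (\<Sum>t<m. x (a, t) * y (k, t))\<^sup>2)"
        by (simp add: power2_eq_square sum_product)
      moreover have "(\<Sum>t<m. W t t) = (\<Sum>a<k. rdot m x a a)" unfolding W_def rdot_def by (rule sum.swap)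
      ultimately show ?thesis by (simp add: inc_def sum_subtractf)
    qed
    have 2: "(\<Sum>s<m. \<Sum>t<m. (W s t)\<^sup>2) = (\<Sum>a<k. \<Sum>b<k. (rdot m x a b)\<^sup>2)"
      using sum_gram_squares_swap[of "{..<k}" "{..<m}" "\<lambda>a t. x (a, t)"] by (simp add: W_def rdot_def)
    have "c\<^sup>2 * (\<Sum>a<k. \<Sum>b<k. (rdot m x a b)\<^sup>2) - v = c\<^sup>2 * ((\<Sum>a<k. \<Sum>b<k. (rdot m x a b)\<^sup>2) - (real m)\<^sup>2 * real k)"
      unfolding v(2) by (simp add: algebra_simps)
    then have 3: "\<bar>c\<^sup>2 * (\<Sum>a<k. \<Sum>b<k. (rdot m x a b)\<^sup>2) - v\<bar> = c\<^sup>2 * \<bar>(\<Sum>a<k. \<Sum>b<k. (rdot m x a b)\<^sup>2) - (real m)\<^sup>2 * real k\<bar>"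
      by (simp add: abs_mult)
    have miy: "(\<lambda>y. inc x y) \<in> borel_measurable (gaussM J)"
      unfolding inc_def
      by (intro borel_measurable_sum borel_measurable_diff borel_measurable_power borel_measurable_times borel_measurable_const)
         (auto simp: J_def intro!: measurable_gaussM_component)
    have "(\<integral>y. h (x, y) \<partial>gaussM J) = iexp (\<tau> * gram_mart q m k x) * ((CLINT y|gaussM J. iexp (c * inc x y)) - complex_of_real (exp (- v)))"
      unfolding h_def fst_conv snd_conv integral_mult_right_zero using miy
      by (subst Bochner_Integration.integral_diff) (auto intro!: PJ.integrable_iexp borel_measurable_times simp: PJ.prob_space)
    then have "cmod (\<integral>y. h (x, y) \<partial>gaussM J) = cmod ((CLINT y|gaussM J. iexp (c * inc x y)) - complex_of_real (exp (- v)))"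
      by (simp add: norm_mult)
    also have "\<dots> \<le> quad_char_const * (v * sqrt v + c\<^sup>2 * \<bar>(\<Sum>a<k. \<Sum>b<k. (rdot m x a b)\<^sup>2) - (real m)\<^sup>2 * real k\<bar>)"
      using char_gaussian_quadratic_form'[OF r symW v(1), of c] unfolding 1 2 3 .
    finally show "cmod (\<integral>y. h (x, y) \<partial>gaussM J) \<le> quad_char_const * (v * sqrt v + c\<^sup>2 * \<bar>(\<Sum>a<k. \<Sum>b<k. (rdot m x a b)\<^sup>2) - (real m)\<^sup>2 * real k\<bar>)" .
  qed
  also have "\<dots> \<le> step_err q m \<tau> k"
  proof -
    have ZI: "gauss_family (gaussM I) ({..<k} \<times> {..<m}) (\<lambda>i \<omega>. \<omega> i)"
      using gauss_family_gaussM[OF IJ(4)] by (simp add: I_def)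
    note gm = gram_second_moment[OF ZI]
    have "(\<integral>x. quad_char_const * (v * sqrt v + c\<^sup>2 * \<bar>(\<Sum>a<k. \<Sum>b<k. (rdot m x a b)\<^sup>2) - (real m)\<^sup>2 * real k\<bar>) \<partial>gaussM I) =
      quad_char_const * (v * sqrt v + c\<^sup>2 * (\<integral>x. \<bar>(\<Sum>a<k. \<Sum>b<k. (rdot m x a b)\<^sup>2) - (real m)\<^sup>2 * real k\<bar> \<partial>gaussM I))"
      using gm(1) by (simp add: PI.prob_space)
    also have "\<dots> \<le> quad_char_const * (v * sqrt v + c\<^sup>2 * (real k * (2 * real m * sqrt (2 * real m) + 2 * real m) + (real k)\<^sup>2 * real m))"
      using gm(2) quad_char_const_pos by (intro mult_left_mono add_left_mono) auto
    finally show ?thesis by (simp add: step_err_def v_def c_def)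
  qed
  finally show ?thesis by (simp add: v_def)
qed

text \<open>Telescoping: the factors \<open>exp (- step_var q \<tau> k)\<close> are at most
  \<open>1\<close>, so the errors of the steps add up.\<close>

lemma gram_mart_char:
  assumes Z: "gauss_family M ({..<q} \<times> {..<m}) g" and "k \<le> q" and qm: "0 < m"
  shows "cmod ((CLINT \<omega>|M. iexp (\<tau> * gram_mart q m k (\<lambda>i. g i \<omega>))) - complex_of_real (exp (- (\<Sum>j<k. step_var q \<tau> j))))
      \<le> (\<Sum>j<k. step_err q m \<tau> j)"
  using \<open>k \<le> q\<close>
proof (induction k)
  case 0
  interpret prob_space M using gauss_familyD(1)[OF Z] .
  show ?case by (simp add: gram_mart_def prob_space)
next
  case (Suc k)
  let ?E = "\<lambda>k. CLINT \<omega>|M. iexp (\<tau> * gram_mart q m k (\<lambda>i. g i \<omega>))"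
  let ?e = "complex_of_real (exp (- step_var q \<tau> k))" and ?f = "complex_of_real (exp (- (\<Sum>j<k. step_var q \<tau> j)))"
  have "0 \<le> step_var q \<tau> k" by (simp add: step_var_def)
  then have e: "cmod ?e \<le> 1" unfolding norm_of_real by simp
  have "complex_of_real (exp (- (\<Sum>j<Suc k. step_var q \<tau> j))) = ?e * ?f"
    by (simp add: exp_add[symmetric] exp_of_real flip: of_real_mult)
  then have eq: "?E (Suc k) - complex_of_real (exp (- (\<Sum>j<Suc k. step_var q \<tau> j))) = (?E (Suc k) - ?e * ?E k) + ?e * (?E k - ?f)"
    by (simp only: right_diff_distrib add_diff_eq diff_add_cancel)
  have "cmod (?E (Suc k) - complex_of_real (exp (- (\<Sum>j<Suc k. step_var q \<tau> j)))) \<le> cmod (?E (Suc k) - ?e * ?E k) + cmod ?e * cmod (?E k - ?f)"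
    unfolding eq norm_mult[symmetric] by (rule norm_triangle_ineq)
  also have "\<dots> \<le> step_err q m \<tau> k + (\<Sum>j<k. step_err q m \<tau> j)"
  proof (rule add_mono)
    show "cmod (?E (Suc k) - ?e * ?E k) \<le> step_err q m \<tau> k"
      by (rule gram_mart_char_step[OF Z _ qm]) (use Suc.prems in simp)
    have "cmod ?e * cmod (?E k - ?f) \<le> 1 * cmod (?E k - ?f)" using e by (rule mult_right_mono) simp
    also have "\<dots> \<le> (\<Sum>j<k. step_err q m \<tau> j)" using Suc.IH Suc.prems by simp
    finally show "cmod ?e * cmod (?E k - ?f) \<le> (\<Sum>j<k. step_err q m \<tau> j)" .
  qed
  also have "\<dots> = (\<Sum>j<Suc k. step_err q m \<tau> j)" by simp
  finally show ?case .
qed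

lemma (in prob_space) char_of_normal:
  assumes X: "distributed M lborel X (normal_density \<mu> \<sigma>)" and \<sigma>: "0 < \<sigma>"
  shows "(CLINT \<omega>|M. iexp (t * X \<omega>)) = iexp (t * \<mu>) * complex_of_real (exp (- (t\<^sup>2 * \<sigma>\<^sup>2) / 2))"
proof -
  have [measurable]: "X \<in> borel_measurable M" using X by (simp add: distributed_def)
  define Y where "Y \<omega> = (X \<omega> - \<mu>) / \<sigma>" for \<omega>
  have [measurable]: "Y \<in> borel_measurable M" unfolding Y_def by measurable
  have "distributed M lborel Y std_normal_density"
    using X unfolding Y_def normal_standard_normal_convert[OF \<sigma>] .
  then have Y: "distr M borel Y = std_normal_distribution"
    by (simp add: distributed_def cong: distr_cong)
  have "iexp (t * X \<omega>) = iexp (t * \<mu>) * iexp ((t * \<sigma>) * Y \<omega>)" for \<omega>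
  proof -
    have "t * X \<omega> = t * \<mu> + (t * \<sigma>) * Y \<omega>" using \<sigma> by (simp add: Y_def field_simps)
    then show ?thesis by (simp only: of_real_add distrib_left exp_add)
  qed
  then have "(CLINT \<omega>|M. iexp (t * X \<omega>)) = iexp (t * \<mu>) * (CLINT \<omega>|M. iexp ((t * \<sigma>) * Y \<omega>))" by simp
  also have "(CLINT \<omega>|M. iexp ((t * \<sigma>) * Y \<omega>)) = char (distr M borel Y) (t * \<sigma>)"
    unfolding char_def by (subst integral_distr) auto
  also have "\<dots> = complex_of_real (exp (- (t\<^sup>2 * \<sigma>\<^sup>2) / 2))"
    unfolding Y char_std_normal_distribution by (simp add: power_mult_distrib)
  finally show ?thesis .
qed

lemma char_normal_distribution:
  assumes "0 < \<sigma>"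
  shows "char (density lborel (normal_density \<mu> \<sigma>)) t = iexp (t * \<mu>) * complex_of_real (exp (- (t\<^sup>2 * \<sigma>\<^sup>2) / 2))"
proof -
  interpret prob_space "density lborel (normal_density \<mu> \<sigma>)"
    by (rule prob_space_normal_density) fact
  have "distributed (density lborel (normal_density \<mu> \<sigma>)) lborel (\<lambda>x. x) (normal_density \<mu> \<sigma>)"
    unfolding distributed_def by (intro conjI distr_id2) simp_all
  from char_of_normal[OF this assms] show ?thesis by (simp add: char_def)
qed

section \<open>The trace statistic and its martingale part\<close>

definition gram_tr1 :: "nat \<Rightarrow> nat \<Rightarrow> (nat \<times> nat \<Rightarrow> real) \<Rightarrow> real" where
  "gram_tr1 q m x = (\<Sum>a<q. rdot m x a a)"

definition gram_tr2 :: "nat \<Rightarrow> nat \<Rightarrow> (nat \<times> nat \<Rightarrow> real) \<Rightarrow> real" where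
  "gram_tr2 q m x = (\<Sum>a<q. \<Sum>b<q. (rdot m x a b)\<^sup>2)"

text \<open>With \<open>t1\<close>, \<open>t2\<close> the two traces and
  \<open>u = t1 / (q * m)\<close>, this is \<open>u^2\<close> times
  \<open>m * (q * t2 / t1^2 - 1) - q\<close>. Clearing the random denominator makes it a polynomial
  in the array, and it is symmetric in rows and columns.\<close>

definition gram_stat :: "nat \<Rightarrow> nat \<Rightarrow> (nat \<times> nat \<Rightarrow> real) \<Rightarrow> real" where
  "gram_stat q m x = gram_tr2 q m x / (real q * real m) - (real m + real q) * (gram_tr1 q m x / (real q * real m))\<^sup>2"

lemma sum_symmetric_split:
  fixes f :: "nat \<Rightarrow> nat \<Rightarrow> real"
  assumes "\<And>a b. f a b = f b a"
  shows "(\<Sum>a<q. \<Sum>b<q. f a b) = (\<Sum>a<q. f a a) + 2 * (\<Sum>b<q. \<Sum>a<b. f a b)"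
proof (induction q)
  case (Suc q)
  have "(\<Sum>a<q. f a q) = (\<Sum>b<q. f q b)" using assms by (intro sum.cong) auto
  with Suc show ?case by (simp add: sum.distrib)
qed simp

text \<open>Row \<open>a\<close> is counted once for each later row.\<close>

lemma sum_lower_triangle:
  fixes f :: "nat \<Rightarrow> real"
  shows "(\<Sum>b<q. \<Sum>a<b. f a) = (\<Sum>a<q. real (q - 1 - a) * f a)"
proof (induction q)
  case (Suc q)
  have "(\<Sum>a<q. real (q - a) * f a) = (\<Sum>a<q. real (q - 1 - a) * f a + f a)"
  proof (intro sum.cong refl)
    fix a assume "a \<in> {..<q}"
    then have "real (q - a) = real (q - 1 - a) + 1" by (subst of_nat_1[symmetric], subst of_nat_add[symmetric]) simp
    then show "real (q - a) * f a = real (q - 1 - a) * f a + f a" by (simp add: algebra_simps)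
  qed
  with Suc show ?case by (simp add: sum.distrib)
qed simp

text \<open>Here \<open>e\<close> is the centred trace, \<open>Q\<close> the centred sum of squared
  row deviations, \<open>L\<close> the weighted trace coming from the compensator and
  \<open>T\<close> the martingale. With \<open>u = e / (q * m)\<close> the terms
  \<open>2 * m * u\<close> cancel and leave \<open>- 2 * q * u\<close>; the constants
  \<open>m + 2 + (q - 1) - (m + q)\<close> leave the limiting mean \<open>1\<close>.\<close>

lemma gram_stat_algebra:
  fixes q m e Q L T :: real
  assumes "0 < q" "0 < m"
  shows "(q * m\<^sup>2 + 2 * m * e + (Q + 2 * m * q) + q * m * T + m * q * (q - 1) + 2 * L) / (q * m) - (m + q) * ((q * m + e) / (q * m))\<^sup>2 =
    1 + T + (Q / (q * m) + 2 * L / (q * m) - 2 * q * (e / (q * m)) - (m + q) * (e / (q * m))\<^sup>2)"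
proof -
  define u where "u = e / (q * m)"
  have e: "e = q * m * u" using assms by (simp add: u_def)
  have "(q * m\<^sup>2 + 2 * m * e + (Q + 2 * m * q) + q * m * T + m * q * (q - 1) + 2 * L) / (q * m) =
    m + 2 * m * u + (Q / (q * m) + 2) + T + (q - 1) + 2 * L / (q * m)"
    using assms unfolding e by (simp add: field_simps power2_eq_square)
  moreover have "(q * m + e) / (q * m) = 1 + u" using assms unfolding e by (simp add: field_simps)
  ultimately show ?thesis unfolding u_def[symmetric] by (simp add: power2_eq_square algebra_simps)
qed

text \<open>The summands bound the contributions of \<open>Q\<close>, \<open>L\<close>,
  \<open>e\<close> and \<open>e^2\<close> to the remainder, in this order.\<close>

definition stat_err :: "nat \<Rightarrow> nat \<Rightarrow> real" where
  "stat_err q m = sqrt (chi4 * real q * (real m)\<^sup>2) / (real q * real m) +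
     2 / (real q * real m) * sqrt (2 * ((real q)\<^sup>2 * (real q * real m))) +
     2 * real q / (real q * real m) * sqrt (2 * (real q * real m)) +
     (real m + real q) / (real q * real m)\<^sup>2 * (2 * (real q * real m))"

text \<open>What remains besides the martingale consists of sums with explicit second moments. The
  contributions of \<open>L\<close> and \<open>e\<close> are of order \<open>sqrt (q / m)\<close>,
  so the approximation suits the regime in which \<open>q / m\<close> vanishes.\<close>

lemma gram_stat_mart:
  fixes g :: "nat \<times> nat \<Rightarrow> 'a \<Rightarrow> real"
  assumes Z: "gauss_family M ({..<q} \<times> {..<m}) g" and q: "0 < q" and m: "0 < m"
  defines "D \<equiv> \<lambda>\<omega>. gram_stat q m (\<lambda>i. g i \<omega>) - (1 + gram_mart q m q (\<lambda>i. g i \<omega>))"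
  shows "integrable M D" "(\<integral>\<omega>. \<bar>D \<omega>\<bar> \<partial>M) \<le> stat_err q m"
proof -
  note G = gauss_familyD[OF Z]
  interpret prob_space M by fact
  note [measurable] = G(3)
  let ?I = "{..<q} \<times> {..<m}"
  define \<epsilon> where "\<epsilon> a \<omega> = (\<Sum>t<m. (g (a, t) \<omega>)\<^sup>2 - 1)" for a \<omega>
  define e where "e \<omega> = (\<Sum>i\<in>?I. 1 * ((g i \<omega>)\<^sup>2 - 1))" for \<omega>
  define L where "L \<omega> = (\<Sum>i\<in>?I. real (q - 1 - fst i) * ((g i \<omega>)\<^sup>2 - 1))" for \<omega>
  define Q where "Q \<omega> = (\<Sum>a<q. (\<epsilon> a \<omega>)\<^sup>2 - 2 * real m)" for \<omega>
  have [measurable]: "e \<in> borel_measurable M" "L \<in> borel_measurable M" "Q \<in> borel_measurable M"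
    unfolding e_def L_def Q_def \<epsilon>_def by measurable
  have e\<epsilon>: "e \<omega> = (\<Sum>a<q. \<epsilon> a \<omega>)" for \<omega>
    by (simp add: e_def \<epsilon>_def sum.cartesian_product case_prod_beta)
  have L\<epsilon>: "L \<omega> = (\<Sum>a<q. real (q - 1 - a) * \<epsilon> a \<omega>)" for \<omega>
    unfolding L_def \<epsilon>_def sum_distrib_left sum.cartesian_product by (simp add: case_prod_beta)
  have diag: "rdot m (\<lambda>i. g i \<omega>) a a = real m + \<epsilon> a \<omega>" for a \<omega>
    by (simp add: rdot_def \<epsilon>_def sum_subtractf power2_eq_square)
  have tri: "(\<Sum>a<q. real (q - 1 - a)) = real q * (real q - 1) / 2"
  proof -
    have "(\<Sum>b<n. real b) = real n * (real n - 1) / 2" for n by (induction n) (auto simp: field_simps)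
    moreover have "(\<Sum>a<q. real (q - 1 - a)) = (\<Sum>b<q. \<Sum>a<b. 1)"
      using sum_lower_triangle[where f="\<lambda>_. 1" and q=q] by (simp only: mult_1_right)
    ultimately show ?thesis by simp
  qed
  have pw: "D \<omega> = Q \<omega> / (real q * real m) + 2 * L \<omega> / (real q * real m) - 2 * real q * (e \<omega> / (real q * real m)) -
      (real m + real q) * (e \<omega> / (real q * real m))\<^sup>2" for \<omega>
  proof -
    let ?x = "\<lambda>i. g i \<omega>"
    have t1: "gram_tr1 q m ?x = real q * real m + e \<omega>"
      by (simp add: gram_tr1_def diag sum.distrib e\<epsilon>)
    have low: "(\<Sum>b<q. \<Sum>a<b. (rdot m ?x a b)\<^sup>2) = real q * real m * gram_mart q m q ?x / 2 + (\<Sum>b<q. \<Sum>a<b. rdot m ?x a a)"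
      using q m unfolding gram_mart_def sum_subtractf by (simp add: field_simps)
    have low2: "(\<Sum>b<q. \<Sum>a<b. rdot m ?x a a) = real m * (real q * (real q - 1) / 2) + L \<omega>"
      unfolding sum_lower_triangle diag distrib_left sum.distrib L\<epsilon> sum_distrib_right[symmetric] tri by (simp add: mult.commute)
    have sq: "(\<Sum>a<q. (rdot m ?x a a)\<^sup>2) = real q * (real m)\<^sup>2 + 2 * real m * e \<omega> + (Q \<omega> + 2 * real m * real q)"
      unfolding diag power2_sum e\<epsilon> Q_def by (simp add: sum.distrib sum_subtractf sum_distrib_left algebra_simps)
    have "gram_tr2 q m ?x = (\<Sum>a<q. (rdot m ?x a a)\<^sup>2) + 2 * (\<Sum>b<q. \<Sum>a<b. (rdot m ?x a b)\<^sup>2)"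
      unfolding gram_tr2_def by (rule sum_symmetric_split) (simp add: rdot_def mult.commute)
    then have t2: "gram_tr2 q m ?x = real q * (real m)\<^sup>2 + 2 * real m * e \<omega> + (Q \<omega> + 2 * real m * real q) + real q * real m * gram_mart q m q ?x +
        real m * real q * (real q - 1) + 2 * L \<omega>"
      unfolding sq low low2 by (simp add: field_simps)
    show ?thesis unfolding D_def gram_stat_def t1 t2
      by (subst gram_stat_algebra) (use q m in auto)
  qed
  have e2: "integrable M (\<lambda>\<omega>. (e \<omega>)\<^sup>2)" "expectation (\<lambda>\<omega>. (e \<omega>)\<^sup>2) = 2 * (real q * real m)"
    using gauss_family_chi_square[OF Z, of "\<lambda>_. 1"] by (simp_all add: e_def)
  have L2: "integrable M (\<lambda>\<omega>. (L \<omega>)\<^sup>2)" "expectation (\<lambda>\<omega>. (L \<omega>)\<^sup>2) \<le> 2 * ((real q)\<^sup>2 * (real q * real m))"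
  proof -
    note ch = gauss_family_chi_square[OF Z, of "\<lambda>i. real (q - 1 - fst i)"]
    show "integrable M (\<lambda>\<omega>. (L \<omega>)\<^sup>2)" using ch(1) by (simp add: L_def)
    have "(\<Sum>i\<in>?I. (real (q - 1 - fst i))\<^sup>2) \<le> (\<Sum>i\<in>?I. (real q)\<^sup>2)"
      by (intro sum_mono power_mono) auto
    then show "expectation (\<lambda>\<omega>. (L \<omega>)\<^sup>2) \<le> 2 * ((real q)\<^sup>2 * (real q * real m))"
      using ch(2) by (simp add: L_def mult_ac)
  qed
  have Q2: "integrable M (\<lambda>\<omega>. (Q \<omega>)\<^sup>2)" "expectation (\<lambda>\<omega>. (Q \<omega>)\<^sup>2) \<le> chi4 * real q * (real m)\<^sup>2"
    using gauss_array_row_norms[OF Z] by (simp_all add: Q_def \<epsilon>_def)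
  have int: "integrable M e" "integrable M L" "integrable M Q"
    and Ee: "expectation (\<lambda>\<omega>. \<bar>e \<omega>\<bar>) \<le> sqrt (2 * (real q * real m))"
    and EL: "expectation (\<lambda>\<omega>. \<bar>L \<omega>\<bar>) \<le> sqrt (2 * ((real q)\<^sup>2 * (real q * real m)))"
    and EQ: "expectation (\<lambda>\<omega>. \<bar>Q \<omega>\<bar>) \<le> sqrt (chi4 * real q * (real m)\<^sup>2)"
  proof -
    show "integrable M e" "integrable M L" "integrable M Q"
      using expectation_abs_le_sqrt(1)[OF _ e2(1)] expectation_abs_le_sqrt(1)[OF _ L2(1)] expectation_abs_le_sqrt(1)[OF _ Q2(1)] by simp_all
    show "expectation (\<lambda>\<omega>. \<bar>e \<omega>\<bar>) \<le> sqrt (2 * (real q * real m))"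
      using expectation_abs_le_sqrt(2)[OF _ e2(1)] unfolding e2(2) by simp
    show "expectation (\<lambda>\<omega>. \<bar>L \<omega>\<bar>) \<le> sqrt (2 * ((real q)\<^sup>2 * (real q * real m)))"
      by (rule order_trans[OF expectation_abs_le_sqrt(2)[OF _ L2(1)] real_sqrt_le_mono[OF L2(2)]]) simp
    show "expectation (\<lambda>\<omega>. \<bar>Q \<omega>\<bar>) \<le> sqrt (chi4 * real q * (real m)\<^sup>2)"
      by (rule order_trans[OF expectation_abs_le_sqrt(2)[OF _ Q2(1)] real_sqrt_le_mono[OF Q2(2)]]) simp
  qed
  show iD: "integrable M D" unfolding pw power_divide
    by (intro Bochner_Integration.integrable_diff Bochner_Integration.integrable_add integrable_divide_zero integrable_mult_right impI int e2(1))
  define U where "U \<omega> = 1 / (real q * real m) * \<bar>Q \<omega>\<bar> + 2 / (real q * real m) * \<bar>L \<omega>\<bar> + 2 * real q / (real q * real m) * \<bar>e \<omega>\<bar> +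
      (real m + real q) / (real q * real m)\<^sup>2 * (e \<omega>)\<^sup>2" for \<omega>
  have DU: "\<bar>D \<omega>\<bar> \<le> U \<omega>" for \<omega>
  proof -
    have tri4: "\<bar>a + b - c - d\<bar> \<le> \<bar>a\<bar> + \<bar>b\<bar> + \<bar>c\<bar> + \<bar>d\<bar>" for a b c d :: real by linarith
    show ?thesis unfolding pw U_def
      by (rule order_trans[OF tri4]) (simp add: abs_mult power_divide)
  qed
  have iU: "integrable M U" unfolding U_def using int e2(1) by auto
  have "expectation (\<lambda>\<omega>. \<bar>D \<omega>\<bar>) \<le> expectation U" using iD iU DU by (intro integral_mono) auto
  also have "\<dots> = 1 / (real q * real m) * expectation (\<lambda>\<omega>. \<bar>Q \<omega>\<bar>) + 2 / (real q * real m) * expectation (\<lambda>\<omega>. \<bar>L \<omega>\<bar>) +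
      2 * real q / (real q * real m) * expectation (\<lambda>\<omega>. \<bar>e \<omega>\<bar>) + (real m + real q) / (real q * real m)\<^sup>2 * expectation (\<lambda>\<omega>. (e \<omega>)\<^sup>2)"
    unfolding U_def using int e2(1) by simp
  also have "\<dots> \<le> 1 / (real q * real m) * sqrt (chi4 * real q * (real m)\<^sup>2) + 2 / (real q * real m) * sqrt (2 * ((real q)\<^sup>2 * (real q * real m))) +
      2 * real q / (real q * real m) * sqrt (2 * (real q * real m)) + (real m + real q) / (real q * real m)\<^sup>2 * (2 * (real q * real m))"
    unfolding e2(2) using EQ EL Ee by (intro add_mono mult_left_mono order_refl) auto
  finally show "(\<integral>\<omega>. \<bar>D \<omega>\<bar> \<partial>M) \<le> stat_err q m" by (simp add: stat_err_def)
qed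

lemma cmod_iexp_diff_le: "cmod (iexp a - iexp b) \<le> \<bar>a - b\<bar>"
proof -
  have "iexp a - iexp b = iexp b * (iexp (a - b) - 1)"
    by (simp add: right_diff_distrib exp_diff)
  then have "cmod (iexp a - iexp b) = cmod (iexp (a - b) - 1)" by (simp add: norm_mult)
  also have "\<dots> \<le> \<bar>a - b\<bar>" using iexp_approx1[of "a - b" 0] by simp
  finally show ?thesis .
qed

lemma gram_stat_char:
  fixes g :: "nat \<times> nat \<Rightarrow> 'a \<Rightarrow> real"
  assumes Z: "gauss_family M ({..<q} \<times> {..<m}) g" and q: "0 < q" and m: "0 < m"
  shows "cmod (char (distr M borel (\<lambda>\<omega>. gram_stat q m (\<lambda>i. g i \<omega>))) \<tau> - iexp \<tau> * complex_of_real (exp (- (\<Sum>j<q. step_var q \<tau> j))))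
    \<le> \<bar>\<tau>\<bar> * stat_err q m + (\<Sum>j<q. step_err q m \<tau> j)"
proof -
  note G = gauss_familyD[OF Z]
  interpret prob_space M by fact
  define S where "S \<omega> = gram_stat q m (\<lambda>i. g i \<omega>)" for \<omega>
  define T where "T \<omega> = gram_mart q m q (\<lambda>i. g i \<omega>)" for \<omega>
  have T[measurable]: "T \<in> borel_measurable M"
    unfolding T_def using G(3) by (intro measurable_gram_mart) auto
  have rd: "(\<lambda>\<omega>. rdot m (\<lambda>i. g i \<omega>) a b) \<in> borel_measurable M" if "a < q" "b < q" for a b
    using G(3) that by (intro measurable_rdot) auto
  have S[measurable]: "S \<in> borel_measurable M"
    unfolding S_def gram_stat_def gram_tr1_def gram_tr2_def using rd
    by (intro borel_measurable_diff borel_measurable_divide borel_measurable_times borel_measurable_power borel_measurable_sum borel_measurable_const) auto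
  have D: "integrable M (\<lambda>\<omega>. S \<omega> - (1 + T \<omega>))" "expectation (\<lambda>\<omega>. \<bar>S \<omega> - (1 + T \<omega>)\<bar>) \<le> stat_err q m"
    using gram_stat_mart[OF Z q m] by (simp_all add: S_def T_def)
  have 1: "char (distr M borel S) \<tau> = (CLINT \<omega>|M. iexp (\<tau> * S \<omega>))"
    unfolding char_def by (subst integral_distr) auto
  have 2: "(CLINT \<omega>|M. iexp (\<tau> * (1 + T \<omega>))) = iexp \<tau> * (CLINT \<omega>|M. iexp (\<tau> * T \<omega>))"
    by (simp add: distrib_left exp_add)
  have "cmod ((CLINT \<omega>|M. iexp (\<tau> * S \<omega>)) - (CLINT \<omega>|M. iexp (\<tau> * (1 + T \<omega>)))) =
      cmod (CLINT \<omega>|M. iexp (\<tau> * S \<omega>) - iexp (\<tau> * (1 + T \<omega>)))"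
    by (subst Bochner_Integration.integral_diff) (auto intro!: integrable_iexp simp del: of_real_mult of_real_add)
  also have "\<dots> \<le> expectation (\<lambda>\<omega>. cmod (iexp (\<tau> * S \<omega>) - iexp (\<tau> * (1 + T \<omega>))))" by (rule integral_norm_bound)
  also have "\<dots> \<le> expectation (\<lambda>\<omega>. \<bar>\<tau>\<bar> * \<bar>S \<omega> - (1 + T \<omega>)\<bar>)"
  proof (rule integral_mono')
    show "integrable M (\<lambda>\<omega>. \<bar>\<tau>\<bar> * \<bar>S \<omega> - (1 + T \<omega>)\<bar>)" by (intro integrable_mult_right integrable_abs D(1))
    show "cmod (iexp (\<tau> * S \<omega>) - iexp (\<tau> * (1 + T \<omega>))) \<le> \<bar>\<tau>\<bar> * \<bar>S \<omega> - (1 + T \<omega>)\<bar>" for \<omega>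
      using cmod_iexp_diff_le[of "\<tau> * S \<omega>" "\<tau> * (1 + T \<omega>)"] by (simp add: abs_mult[symmetric] algebra_simps)
  qed simp
  also have "\<dots> = \<bar>\<tau>\<bar> * expectation (\<lambda>\<omega>. \<bar>S \<omega> - (1 + T \<omega>)\<bar>)" by simp
  also have "\<dots> \<le> \<bar>\<tau>\<bar> * stat_err q m" using D(2) by (intro mult_left_mono) auto
  finally have a: "cmod ((CLINT \<omega>|M. iexp (\<tau> * S \<omega>)) - iexp \<tau> * (CLINT \<omega>|M. iexp (\<tau> * T \<omega>))) \<le> \<bar>\<tau>\<bar> * stat_err q m"
    unfolding 2 .
  have "cmod (iexp \<tau> * (CLINT \<omega>|M. iexp (\<tau> * T \<omega>)) - iexp \<tau> * complex_of_real (exp (- (\<Sum>j<q. step_var q \<tau> j)))) =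
     cmod ((CLINT \<omega>|M. iexp (\<tau> * T \<omega>)) - complex_of_real (exp (- (\<Sum>j<q. step_var q \<tau> j))))"
    unfolding right_diff_distrib[symmetric] by (simp add: norm_mult)
  also have "\<dots> \<le> (\<Sum>j<q. step_err q m \<tau> j)" unfolding T_def by (rule gram_mart_char[OF Z order_refl m])
  finally have b: "cmod (iexp \<tau> * (CLINT \<omega>|M. iexp (\<tau> * T \<omega>)) - iexp \<tau> * complex_of_real (exp (- (\<Sum>j<q. step_var q \<tau> j)))) \<le> (\<Sum>j<q. step_err q m \<tau> j)" .
  show ?thesis
    using norm_triangle_ineq[of "(CLINT \<omega>|M. iexp (\<tau> * S \<omega>)) - iexp \<tau> * (CLINT \<omega>|M. iexp (\<tau> * T \<omega>))"
       "iexp \<tau> * (CLINT \<omega>|M. iexp (\<tau> * T \<omega>)) - iexp \<tau> * complex_of_real (exp (- (\<Sum>j<q. step_var q \<tau> j)))"] a b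
    unfolding S_def[symmetric] 1 by simp
qed

text \<open>The total exponent tends to \<open>2 * \<tau>^2\<close>, that is
  \<open>4 * \<tau>^2 / 2\<close>: the source of the limiting variance \<open>4\<close>.\<close>

lemma sum_step_var: "0 < q \<Longrightarrow> (\<Sum>j<q. step_var q \<tau> j) = 2 * \<tau>\<^sup>2 * (1 - 1 / real q)"
proof -
  assume q: "0 < q"
  have f: "(\<Sum>b<n. real b) = real n * (real n - 1) / 2" for n by (induction n) (auto simp: field_simps)
  have "(\<Sum>j<q. step_var q \<tau> j) = \<tau>\<^sup>2 * 4 / (real q)\<^sup>2 * (\<Sum>j<q. real j)"
    unfolding step_var_def sum_distrib_left by (intro sum.cong refl) simp
  also have "\<dots> = \<tau>\<^sup>2 * 4 / (real q)\<^sup>2 * (real q * (real q - 1) / 2)" by (simp only: f)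
  also have "\<dots> = 2 * \<tau>\<^sup>2 * (1 - 1 / real q)" using q by (simp add: field_simps power2_eq_square)
  finally show ?thesis .
qed

text \<open>Bounding each step by the last one shows the rate: for fixed \<open>\<tau>\<close> the
  total is of order \<open>1 / sqrt q + 1 / sqrt m + q / m\<close>.\<close>

lemma sum_step_err_le:
  assumes q: "0 < q" and m: "0 < m"
  shows "(\<Sum>j<q. step_err q m \<tau> j) \<le> quad_char_const * (4 * \<tau>\<^sup>2 * sqrt (4 * \<tau>\<^sup>2 / real q) +
     4 * \<tau>\<^sup>2 * (2 * sqrt (2 / real m) + 2 / real m + real q / real m))"
proof -
  have "(\<Sum>j<q. step_err q m \<tau> j) \<le> (\<Sum>j<q. quad_char_const * (4 * \<tau>\<^sup>2 / real q * sqrt (4 * \<tau>\<^sup>2 / real q) +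
     (\<tau> * (2 / (real q * real m)))\<^sup>2 * (real q * (2 * real m * sqrt (2 * real m) + 2 * real m) + (real q)\<^sup>2 * real m)))"
  proof (intro sum_mono)
    fix j assume j: "j \<in> {..<q}"
    have "step_var q \<tau> j \<le> 4 * \<tau>\<^sup>2 / real q"
    proof -
      have "\<tau>\<^sup>2 * (4 * real j) \<le> \<tau>\<^sup>2 * (4 * real q)" using j by (intro mult_left_mono) auto
      then show ?thesis using q by (simp add: step_var_def field_simps power2_eq_square)
    qed
    moreover have "0 \<le> step_var q \<tau> j" by (simp add: step_var_def)
    ultimately show "step_err q m \<tau> j \<le> quad_char_const * (4 * \<tau>\<^sup>2 / real q * sqrt (4 * \<tau>\<^sup>2 / real q) +
       (\<tau> * (2 / (real q * real m)))\<^sup>2 * (real q * (2 * real m * sqrt (2 * real m) + 2 * real m) + (real q)\<^sup>2 * real m))"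
      unfolding step_err_def using j quad_char_const_pos
      by (intro mult_left_mono add_mono mult_mono mult_right_mono real_sqrt_le_mono power_mono) auto
  qed
  also have "\<dots> = quad_char_const * (real q * (4 * \<tau>\<^sup>2 / real q * sqrt (4 * \<tau>\<^sup>2 / real q)) +
     real q * ((\<tau> * (2 / (real q * real m)))\<^sup>2 * (real q * (2 * real m * sqrt (2 * real m) + 2 * real m) + (real q)\<^sup>2 * real m)))"
    by (simp add: algebra_simps)
  also have "real q * (4 * \<tau>\<^sup>2 / real q * sqrt (4 * \<tau>\<^sup>2 / real q)) = 4 * \<tau>\<^sup>2 * sqrt (4 * \<tau>\<^sup>2 / real q)" using q by simp
  also have "real q * ((\<tau> * (2 / (real q * real m)))\<^sup>2 * (real q * (2 * real m * sqrt (2 * real m) + 2 * real m) + (real q)\<^sup>2 * real m)) =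
     4 * \<tau>\<^sup>2 * (2 * (sqrt (2 * real m) / real m) + 2 / real m + real q / real m)"
    using q m by (simp add: field_simps power2_eq_square)
  also have "sqrt (2 * real m) / real m = sqrt (2 / real m)"
    using m by (simp add: real_sqrt_mult real_sqrt_divide field_simps)
  finally show ?thesis .
qed

lemma stat_err_eq:
  assumes q: "0 < q" and m: "0 < m"
  shows "stat_err q m = sqrt (chi4 / real q) + 4 * sqrt (2 * (real q / real m)) + 2 * (1 / real q + 1 / real m)"
proof -
  have 1: "sqrt (chi4 * real q * (real m)\<^sup>2) / (real q * real m) = sqrt (chi4 / real q)"
    using q m by (simp add: real_sqrt_mult real_sqrt_divide field_simps)
  have 2: "2 / (real q * real m) * sqrt (2 * ((real q)\<^sup>2 * (real q * real m))) = 2 * sqrt (2 * (real q / real m))"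
    using q m by (simp add: real_sqrt_mult real_sqrt_divide field_simps)
  have 3: "2 * real q / (real q * real m) * sqrt (2 * (real q * real m)) = 2 * sqrt (2 * (real q / real m))"
    using q m by (simp add: real_sqrt_mult real_sqrt_divide field_simps)
  have 4: "(real m + real q) / (real q * real m)\<^sup>2 * (2 * (real q * real m)) = 2 * (1 / real q + 1 / real m)"
    using q m by (simp add: field_simps power2_eq_square)
  show ?thesis unfolding stat_err_def 1 2 3 4 by simp
qed

text \<open>Levy's continuity theorem, as the explicit error bounds vanish in this regime. The
  second parameter of \<open>normal_density 1 2\<close> is the standard deviation.\<close>

theorem gram_stat_CLT:
  fixes q m :: "nat \<Rightarrow> nat" and M :: "nat \<Rightarrow> 'a measure" and g :: "nat \<Rightarrow> nat \<times> nat \<Rightarrow> 'a \<Rightarrow> real"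
  assumes Z: "\<And>n. gauss_family (M n) ({..<q n} \<times> {..<m n}) (g n)"
    and q: "filterlim q at_top sequentially" and m: "filterlim m at_top sequentially"
    and qm: "(\<lambda>n. real (q n) / real (m n)) \<longlonglongrightarrow> 0"
  shows "weak_conv_m (\<lambda>n. distr (M n) borel (\<lambda>\<omega>. gram_stat (q n) (m n) (\<lambda>i. g n i \<omega>))) (density lborel (normal_density 1 2))"
proof (rule levy_continuity)
  fix n
  interpret prob_space "M n" using gauss_familyD(1)[OF Z] .
  have rd: "(\<lambda>\<omega>. rdot (m n) (\<lambda>i. g n i \<omega>) a b) \<in> borel_measurable (M n)" if "a < q n" "b < q n" for a b
    using gauss_familyD(3)[OF Z[of n]] that by (intro measurable_rdot) auto
  have "(\<lambda>\<omega>. gram_stat (q n) (m n) (\<lambda>i. g n i \<omega>)) \<in> borel_measurable (M n)"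
    unfolding gram_stat_def gram_tr1_def gram_tr2_def using rd
    by (intro borel_measurable_diff borel_measurable_divide borel_measurable_times borel_measurable_power borel_measurable_sum borel_measurable_const) auto
  then show "real_distribution (distr (M n) borel (\<lambda>\<omega>. gram_stat (q n) (m n) (\<lambda>i. g n i \<omega>)))"
    by (rule real_distribution_distr)
next
  show "real_distribution (density lborel (normal_density 1 2))"
    using prob_space_normal_density[of 2 1] by (auto simp: real_distribution_def real_distribution_axioms_def)
next
  fix \<tau>
  have q1: "eventually (\<lambda>n. 0 < q n) sequentially" and m1: "eventually (\<lambda>n. 0 < m n) sequentially"
    using q[unfolded filterlim_at_top, rule_format, of 1] m[unfolded filterlim_at_top, rule_format, of 1]
    by (auto elim: eventually_mono)
  have rq: "filterlim (\<lambda>n. real (q n)) at_top sequentially" and rm: "filterlim (\<lambda>n. real (m n)) at_top sequentially"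
    using q m by (auto intro: filterlim_compose[OF filterlim_real_sequentially])
  have iq: "(\<lambda>n. c / real (q n)) \<longlonglongrightarrow> 0" and im: "(\<lambda>n. c / real (m n)) \<longlonglongrightarrow> 0" for c
    using rq rm by (auto intro!: real_tendsto_divide_at_top)
  define c where "c n = iexp \<tau> * complex_of_real (exp (- (2 * \<tau>\<^sup>2 * (1 - 1 / real (q n)))))" for n
  have "c \<longlonglongrightarrow> iexp \<tau> * complex_of_real (exp (- (2 * \<tau>\<^sup>2 * (1 - 0))))"
    unfolding c_def by (intro tendsto_intros iq)
  also have "iexp \<tau> * complex_of_real (exp (- (2 * \<tau>\<^sup>2 * (1 - 0)))) = char (density lborel (normal_density 1 2)) \<tau>"
    by (simp add: char_normal_distribution)
  finally have lim: "c \<longlonglongrightarrow> char (density lborel (normal_density 1 2)) \<tau>" .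
  define B where "B n = \<bar>\<tau>\<bar> * (sqrt (chi4 / real (q n)) + 4 * sqrt (2 * (real (q n) / real (m n))) + 2 * (1 / real (q n) + 1 / real (m n))) +
     quad_char_const * (4 * \<tau>\<^sup>2 * sqrt (4 * \<tau>\<^sup>2 / real (q n)) +
     4 * \<tau>\<^sup>2 * (2 * sqrt (2 / real (m n)) + 2 / real (m n) + real (q n) / real (m n)))" for n
  have "B \<longlonglongrightarrow> \<bar>\<tau>\<bar> * (sqrt 0 + 4 * sqrt (2 * 0) + 2 * (0 + 0)) + quad_char_const * (4 * \<tau>\<^sup>2 * sqrt 0 + 4 * \<tau>\<^sup>2 * (2 * sqrt 0 + 0 + 0))"
    unfolding B_def by (intro tendsto_intros iq im qm)
  then have B: "B \<longlonglongrightarrow> 0" by simp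
  have "eventually (\<lambda>n. cmod (char (distr (M n) borel (\<lambda>\<omega>. gram_stat (q n) (m n) (\<lambda>i. g n i \<omega>))) \<tau> - c n) \<le> B n) sequentially"
    using q1 m1
  proof eventually_elim
    case (elim n)
    show ?case
      using gram_stat_char[OF Z[of n] elim, of \<tau>] sum_step_err_le[OF elim, of \<tau>]
      unfolding sum_step_var[OF elim(1)] stat_err_eq[OF elim] B_def c_def by linarith
  qed
  from Lim_null_comparison[OF this B]
  have "(\<lambda>n. (char (distr (M n) borel (\<lambda>\<omega>. gram_stat (q n) (m n) (\<lambda>i. g n i \<omega>))) \<tau> - c n) + c n) \<longlonglongrightarrow> 0 + char (density lborel (normal_density 1 2)) \<tau>"
    by (intro tendsto_add lim)
  then show "(\<lambda>n. char (distr (M n) borel (\<lambda>\<omega>. gram_stat (q n) (m n) (\<lambda>i. g n i \<omega>))) \<tau>) \<longlonglongrightarrow> char (density lborel (normal_density 1 2)) \<tau>"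
    by simp
qed

text \<open>The Gram matrices of rows and of columns have the same trace and the same trace of the
  square, and the centring is symmetric in \<open>q\<close> and \<open>m\<close>.\<close>

lemma gram_stat_transpose: "gram_stat m q (\<lambda>(t, a). x (a, t)) = gram_stat q m x"
proof -
  have "gram_tr1 m q (\<lambda>(t, a). x (a, t)) = gram_tr1 q m x"
    unfolding gram_tr1_def rdot_def by (subst sum.swap) simp
  moreover have "gram_tr2 m q (\<lambda>(t, a). x (a, t)) = gram_tr2 q m x"
    unfolding gram_tr2_def rdot_def using sum_gram_squares_swap[of "{..<q}" "{..<m}" "\<lambda>a t. x (a, t)"] by simp
  ultimately show ?thesis by (simp add: gram_stat_def mult.commute add.commute)
qed

theorem gram_stat_CLT_transposed:
  fixes q m :: "nat \<Rightarrow> nat" and M :: "nat \<Rightarrow> 'a measure" and g :: "nat \<Rightarrow> nat \<times> nat \<Rightarrow> 'a \<Rightarrow> real"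
  assumes Z: "\<And>n. gauss_family (M n) ({..<q n} \<times> {..<m n}) (g n)"
    and q: "filterlim q at_top sequentially" and m: "filterlim m at_top sequentially"
    and qm: "(\<lambda>n. real (m n) / real (q n)) \<longlonglongrightarrow> 0"
  shows "weak_conv_m (\<lambda>n. distr (M n) borel (\<lambda>\<omega>. gram_stat (q n) (m n) (\<lambda>i. g n i \<omega>))) (density lborel (normal_density 1 2))"
proof -
  have Z': "gauss_family (M n) ({..<m n} \<times> {..<q n}) (\<lambda>(t, a). g n (a, t))" for n
  proof -
    have "gauss_family (M n) ({..<m n} \<times> {..<q n}) (\<lambda>i. g n (prod.swap i))"
      by (rule gauss_family_reindex[OF Z]) auto
    then show ?thesis by (simp add: case_prod_beta' prod.swap_def)
  qed
  have "gram_stat (m n) (q n) (\<lambda>i. (case i of (t, a) \<Rightarrow> g n (a, t)) \<omega>) = gram_stat (q n) (m n) (\<lambda>i. g n i \<omega>)" for n \<omega>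
    using gram_stat_transpose[of "m n" "q n" "\<lambda>i. g n i \<omega>"] by (simp add: case_prod_beta')
  with gram_stat_CLT[OF Z' m q qm] show ?thesis by simp
qed

subsection \<open>The operator norm of a Gaussian array\<close>

text \<open>Multiplied by \<open>exp (x^2 / 4)\<close>, the standard normal density becomes
  \<open>sqrt 2\<close> times the centred normal density of variance \<open>2\<close>.\<close>

lemma exp_square_quarter_std_normal:
  "integrable std_normal_distribution (\<lambda>x. exp (x\<^sup>2 / 4))"
  "(\<integral>x. exp (x\<^sup>2 / 4) \<partial>std_normal_distribution) = sqrt 2"
proof -
  have eq: "std_normal_density x * exp (x\<^sup>2 / 4) = sqrt 2 * normal_density 0 (sqrt 2) x" for x
  proof -
    have "exp (- x\<^sup>2 / 2) * exp (x\<^sup>2 / 4) = exp (- x\<^sup>2 / 4)" by (simp add: exp_add[symmetric])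
    then show ?thesis by (simp add: normal_density_def real_sqrt_mult field_simps)
  qed
  have "integrable lborel (\<lambda>x. std_normal_density x *\<^sub>R exp (x\<^sup>2 / 4))"
    by (simp add: eq integrable_normal_density)
  then show "integrable std_normal_distribution (\<lambda>x. exp (x\<^sup>2 / 4))"
    by (subst integrable_density) auto
  have "(\<integral>x. exp (x\<^sup>2 / 4) \<partial>std_normal_distribution) = (\<integral>x. std_normal_density x *\<^sub>R exp (x\<^sup>2 / 4) \<partial>lborel)"
    by (subst integral_density) auto
  then show "(\<integral>x. exp (x\<^sup>2 / 4) \<partial>std_normal_distribution) = sqrt 2"
    by (simp add: eq integral_normal_density)
qed

text \<open>Chernoff's bound with exponent \<open>1 / 4\<close>, for which each factor contributes
  \<open>sqrt 2\<close>.\<close>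

lemma chi_square_tail:
  assumes Z: "gauss_family M J \<xi>"
  shows "measure M {\<omega>\<in>space M. s < (\<Sum>j\<in>J. (\<xi> j \<omega>)\<^sup>2)} \<le> exp (- s / 4) * sqrt 2 ^ card J"
proof -
  note G = gauss_familyD[OF Z]
  interpret prob_space M by fact
  note [measurable] = G(3)
  define E where "E \<omega> = (\<Prod>j\<in>J. exp ((\<xi> j \<omega>)\<^sup>2 / 4))" for \<omega>
  have E: "E \<omega> = exp ((\<Sum>j\<in>J. (\<xi> j \<omega>)\<^sup>2) / 4)" for \<omega>
    using G(2) by (simp add: E_def exp_sum sum_divide_distrib)
  have iv: "indep_vars (\<lambda>_. borel) (\<lambda>j \<omega>. exp ((\<xi> j \<omega>)\<^sup>2 / 4)) J"
    by (rule indep_vars_compose2[OF G(4)]) auto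
  have i1: "integrable M (\<lambda>\<omega>. exp ((\<xi> j \<omega>)\<^sup>2 / 4))" "expectation (\<lambda>\<omega>. exp ((\<xi> j \<omega>)\<^sup>2 / 4)) = sqrt 2" if "j \<in> J" for j
    using gauss_family_expectation[OF Z that, of "\<lambda>x. exp (x\<^sup>2 / 4)"] exp_square_quarter_std_normal by simp_all
  have iE: "integrable M E" unfolding E_def by (rule indep_vars_integrable[OF G(2) iv i1(1)])
  have "expectation E = (\<Prod>j\<in>J. expectation (\<lambda>\<omega>. exp ((\<xi> j \<omega>)\<^sup>2 / 4)))"
    unfolding E_def by (rule indep_vars_lebesgue_integral[OF G(2) iv i1(1)])
  also have "\<dots> = sqrt 2 ^ card J" using i1(2) by simp
  finally have EE: "expectation E = sqrt 2 ^ card J" .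
  have "{\<omega>\<in>space M. s < (\<Sum>j\<in>J. (\<xi> j \<omega>)\<^sup>2)} \<subseteq> {\<omega>\<in>space M. exp (s / 4) \<le> \<bar>E \<omega>\<bar>}" by (auto simp: E)
  then have "prob {\<omega>\<in>space M. s < (\<Sum>j\<in>J. (\<xi> j \<omega>)\<^sup>2)} \<le> prob {\<omega>\<in>space M. exp (s / 4) \<le> \<bar>E \<omega>\<bar>}"
    unfolding E by (intro finite_measure_mono) auto
  also have "\<dots> \<le> expectation (\<lambda>\<omega>. \<bar>E \<omega>\<bar>) / exp (s / 4)"
    using iE by (intro prob_abs_ge_le) (auto simp: E[abs_def])
  also have "(\<lambda>\<omega>. \<bar>E \<omega>\<bar>) = E" by (simp add: E fun_eq_iff)
  finally show ?thesis by (simp add: EE exp_minus field_simps)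
qed

text \<open>A convex function is maximised at vertices: rounding coordinate by coordinate to integers
  need not decrease the sum of squares.\<close>

lemma round_to_lattice:
  fixes a :: "'j \<Rightarrow> nat \<Rightarrow> real" and u :: "nat \<Rightarrow> real"
  shows "\<exists>k :: nat \<Rightarrow> int. (\<forall>i<N. \<bar>of_int (k i) - u i\<bar> \<le> 1) \<and>
    (\<Sum>j\<in>J. (\<Sum>t<N. a j t * u t)\<^sup>2) \<le> (\<Sum>j\<in>J. (\<Sum>t<N. a j t * of_int (k t))\<^sup>2)"
proof -
  define f where "f v = (\<Sum>j\<in>J. (\<Sum>t<N. a j t * v t)\<^sup>2)" for v
  have "\<exists>k :: nat \<Rightarrow> int. (\<forall>i<n. \<bar>of_int (k i) - u i\<bar> \<le> 1) \<and> f u \<le> f (\<lambda>t. if t < n then of_int (k t) else u t)" if "n \<le> N" for n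
    using that
  proof (induction n)
    case 0
    then show ?case by simp
  next
    case (Suc n)
    then obtain k :: "nat \<Rightarrow> int" where k: "\<forall>i<n. \<bar>of_int (k i) - u i\<bar> \<le> 1"
      "f u \<le> f (\<lambda>t. if t < n then of_int (k t) else u t)" by auto
    define v where "v s t = (if t < n then of_int (k t) else if t = n then s else u t)" for s t
    define lo where "lo = \<lfloor>u n\<rfloor>"
    \<comment> \<open>\<open>u n\<close> is the mixture of its two neighbouring integers with weight
      \<open>x\<close> on the upper one; by convexity one of the two does not lower
      \<open>f\<close>.\<close>
    define x where "x = u n - of_int lo"
    have x: "0 \<le> x" "x \<le> 1" unfolding x_def lo_def by linarith+
    define A where "A j = (\<Sum>t<N. a j t * v (of_int lo) t)" for j
    define B where "B j = (\<Sum>t<N. a j t * v (of_int (lo + 1)) t)" for j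
    have mix: "(\<Sum>t<N. a j t * v (u n) t) = (1 - x) * A j + x * B j" for j
      unfolding A_def B_def sum_distrib_left sum.distrib[symmetric]
      by (intro sum.cong refl) (auto simp: v_def x_def algebra_simps)
    have cvx: "((1 - x) * A j + x * B j)\<^sup>2 \<le> (1 - x) * (A j)\<^sup>2 + x * (B j)\<^sup>2" for j
    proof -
      have "(1 - x) * (A j)\<^sup>2 + x * (B j)\<^sup>2 - ((1 - x) * A j + x * B j)\<^sup>2 = x * (1 - x) * (A j - B j)\<^sup>2"
        by (simp add: power2_eq_square algebra_simps)
      also have "\<dots> \<ge> 0" using x by simp
      finally show ?thesis by simp
    qed
    have "f (v (u n)) \<le> (\<Sum>j\<in>J. (1 - x) * (A j)\<^sup>2 + x * (B j)\<^sup>2)"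
      unfolding f_def mix by (intro sum_mono cvx)
    also have "\<dots> = (1 - x) * f (v (of_int lo)) + x * f (v (of_int (lo + 1)))"
      by (simp add: f_def A_def B_def sum.distrib sum_distrib_left)
    also have "\<dots> \<le> max (f (v (of_int lo))) (f (v (of_int (lo + 1))))"
      using x convex_bound_le[of "f (v (of_int lo))" "max (f (v (of_int lo))) (f (v (of_int (lo + 1))))" "f (v (of_int (lo + 1)))" "1 - x" x] by simp
    finally have mx: "f (v (u n)) \<le> max (f (v (of_int lo))) (f (v (of_int (lo + 1))))" .
    have vu: "v (u n) = (\<lambda>t. if t < n then of_int (k t) else u t)" by (auto simp: v_def fun_eq_iff)
    define c where "c = (if f (v (of_int (lo + 1))) \<le> f (v (of_int lo)) then lo else lo + 1)"
    have fc: "f (v (u n)) \<le> f (v (of_int c))" using mx by (auto simp: c_def)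
    have c1: "\<bar>of_int c - u n\<bar> \<le> 1" using x by (auto simp: c_def x_def)
    have "v (of_int c) = (\<lambda>t. if t < Suc n then of_int ((k(n := c)) t) else u t)"
      by (auto simp: v_def fun_eq_iff less_Suc_eq)
    then show ?case using k fc c1 unfolding vu
      by (intro exI[of _ "k(n := c)"]) (auto simp: less_Suc_eq)
  qed
  from this[of N] obtain k :: "nat \<Rightarrow> int" where k: "\<forall>i<N. \<bar>of_int (k i) - u i\<bar> \<le> 1"
    "f u \<le> f (\<lambda>t. if t < N then of_int (k t) else u t)" by auto
  have "f (\<lambda>t. if t < N then of_int (k t) else u t) = f (\<lambda>t. of_int (k t))"
    by (simp add: f_def)
  with k show ?thesis unfolding f_def by auto
qed

text \<open>A vector of squared norm \<open>N\<close>, rounded with error at most \<open>1\<close>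
  per coordinate, has squared norm at most \<open>2 * N + 2 * N\<close>. The box makes finiteness
  immediate.\<close>

definition lattice_ball :: "nat \<Rightarrow> (nat \<Rightarrow> int) set" where
  "lattice_ball N = {k \<in> Pi\<^sub>E {..<N} (\<lambda>_. {- 4 * int N..4 * int N}). (\<Sum>i<N. (k i)\<^sup>2) \<le> 4 * int N}"

lemma finite_lattice_ball: "finite (lattice_ball N)"
proof (rule finite_subset)
  show "lattice_ball N \<subseteq> Pi\<^sub>E {..<N} (\<lambda>_. {- 4 * int N..4 * int N})" by (auto simp: lattice_ball_def)
  show "finite (Pi\<^sub>E {..<N} (\<lambda>_. {- 4 * int N..4 * int N}))" by (rule finite_PiE) auto
qed

text \<open>For \<open>j \<ge> 1\<close> a term is at most \<open>exp (- j) \<le> (1 / 2)^j\<close>,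
  so each side of \<open>0\<close> contributes at most \<open>1\<close>.\<close>

lemma sum_exp_neg_square_le:
  "(\<Sum>j\<in>{- int B..int B}. exp (- (real_of_int j)\<^sup>2)) \<le> 3"
proof -
  have half: "(\<Sum>j=1..n. exp (- (real j)\<^sup>2)) \<le> 1 - (1/2) ^ n" for n
  proof (induction n)
    case (Suc n)
    have "real (Suc n) * 1 \<le> (real (Suc n))\<^sup>2"
      unfolding power2_eq_square by (intro mult_left_mono) auto
    then have "exp (- (real (Suc n))\<^sup>2) \<le> exp (- real (Suc n))" by simp
    also have "exp (- real (Suc n)) = exp (-1) ^ Suc n" by (subst exp_of_nat_mult[symmetric]) simp
    also have "\<dots> \<le> (1/2) ^ Suc n"
    proof (rule power_mono)
      have "(2::real) \<le> exp 1" using exp_ge_add_one_self[of 1] by simp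
      then show "exp (-1) \<le> (1/2 :: real)" by (simp add: exp_minus field_simps)
    qed simp
    finally have "exp (- (real (Suc n))\<^sup>2) \<le> (1/2) ^ Suc n" .
    with Suc show ?case by simp
  qed simp
  have "{- int B..int B} = {0} \<union> (int ` {1..B} \<union> (\<lambda>j. - int j) ` {1..B})"
  proof (intro equalityI subsetI)
    fix j assume j: "j \<in> {- int B..int B}"
    show "j \<in> {0} \<union> (int ` {1..B} \<union> (\<lambda>j. - int j) ` {1..B})"
    proof (cases j rule: int_cases3)
      case (pos n)
      then show ?thesis using j by auto
    next
      case (neg n)
      then show ?thesis using j by auto
    qed simp
  qed auto
  moreover have "(\<Sum>j\<in>{0} \<union> (int ` {1..B} \<union> (\<lambda>j. - int j) ` {1..B}). exp (- (real_of_int j)\<^sup>2)) =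
     (\<Sum>j\<in>{0}. exp (- (real_of_int j)\<^sup>2)) + ((\<Sum>j\<in>int ` {1..B}. exp (- (real_of_int j)\<^sup>2)) + (\<Sum>j\<in>(\<lambda>j. - int j) ` {1..B}. exp (- (real_of_int j)\<^sup>2)))"
    by (subst sum.union_disjoint, simp, simp, force, subst sum.union_disjoint) auto
  moreover have "(\<Sum>j\<in>int ` {1..B}. exp (- (real_of_int j)\<^sup>2)) = (\<Sum>j=1..B. exp (- (real j)\<^sup>2))"
    by (subst sum.reindex) (auto simp: inj_on_def)
  moreover have "(\<Sum>j\<in>(\<lambda>j. - int j) ` {1..B}. exp (- (real_of_int j)\<^sup>2)) = (\<Sum>j=1..B. exp (- (real j)\<^sup>2))"
    by (subst sum.reindex) (auto simp: inj_on_def)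
  moreover have "(\<Sum>j=1..B. exp (- (real j)\<^sup>2)) \<le> 1" using half[of B] zero_le_power[of "1/2::real" B] by linarith
  ultimately show ?thesis by simp
qed

text \<open>On the ball, \<open>exp (4 * N)\<close> times the Gaussian weight is at least
  \<open>1\<close>; over the box the weight factorises into \<open>N\<close> sums, each at most
  \<open>3 \<le> exp 2\<close>.\<close>

lemma card_lattice_ball_le: "real (card (lattice_ball N)) \<le> exp (6 * real N)"
proof -
  let ?P = "Pi\<^sub>E {..<N} (\<lambda>_. {- 4 * int N..4 * int N})"
  have "real (card (lattice_ball N)) = (\<Sum>k\<in>lattice_ball N. 1)" by simp
  also have "\<dots> \<le> (\<Sum>k\<in>lattice_ball N. exp (4 * real N) * (\<Prod>i<N. exp (- (real_of_int (k i))\<^sup>2)))"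
  proof (intro sum_mono)
    fix k assume "k \<in> lattice_ball N"
    then have "(\<Sum>i<N. (k i)\<^sup>2) \<le> 4 * int N" by (simp add: lattice_ball_def)
    then have "real_of_int (\<Sum>i<N. (k i)\<^sup>2) \<le> real_of_int (4 * int N)" by (simp only: of_int_le_iff)
    then have "(\<Sum>i<N. (real_of_int (k i))\<^sup>2) \<le> 4 * real N" by simp
    then have "1 \<le> exp (4 * real N + (\<Sum>i<N. - (real_of_int (k i))\<^sup>2))"
      by (simp add: sum_negf)
    then show "1 \<le> exp (4 * real N) * (\<Prod>i<N. exp (- (real_of_int (k i))\<^sup>2))"
      by (simp add: exp_add exp_sum)
  qed
  also have "\<dots> \<le> (\<Sum>k\<in>?P. exp (4 * real N) * (\<Prod>i<N. exp (- (real_of_int (k i))\<^sup>2)))"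
  proof (rule sum_mono2)
    show "finite ?P" by (rule finite_PiE) auto
    show "lattice_ball N \<subseteq> ?P" unfolding lattice_ball_def by blast
  qed (simp add: prod_nonneg)
  also have "\<dots> = exp (4 * real N) * (\<Prod>i<N. \<Sum>j\<in>{- 4 * int N..4 * int N}. exp (- (real_of_int j)\<^sup>2))"
    unfolding sum_distrib_left[symmetric] by (subst prod_sum_PiE) simp_all
  also have "(\<Prod>i<N. \<Sum>j\<in>{- 4 * int N..4 * int N}. exp (- (real_of_int j)\<^sup>2)) \<le> (\<Prod>i<N. 3)"
    using sum_exp_neg_square_le[of "4 * N"] by (intro prod_mono) (auto intro: sum_nonneg)
  also have "(\<Prod>i<N. 3) \<le> (exp 2 :: real) ^ N"
  proof -
    have "(3::real) \<le> exp 2" using exp_ge_add_one_self[of 2] by simp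
    then show ?thesis by (simp add: power_mono)
  qed
  also have "exp (4 * real N) * exp 2 ^ N = exp (6 * real N)"
    by (simp add: exp_of_nat_mult[symmetric] exp_add[symmetric] mult.commute)
  finally show ?thesis by simp
qed

text \<open>For a lattice point of squared norm \<open>S \<le> 4 * N\<close> the image has squared
  norm \<open>S\<close> times a chi-square variable with \<open>card J\<close> degrees of freedom,
  so exceeding \<open>z * N\<close> forces that variable above \<open>z / 4\<close>. The tail is
  \<open>exp (- z / 16) * sqrt 2 ^ card J\<close>, the union costs \<open>exp (6 * N)\<close>, and
  \<open>112 = 16 * 7\<close> leaves at most \<open>exp (- N)\<close>. One exceptional set, a finite
  union, serves all \<open>w\<close> at once.\<close>

lemma gauss_array_opnorm:
  fixes g :: "'j \<times> nat \<Rightarrow> 'a \<Rightarrow> real"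
  assumes Z: "gauss_family M (J \<times> {..<N}) g" and J: "finite J" and N: "0 < N" and z: "z = 112 * (real N + real (card J))"
  obtains Bad where "Bad \<in> sets M" "measure M Bad \<le> exp (- real N)"
    "\<And>\<omega> w. \<omega> \<in> space M - Bad \<Longrightarrow> (\<Sum>j\<in>J. (\<Sum>t<N. g (j, t) \<omega> * w t)\<^sup>2) \<le> z * (\<Sum>t<N. (w t)\<^sup>2)"
proof -
  note G = gauss_familyD[OF Z]
  interpret prob_space M by fact
  define f where "f v \<omega> = (\<Sum>j\<in>J. (\<Sum>t<N. g (j, t) \<omega> * v t)\<^sup>2)" for v :: "nat \<Rightarrow> real" and \<omega>
  have fm[measurable]: "f v \<in> borel_measurable M" for v
    unfolding f_def using G(3) by (intro borel_measurable_sum borel_measurable_power borel_measurable_times borel_measurable_const) auto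
  define B where "B k = {\<omega>\<in>space M. z * real N < f (\<lambda>t. of_int (k t)) \<omega>}" for k :: "nat \<Rightarrow> int"
  define Bad where "Bad = (\<Union>k\<in>lattice_ball N. B k)"
  have Bk: "B k \<in> sets M" for k unfolding B_def by measurable
  have z0: "0 \<le> z" using z by simp
  have PB: "measure M (B k) \<le> exp (- z / 16) * sqrt 2 ^ card J" if k: "k \<in> lattice_ball N" for k
  proof -
    define S where "S = (\<Sum>t<N. (real_of_int (k t))\<^sup>2)"
    have "(\<Sum>i<N. (k i)\<^sup>2) \<le> 4 * int N" using k by (simp add: lattice_ball_def)
    then have "real_of_int (\<Sum>i<N. (k i)\<^sup>2) \<le> real_of_int (4 * int N)" by (simp only: of_int_le_iff)
    then have S4: "S \<le> 4 * real N" by (simp add: S_def)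
    have S0: "0 \<le> S" by (simp add: S_def sum_nonneg)
    show ?thesis
    proof (cases "S = 0")
      case True
      then have "\<forall>t\<in>{..<N}. (real_of_int (k t))\<^sup>2 = 0" unfolding S_def by (subst (asm) sum_nonneg_eq_0_iff) auto
      then have "f (\<lambda>t. of_int (k t)) \<omega> = 0" for \<omega> by (simp add: f_def)
      then have "B k = {}" using z0 by (auto simp: B_def mult_less_0_iff not_less)
      then show ?thesis by simp
    next
      case False
      then have S: "0 < S" using S0 by simp
      \<comment> \<open>The normalised pairing of row \<open>j\<close> with \<open>k\<close>;
        orthonormal in \<open>j\<close>, because different rows share no entries.\<close>
      define c where "c j i = (if fst i = j then real_of_int (k (snd i)) / sqrt S else 0)" for j :: 'j and i :: "'j \<times> nat"
      define \<xi> where "\<xi> j \<omega> = (\<Sum>i\<in>J \<times> {..<N}. c j i * g i \<omega>)" for j \<omega>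
      have row: "(\<Sum>i\<in>J \<times> {..<N}. c j i * h i) = (\<Sum>t<N. real_of_int (k t) / sqrt S * h (j, t))" if "j \<in> J" for j and h :: "'j \<times> nat \<Rightarrow> real"
      proof -
        have "(\<Sum>i\<in>J \<times> {..<N}. c j i * h i) = (\<Sum>j'\<in>J. \<Sum>t<N. c j (j', t) * h (j', t))"
          by (simp add: sum.cartesian_product case_prod_beta)
        also have "\<dots> = (\<Sum>j'\<in>J. if j' = j then \<Sum>t<N. real_of_int (k t) / sqrt S * h (j, t) else 0)"
          by (intro sum.cong refl) (auto simp: c_def)
        finally show ?thesis using that J by simp
      qed
      have \<xi>: "gauss_family M J \<xi>" unfolding \<xi>_def
      proof (rule gauss_family_linear[OF Z J])
        fix j l assume jl: "j \<in> J" "l \<in> J"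
        show "(\<Sum>i\<in>J \<times> {..<N}. c j i * c l i) = of_bool (j = l)"
        proof (cases "j = l")
          case True
          have "(\<Sum>i\<in>J \<times> {..<N}. c j i * c l i) = (\<Sum>t<N. (real_of_int (k t))\<^sup>2 / S)"
            unfolding row[OF jl(1)] using S True by (intro sum.cong refl) (auto simp: c_def power2_eq_square)
          also have "\<dots> = 1" using S by (simp add: S_def sum_divide_distrib[symmetric])
          finally show ?thesis using True by simp
        next
          case False
          then show ?thesis unfolding row[OF jl(1)] by (simp add: c_def)
        qed
      qed
      have f\<xi>: "f (\<lambda>t. of_int (k t)) \<omega> = S * (\<Sum>j\<in>J. (\<xi> j \<omega>)\<^sup>2)" for \<omega>
      proof -
        have "S * (\<Sum>j\<in>J. (\<xi> j \<omega>)\<^sup>2) = (\<Sum>j\<in>J. (sqrt S * \<xi> j \<omega>)\<^sup>2)"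
          using S by (simp add: sum_distrib_left power_mult_distrib)
        also have "\<dots> = (\<Sum>j\<in>J. (\<Sum>t<N. g (j, t) \<omega> * real_of_int (k t))\<^sup>2)"
        proof (intro sum.cong refl arg_cong[where f="\<lambda>x. x\<^sup>2"])
          fix j assume "j \<in> J"
          then show "sqrt S * \<xi> j \<omega> = (\<Sum>t<N. g (j, t) \<omega> * real_of_int (k t))"
            unfolding \<xi>_def row[OF \<open>j \<in> J\<close>] sum_distrib_left using S by (intro sum.cong refl) simp
        qed
        finally show ?thesis by (simp add: f_def)
      qed
      have "B k \<subseteq> {\<omega>\<in>space M. z / 4 < (\<Sum>j\<in>J. (\<xi> j \<omega>)\<^sup>2)}"
      proof
        fix \<omega> assume "\<omega> \<in> B k"
        then have w: "\<omega> \<in> space M" "z * real N < S * (\<Sum>j\<in>J. (\<xi> j \<omega>)\<^sup>2)" by (auto simp: B_def f\<xi>)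
        have "S * (\<Sum>j\<in>J. (\<xi> j \<omega>)\<^sup>2) \<le> 4 * real N * (\<Sum>j\<in>J. (\<xi> j \<omega>)\<^sup>2)"
          using S4 by (intro mult_right_mono sum_nonneg) auto
        with w have "z * real N < 4 * (\<Sum>j\<in>J. (\<xi> j \<omega>)\<^sup>2) * real N" by (simp add: mult_ac)
        then have "z < 4 * (\<Sum>j\<in>J. (\<xi> j \<omega>)\<^sup>2)" using N by simp
        with w show "\<omega> \<in> {\<omega>\<in>space M. z / 4 < (\<Sum>j\<in>J. (\<xi> j \<omega>)\<^sup>2)}" by simp
      qed
      moreover have "{\<omega>\<in>space M. z / 4 < (\<Sum>j\<in>J. (\<xi> j \<omega>)\<^sup>2)} \<in> sets M"
      proof -
        have [measurable]: "\<And>j. j \<in> J \<Longrightarrow> \<xi> j \<in> borel_measurable M" using gauss_familyD(3)[OF \<xi>] .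
        show ?thesis by measurable
      qed
      ultimately have "measure M (B k) \<le> measure M {\<omega>\<in>space M. z / 4 < (\<Sum>j\<in>J. (\<xi> j \<omega>)\<^sup>2)}"
        by (rule finite_measure_mono)
      also have "\<dots> \<le> exp (- (z / 4) / 4) * sqrt 2 ^ card J" by (rule chi_square_tail[OF \<xi>])
      finally show ?thesis by simp
    qed
  qed
  have "measure M Bad \<le> (\<Sum>k\<in>lattice_ball N. measure M (B k))"
    unfolding Bad_def using Bk by (intro finite_measure_subadditive_finite finite_lattice_ball) auto
  also have "\<dots> \<le> (\<Sum>k\<in>lattice_ball N. exp (- z / 16) * sqrt 2 ^ card J)" by (intro sum_mono PB)
  also have "\<dots> = real (card (lattice_ball N)) * (exp (- z / 16) * sqrt 2 ^ card J)" by simp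
  also have "\<dots> \<le> exp (6 * real N) * (exp (- z / 16) * exp (real (card J)))"
  proof (intro mult_mono card_lattice_ball_le mult_left_mono)
    have "sqrt 2 \<le> 2" by (rule real_le_lsqrt) simp_all
    also have "2 \<le> exp (1::real)" using exp_ge_add_one_self[of 1] by simp
    finally have "sqrt 2 ^ card J \<le> exp 1 ^ card J" by (intro power_mono) auto
    then show "sqrt 2 ^ card J \<le> exp (real (card J))" by (simp add: exp_of_nat_mult[symmetric])
  qed auto
  also have "\<dots> = exp (6 * real N - z / 16 + real (card J))" by (simp add: exp_add[symmetric] algebra_simps)
  also have "\<dots> \<le> exp (- real N)"
  proof -
    have "6 * real N - z / 16 + real (card J) \<le> - real N" unfolding z by (simp add: field_simps)
    then show ?thesis by (simp only: exp_le_cancel_iff)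
  qed
  finally have P: "measure M Bad \<le> exp (- real N)" .
  show ?thesis
  proof (rule that[OF _ P])
    show "Bad \<in> sets M" unfolding Bad_def using Bk by (intro sets.finite_UN finite_lattice_ball) auto
    fix \<omega> w assume \<omega>: "\<omega> \<in> space M - Bad"
    show "(\<Sum>j\<in>J. (\<Sum>t<N. g (j, t) \<omega> * w t)\<^sup>2) \<le> z * (\<Sum>t<N. (w t)\<^sup>2)"
    proof (cases "(\<Sum>t<N. (w t)\<^sup>2) = 0")
      case True
      then have "\<forall>t\<in>{..<N}. (w t)\<^sup>2 = 0" by (subst (asm) sum_nonneg_eq_0_iff) auto
      then show ?thesis using True by simp
    next
      case False
      define W where "W = (\<Sum>t<N. (w t)\<^sup>2)"
      have W: "0 < W" using False sum_nonneg[of "{..<N}" "\<lambda>t. (w t)\<^sup>2"] by (simp add: W_def less_le)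
      \<comment> \<open>The claim is homogeneous in \<open>w\<close>, so \<open>w\<close> is scaled
        to squared norm \<open>N\<close>, where rounding to integers costs only a constant
        factor.\<close>
      define s where "s = sqrt (real N / W)"
      have s: "s\<^sup>2 = real N / W" using W by (simp add: s_def)
      define u where "u t = s * w t" for t
      have uu: "(\<Sum>t<N. (u t)\<^sup>2) = real N"
      proof -
        have "(\<Sum>t<N. (u t)\<^sup>2) = s\<^sup>2 * W"
          by (simp only: u_def power_mult_distrib sum_distrib_left[symmetric] W_def)
        then show ?thesis using W by (simp add: s)
      qed
      obtain k where k: "\<forall>i<N. \<bar>of_int (k i) - u i\<bar> \<le> 1" "f u \<omega> \<le> f (\<lambda>t. of_int (k t)) \<omega>"
        using round_to_lattice[where N=N and u=u and J=J and a="\<lambda>j t. g (j, t) \<omega>"] unfolding f_def by blast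
      have sq: "(\<Sum>i<N. (real_of_int (k i))\<^sup>2) \<le> 4 * real N"
      proof -
        have "(\<Sum>i<N. (real_of_int (k i))\<^sup>2) \<le> (\<Sum>i<N. 2 * (of_int (k i) - u i)\<^sup>2 + 2 * (u i)\<^sup>2)"
        proof (intro sum_mono)
          fix i
          have "0 \<le> ((of_int (k i) - u i) - u i)\<^sup>2" by simp
          then show "(real_of_int (k i))\<^sup>2 \<le> 2 * (of_int (k i) - u i)\<^sup>2 + 2 * (u i)\<^sup>2"
            by (simp add: power2_eq_square algebra_simps)
        qed
        also have "\<dots> \<le> (\<Sum>i<N. 2 * 1 + 2 * (u i)\<^sup>2)"
          using k(1) by (intro sum_mono add_right_mono mult_left_mono) (auto simp: abs_square_le_1)
        also have "\<dots> = 4 * real N" using uu by (simp add: sum.distrib sum_distrib_left[symmetric])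
        finally show ?thesis .
      qed
      define k' where "k' = restrict k {..<N}"
      have "k' \<in> lattice_ball N"
      proof -
        have "real_of_int (\<Sum>i<N. (k i)\<^sup>2) \<le> real_of_int (4 * int N)" using sq by simp
        then have i: "(\<Sum>i<N. (k i)\<^sup>2) \<le> 4 * int N" by (simp only: of_int_le_iff)
        have "\<bar>k i\<bar> \<le> 4 * int N" if "i < N" for i
        proof -
          have "\<bar>k i\<bar> \<le> (k i)\<^sup>2"
          proof (cases "k i = 0")
            case False
            then have "1 \<le> \<bar>k i\<bar>" by simp
            then have "\<bar>k i\<bar> ^ 1 \<le> \<bar>k i\<bar> ^ 2" by (intro power_increasing) auto
            then show ?thesis by simp
          qed simp
          also have "\<dots> \<le> (\<Sum>i<N. (k i)\<^sup>2)" using that by (intro member_le_sum) auto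
          finally show ?thesis using i by simp
        qed
        then have "- 4 * int N \<le> k i \<and> k i \<le> 4 * int N" if "i < N" for i
          using abs_le_iff[of "k i" "4 * int N"] that by fastforce
        then show ?thesis using i by (auto simp: lattice_ball_def k'_def)
      qed
      moreover have "f (\<lambda>t. of_int (k' t)) \<omega> = f (\<lambda>t. of_int (k t)) \<omega>" by (simp add: f_def k'_def)
      ultimately have "f (\<lambda>t. of_int (k t)) \<omega> \<le> z * real N"
        using \<omega> by (fastforce simp: Bad_def B_def not_less)
      then have "f u \<omega> \<le> z * real N" using k(2) by simp
      moreover have "f u \<omega> = s\<^sup>2 * f w \<omega>"
        by (simp add: f_def u_def sum_distrib_left power_mult_distrib[symmetric] mult_ac)
      ultimately have "real N * f w \<omega> \<le> real N * (z * W)" using W s by (simp add: field_simps)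
      then show ?thesis using N by (simp add: f_def W_def)
    qed
  qed
qed

subsection \<open>Spiked Gaussian arrays\<close>

lemma sum_shift_atLeastLessThan: "(\<Sum>i=d..<p. f i) = (\<Sum>a<p - d. f (d + a))" for d p :: nat
  by (rule sum.reindex_bij_witness[where i="\<lambda>a. d + a" and j="\<lambda>i. i - d"]) auto

text \<open>Errors of \<open>N / (2 * d)\<close> per entry of a \<open>d\<close> by \<open>d\<close>
  matrix amount to at most \<open>N / 2\<close> in operator norm, so the spike Gram matrix stays
  above \<open>N / 2\<close> times the identity.\<close>

definition well_conditioned :: "nat \<Rightarrow> nat \<Rightarrow> (nat \<times> nat \<Rightarrow> real) \<Rightarrow> bool" where
  "well_conditioned d N y \<longleftrightarrow> (\<forall>k<d. \<forall>l<d. \<bar>rdot N y k l - real N * of_bool (k = l)\<bar> \<le> real N / (2 * real d))"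

lemma well_conditioned_lower:
  assumes "well_conditioned d N y" "0 < d"
  shows "real N / 2 * (\<Sum>k<d. (v k)\<^sup>2) \<le> (\<Sum>t<N. (\<Sum>k<d. v k * y (k, t))\<^sup>2)"
proof -
  have "(\<Sum>t<N. (\<Sum>k<d. v k * y (k, t))\<^sup>2) = (\<Sum>t<N. \<Sum>k<d. \<Sum>l<d. v k * v l * (y (k, t) * y (l, t)))"
    by (simp add: power2_eq_square sum_product mult_ac)
  also have "\<dots> = (\<Sum>k<d. \<Sum>t<N. \<Sum>l<d. v k * v l * (y (k, t) * y (l, t)))" by (rule sum.swap)
  also have "\<dots> = (\<Sum>k<d. \<Sum>l<d. \<Sum>t<N. v k * v l * (y (k, t) * y (l, t)))" by (intro sum.cong refl sum.swap)
  also have "\<dots> = (\<Sum>k<d. \<Sum>l<d. v k * v l * rdot N y k l)" by (simp add: rdot_def sum_distrib_left)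
  finally have eq: "(\<Sum>t<N. (\<Sum>k<d. v k * y (k, t))\<^sup>2) = (\<Sum>k<d. \<Sum>l<d. v k * v l * rdot N y k l)" .
  have "(\<Sum>k<d. \<Sum>l<d. (if l = k then real N * (v k)\<^sup>2 else 0) - \<bar>v k\<bar> * \<bar>v l\<bar> * (real N / (2 * real d))) \<le> (\<Sum>k<d. \<Sum>l<d. v k * v l * rdot N y k l)"
  proof (intro sum_mono)
    fix k l assume kl: "k \<in> {..<d}" "l \<in> {..<d}"
    have "\<bar>v k * v l * (rdot N y k l - real N * of_bool (k = l))\<bar> \<le> \<bar>v k\<bar> * \<bar>v l\<bar> * (real N / (2 * real d))"
      unfolding abs_mult using assms kl by (intro mult_left_mono) (auto simp: well_conditioned_def)
    then have "- (\<bar>v k\<bar> * \<bar>v l\<bar> * (real N / (2 * real d))) \<le> v k * v l * (rdot N y k l - real N * of_bool (k = l))" by linarith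
    then show "(if l = k then real N * (v k)\<^sup>2 else 0) - \<bar>v k\<bar> * \<bar>v l\<bar> * (real N / (2 * real d)) \<le> v k * v l * rdot N y k l"
      by (cases "k = l") (auto simp: right_diff_distrib power2_eq_square mult_ac)
  qed
  also have "(\<Sum>k<d. \<Sum>l<d. (if l = k then real N * (v k)\<^sup>2 else 0) - \<bar>v k\<bar> * \<bar>v l\<bar> * (real N / (2 * real d))) =
      real N * (\<Sum>k<d. (v k)\<^sup>2) - (\<Sum>k<d. \<bar>v k\<bar>)\<^sup>2 * (real N / (2 * real d))"
  proof -
    define c where "c = real N / (2 * real d)"
    have "(\<Sum>k<d. \<bar>v k\<bar>)\<^sup>2 * c = (\<Sum>k<d. \<Sum>l<d. \<bar>v k\<bar> * \<bar>v l\<bar> * c)"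
      by (subst power2_eq_square, subst sum_product) (simp add: sum_distrib_right)
    then show ?thesis unfolding c_def[symmetric] by (simp add: sum_subtractf sum_distrib_left)
  qed
  finally have 1: "real N * (\<Sum>k<d. (v k)\<^sup>2) - (\<Sum>k<d. \<bar>v k\<bar>)\<^sup>2 * (real N / (2 * real d)) \<le> (\<Sum>t<N. (\<Sum>k<d. v k * y (k, t))\<^sup>2)"
    unfolding eq .
  have "(\<Sum>k<d. \<bar>v k\<bar>)\<^sup>2 \<le> (\<Sum>k<d. (v k)\<^sup>2) * real d"
    using Cauchy_Schwarz_ineq_sum[of "\<lambda>k. \<bar>v k\<bar>" "\<lambda>_. 1" "{..<d}"] by simp
  then have "(\<Sum>k<d. \<bar>v k\<bar>)\<^sup>2 * (real N / (2 * real d)) \<le> ((\<Sum>k<d. (v k)\<^sup>2) * real d) * (real N / (2 * real d))"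
    by (intro mult_right_mono) auto
  also have "\<dots> = real N / 2 * (\<Sum>k<d. (v k)\<^sup>2)" using assms(2) by simp
  finally show ?thesis using 1 by simp
qed

lemma (in prob_space) prob_square_tail:
  fixes f :: "'a \<Rightarrow> real"
  assumes [measurable]: "f \<in> borel_measurable M" and f: "integrable M (\<lambda>\<omega>. (f \<omega>)\<^sup>2)" and a: "0 < a"
  shows "prob {\<omega>\<in>space M. a < \<bar>f \<omega>\<bar>} \<le> expectation (\<lambda>\<omega>. (f \<omega>)\<^sup>2) / a\<^sup>2"
proof -
  have "prob {\<omega>\<in>space M. a < \<bar>f \<omega>\<bar>} \<le> prob {\<omega>\<in>space M. a\<^sup>2 \<le> \<bar>(f \<omega>)\<^sup>2\<bar>}"
  proof (rule finite_measure_mono)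
    show "{\<omega>\<in>space M. a < \<bar>f \<omega>\<bar>} \<subseteq> {\<omega>\<in>space M. a\<^sup>2 \<le> \<bar>(f \<omega>)\<^sup>2\<bar>}"
    proof -
      have "a\<^sup>2 \<le> \<bar>(f \<omega>)\<^sup>2\<bar>" if "a < \<bar>f \<omega>\<bar>" for \<omega>
        using power_mono[of a "\<bar>f \<omega>\<bar>" 2] that a by simp
      then show ?thesis by blast
    qed
  qed measurable
  also have "\<dots> \<le> expectation (\<lambda>\<omega>. \<bar>(f \<omega>)\<^sup>2\<bar>) / a\<^sup>2"
    using f a by (intro prob_abs_ge_le) auto
  finally show ?thesis by simp
qed

text \<open>Each entry has variance at most \<open>2 * N\<close>; Chebyshev's inequality at level
  \<open>N / (2 * d)\<close> costs \<open>8 * d^2 / N\<close> for each of the \<open>d^2\<close>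
  entries.\<close>

lemma prob_not_well_conditioned:
  assumes Z: "gauss_family M ({..<d} \<times> {..<N}) g" and d: "0 < d" and N: "0 < N"
  shows "{\<omega>\<in>space M. \<not> well_conditioned d N (\<lambda>i. g i \<omega>)} \<in> sets M"
    "measure M {\<omega>\<in>space M. \<not> well_conditioned d N (\<lambda>i. g i \<omega>)} \<le> 8 * real d ^ 4 / real N"
proof -
  note G = gauss_familyD[OF Z]
  interpret prob_space M by fact
  define D where "D k l \<omega> = rdot N (\<lambda>i. g i \<omega>) k l - real N * of_bool (k = l)" for k l \<omega>
  let ?a = "real N / (2 * real d)"
  have a: "0 < ?a" using d N by simp
  have mD: "D k l \<in> borel_measurable M" if "k < d" "l < d" for k l
  proof -
    have "(\<lambda>\<omega>. rdot N (\<lambda>i. g i \<omega>) k l) \<in> borel_measurable M" using G(3) that by (intro measurable_rdot) auto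
    then show ?thesis unfolding D_def by measurable
  qed
  have D2: "integrable M (\<lambda>\<omega>. (D k l \<omega>)\<^sup>2) \<and> expectation (\<lambda>\<omega>. (D k l \<omega>)\<^sup>2) \<le> 2 * real N" if "k < d" "l < d" for k l
  proof (cases "k = l")
    case True
    have "D k l = (\<lambda>\<omega>. \<Sum>t<N. 1 * ((g (k, t) \<omega>)\<^sup>2 - 1))"
      using True by (simp add: D_def fun_eq_iff rdot_def sum_subtractf power2_eq_square)
    then show ?thesis using gauss_family_chi_square[OF gauss_array_row[OF Z that(1)], of "\<lambda>_. 1"] by simp
  next
    case False
    then show ?thesis using gauss_array_rdot[OF Z that False] by (simp add: D_def)
  qed
  define B where "B k l = {\<omega>\<in>space M. ?a < \<bar>D k l \<omega>\<bar>}" for k l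
  have mB: "B k l \<in> sets M" if "k < d" "l < d" for k l
    using mD[OF that] unfolding B_def by measurable
  have eq: "{\<omega>\<in>space M. \<not> well_conditioned d N (\<lambda>i. g i \<omega>)} = (\<Union>kl\<in>{..<d}\<times>{..<d}. B (fst kl) (snd kl))"
  proof -
    have "\<not> well_conditioned d N (\<lambda>i. g i \<omega>) \<longleftrightarrow> (\<exists>k<d. \<exists>l<d. ?a < \<bar>D k l \<omega>\<bar>)" for \<omega>
      unfolding well_conditioned_def D_def by (simp only: not_all not_imp not_le)
    then show ?thesis by (auto simp: B_def; blast)
  qed
  show "{\<omega>\<in>space M. \<not> well_conditioned d N (\<lambda>i. g i \<omega>)} \<in> sets M"
    unfolding eq using mB by (intro sets.finite_UN) auto
  have "measure M (\<Union>kl\<in>{..<d}\<times>{..<d}. B (fst kl) (snd kl)) \<le> (\<Sum>kl\<in>{..<d}\<times>{..<d}. measure M (B (fst kl) (snd kl)))"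
    using mB by (intro finite_measure_subadditive_finite) auto
  also have "\<dots> \<le> (\<Sum>kl\<in>{..<d}\<times>{..<d}. 8 * (real d)\<^sup>2 / real N)"
  proof (intro sum_mono)
    fix kl assume "kl \<in> {..<d} \<times> {..<d}"
    then have kl: "fst kl < d" "snd kl < d" by auto
    have "measure M (B (fst kl) (snd kl)) \<le> expectation (\<lambda>\<omega>. (D (fst kl) (snd kl) \<omega>)\<^sup>2) / ?a\<^sup>2"
      unfolding B_def using mD[OF kl] D2[OF kl] a by (intro prob_square_tail) auto
    also have "\<dots> \<le> 2 * real N / ?a\<^sup>2" using D2[OF kl] by (intro divide_right_mono) auto
    also have "\<dots> = 8 * (real d)\<^sup>2 / real N" using d N by (simp add: field_simps power2_eq_square)
    finally show "measure M (B (fst kl) (snd kl)) \<le> 8 * (real d)\<^sup>2 / real N" .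
  qed
  also have "\<dots> = 8 * real d ^ 4 / real N" by (simp add: power2_eq_square power4_eq_xxxx)
  finally show "measure M {\<omega>\<in>space M. \<not> well_conditioned d N (\<lambda>i. g i \<omega>)} \<le> 8 * real d ^ 4 / real N" unfolding eq .
qed

text \<open>The noise block occupies the rows \<open>d..<p\<close>; its Gram matrix is formed from the columns
  \<open>d..<N\<close> only.\<close>

definition noise_block :: "nat \<Rightarrow> (nat \<times> nat \<Rightarrow> real) \<Rightarrow> nat \<times> nat \<Rightarrow> real" where
  "noise_block d z = (\<lambda>(a, t). z (d + a, d + t))"

text \<open>The quantity \<open>C2\<close> of the perturbation bound: the squared Frobenius norm of
  the block of the noise Gram matrix that joins the first \<open>d\<close> columns to the
  others.\<close>

definition cross_energy :: "nat \<Rightarrow> nat \<Rightarrow> nat \<Rightarrow> (nat \<times> nat \<Rightarrow> real) \<Rightarrow> real" where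
  "cross_energy d p N z = (\<Sum>s<d. \<Sum>t=d..<N. (\<Sum>i=d..<p. z (i, s) * z (i, t))\<^sup>2)"

text \<open>The cross energy has mean \<open>d * q * m\<close> for \<open>q = p - d\<close> and
  \<open>m = N - d\<close>, and is controlled by Markov's inequality only. Its level
  \<open>R\<close> therefore stays free until the accuracy of the final estimate is fixed.\<close>

definition typical_noise :: "nat \<Rightarrow> nat \<Rightarrow> nat \<Rightarrow> real \<Rightarrow> real \<Rightarrow> (nat \<times> nat \<Rightarrow> real) \<Rightarrow> bool" where
  "typical_noise d p N R \<epsilon> z \<longleftrightarrow>
     (\<forall>w. (\<Sum>i=d..<p. (\<Sum>t<N. z (i, t) * w t)\<^sup>2) \<le> 112 * (real N + real (p - d)) * (\<Sum>t<N. (w t)\<^sup>2)) \<and>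
     cross_energy d p N z \<le> R * (real (p - d) * real (N - d)) \<and>
     \<bar>gram_tr1 (p - d) (N - d) (noise_block d z) / (real (p - d) * real (N - d)) - 1\<bar> \<le> \<epsilon>"

lemma gauss_noise_block:
  fixes g :: "nat \<times> nat \<Rightarrow> 'a \<Rightarrow> real"
  assumes "gauss_family M ({d..<p} \<times> {..<N}) g"
  shows "gauss_family M ({..<p - d} \<times> {..<N - d}) (\<lambda>(a, t). g (d + a, d + t))"
proof -
  have "gauss_family M ({..<p - d} \<times> {..<N - d}) (\<lambda>i. g ((\<lambda>(a, t). (d + a, d + t)) i))"
    by (rule gauss_family_reindex[OF assms]) (auto simp: inj_on_def)
  then show ?thesis by (simp add: case_prod_beta')
qed

text \<open>One summand per condition: the operator norm, Markov's inequality for the cross energy,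
  Chebyshev's inequality for the trace.\<close>

lemma prob_not_typical_noise:
  fixes g :: "nat \<times> nat \<Rightarrow> 'a \<Rightarrow> real"
  assumes Z: "gauss_family M ({d..<p} \<times> {..<N}) g" and d: "d < p" "d < N" and R: "0 < R" and \<epsilon>: "0 < \<epsilon>"
  obtains Bad where "Bad \<in> sets M"
    "measure M Bad \<le> exp (- real N) + real d / R + 2 / (real (p - d) * real (N - d) * \<epsilon>\<^sup>2)"
    "\<And>\<omega>. \<omega> \<in> space M - Bad \<Longrightarrow> typical_noise d p N R \<epsilon> (\<lambda>i. g i \<omega>)"
proof -
  note G = gauss_familyD[OF Z]
  interpret prob_space M by fact
  let ?q = "real (p - d)" and ?m = "real (N - d)"
  have qm: "0 < ?q" "0 < ?m" using d by auto
  obtain B1 where B1: "B1 \<in> sets M" "measure M B1 \<le> exp (- real N)"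
    "\<And>\<omega> w. \<omega> \<in> space M - B1 \<Longrightarrow> (\<Sum>i\<in>{d..<p}. (\<Sum>t<N. g (i, t) \<omega> * w t)\<^sup>2) \<le> 112 * (real N + real (p - d)) * (\<Sum>t<N. (w t)\<^sup>2)"
    using gauss_array_opnorm[OF Z, of "112 * (real N + real (p - d))"] d by auto
  define C where "C \<omega> = cross_energy d p N (\<lambda>i. g i \<omega>)" for \<omega>
  have C1: "integrable M (\<lambda>\<omega>. (\<Sum>i=d..<p. g (i, s) \<omega> * g (i, t) \<omega>)\<^sup>2)"
    "expectation (\<lambda>\<omega>. (\<Sum>i=d..<p. g (i, s) \<omega> * g (i, t) \<omega>)\<^sup>2) = ?q" if "s < d" "t \<in> {d..<N}" for s t
  proof -
    show "integrable M (\<lambda>\<omega>. (\<Sum>i=d..<p. g (i, s) \<omega> * g (i, t) \<omega>)\<^sup>2)"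
      by (rule gauss_family_inner_product(1)[OF Z]) (use that d in \<open>auto simp: inj_on_def\<close>)
    have "expectation (\<lambda>\<omega>. (\<Sum>i=d..<p. g (i, s) \<omega> * g (i, t) \<omega>)\<^sup>2) = real (card {d..<p})"
      by (rule gauss_family_inner_product(2)[OF Z]) (use that d in \<open>auto simp: inj_on_def\<close>)
    then show "expectation (\<lambda>\<omega>. (\<Sum>i=d..<p. g (i, s) \<omega> * g (i, t) \<omega>)\<^sup>2) = ?q" by simp
  qed
  have C2: "integrable M (\<lambda>\<omega>. \<Sum>t=d..<N. (\<Sum>i=d..<p. g (i, s) \<omega> * g (i, t) \<omega>)\<^sup>2)"
    "expectation (\<lambda>\<omega>. \<Sum>t=d..<N. (\<Sum>i=d..<p. g (i, s) \<omega> * g (i, t) \<omega>)\<^sup>2) = ?m * ?q" if "s \<in> {..<d}" for s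
  proof -
    have s: "s < d" using that by simp
    show "integrable M (\<lambda>\<omega>. \<Sum>t=d..<N. (\<Sum>i=d..<p. g (i, s) \<omega> * g (i, t) \<omega>)\<^sup>2)"
      by (rule Bochner_Integration.integrable_sum) (rule C1(1)[OF s])
    have "expectation (\<lambda>\<omega>. \<Sum>t=d..<N. (\<Sum>i=d..<p. g (i, s) \<omega> * g (i, t) \<omega>)\<^sup>2) = (\<Sum>t=d..<N. expectation (\<lambda>\<omega>. (\<Sum>i=d..<p. g (i, s) \<omega> * g (i, t) \<omega>)\<^sup>2))"
      by (rule Bochner_Integration.integral_sum) (rule C1(1)[OF s])
    also have "\<dots> = (\<Sum>t=d..<N. ?q)" by (intro sum.cong refl C1(2)[OF s])
    finally show "expectation (\<lambda>\<omega>. \<Sum>t=d..<N. (\<Sum>i=d..<p. g (i, s) \<omega> * g (i, t) \<omega>)\<^sup>2) = ?m * ?q" by simp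
  qed
  have iC: "integrable M C" unfolding C_def cross_energy_def
    by (rule Bochner_Integration.integrable_sum) (rule C2(1))
  have "expectation C = (\<Sum>s<d. expectation (\<lambda>\<omega>. \<Sum>t=d..<N. (\<Sum>i=d..<p. g (i, s) \<omega> * g (i, t) \<omega>)\<^sup>2))"
    unfolding C_def cross_energy_def by (rule Bochner_Integration.integral_sum) (rule C2(1))
  also have "\<dots> = (\<Sum>s<d. ?m * ?q)" by (intro sum.cong refl C2(2))
  finally have EC: "expectation C = real d * (?m * ?q)" by simp
  have C_nn: "0 \<le> C \<omega>" for \<omega> by (simp add: C_def cross_energy_def sum_nonneg)
  have [measurable]: "C \<in> borel_measurable M" using iC by simp
  define B2 where "B2 = {\<omega>\<in>space M. R * (?q * ?m) \<le> \<bar>C \<omega>\<bar>}"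
  have B2: "B2 \<in> sets M" unfolding B2_def by measurable
  have "measure M B2 \<le> expectation (\<lambda>\<omega>. \<bar>C \<omega>\<bar>) / (R * (?q * ?m))"
    unfolding B2_def using iC R qm by (intro prob_abs_ge_le) auto
  also have "expectation (\<lambda>\<omega>. \<bar>C \<omega>\<bar>) = real d * (?m * ?q)" using C_nn EC by simp
  also have "real d * (?m * ?q) / (R * (?q * ?m)) = real d / R" using qm by simp
  finally have PB2: "measure M B2 \<le> real d / R" .
  define h where "h = (\<lambda>(a, t). g (d + a, d + t))"
  have h: "gauss_family M ({..<p - d} \<times> {..<N - d}) h" unfolding h_def by (rule gauss_noise_block[OF Z])
  define e where "e \<omega> = (\<Sum>i\<in>{..<p - d} \<times> {..<N - d}. 1 * ((h i \<omega>)\<^sup>2 - 1))" for \<omega>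
  have e: "integrable M (\<lambda>\<omega>. (e \<omega>)\<^sup>2)" "expectation (\<lambda>\<omega>. (e \<omega>)\<^sup>2) = 2 * (?q * ?m)"
    using gauss_family_chi_square[OF h, of "\<lambda>_. 1"] by (simp_all add: e_def)
  have [measurable]: "e \<in> borel_measurable M" unfolding e_def using gauss_familyD(3)[OF h] by measurable
  have tr: "gram_tr1 (p - d) (N - d) (noise_block d (\<lambda>i. g i \<omega>)) = ?q * ?m + e \<omega>" for \<omega>
    by (simp add: gram_tr1_def rdot_def e_def h_def noise_block_def sum.cartesian_product case_prod_beta sum_subtractf power2_eq_square)
  define B3 where "B3 = {\<omega>\<in>space M. \<epsilon> * (?q * ?m) < \<bar>e \<omega>\<bar>}"
  have B3: "B3 \<in> sets M" unfolding B3_def by measurable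
  have "measure M B3 \<le> expectation (\<lambda>\<omega>. (e \<omega>)\<^sup>2) / (\<epsilon> * (?q * ?m))\<^sup>2"
    unfolding B3_def using e \<epsilon> qm by (intro prob_square_tail) auto
  also have "\<dots> = 2 / (?q * ?m * \<epsilon>\<^sup>2)" 
  proof -
    have "2 * (a * b) / (\<epsilon> * (a * b))\<^sup>2 = 2 / (a * b * \<epsilon>\<^sup>2)" if "0 < a" "0 < b" for a b
      using that \<epsilon> by (simp add: power2_eq_square)
    from this[OF qm] show ?thesis unfolding e(2) .
  qed
  finally have PB3: "measure M B3 \<le> 2 / (?q * ?m * \<epsilon>\<^sup>2)" .
  have "measure M (B1 \<union> B2 \<union> B3) \<le> measure M (B1 \<union> B2) + measure M B3"
    using B1(1) B2 B3 by (intro measure_Un_le) auto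
  moreover have "measure M (B1 \<union> B2) \<le> measure M B1 + measure M B2"
    using B1(1) B2 by (intro measure_Un_le) auto
  ultimately have "measure M (B1 \<union> B2 \<union> B3) \<le> measure M B1 + measure M B2 + measure M B3" by linarith
  also note add_mono[OF add_mono[OF B1(2) PB2] PB3]
  finally have P: "measure M (B1 \<union> B2 \<union> B3) \<le> exp (- real N) + real d / R + 2 / (?q * ?m * \<epsilon>\<^sup>2)" .
  show ?thesis
  proof (rule that[OF _ P])
    show "B1 \<union> B2 \<union> B3 \<in> sets M" using B1(1) B2 B3 by auto
    fix \<omega> assume \<omega>: "\<omega> \<in> space M - (B1 \<union> B2 \<union> B3)"
    have "\<bar>(?q * ?m + e \<omega>) / (?q * ?m) - 1\<bar> = \<bar>e \<omega>\<bar> / (?q * ?m)"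
      using qm by (simp add: add_divide_distrib)
    also have "\<dots> \<le> \<epsilon>" using \<omega> qm by (auto simp: B3_def not_less pos_divide_le_eq)
    finally have "\<bar>(?q * ?m + e \<omega>) / (?q * ?m) - 1\<bar> \<le> \<epsilon>" .
    moreover have "cross_energy d p N (\<lambda>i. g i \<omega>) \<le> R * (?q * ?m)"
    proof -
      have "\<not> R * (?q * ?m) \<le> \<bar>C \<omega>\<bar>" using \<omega> unfolding B2_def by blast
      then have "\<bar>C \<omega>\<bar> < R * (?q * ?m)" by (simp only: not_le)
      from order_trans[OF abs_ge_self less_imp_le[OF this]] show ?thesis unfolding C_def .
    qed
    moreover have "\<forall>w. (\<Sum>i=d..<p. (\<Sum>t<N. g (i, t) \<omega> * w t)\<^sup>2) \<le> 112 * (real N + real (p - d)) * (\<Sum>t<N. (w t)\<^sup>2)"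
      using B1(3)[of \<omega>] \<omega> by auto
    ultimately show "typical_noise d p N R \<epsilon> (\<lambda>i. g i \<omega>)" unfolding typical_noise_def tr by blast
  qed
qed

section \<open>Deterministic comparison of the spiked statistic with the noise statistic\<close>

text \<open>Spike rows and noise rows are separate arguments so that the former can be frozen; for
  the sample both are the same array. The weight \<open>l i\<close> will be the spike eigenvalue
  divided by \<open>\<sigma>^2\<close>.\<close>

definition spiked_rows :: "nat \<Rightarrow> (nat \<Rightarrow> real) \<Rightarrow> (nat \<times> nat \<Rightarrow> real) \<Rightarrow> (nat \<times> nat \<Rightarrow> real) \<Rightarrow> nat \<Rightarrow> nat \<Rightarrow> real" where
  "spiked_rows d l y z i t = (if i < d then sqrt (l i) * y (i, t) else z (i, t))"

definition gram_mat :: "nat \<Rightarrow> (nat \<Rightarrow> nat \<Rightarrow> real) \<Rightarrow> nat \<Rightarrow> nat \<Rightarrow> real" where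
  "gram_mat N X i j = (\<Sum>t<N. X i t * X j t)"

text \<open>The statistic of the theorem for \<open>N = n - 1\<close>. The ratio of power sums is
  invariant under scaling of the matrix, and the indices \<open>d..<p\<close> belong to the
  \<open>p - d\<close> smallest eigenvalues.\<close>

definition spike_stat :: "nat \<Rightarrow> nat \<Rightarrow> nat \<Rightarrow> (nat \<Rightarrow> nat \<Rightarrow> real) \<Rightarrow> real" where
  "spike_stat d p N A = real (N - d) * (real (p - d) * (\<Sum>k=d..<p. (eigs_desc p A ! k)\<^sup>2) / (\<Sum>k=d..<p. eigs_desc p A ! k)\<^sup>2 - 1) - real (p - d)"

lemma symmetric_gram_mat: "symmetric_mat p (gram_mat N X)"
  by (simp add: symmetric_mat_def gram_mat_def mult.commute)

definition rotate_cols :: "nat \<Rightarrow> (nat \<Rightarrow> nat \<Rightarrow> real) \<Rightarrow> (nat \<times> nat \<Rightarrow> real) \<Rightarrow> nat \<times> nat \<Rightarrow> real" where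
  "rotate_cols N W z = (\<lambda>(i, t). \<Sum>s<N. W t s * z (i, s))"

text \<open>\<open>F\<close> times a factor close to \<open>1\<close> equals \<open>V\<close> up to
  small errors. As \<open>F\<close> may be large, the two are compared through a fixed threshold:
  the factor moves \<open>x\<close> by at most \<open>8 * \<bar>x\<bar> * \<epsilon>\<close>, and
  the other errors total at most \<open>454 * \<epsilon>\<close>.\<close>

lemma stat_sandwich_algebra:
  fixes x \<epsilon> \<delta> u v \<kappa>1 \<kappa>2 q m F V :: real
  assumes F: "F * (u + \<kappa>1)\<^sup>2 = V + \<kappa>2 - (m + q) * (2 * u * \<kappa>1 + \<kappa>1\<^sup>2)"
    and u: "\<bar>u - 1\<bar> \<le> \<epsilon>" and \<epsilon>: "0 < \<epsilon>" "\<epsilon> \<le> 1 / 4" "(8 * \<bar>x\<bar> + 600) * \<epsilon> \<le> \<delta>"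
    and k1: "(m + q) * \<bar>\<kappa>1\<bar> \<le> \<epsilon>" and mq: "1 \<le> m + q" and k2: "\<bar>\<kappa>2\<bar> \<le> 450 * \<epsilon>"
  shows "F \<le> x \<Longrightarrow> V \<le> x + \<delta>" and "V \<le> x - \<delta> \<Longrightarrow> F \<le> x"
proof -
  let ?D = "(u + \<kappa>1)\<^sup>2"
  have "1 * \<bar>\<kappa>1\<bar> \<le> (m + q) * \<bar>\<kappa>1\<bar>" using mq by (intro mult_right_mono) auto
  then have k: "\<bar>\<kappa>1\<bar> \<le> \<epsilon>" using k1 by simp
  have "1 / 2 \<le> u + \<kappa>1" using u k \<epsilon> by linarith
  then have D: "0 < ?D" by simp
  have "\<bar>?D - 1\<bar> = \<bar>u + \<kappa>1 - 1\<bar> * \<bar>u + \<kappa>1 + 1\<bar>"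
    unfolding abs_mult[symmetric] by (simp add: power2_eq_square algebra_simps)
  also have "\<dots> \<le> (2 * \<epsilon>) * 4" using u k \<epsilon> by (intro mult_mono) linarith+
  finally have "\<bar>x\<bar> * \<bar>?D - 1\<bar> \<le> \<bar>x\<bar> * (8 * \<epsilon>)" by (intro mult_left_mono) auto
  then have xD: "\<bar>x * ?D - x\<bar> \<le> 8 * \<bar>x\<bar> * \<epsilon>"
    by (simp add: abs_mult[symmetric] right_diff_distrib mult_ac)
  have "\<bar>(m + q) * (2 * u * \<kappa>1 + \<kappa>1\<^sup>2)\<bar> = ((m + q) * \<bar>\<kappa>1\<bar>) * \<bar>2 * u + \<kappa>1\<bar>"
  proof -
    have "(m + q) * (2 * u * \<kappa>1 + \<kappa>1\<^sup>2) = (m + q) * \<kappa>1 * (2 * u + \<kappa>1)"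
      by (simp add: power2_eq_square algebra_simps)
    then show ?thesis using mq by (simp add: abs_mult)
  qed
  also have "\<dots> \<le> \<epsilon> * 4" using k1 u k \<epsilon> by (intro mult_mono) linarith+
  finally have kk: "\<bar>\<kappa>2 - (m + q) * (2 * u * \<kappa>1 + \<kappa>1\<^sup>2)\<bar> \<le> 454 * \<epsilon>" using k2 by linarith
  have d: "8 * \<bar>x\<bar> * \<epsilon> + 600 * \<epsilon> \<le> \<delta>" using \<epsilon>(3) by (simp add: distrib_right)
  show "V \<le> x + \<delta>" if "F \<le> x"
  proof -
    have "F * ?D \<le> x * ?D" using that D by (intro mult_right_mono) auto
    then show ?thesis using F xD kk d \<epsilon>(1) by linarith
  qed
  show "F \<le> x" if "V \<le> x - \<delta>"
  proof -
    have "F * ?D \<le> x * ?D" using that F xD kk d \<epsilon>(1) by linarith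
    then show ?thesis using D by (simp add: mult_le_cancel_right)
  qed
qed

text \<open>Rotating the columns puts the spikes into the first \<open>d\<close> of them and
  preserves the row Gram matrix, so the perturbation bound applies with noise level
  \<open>112 * (N + q)\<close> and spike level \<open>lam * N / 2\<close>. The relative leakage
  \<open>\<kappa>\<close> is at most \<open>8 * d * R / (lam * N)\<close>; the statistic amplifies
  it by a factor of order \<open>N + q\<close>, and the second smallness condition keeps
  \<open>(N + q) * \<kappa>\<close> below \<open>\<epsilon>\<close>.\<close>

lemma spike_stat_sandwich:
  assumes d: "0 < d" "d < p" "d < N" and lam: "0 < lam" "\<And>k. k < d \<Longrightarrow> lam \<le> l k"
    and y: "well_conditioned d N y"
    and W: "orthonormal N W" "\<And>k t. k < d \<Longrightarrow> d \<le> t \<Longrightarrow> t < N \<Longrightarrow> dotp N (W t) (\<lambda>s. y (k, s)) = 0"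
    and z: "typical_noise d p N R \<epsilon> (rotate_cols N W z)" and R: "0 \<le> R"
    and \<epsilon>: "0 < \<epsilon>" "\<epsilon> \<le> 1 / 4" "(8 * \<bar>x\<bar> + 600) * \<epsilon> \<le> \<delta>"
    and small: "448 * (real N + real (p - d)) \<le> lam * real N"
      "8 * real d * R * (real N + real (p - d)) \<le> \<epsilon> * (lam * real N)"
  defines "F \<equiv> spike_stat d p N (gram_mat N (spiked_rows d l y z))"
    and "V \<equiv> gram_stat (p - d) (N - d) (noise_block d (rotate_cols N W z))"
  shows "F \<le> x \<Longrightarrow> V \<le> x + \<delta>" and "V \<le> x - \<delta> \<Longrightarrow> F \<le> x"
proof -
  define q where "q = real (p - d)"
  define m where "m = real (N - d)"
  have qm: "1 \<le> q" "1 \<le> m" "m \<le> real N" using d by (auto simp: q_def m_def)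
  then have qm': "q \<noteq> 0" "m \<noteq> 0" by auto
  define X where "X = spiked_rows d l y z"
  \<comment> \<open>The rows in coordinates along the basis \<open>W\<close>; spike rows vanish from
    column \<open>d\<close> on.\<close>
  define X' where "X' i t = dotp N (W t) (X i)" for i t
  define A where "A = gram_mat N X"
  obtain U \<phi> where es: "eigensystem p A U \<phi>"
    using ex_eigensystem[OF symmetric_gram_mat] unfolding A_def by blast
  have low_row: "X' k t = sqrt (l k) * dotp N (W t) (\<lambda>s. y (k, s))" if "k < d" for k t
    using that by (simp add: X'_def X_def dotp_def spiked_rows_def sum_distrib_left mult_ac)
  have high_row: "X' i t = rotate_cols N W z (i, t)" if "d \<le> i" for i t
    using that by (simp add: X'_def X_def dotp_def spiked_rows_def rotate_cols_def)
  let ?zz = "112 * (real N + q)" and ?lw = "lam * real N / 2"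
  note tz = z[unfolded typical_noise_def]
  have N0: "0 < real N" using d by simp
  have h1: "A i j = (\<Sum>t<N. X' i t * X' j t)" for i j
    using orthonormal_Parseval[OF W(1), of "X i" "X j"] by (simp add: A_def gram_mat_def X'_def dotp_def)
  have h2: "X' k t = 0" if "k < d" "d \<le> t" "t < N" for k t using W(2)[OF that] low_row[OF that(1)] by simp
  have h3: "(\<Sum>i=d..<p. (\<Sum>t<N. X' i t * w t)\<^sup>2) \<le> ?zz * dotp N w w" for w
  proof -
    have "(\<Sum>i=d..<p. (\<Sum>t<N. X' i t * w t)\<^sup>2) = (\<Sum>i=d..<p. (\<Sum>t<N. rotate_cols N W z (i, t) * w t)\<^sup>2)"
      using high_row by (intro sum.cong refl) auto
    then show ?thesis using tz by (simp add: dotp_def power2_eq_square q_def)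
  qed
  have h4: "?lw * (\<Sum>k<d. (u k)\<^sup>2) \<le> (\<Sum>t<N. (\<Sum>k<d. u k * X' k t)\<^sup>2)" for u
  proof -
    have "(\<Sum>t<N. (\<Sum>k<d. u k * X' k t)\<^sup>2) = (\<Sum>t<N. (dotp N (W t) (\<lambda>s. \<Sum>k<d. u k * X k s))\<^sup>2)"
      unfolding X'_def dotp_linear ..
    also have "\<dots> = dotp N (\<lambda>s. \<Sum>k<d. u k * X k s) (\<lambda>s. \<Sum>k<d. u k * X k s)"
      unfolding orthonormal_Parseval[OF W(1), of "\<lambda>s. \<Sum>k<d. u k * X k s" "\<lambda>s. \<Sum>k<d. u k * X k s"] by (simp add: power2_eq_square)
    also have "\<dots> = (\<Sum>t<N. (\<Sum>k<d. (u k * sqrt (l k)) * y (k, t))\<^sup>2)"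
      by (simp add: dotp_def X_def spiked_rows_def power2_eq_square mult.assoc)
    also have "\<dots> \<ge> real N / 2 * (\<Sum>k<d. (u k * sqrt (l k))\<^sup>2)"
      by (rule well_conditioned_lower[OF y d(1)])
    also have "real N / 2 * (\<Sum>k<d. (u k * sqrt (l k))\<^sup>2) \<ge> real N / 2 * (\<Sum>k<d. lam * (u k)\<^sup>2)"
    proof (intro mult_left_mono sum_mono)
      fix k assume "k \<in> {..<d}"
      then have lk: "lam \<le> l k" using lam(2) by simp
      then have "(u k * sqrt (l k))\<^sup>2 = l k * (u k)\<^sup>2" using lam(1) by (simp add: power_mult_distrib)
      then show "lam * (u k)\<^sup>2 \<le> (u k * sqrt (l k))\<^sup>2" using lk by (simp add: mult_right_mono)
    qed simp
    finally show ?thesis by (simp add: sum_distrib_left[symmetric] mult_ac)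
  qed
  have h5: "2 * ?zz \<le> ?lw" using small(1) by (simp add: q_def)
  have h6: "0 < ?lw" using lam N0 by simp
  have h7: "0 \<le> ?zz" "d \<le> N" using d qm by auto
  obtain \<eta> where \<eta>: "0 \<le> \<eta>" "\<eta> \<le> 4 * real d * (\<Sum>s<d. \<Sum>t=d..<N. (\<Sum>i=d..<p. X' i s * X' i t)\<^sup>2) / ?lw"
    "\<bar>(\<Sum>k=d..<p. \<phi> k) - (\<Sum>i=d..<p. \<Sum>t=d..<N. (X' i t)\<^sup>2)\<bar> \<le> \<eta>"
    "\<bar>(\<Sum>k=d..<p. (\<phi> k)\<^sup>2) - (\<Sum>s=d..<N. \<Sum>t=d..<N. (\<Sum>i=d..<p. X' i s * X' i t)\<^sup>2)\<bar> \<le> 4 * ?zz * \<eta> + \<eta>\<^sup>2"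
    by (rule spiked_gram_perturbation[OF es h1 d(1,2) h7(2) h2 h3 h4 h7(1) h5 h6]; (assumption | (rule that; assumption)))
  let ?G = "noise_block d (rotate_cols N W z)"
  have tr1: "(\<Sum>i=d..<p. \<Sum>t=d..<N. (X' i t)\<^sup>2) = gram_tr1 (p - d) (N - d) ?G"
    by (simp add: gram_tr1_def rdot_def noise_block_def sum_shift_atLeastLessThan high_row power2_eq_square)
  have tr2: "(\<Sum>s=d..<N. \<Sum>t=d..<N. (\<Sum>i=d..<p. X' i s * X' i t)\<^sup>2) = gram_tr2 (p - d) (N - d) ?G"
    unfolding sum_gram_squares_swap[of "{d..<p}" "{d..<N}" X', simplified]
    by (simp add: gram_tr2_def rdot_def noise_block_def sum_shift_atLeastLessThan high_row)
  have CC: "(\<Sum>s<d. \<Sum>t=d..<N. (\<Sum>i=d..<p. X' i s * X' i t)\<^sup>2) = cross_energy d p N (rotate_cols N W z)"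
    unfolding cross_energy_def using high_row by (intro sum.cong refl arg_cong[where f="\<lambda>x. x\<^sup>2"]) auto
  have C: "cross_energy d p N (rotate_cols N W z) \<le> R * (q * m)" using tz by (simp add: q_def m_def)
  define \<kappa> where "\<kappa> = \<eta> / (q * m)"
  have \<kappa>0: "0 \<le> \<kappa>" using \<eta>(1) qm by (simp add: \<kappa>_def)
  have "\<eta> \<le> 4 * real d * (R * (q * m)) / ?lw"
  proof -
    have "4 * real d * cross_energy d p N (rotate_cols N W z) / ?lw \<le> 4 * real d * (R * (q * m)) / ?lw"
      using C lam N0 by (intro divide_right_mono mult_left_mono) auto
    then show ?thesis using \<eta>(2) unfolding CC by linarith
  qed
  also have "\<dots> = (8 * real d * R / (lam * real N)) * (q * m)" by (simp add: field_simps)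
  finally have "\<kappa> \<le> 8 * real d * R / (lam * real N)" unfolding \<kappa>_def using qm by (simp add: pos_divide_le_eq)
  then have "(real N + q) * \<kappa> \<le> (real N + q) * (8 * real d * R / (lam * real N))"
    using qm by (intro mult_left_mono) auto
  also have "\<dots> = 8 * real d * R * (real N + q) / (lam * real N)" by simp
  also have "\<dots> \<le> \<epsilon>" using small(2) lam N0 by (simp add: pos_divide_le_eq q_def)
  finally have \<kappa>\<epsilon>: "(real N + q) * \<kappa> \<le> \<epsilon>" .
  define L1 where "L1 = (\<Sum>k=d..<p. \<phi> k)"
  define L2 where "L2 = (\<Sum>k=d..<p. (\<phi> k)\<^sup>2)"
  define u where "u = gram_tr1 (p - d) (N - d) ?G / (q * m)"
  define \<kappa>1 where "\<kappa>1 = (L1 - gram_tr1 (p - d) (N - d) ?G) / (q * m)"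
  define \<kappa>2 where "\<kappa>2 = (L2 - gram_tr2 (p - d) (N - d) ?G) / (q * m)"
  have qm0: "0 < q * m" using qm by simp
  have k1: "\<bar>\<kappa>1\<bar> \<le> \<kappa>" unfolding \<kappa>1_def \<kappa>_def abs_divide
    using \<eta>(3) qm0 unfolding tr1 L1_def by (simp add: divide_right_mono)
  have "\<bar>\<kappa>2\<bar> \<le> (4 * ?zz * \<eta> + \<eta>\<^sup>2) / (q * m)" unfolding \<kappa>2_def abs_divide
    using \<eta>(4) qm0 unfolding tr2 L2_def by (simp add: divide_right_mono)
  also have "\<dots> = 448 * ((real N + q) * \<kappa>) + (q * m) * (\<kappa> * \<kappa>)"
  proof -
    have "\<eta> = \<kappa> * (q * m)" using qm0 qm' by (simp add: \<kappa>_def)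
    moreover have "(4 * (112 * a) * (k * c) + (k * c)\<^sup>2) / c = 448 * (a * k) + c * (k * k)" if "0 < c" for a k c :: real
      using that by (simp add: power2_eq_square add_divide_distrib)
    ultimately show ?thesis using qm0 qm' by metis
  qed
  also have "(q * m) * (\<kappa> * \<kappa>) \<le> ((real N + q) * (real N + q)) * (\<kappa> * \<kappa>)"
    using qm \<kappa>0 by (intro mult_right_mono mult_mono) auto
  also have "\<dots> = ((real N + q) * \<kappa>) * ((real N + q) * \<kappa>)" by simp
  also have "\<dots> \<le> \<epsilon> * 1" using \<kappa>\<epsilon> \<epsilon> \<kappa>0 qm by (intro mult_mono) auto
  finally have k2: "\<bar>\<kappa>2\<bar> \<le> 450 * \<epsilon>" using \<kappa>\<epsilon> \<epsilon> by linarith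
  have "(m + q) * \<bar>\<kappa>1\<bar> \<le> (real N + q) * \<kappa>" using qm k1 by (intro mult_mono) auto
  then have k1': "(m + q) * \<bar>\<kappa>1\<bar> \<le> \<epsilon>" using \<kappa>\<epsilon> by simp
  have u1: "\<bar>u - 1\<bar> \<le> \<epsilon>" using tz by (simp add: u_def q_def m_def)
  have L1: "L1 = (q * m) * (u + \<kappa>1)" using qm0 qm' by (simp add: u_def \<kappa>1_def add_divide_distrib[symmetric])
  have "\<bar>\<kappa>1\<bar> \<le> \<epsilon>"
  proof -
    have "1 * \<bar>\<kappa>1\<bar> \<le> (m + q) * \<bar>\<kappa>1\<bar>" using qm by (intro mult_right_mono) auto
    then show ?thesis using k1' by simp
  qed
  then have "u + \<kappa>1 \<noteq> 0" using u1 \<epsilon> by linarith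
  have eigs: "(\<Sum>k=d..<p. eigs_desc p A ! k) = L1" "(\<Sum>k=d..<p. (eigs_desc p A ! k)\<^sup>2) = L2"
    unfolding L1_def L2_def by (auto intro!: sum.cong simp: eigs_desc_nth[OF es])
  have F: "F = m * (q * L2 / L1\<^sup>2 - 1) - q"
    unfolding F_def spike_stat_def X_def[symmetric] A_def[symmetric] eigs by (simp add: q_def m_def)
  \<comment> \<open>Clearing the denominator \<open>L1^2\<close> turns \<open>F\<close> into the
    polynomial form of \<open>gram_stat\<close>, taken at perturbed traces.\<close>
  have "F * (u + \<kappa>1)\<^sup>2 = m * q * L2 * (u + \<kappa>1)\<^sup>2 / L1\<^sup>2 - (m + q) * (u + \<kappa>1)\<^sup>2"
  proof -
    have "(m * (q * L / K - 1) - q) * D = m * q * L * D / K - (m + q) * D" for L K D :: real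
      by (simp add: algebra_simps)
    then show ?thesis unfolding F .
  qed
  also have "m * q * L2 * (u + \<kappa>1)\<^sup>2 / L1\<^sup>2 = L2 / (q * m)"
    unfolding L1 using qm0 qm' \<open>u + \<kappa>1 \<noteq> 0\<close> by (simp add: power_mult_distrib power2_eq_square)
  also have "L2 / (q * m) = gram_tr2 (p - d) (N - d) ?G / (q * m) + \<kappa>2" using qm0 qm' by (simp add: \<kappa>2_def diff_divide_distrib)
  also have "gram_tr2 (p - d) (N - d) ?G / (q * m) + \<kappa>2 - (m + q) * (u + \<kappa>1)\<^sup>2 = V + \<kappa>2 - (m + q) * (2 * u * \<kappa>1 + \<kappa>1\<^sup>2)"
    unfolding V_def gram_stat_def q_def[symmetric] m_def[symmetric] u_def[symmetric]
    by (simp add: power2_eq_square algebra_simps)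
  finally have Feq: "F * (u + \<kappa>1)\<^sup>2 = V + \<kappa>2 - (m + q) * (2 * u * \<kappa>1 + \<kappa>1\<^sup>2)" .
  have mq: "1 \<le> m + q" using qm by simp
  show "F \<le> x \<Longrightarrow> V \<le> x + \<delta>" "V \<le> x - \<delta> \<Longrightarrow> F \<le> x"
    using stat_sandwich_algebra[OF Feq u1 \<epsilon> k1' mq k2] by blast+
qed

section \<open>Measurability and laws of rotated arrays\<close>

lemma eigs_desc_cong:
  assumes "\<And>i j. i < p \<Longrightarrow> j < p \<Longrightarrow> A i j = B i j"
  shows "eigs_desc p A = eigs_desc p B"
proof -
  have "to_mat p A = to_mat p B" unfolding to_mat_def using assms by (intro cong_mat) auto
  then show ?thesis by (simp add: eigs_desc_def)
qed

lemma spike_stat_cong: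
  "(\<And>i j. i < p \<Longrightarrow> j < p \<Longrightarrow> A i j = B i j) \<Longrightarrow> spike_stat d p N A = spike_stat d p N B"
  unfolding spike_stat_def by (simp add: eigs_desc_cong[of p A B])

lemma measurable_spike_stat:
  assumes A: "\<And>i j. i < p \<Longrightarrow> j < p \<Longrightarrow> (\<lambda>\<omega>. A \<omega> i j) \<in> borel_measurable M"
    and sym: "\<And>\<omega>. symmetric_mat p (A \<omega>)"
  shows "(\<lambda>\<omega>. spike_stat d p N (A \<omega>)) \<in> borel_measurable M"
proof -
  \<comment> \<open>Entries outside the \<open>p\<close> by \<open>p\<close> block are set to
    \<open>0\<close>, since measurability is assumed on the block only.\<close>
  define A' where "A' \<omega> i j = (if i < p \<and> j < p then A \<omega> i j else 0)" for \<omega> i j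
  have "(\<lambda>\<omega>. A' \<omega> i j) \<in> borel_measurable M" for i j
    unfolding A'_def using A by (cases "i < p \<and> j < p") auto
  moreover have "symmetric_mat p (A' \<omega>)" for \<omega> using sym[of \<omega>] by (auto simp: symmetric_mat_def A'_def)
  ultimately have e: "(\<lambda>\<omega>. eigs_desc p (A' \<omega>) ! k) \<in> borel_measurable M" if "k < p" for k
    using that by (intro measurable_eigs_desc) auto
  have "(\<lambda>\<omega>. spike_stat d p N (A' \<omega>)) \<in> borel_measurable M"
    unfolding spike_stat_def using e
    by (intro borel_measurable_diff borel_measurable_times borel_measurable_divide borel_measurable_power
        borel_measurable_sum borel_measurable_const) auto
  moreover have "spike_stat d p N (A' \<omega>) = spike_stat d p N (A \<omega>)" for \<omega>
    by (rule spike_stat_cong) (simp add: A'_def)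
  ultimately show ?thesis by simp
qed

lemma measurable_gram_stat_block:
  assumes "\<And>i. i \<in> {d..<p} \<times> {..<N} \<Longrightarrow> (\<lambda>\<omega>. x \<omega> i) \<in> borel_measurable M"
  shows "(\<lambda>\<omega>. gram_stat (p - d) (N - d) (noise_block d (x \<omega>))) \<in> borel_measurable M"
proof -
  have c: "(\<lambda>\<omega>. noise_block d (x \<omega>) (a, t)) \<in> borel_measurable M" if "a < p - d" "t < N - d" for a t
    unfolding noise_block_def using assms[of "(d + a, d + t)"] that by (auto simp: less_diff_conv add.commute)
  have rd: "(\<lambda>\<omega>. rdot (N - d) (noise_block d (x \<omega>)) a b) \<in> borel_measurable M" if "a < p - d" "b < p - d" for a b
    using that c by (intro measurable_rdot) auto
  show ?thesis
    unfolding gram_stat_def gram_tr1_def gram_tr2_def using rd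
    by (intro borel_measurable_diff borel_measurable_divide borel_measurable_times borel_measurable_power borel_measurable_sum borel_measurable_const) auto
qed

lemma gram_stat_block_restrict:
  "gram_stat (p - d) (N - d) (noise_block d (restrict x ({d..<p} \<times> {..<N}))) = gram_stat (p - d) (N - d) (noise_block d x)"
proof -
  have "rdot (N - d) (noise_block d (restrict x ({d..<p} \<times> {..<N}))) a b = rdot (N - d) (noise_block d x) a b" if "a < p - d" "b < p - d" for a b
    using that by (intro rdot_cong) (auto simp: noise_block_def)
  then show ?thesis by (simp add: gram_stat_def gram_tr1_def gram_tr2_def)
qed

lemma gram_stat_block_law:
  assumes Z: "gauss_family M ({d..<p} \<times> {..<N}) g" and T: "T \<in> sets borel"
  shows "measure M {\<omega>\<in>space M. gram_stat (p - d) (N - d) (noise_block d (\<lambda>i. g i \<omega>)) \<in> T} =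
    measure (gaussM ({d..<p} \<times> {..<N})) {z\<in>space (gaussM ({d..<p} \<times> {..<N})). gram_stat (p - d) (N - d) (noise_block d z) \<in> T}"
proof -
  let ?J = "{d..<p} \<times> {..<N}"
  let ?V = "\<lambda>z. gram_stat (p - d) (N - d) (noise_block d z)"
  let ?r = "\<lambda>\<omega>. \<lambda>i\<in>?J. g i \<omega>"
  have V: "?V \<in> borel_measurable (gaussM ?J)"
    by (rule measurable_gram_stat_block) (rule measurable_gaussM_component)
  have r: "?r \<in> M \<rightarrow>\<^sub>M gaussM ?J" using gauss_familyD(3)[OF Z] by (rule measurable_restrict_family)
  have "{z\<in>space (gaussM ?J). ?V z \<in> T} \<in> sets (gaussM ?J)" using V T by measurable
  then have "measure (distr M (gaussM ?J) ?r) {z\<in>space (gaussM ?J). ?V z \<in> T} = measure M (?r -` {z\<in>space (gaussM ?J). ?V z \<in> T} \<inter> space M)"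
    by (rule measure_distr[OF r])
  also have "?r -` {z\<in>space (gaussM ?J). ?V z \<in> T} \<inter> space M = {\<omega>\<in>space M. ?V (\<lambda>i. g i \<omega>) \<in> T}"
  proof -
    have VR: "?V (?r \<omega>) = ?V (\<lambda>i. g i \<omega>)" for \<omega> by (rule gram_stat_block_restrict)
    have "\<omega> \<in> ?r -` {z\<in>space (gaussM ?J). ?V z \<in> T} \<inter> space M \<longleftrightarrow> \<omega> \<in> space M \<and> ?V (?r \<omega>) \<in> T" for \<omega>
      using measurable_space[OF r, of \<omega>] by blast
    then show ?thesis unfolding VR by blast
  qed
  finally show ?thesis unfolding gauss_family_distr[OF Z] ..
qed

text \<open>The rotation acts within each row. The column set \<open>B\<close> may be smaller than
  the original one, as when the constant row of a Helmert matrix is dropped.\<close>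

lemma gauss_family_rotate:
  fixes A B :: "nat set" and Z :: "nat \<times> nat \<Rightarrow> 'a \<Rightarrow> real"
  assumes Z: "gauss_family M (A \<times> {..<N}) Z" and fin: "finite A" "finite B"
    and h: "\<And>s t. s \<in> B \<Longrightarrow> t \<in> B \<Longrightarrow> dotp N (h s) (h t) = of_bool (s = t)"
  shows "gauss_family M (A \<times> B) (\<lambda>j \<omega>. \<Sum>t<N. h (snd j) t * Z (fst j, t) \<omega>)"
proof -
  let ?J = "A \<times> {..<N}"
  define c where "c j i = (if fst i = fst j then h (snd j) (snd i) else 0)" for i j :: "nat \<times> nat"
  have row: "(\<Sum>i\<in>?J. c j i * f i) = (\<Sum>s<N. h (snd j) s * f (fst j, s))" if "j \<in> A \<times> B" for j and f :: "nat \<times> nat \<Rightarrow> real"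
  proof -
    have "(\<Sum>i\<in>?J. c j i * f i) = (\<Sum>i\<in>A. \<Sum>s<N. c j (i, s) * f (i, s))"
      by (simp add: sum.cartesian_product case_prod_beta)
    also have "\<dots> = (\<Sum>i\<in>A. if i = fst j then \<Sum>s<N. h (snd j) s * f (fst j, s) else 0)"
      by (intro sum.cong refl) (auto simp: c_def)
    finally show ?thesis using that fin by auto
  qed
  have "gauss_family M (A \<times> B) (\<lambda>j \<omega>. \<Sum>i\<in>?J. c j i * Z i \<omega>)"
  proof (rule gauss_family_linear[OF Z])
    fix j l assume jl: "j \<in> A \<times> B" "l \<in> A \<times> B"
    show "(\<Sum>i\<in>?J. c j i * c l i) = of_bool (j = l)"
    proof (cases "fst j = fst l")
      case True
      have "(\<Sum>i\<in>?J. c j i * c l i) = dotp N (h (snd j)) (h (snd l))"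
        unfolding row[OF jl(1)] using True by (simp add: c_def dotp_def)
      also have "\<dots> = of_bool (snd j = snd l)" using h jl by auto
      finally show ?thesis using True by (simp add: prod_eq_iff)
    next
      case False
      then show ?thesis unfolding row[OF jl(1)] by (auto simp: c_def)
    qed
  qed (use fin in auto)
  then show ?thesis
    by (subst (asm) gauss_family_cong[where Z'="\<lambda>j \<omega>. \<Sum>t<N. h (snd j) t * Z (fst j, t) \<omega>"]) (auto simp: row)
qed

lemma gauss_rotate_cols:
  assumes W: "orthonormal N W"
  shows "gauss_family (gaussM ({d..<p} \<times> {..<N})) ({d..<p} \<times> {..<N}) (\<lambda>i z. rotate_cols N W z i)"
proof -
  have "gauss_family (gaussM ({d..<p} \<times> {..<N})) ({d..<p} \<times> {..<N}) (\<lambda>j z. \<Sum>t<N. W (snd j) t * z (fst j, t))"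
    using W by (intro gauss_family_rotate[OF gauss_family_gaussM]) (auto simp: orthonormal_def)
  then show ?thesis
    by (subst (asm) gauss_family_cong[where Z'="\<lambda>i z. rotate_cols N W z i"]) (auto simp: rotate_cols_def)
qed

lemma measurable_spike_stat_rows:
  fixes g :: "nat \<times> nat \<Rightarrow> 'a \<Rightarrow> real"
  assumes Z: "gauss_family M ({..<p} \<times> {..<N}) g"
  shows "(\<lambda>\<omega>. spike_stat d p N (gram_mat N (spiked_rows d l (\<lambda>i. g i \<omega>) (\<lambda>i. g i \<omega>)))) \<in> borel_measurable M"
proof (rule measurable_spike_stat)
  have X: "(\<lambda>\<omega>. spiked_rows d l (\<lambda>i. g i \<omega>) (\<lambda>i. g i \<omega>) i t) \<in> borel_measurable M" if "i < p" "t < N" for i t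
    using gauss_familyD(3)[OF Z, of "(i, t)"] that unfolding spiked_rows_def
    by (cases "i < d") (auto intro: borel_measurable_times)
  show "(\<lambda>\<omega>. gram_mat N (spiked_rows d l (\<lambda>i. g i \<omega>) (\<lambda>i. g i \<omega>)) i j) \<in> borel_measurable M" if "i < p" "j < p" for i j
    unfolding gram_mat_def using X that by (intro borel_measurable_sum borel_measurable_times) auto
qed (rule symmetric_gram_mat)

text \<open>By Fubini it suffices to bound the inner integral for each fixed well-conditioned
  \<open>y\<close>. There \<open>W\<close> may be chosen freely, since the bound
  \<open>PV + b\<close> does not depend on it. The alternatives for \<open>Q\<close> and
  \<open>T\<close> are the two halves of the sandwich.\<close>

lemma spike_prob_le:
  fixes g :: "nat \<times> nat \<Rightarrow> 'a \<Rightarrow> real"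
  assumes Z: "gauss_family M ({..<p} \<times> {..<N}) g"
    and d: "0 < d" "d < p" "d < N" and lam: "0 < lam" "\<And>k. k < d \<Longrightarrow> lam \<le> l k"
    and R: "0 < R" and \<epsilon>: "0 < \<epsilon>" "\<epsilon> \<le> 1 / 4" "(8 * \<bar>x\<bar> + 600) * \<epsilon> \<le> \<delta>"
    and small: "448 * (real N + real (p - d)) \<le> lam * real N"
      "8 * real d * R * (real N + real (p - d)) \<le> \<epsilon> * (lam * real N)"
    and QT: "(Q = {..x} \<and> T = {..x + \<delta>}) \<or> (Q = {x<..} \<and> T = {x - \<delta><..})"
  shows "measure M {\<omega>\<in>space M. spike_stat d p N (gram_mat N (spiked_rows d l (\<lambda>i. g i \<omega>) (\<lambda>i. g i \<omega>))) \<in> Q} \<le>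
     measure (gaussM ({d..<p} \<times> {..<N})) {z\<in>space (gaussM ({d..<p} \<times> {..<N})). gram_stat (p - d) (N - d) (noise_block d z) \<in> T} +
     (exp (- real N) + real d / R + 2 / (real (p - d) * real (N - d) * \<epsilon>\<^sup>2) + 8 * real d ^ 4 / real N)"
proof -
  note G = gauss_familyD[OF Z]
  interpret prob_space M by fact
  let ?I = "{..<d} \<times> {..<N}" and ?J = "{d..<p} \<times> {..<N}"
  interpret PI: prob_space "gaussM ?I" by (rule prob_space_gaussM)
  interpret PJ: prob_space "gaussM ?J" by (rule prob_space_gaussM)
  define b where "b = exp (- real N) + real d / R + 2 / (real (p - d) * real (N - d) * \<epsilon>\<^sup>2)"
  define PV where "PV = measure (gaussM ?J) {z\<in>space (gaussM ?J). gram_stat (p - d) (N - d) (noise_block d z) \<in> T}"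
  have b0: "0 \<le> b" using R by (simp add: b_def)
  have QTb: "Q \<in> sets borel" "T \<in> sets borel" using QT by auto
  define H where "H yz = spike_stat d p N (gram_mat N (spiked_rows d l (fst yz) (snd yz)))" for yz
  have mX: "(\<lambda>yz. spiked_rows d l (fst yz) (snd yz) i t) \<in> borel_measurable (gaussM ?I \<Otimes>\<^sub>M gaussM ?J)" if "i < p" "t < N" for i t
    using that measurable_coord_pair(1)[of "(i, t)" ?I "gaussM ?J"] measurable_coord_pair(2)[of "(i, t)" ?J "gaussM ?I"]
    unfolding spiked_rows_def by (cases "i < d") (auto intro: borel_measurable_times)
  have mH[measurable]: "H \<in> borel_measurable (gaussM ?I \<Otimes>\<^sub>M gaussM ?J)"
    unfolding H_def
  proof (rule measurable_spike_stat)
    show "(\<lambda>yz. gram_mat N (spiked_rows d l (fst yz) (snd yz)) i j) \<in> borel_measurable (gaussM ?I \<Otimes>\<^sub>M gaussM ?J)" if "i < p" "j < p" for i j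
      unfolding gram_mat_def using mX that by (intro borel_measurable_sum borel_measurable_times) auto
  qed (rule symmetric_gram_mat)
  have HF: "H (\<lambda>i\<in>?I. g i \<omega>, \<lambda>i\<in>?J. g i \<omega>) = spike_stat d p N (gram_mat N (spiked_rows d l (\<lambda>i. g i \<omega>) (\<lambda>i. g i \<omega>)))" for \<omega>
    unfolding H_def
  proof (rule spike_stat_cong)
    fix i j assume "i < p" "j < p"
    then show "gram_mat N (spiked_rows d l (fst (\<lambda>i\<in>?I. g i \<omega>, \<lambda>i\<in>?J. g i \<omega>)) (snd (\<lambda>i\<in>?I. g i \<omega>, \<lambda>i\<in>?J. g i \<omega>))) i j =
        gram_mat N (spiked_rows d l (\<lambda>i. g i \<omega>) (\<lambda>i. g i \<omega>)) i j"
      unfolding gram_mat_def by (intro sum.cong refl) (simp add: spiked_rows_def)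
  qed
  define h where "h yz = indicat_real Q (H yz)" for yz
  have mh: "h \<in> borel_measurable (gaussM ?I \<Otimes>\<^sub>M gaussM ?J)" unfolding h_def using QTb by measurable
  have pairJ: "(\<lambda>z. (y, z)) \<in> gaussM ?J \<rightarrow>\<^sub>M gaussM ?I \<Otimes>\<^sub>M gaussM ?J" if "y \<in> space (gaussM ?I)" for y
    using that by simp
  define bad where "bad = {y\<in>space (gaussM ?I). \<not> well_conditioned d N y}"
  have N0: "0 < N" using d by simp
  have bad: "bad \<in> sets (gaussM ?I)" "measure (gaussM ?I) bad \<le> 8 * real d ^ 4 / real N"
    using prob_not_well_conditioned[OF gauss_family_gaussM d(1) N0] by (auto simp: bad_def)
  have inner: "(\<integral>z. h (y, z) \<partial>gaussM ?J) \<le> PV + b" if y: "y \<in> space (gaussM ?I)" "well_conditioned d N y" for y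
  proof -
    obtain W where W: "orthonormal N W" "\<And>k t. k < d \<Longrightarrow> d \<le> t \<Longrightarrow> t < N \<Longrightarrow> dotp N (W t) (\<lambda>s. y (k, s)) = 0"
      using ex_orthonormal_adapted[of N d "\<lambda>k s. y (k, s)"] by blast
    note rot = gauss_rotate_cols[OF W(1), of d p]
    obtain Bad where Bad: "Bad \<in> sets (gaussM ?J)" "measure (gaussM ?J) Bad \<le> b"
      "\<And>z. z \<in> space (gaussM ?J) - Bad \<Longrightarrow> typical_noise d p N R \<epsilon> (rotate_cols N W z)"
      using prob_not_typical_noise[OF rot d(2,3) R \<epsilon>(1)] unfolding b_def by blast
    define E where "E = {z\<in>space (gaussM ?J). gram_stat (p - d) (N - d) (noise_block d (rotate_cols N W z)) \<in> T}"
    have E: "measure (gaussM ?J) E = PV" unfolding E_def PV_def by (rule gram_stat_block_law[OF rot QTb(2)])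
    have mE: "E \<in> sets (gaussM ?J)"
    proof -
      have "(\<lambda>z. gram_stat (p - d) (N - d) (noise_block d (rotate_cols N W z))) \<in> borel_measurable (gaussM ?J)"
        using gauss_familyD(3)[OF rot] by (rule measurable_gram_stat_block)
      then show ?thesis unfolding E_def using QTb(2) by measurable
    qed
    have mHy: "(\<lambda>z. H (y, z)) \<in> borel_measurable (gaussM ?J)" using measurable_compose[OF pairJ[OF y(1)] mH] .
    then have mS: "{z\<in>space (gaussM ?J). H (y, z) \<in> Q} \<in> sets (gaussM ?J)" using QTb(1) by measurable
    have "(\<integral>z. h (y, z) \<partial>gaussM ?J) = (\<integral>z. indicat_real {z\<in>space (gaussM ?J). H (y, z) \<in> Q} z \<partial>gaussM ?J)"
      by (intro Bochner_Integration.integral_cong refl) (auto simp: h_def indicator_def)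
    also have "\<dots> = measure (gaussM ?J) {z\<in>space (gaussM ?J). H (y, z) \<in> Q}" using mS by simp
    also have "\<dots> \<le> measure (gaussM ?J) (E \<union> Bad)"
    proof (rule PJ.finite_measure_mono)
      show "{z\<in>space (gaussM ?J). H (y, z) \<in> Q} \<subseteq> E \<union> Bad"
      proof
        fix z assume z: "z \<in> {z\<in>space (gaussM ?J). H (y, z) \<in> Q}"
        show "z \<in> E \<union> Bad"
        proof (cases "z \<in> Bad")
          case False
          then have tz: "typical_noise d p N R \<epsilon> (rotate_cols N W z)" using z Bad(3) by auto
          note sw = spike_stat_sandwich[OF d lam y(2) W tz less_imp_le[OF R] \<epsilon> small]
          from QT show ?thesis
          proof (elim disjE conjE)
            assume "Q = {..x}" "T = {..x + \<delta>}"
            then show ?thesis using z sw(1) by (auto simp: E_def H_def)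
          next
            assume "Q = {x<..}" "T = {x - \<delta><..}"
            then show ?thesis using z sw(2) by (auto simp: E_def H_def not_le[symmetric])
          qed
        qed simp
      qed
      show "E \<union> Bad \<in> sets (gaussM ?J)" using mE Bad(1) by auto
    qed
    also have "\<dots> \<le> measure (gaussM ?J) E + measure (gaussM ?J) Bad" using mE Bad(1) by (rule measure_Un_le)
    also have "\<dots> \<le> PV + b" using Bad(2) by (simp add: E)
    finally show ?thesis .
  qed
  have inner1: "(\<integral>z. h (y, z) \<partial>gaussM ?J) \<le> 1" for y
  proof -
    have "(\<integral>z. h (y, z) \<partial>gaussM ?J) \<le> (\<integral>z. 1 \<partial>gaussM ?J)"
      by (rule integral_mono') (auto simp: h_def)
    then show ?thesis by (simp add: PJ.prob_space)
  qed
  have "measure M {\<omega>\<in>space M. spike_stat d p N (gram_mat N (spiked_rows d l (\<lambda>i. g i \<omega>) (\<lambda>i. g i \<omega>))) \<in> Q} =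
     (\<integral>\<omega>. indicat_real {\<omega>\<in>space M. spike_stat d p N (gram_mat N (spiked_rows d l (\<lambda>i. g i \<omega>) (\<lambda>i. g i \<omega>))) \<in> Q} \<omega> \<partial>M)"
    by (simp add: Int_def conj_commute cong: conj_cong)
  also have "\<dots> = (\<integral>\<omega>. h (\<lambda>i\<in>?I. g i \<omega>, \<lambda>i\<in>?J. g i \<omega>) \<partial>M)"
    by (intro Bochner_Integration.integral_cong refl) (auto simp: h_def HF indicator_def)
  also have "\<dots> = (\<integral>y. (\<integral>z. h (y, z) \<partial>gaussM ?J) \<partial>gaussM ?I)"
  proof (rule gauss_family_Fubini[OF Z _ _ _ mh])
    show "norm (h yz) \<le> 1" for yz by (simp add: h_def)
  qed (use d in auto)
  \<comment> \<open>For badly conditioned \<open>y\<close> the inner integral is bounded by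
    \<open>1\<close>.\<close>
  also have "\<dots> \<le> (\<integral>y. (PV + b) + indicat_real bad y \<partial>gaussM ?I)"
  proof (rule integral_mono')
    show "integrable (gaussM ?I) (\<lambda>y. PV + b + indicat_real bad y)"
      using bad(1) by (intro Bochner_Integration.integrable_add integrable_real_indicator) (auto simp: PI.emeasure_eq_measure)
    show "(\<integral>z. h (y, z) \<partial>gaussM ?J) \<le> PV + b + indicat_real bad y" if "y \<in> space (gaussM ?I)" for y
    proof (cases "y \<in> bad")
      case True
      have "0 \<le> PV" by (simp add: PV_def)
      then show ?thesis using True inner1[of y] b0 by simp
    next
      case False
      then show ?thesis using inner[of y] that by (simp add: bad_def)
    qed
    show "0 \<le> PV + b + indicat_real bad y" for y using b0 by (simp add: PV_def)
  qed
  also have "\<dots> = PV + b + measure (gaussM ?I) bad"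
    using bad(1) by (subst Bochner_Integration.integral_add) (auto simp: PI.prob_space PI.emeasure_eq_measure)
  also have "\<dots> \<le> PV + (b + 8 * real d ^ 4 / real N)" using bad(2) by simp
  finally show ?thesis unfolding PV_def b_def .
qed

section \<open>Passage to the limit\<close>

text \<open>The law has no atoms. Hence weak convergence gives convergence of distribution functions
  at every point, and a small shift of the threshold costs little.\<close>

lemma normal_cdf_continuous:
  assumes "0 < \<sigma>"
  shows "isCont (cdf (density lborel (normal_density \<mu> \<sigma>))) x"
proof -
  interpret prob_space "density lborel (normal_density \<mu> \<sigma>)"
    by (rule prob_space_normal_density) fact
  interpret real_distribution "density lborel (normal_density \<mu> \<sigma>)"
    by standard auto
  have "emeasure (density lborel (normal_density \<mu> \<sigma>)) {x} = (\<integral>\<^sup>+y. ennreal (normal_density \<mu> \<sigma> y) * indicator {x} y \<partial>lborel)"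
    by (rule emeasure_density) auto
  also have "\<dots> = 0" by (subst nn_integral_0_iff_AE) (auto intro!: AE_I[of _ _ "{x}"] simp: indicator_def)
  finally show ?thesis by (simp add: isCont_cdf measure_def)
qed

text \<open>Given \<open>e\<close>, continuity of the limiting distribution function yields the
  shift \<open>\<delta>\<close>, which determines \<open>\<epsilon>\<close>; then \<open>R\<close>
  is taken so large that Markov's inequality costs \<open>e / 8\<close>. With
  \<open>\<epsilon>\<close> and \<open>R\<close> fixed, the other exceptional probabilities vanish
  and the smallness conditions hold eventually.\<close>

theorem spike_stat_limit:
  fixes p N :: "nat \<Rightarrow> nat" and M :: "nat \<Rightarrow> 'a measure" and g :: "nat \<Rightarrow> nat \<times> nat \<Rightarrow> 'a \<Rightarrow> real"
    and l :: "nat \<Rightarrow> nat \<Rightarrow> real" and lam :: "nat \<Rightarrow> real"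
  assumes Z: "eventually (\<lambda>n. gauss_family (M n) ({..<p n} \<times> {..<N n}) (g n)) sequentially"
    and d: "0 < d" and p: "filterlim p at_top sequentially" and N: "filterlim N at_top sequentially"
    and l: "eventually (\<lambda>n. 0 < lam n \<and> (\<forall>k<d. lam n \<le> l n k)) sequentially"
    and lamN: "(\<lambda>n. (real (N n) + real (p n - d)) / (lam n * real (N n))) \<longlonglongrightarrow> 0"
    and regime: "((\<lambda>n. real (p n - d) / real (N n - d)) \<longlonglongrightarrow> 0) \<or> ((\<lambda>n. real (N n - d) / real (p n - d)) \<longlonglongrightarrow> 0)"
  shows "(\<lambda>n. measure (M n) {\<omega>\<in>space (M n). spike_stat d (p n) (N n) (gram_mat (N n) (spiked_rows d (l n) (\<lambda>i. g n i \<omega>) (\<lambda>i. g n i \<omega>))) \<le> x})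
     \<longlonglongrightarrow> cdf (density lborel (normal_density 1 2)) x"
proof -
  let ?\<Phi> = "cdf (density lborel (normal_density 1 2))"
  define V where "V n z = gram_stat (p n - d) (N n - d) (noise_block d z)" for n z
  define J where "J n = {d..<p n} \<times> {..<N n}" for n
  have qlim: "filterlim (\<lambda>n. p n - d) at_top sequentially" and mlim: "filterlim (\<lambda>n. N n - d) at_top sequentially"
    using filterlim_compose[OF filterlim_minus_const_nat_at_top p] filterlim_compose[OF filterlim_minus_const_nat_at_top N] by auto
  have ZJ: "gauss_family (gaussM (J n)) ({..<p n - d} \<times> {..<N n - d}) (\<lambda>(a, t) z. z (d + a, d + t))" for n
    using gauss_noise_block[OF gauss_family_gaussM, of d "p n" "N n"] unfolding J_def by simp
  have wc: "weak_conv_m (\<lambda>n. distr (gaussM (J n)) borel (V n)) (density lborel (normal_density 1 2))"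
  proof -
    have "V n = (\<lambda>z. gram_stat (p n - d) (N n - d) (\<lambda>i. (case i of (a, t) \<Rightarrow> \<lambda>z. z (d + a, d + t)) z))" for n
      by (auto simp: V_def noise_block_def fun_eq_iff case_prod_beta')
    then show ?thesis
      using regime gram_stat_CLT[OF ZJ qlim mlim] gram_stat_CLT_transposed[OF ZJ qlim mlim] by auto
  qed
  have mV: "V n \<in> borel_measurable (gaussM (J n))" for n
    unfolding V_def J_def by (rule measurable_gram_stat_block) (rule measurable_gaussM_component)
  have Vlim: "(\<lambda>n. measure (gaussM (J n)) {z\<in>space (gaussM (J n)). V n z \<le> s}) \<longlonglongrightarrow> ?\<Phi> s" for s
  proof -
    have "(\<lambda>n. cdf (distr (gaussM (J n)) borel (V n)) s) \<longlonglongrightarrow> ?\<Phi> s"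
      using wc normal_cdf_continuous[of 2 s 1] by (simp add: weak_conv_m_def weak_conv_def)
    moreover have "cdf (distr (gaussM (J n)) borel (V n)) s = measure (gaussM (J n)) {z\<in>space (gaussM (J n)). V n z \<le> s}" for n
      unfolding cdf_def by (subst measure_distr[OF mV]) (auto intro!: arg_cong[where f="measure _"])
    ultimately show ?thesis by simp
  qed
  define F where "F n \<omega> = spike_stat d (p n) (N n) (gram_mat (N n) (spiked_rows d (l n) (\<lambda>i. g n i \<omega>) (\<lambda>i. g n i \<omega>)))" for n \<omega>
  have rq: "filterlim (\<lambda>n. real (p n - d)) at_top sequentially" and rm: "filterlim (\<lambda>n. real (N n - d)) at_top sequentially"
    and rN: "filterlim (\<lambda>n. real (N n)) at_top sequentially"
    using qlim mlim N by (auto intro: filterlim_compose[OF filterlim_real_sequentially])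
  have "\<forall>\<^sub>F n in sequentially. \<bar>measure (M n) {\<omega>\<in>space (M n). F n \<omega> \<le> x} - ?\<Phi> x\<bar> < e" if e: "0 < e" for e
  proof -
    have e4: "0 < e / 4" using e by simp
    have "isCont ?\<Phi> x" by (rule normal_cdf_continuous) simp
    then have "\<exists>\<delta>0>0. \<forall>y. dist y x < \<delta>0 \<longrightarrow> dist (?\<Phi> y) (?\<Phi> x) < e / 4"
      using e unfolding continuous_at_eps_delta by (elim allE[of _ "e / 4"]) simp
    then obtain \<delta>0 where \<delta>0: "0 < \<delta>0" "\<And>y. \<bar>y - x\<bar> < \<delta>0 \<Longrightarrow> \<bar>?\<Phi> y - ?\<Phi> x\<bar> < e / 4"
      unfolding dist_real_def by blast
    define \<delta> where "\<delta> = \<delta>0 / 2"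
    have \<delta>: "0 < \<delta>" "\<bar>?\<Phi> (x + \<delta>) - ?\<Phi> x\<bar> < e / 4" "\<bar>?\<Phi> (x - \<delta>) - ?\<Phi> x\<bar> < e / 4"
      using \<delta>0 by (auto simp: \<delta>_def)
    define \<epsilon> where "\<epsilon> = min (1 / 4) (\<delta> / (8 * \<bar>x\<bar> + 600))"
    have pos: "0 < 8 * \<bar>x\<bar> + 600" by (simp add: add_nonneg_pos)
    have \<epsilon>: "0 < \<epsilon>" "\<epsilon> \<le> 1 / 4" using \<delta>(1) pos unfolding \<epsilon>_def by (simp, intro min.cobounded1)
    have \<epsilon>3: "(8 * \<bar>x\<bar> + 600) * \<epsilon> \<le> \<delta>"
    proof -
      have "\<epsilon> \<le> \<delta> / (8 * \<bar>x\<bar> + 600)" by (simp add: \<epsilon>_def)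
      then show ?thesis using pos by (simp add: pos_le_divide_eq mult.commute)
    qed
    define R where "R = 8 * real d / e"
    have R: "0 < R" "real d / R = e / 8" using d e by (simp_all add: R_def)
    define B where "B n = exp (- real (N n)) + real d / R + 2 / (real (p n - d) * real (N n - d) * \<epsilon>\<^sup>2) + 8 * real d ^ 4 / real (N n)" for n
    have "B \<longlonglongrightarrow> 0 + e / 8 + 0 + 0" unfolding B_def R(2)
    proof (intro tendsto_add tendsto_const)
      show "(\<lambda>n. exp (- real (N n))) \<longlonglongrightarrow> 0"
        by (rule filterlim_compose[OF exp_at_bot]) (use rN in \<open>simp add: filterlim_uminus_at_bot\<close>)
      show "(\<lambda>n. 8 * real d ^ 4 / real (N n)) \<longlonglongrightarrow> 0" by (rule real_tendsto_divide_at_top[OF tendsto_const rN])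
      have "filterlim (\<lambda>n. real (p n - d) * real (N n - d) * \<epsilon>\<^sup>2) at_top sequentially"
        using \<epsilon> by (intro filterlim_at_top_mult_tendsto_pos[OF tendsto_const _ filterlim_at_top_mult_at_top[OF rq rm]]) simp
      then show "(\<lambda>n. 2 / (real (p n - d) * real (N n - d) * \<epsilon>\<^sup>2)) \<longlonglongrightarrow> 0" by (rule real_tendsto_divide_at_top[OF tendsto_const])
    qed
    moreover have "0 + e / 8 + 0 + 0 < e / 4" using e by simp
    ultimately have "\<forall>\<^sub>F n in sequentially. B n < e / 4" by (rule order_tendstoD(2))
    moreover have "\<forall>\<^sub>F n in sequentially. \<bar>measure (gaussM (J n)) {z\<in>space (gaussM (J n)). V n z \<le> x + \<delta>} - ?\<Phi> (x + \<delta>)\<bar> < e / 4"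
      using tendstoD[OF Vlim e4] unfolding dist_real_def .
    moreover have "\<forall>\<^sub>F n in sequentially. \<bar>measure (gaussM (J n)) {z\<in>space (gaussM (J n)). V n z \<le> x - \<delta>} - ?\<Phi> (x - \<delta>)\<bar> < e / 4"
      using tendstoD[OF Vlim e4] unfolding dist_real_def .
    \<comment> \<open>The two bounds are the smallness conditions of the sandwich, solved for this
      ratio.\<close>
    moreover have "\<forall>\<^sub>F n in sequentially. (real (N n) + real (p n - d)) / (lam n * real (N n)) < min (1 / 448) (\<epsilon> / (8 * real d * R))"
      using d R \<epsilon> by (intro order_tendstoD(2)[OF lamN]) simp
    moreover have "\<forall>\<^sub>F n in sequentially. d < p n" by (rule eventually_compose_filterlim[OF eventually_gt_at_top p])
    moreover have "\<forall>\<^sub>F n in sequentially. d < N n" by (rule eventually_compose_filterlim[OF eventually_gt_at_top N])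
    ultimately show ?thesis using Z l
    proof eventually_elim
      case (elim n)
      interpret prob_space "M n" using gauss_familyD(1)[OF elim(7)] .
      interpret PJ: prob_space "gaussM (J n)" by (rule prob_space_gaussM)
      have lam: "0 < lam n" "\<And>k. k < d \<Longrightarrow> lam n \<le> l n k" using elim(8) by auto
      have D: "0 < lam n * real (N n)" using lam(1) elim(6) by simp
      have s1: "448 * (real (N n) + real (p n - d)) \<le> lam n * real (N n)"
        using elim(4) D by (simp add: pos_divide_less_eq min_less_iff_conj)
      have s2: "8 * real d * R * (real (N n) + real (p n - d)) \<le> \<epsilon> * (lam n * real (N n))"
      proof -
        have dR: "0 < 8 * real d * R" using d R by simp
        have "(real (N n) + real (p n - d)) / (lam n * real (N n)) < \<epsilon> / (8 * real d * R)" using elim(4) by simp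
        then have "real (N n) + real (p n - d) < \<epsilon> / (8 * real d * R) * (lam n * real (N n))" using D by (simp only: pos_divide_less_eq)
        then have "8 * real d * R * (real (N n) + real (p n - d)) \<le> 8 * real d * R * (\<epsilon> / (8 * real d * R) * (lam n * real (N n)))"
          using dR by (intro mult_left_mono) auto
        also have "\<dots> = \<epsilon> * (lam n * real (N n))" using d R by simp
        finally show ?thesis .
      qed
      note le = spike_prob_le[OF elim(7) d elim(5,6) lam R(1) \<epsilon> \<epsilon>3 s1 s2]
      have up: "measure (M n) {\<omega>\<in>space (M n). F n \<omega> \<le> x} \<le> measure (gaussM (J n)) {z\<in>space (gaussM (J n)). V n z \<le> x + \<delta>} + B n"
        using le[where Q="{..x}" and T="{..x + \<delta>}"] unfolding F_def V_def J_def B_def atMost_iff by simp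
      \<comment> \<open>The lower bound on the distribution function, stated for the complementary
        events.\<close>
      have lo: "measure (M n) {\<omega>\<in>space (M n). x < F n \<omega>} \<le> measure (gaussM (J n)) {z\<in>space (gaussM (J n)). x - \<delta> < V n z} + B n"
        using le[where Q="{x<..}" and T="{x - \<delta><..}"] unfolding F_def V_def J_def B_def greaterThan_iff by simp
      have mF: "F n \<in> borel_measurable (M n)" unfolding F_def by (rule measurable_spike_stat_rows[OF elim(7)])
      have c1: "measure (M n) {\<omega>\<in>space (M n). x < F n \<omega>} = 1 - measure (M n) {\<omega>\<in>space (M n). F n \<omega> \<le> x}"
        using mF by (subst prob_compl[symmetric]) (auto intro!: arg_cong[where f="measure _"])
      have c2: "measure (gaussM (J n)) {z\<in>space (gaussM (J n)). x - \<delta> < V n z} = 1 - measure (gaussM (J n)) {z\<in>space (gaussM (J n)). V n z \<le> x - \<delta>}"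
        using mV[of n] by (subst PJ.prob_compl[symmetric]) (auto intro!: arg_cong[where f="measure _"])
      show ?case using up lo elim(1-3) \<delta>(2,3) unfolding c1 c2 by linarith
    qed
  qed
  then show ?thesis unfolding F_def[symmetric] tendsto_iff dist_real_def by blast
qed

subsection \<open>Reduction of the sample covariance matrix\<close>

lemma dotp_orthonormal_sum:
  assumes V: "orthonormal p V" and b: "b < p"
  shows "dotp p (V b) (\<lambda>i. \<Sum>a<p. f a * V a i) = f b"
proof -
  have "dotp p (V b) (\<lambda>i. \<Sum>a<p. f a * V a i) = (\<Sum>i<p. \<Sum>a<p. f a * (V b i * V a i))"
    by (simp add: dotp_def sum_distrib_left mult_ac)
  also have "\<dots> = (\<Sum>a<p. f a * dotp p (V b) (V a))"
    by (subst sum.swap) (simp add: dotp_def sum_distrib_left)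
  also have "\<dots> = (\<Sum>a<p. if a = b then f b else 0)"
    using V b by (intro sum.cong refl) (auto simp: orthonormal_def)
  finally show ?thesis using b by simp
qed

text \<open>A linear combination of whitened coordinates is, for each observation \<open>t\<close>,
  a linear functional of \<open>X t\<close> with coefficients \<open>a t\<close> and variance
  \<open>Q t\<close>. The Cramer-Wold definition gives its characteristic function, and independence
  over \<open>t\<close> multiplies these to the standard normal one.\<close>

lemma whitened_sample_gauss:
  assumes M: "prob_space M" and S: "normal_sample M n p mu Sig X" and E: "eigensystem p Sig V \<phi>"
    and pos: "\<And>k. k < p \<Longrightarrow> 0 < \<phi> k"
  shows "gauss_family M ({..<p} \<times> {..<n}) (\<lambda>(k, t) \<omega>. (\<Sum>i<p. V k i * (X t \<omega> i - mu i)) / sqrt (\<phi> k))"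
proof (rule gauss_familyI_char[OF M])
  interpret prob_space M by fact
  let ?Z = "\<lambda>(k, t) \<omega>. (\<Sum>i<p. V k i * (X t \<omega> i - mu i)) / sqrt (\<phi> k)"
  have V: "orthonormal p V" using E by (simp add: eigensystem_def)
  have N: "mvnormal M p mu Sig (X t)" if "t < n" for t using S that by (simp add: normal_sample_def)
  have mX: "(\<lambda>\<omega>. X t \<omega> i) \<in> borel_measurable M" if "t < n" "i < p" for t i
    using N[OF that(1)] that(2) by (simp add: mvnormal_def)
  show "finite ({..<p} \<times> {..<n})" by simp
  show "?Z i \<in> borel_measurable M" if "i \<in> {..<p} \<times> {..<n}" for i
    using that mX by (auto intro!: borel_measurable_divide borel_measurable_sum borel_measurable_times borel_measurable_diff)
  fix s :: "nat \<times> nat \<Rightarrow> real"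
  define a where "a t i = (\<Sum>k<p. (s (k, t) / sqrt (\<phi> k)) * V k i)" for t i
  define L where "L t \<omega> = (\<Sum>i<p. a t i * X t \<omega> i)" for t \<omega>
  define c where "c t = (\<Sum>i<p. a t i * mu i)" for t
  define Q where "Q t = (\<Sum>k<p. (s (k, t))\<^sup>2)" for t
  have Q0: "0 \<le> Q t" for t by (simp add: Q_def sum_nonneg)
  have quad: "quad_form p Sig (a t) = Q t" for t
  proof -
    have "quad_form p Sig (a t) = dotp p (a t) (mulv p Sig (a t))"
      by (simp add: quad_form_def dotp_def mulv_def sum_distrib_left mult_ac)
    also have "\<dots> = (\<Sum>k<p. \<phi> k * (dotp p (V k) (a t))\<^sup>2)" by (rule eigensystem_quadratic[OF E])
    also have "\<dots> = Q t" unfolding Q_def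
    proof (intro sum.cong refl)
      fix k assume "k \<in> {..<p}"
      then have k: "k < p" by simp
      have "dotp p (V k) (a t) = s (k, t) / sqrt (\<phi> k)"
        unfolding a_def by (rule dotp_orthonormal_sum[OF V k])
      then show "\<phi> k * (dotp p (V k) (a t))\<^sup>2 = (s (k, t))\<^sup>2" using pos[OF k] by (simp add: power_divide)
    qed
    finally show ?thesis .
  qed
  have split: "(\<Sum>i\<in>{..<p} \<times> {..<n}. s i * ?Z i \<omega>) = (\<Sum>t<n. L t \<omega> - c t)" for \<omega>
  proof -
    have "(\<Sum>i\<in>{..<p} \<times> {..<n}. s i * ?Z i \<omega>) = (\<Sum>k<p. \<Sum>t<n. s (k, t) * ((\<Sum>i<p. V k i * (X t \<omega> i - mu i)) / sqrt (\<phi> k)))"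
      by (simp add: sum.cartesian_product case_prod_beta)
    also have "\<dots> = (\<Sum>t<n. \<Sum>k<p. s (k, t) * ((\<Sum>i<p. V k i * (X t \<omega> i - mu i)) / sqrt (\<phi> k)))" by (rule sum.swap)
    also have "\<dots> = (\<Sum>t<n. \<Sum>k<p. \<Sum>i<p. s (k, t) / sqrt (\<phi> k) * V k i * (X t \<omega> i - mu i))"
      by (simp add: sum_distrib_left sum_divide_distrib mult_ac)
    also have "\<dots> = (\<Sum>t<n. \<Sum>i<p. \<Sum>k<p. s (k, t) / sqrt (\<phi> k) * V k i * (X t \<omega> i - mu i))"
      by (intro sum.cong refl sum.swap)
    also have "\<dots> = (\<Sum>t<n. \<Sum>i<p. a t i * (X t \<omega> i - mu i))" by (simp only: a_def sum_distrib_right)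
    also have "\<dots> = (\<Sum>t<n. L t \<omega> - c t)"
      by (simp only: L_def c_def right_diff_distrib sum_subtractf)
    finally show ?thesis .
  qed
  define Y where "Y t x = iexp ((\<Sum>i<p. a t i * x i) - c t)" for t and x :: "nat \<Rightarrow> real"
  have YL: "Y t (restrict (X t \<omega>) {..<p}) = iexp (L t \<omega> - c t)" for t \<omega>
    by (simp add: Y_def L_def)
  have mL: "L t \<in> borel_measurable M" if "t < n" for t
    unfolding L_def using mX[OF that] by (intro borel_measurable_sum borel_measurable_times) auto
  have "indep_vars (\<lambda>_. PiM {..<p} (\<lambda>_. borel)) (\<lambda>t \<omega>. restrict (X t \<omega>) {..<p}) {..<n}"
    using S by (simp add: normal_sample_def)
  then have "indep_vars (\<lambda>_. borel) (\<lambda>t \<omega>. Y t (restrict (X t \<omega>) {..<p})) {..<n}"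
    by (rule indep_vars_compose2) (unfold Y_def, measurable)
  then have ind: "indep_vars (\<lambda>_. borel) (\<lambda>t \<omega>. iexp (L t \<omega> - c t)) {..<n}" by (simp only: YL)
  have int: "integrable M (\<lambda>\<omega>. iexp (L t \<omega> - c t))" if "t < n" for t
    using mL[OF that] by (intro integrable_const_bound[where B=1]) (auto simp del: of_real_diff)
  \<comment> \<open>For \<open>a t = 0\<close> the definition of \<open>mvnormal\<close> says
    nothing, but then the functional is zero and \<open>Q t = 0\<close>.\<close>
  have one: "(CLINT \<omega>|M. iexp (L t \<omega> - c t)) = complex_of_real (exp (- Q t / 2))" if t: "t < n" for t
  proof (cases "\<exists>i<p. a t i \<noteq> 0")
    case True
    have "Q t \<noteq> 0"
    proof
      assume "Q t = 0"
      then have "s (k, t) = 0" if "k < p" for k using that by (auto simp: Q_def sum_nonneg_eq_0_iff)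
      then have "a t i = 0" for i by (simp add: a_def)
      then show False using True by simp
    qed
    then have Q: "0 < Q t" using Q0[of t] by simp
    have "distributed M lborel (L t) (normal_density (c t) (sqrt (Q t)))"
      using N[OF t] True unfolding mvnormal_def L_def[abs_def] c_def quad[symmetric] by blast
    from char_of_normal[OF this, of 1] Q
    have ch: "(CLINT \<omega>|M. iexp (L t \<omega>)) = iexp (c t) * complex_of_real (exp (- Q t / 2))" by simp
    have "iexp (L t \<omega> - c t) = iexp (- c t) * iexp (L t \<omega>)" for \<omega>
      by (simp add: exp_add[symmetric] algebra_simps)
    then have "(CLINT \<omega>|M. iexp (L t \<omega> - c t)) = iexp (- c t) * (CLINT \<omega>|M. iexp (L t \<omega>))" by (simp del: of_real_diff of_real_minus)
    also have "\<dots> = (iexp (- c t) * iexp (c t)) * complex_of_real (exp (- Q t / 2))" unfolding ch by (simp only: mult.assoc)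
    also have "iexp (- c t) * iexp (c t) = 1" by (simp add: exp_add[symmetric])
    finally show ?thesis by simp
  next
    case False
    then have "L t \<omega> = 0" "c t = 0" "quad_form p Sig (a t) = 0" for \<omega> by (auto simp: L_def c_def quad_form_def)
    then show ?thesis using quad[of t] by (simp add: prob_space)
  qed
  have "iexp (\<Sum>t<n. L t \<omega> - c t) = (\<Prod>t<n. iexp (L t \<omega> - c t))" for \<omega>
    by (simp only: of_real_sum sum_distrib_left exp_sum finite_lessThan)
  then have "(CLINT \<omega>|M. iexp (\<Sum>i\<in>{..<p} \<times> {..<n}. s i * ?Z i \<omega>)) = (CLINT \<omega>|M. (\<Prod>t<n. iexp (L t \<omega> - c t)))"
    by (simp only: split)
  also have "\<dots> = (\<Prod>t<n. CLINT \<omega>|M. iexp (L t \<omega> - c t))"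
    by (rule indep_vars_lebesgue_integral[OF finite_lessThan ind]) (simp add: int del: of_real_diff)
  also have "\<dots> = (\<Prod>t<n. complex_of_real (exp (- Q t / 2)))" by (intro prod.cong refl one) simp
  also have "\<dots> = complex_of_real (exp (\<Sum>t<n. - Q t / 2))" by (simp only: exp_sum finite_lessThan of_real_prod)
  also have "(\<Sum>t<n. - Q t / 2) = - (\<Sum>i\<in>{..<p} \<times> {..<n}. (s i)\<^sup>2) / 2"
  proof -
    have "(\<Sum>i\<in>{..<p} \<times> {..<n}. (s i)\<^sup>2) = (\<Sum>k<p. \<Sum>t<n. (s (k, t))\<^sup>2)"
      by (simp add: sum.cartesian_product case_prod_beta)
    also have "\<dots> = (\<Sum>t<n. Q t)" unfolding Q_def by (rule sum.swap)
    finally show ?thesis by (simp add: sum_negf sum_divide_distrib)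
  qed
  finally show "(CLINT \<omega>|M. iexp (\<Sum>i\<in>{..<p} \<times> {..<n}. s i * ?Z i \<omega>)) = complex_of_real (exp (- (\<Sum>i\<in>{..<p} \<times> {..<n}. (s i)\<^sup>2) / 2))" .
qed

text \<open>A Helmert matrix: its first row is constant, so the other rows annihilate the sample mean.\<close>

lemma centred_sum_products:
  fixes u v :: "nat \<Rightarrow> real"
  assumes H: "orthonormal n H" "\<And>s. 1 \<le> s \<Longrightarrow> s < n \<Longrightarrow> (\<Sum>t<n. H s t) = 0" and n: "0 < n"
  shows "(\<Sum>t<n. (u t - 1 / real n * (\<Sum>t<n. u t)) * (v t - 1 / real n * (\<Sum>t<n. v t))) =
    (\<Sum>s<n - 1. dotp n (H (Suc s)) u * dotp n (H (Suc s)) v)"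
proof -
  define c where "c w t = w t - 1 / real n * (\<Sum>t<n. w t)" for w :: "nat \<Rightarrow> real" and t
  have c0: "(\<Sum>t<n. c w t) = 0" for w using n by (simp add: c_def sum_subtractf)
  have c1: "dotp n (H s) (c w) = dotp n (H s) w" if "1 \<le> s" "s < n" for s w
  proof -
    have "dotp n (H s) (c w) = dotp n (H s) w - (\<Sum>t<n. H s t) * (1 / real n * (\<Sum>t<n. w t))"
      by (simp only: dotp_def c_def right_diff_distrib sum_subtractf sum_distrib_right)
    then show ?thesis using H(2)[OF that] by simp
  qed
  \<comment> \<open>The vector of ones is orthogonal to all rows but \<open>H 0\<close>, so it
    equals \<open>h\<close> times that row.\<close>
  define h where "h = dotp n (H 0) (\<lambda>_. 1)"
  have one: "1 = h * H 0 t" if t: "t < n" for t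
  proof -
    have "1 = (\<Sum>s<n. dotp n (H s) (\<lambda>_. 1) * H s t)" by (rule orthonormal_expand[OF H(1) t])
    also have "\<dots> = (\<Sum>s<n. if s = 0 then h * H 0 t else 0)"
      using H(2) by (intro sum.cong refl) (auto simp: h_def dotp_def)
    finally show ?thesis using n by simp
  qed
  have cc: "dotp n (H 0) (c w) = 0" for w
  proof -
    have "(\<Sum>t<n. c w t) = (\<Sum>t<n. h * (H 0 t * c w t))"
    proof (intro sum.cong refl)
      fix t assume "t \<in> {..<n}"
      then have "h * H 0 t = 1" using one by simp
      then show "c w t = h * (H 0 t * c w t)" by (simp only: mult.assoc[symmetric] mult_1)
    qed
    then have "h * dotp n (H 0) (c w) = 0" unfolding c0 by (simp add: dotp_def sum_distrib_left)
    moreover have "h \<noteq> 0" using one[OF n] by auto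
    ultimately show ?thesis by simp
  qed
  have "(\<Sum>t<n. c u t * c v t) = (\<Sum>s<n. dotp n (H s) (c u) * dotp n (H s) (c v))"
    using orthonormal_Parseval[OF H(1), of "c u" "c v"] by (simp only: dotp_def)
  also have "\<dots> = (\<Sum>s<Suc (n - 1). dotp n (H s) (c u) * dotp n (H s) (c v))" using n by simp
  also have "\<dots> = (\<Sum>s<n - 1. dotp n (H (Suc s)) (c u) * dotp n (H (Suc s)) (c v))"
    by (subst sum.lessThan_Suc_shift) (simp add: cc)
  also have "\<dots> = (\<Sum>s<n - 1. dotp n (H (Suc s)) u * dotp n (H (Suc s)) v)"
    by (intro sum.cong refl) (simp add: c1)
  finally show ?thesis by (simp only: c_def)
qed

text \<open>In the eigenbasis \<open>S\<close> becomes \<open>V' (Y Y') V\<close> up to a scalar.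
  The mean drops out because the Helmert rows in use sum to zero; \<open>Suc s\<close> skips row
  \<open>0\<close> and leaves \<open>n - 1\<close> columns.\<close>

lemma sample_cov_spiked_form:
  assumes n: "1 < n" and H: "orthonormal n H" "\<And>s. 1 \<le> s \<Longrightarrow> s < n \<Longrightarrow> (\<Sum>t<n. H s t) = 0"
    and V: "orthonormal p V" and pos: "\<And>k. k < p \<Longrightarrow> 0 < \<phi> k" and \<sigma>2: "0 < \<sigma>2" "\<And>k. d \<le> k \<Longrightarrow> k < p \<Longrightarrow> \<phi> k = \<sigma>2"
    and g: "\<And>k s. g (k, s) = (\<Sum>t<n. H (Suc s) t * ((\<Sum>i<p. V k i * (x t i - mu i)) / sqrt (\<phi> k)))"
    and ij: "i < p" "j < p"
  shows "sample_cov n x i j = \<sigma>2 / (real n - 1) *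
    (\<Sum>k<p. \<Sum>l<p. V k i * V l j * gram_mat (n - 1) (spiked_rows d (\<lambda>k. \<phi> k / \<sigma>2) g g) k l)"
proof -
  define Y where "Y = spiked_rows d (\<lambda>k. \<phi> k / \<sigma>2) g g"
  have sY: "sqrt (\<phi> k) * g (k, s) = sqrt \<sigma>2 * Y k s" if "k < p" for k s
    using \<sigma>2 that by (simp add: Y_def spiked_rows_def real_sqrt_divide)
  have proj: "dotp n (H (Suc s)) (\<lambda>t. x t i) = sqrt \<sigma>2 * (\<Sum>k<p. V k i * Y k s)" if i: "i < p" and s: "s < n - 1" for i s
  proof -
    have e: "x t i = mu i + (\<Sum>k<p. V k i * (sqrt (\<phi> k) * ((\<Sum>i<p. V k i * (x t i - mu i)) / sqrt (\<phi> k))))" for t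
    proof -
      have "x t i - mu i = (\<Sum>k<p. dotp p (V k) (\<lambda>i. x t i - mu i) * V k i)" by (rule orthonormal_expand[OF V i])
      also have "\<dots> = (\<Sum>k<p. V k i * (sqrt (\<phi> k) * ((\<Sum>i<p. V k i * (x t i - mu i)) / sqrt (\<phi> k))))"
      proof (intro sum.cong refl)
        fix k assume "k \<in> {..<p}"
        then have "sqrt (\<phi> k) \<noteq> 0" using pos[of k] by simp
        then show "dotp p (V k) (\<lambda>i. x t i - mu i) * V k i = V k i * (sqrt (\<phi> k) * ((\<Sum>i<p. V k i * (x t i - mu i)) / sqrt (\<phi> k)))"
          by (simp add: dotp_def)
      qed
      finally show ?thesis by simp
    qed
    define r where "r k t = (\<Sum>i<p. V k i * (x t i - mu i)) / sqrt (\<phi> k)" for k t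
    have "dotp n (H (Suc s)) (\<lambda>t. x t i) = (\<Sum>t<n. H (Suc s) t * (mu i + (\<Sum>k<p. V k i * (sqrt (\<phi> k) * r k t))))"
      unfolding dotp_def r_def by (subst e) (rule refl)
    also have "\<dots> = (\<Sum>t<n. H (Suc s) t) * mu i + (\<Sum>t<n. \<Sum>k<p. V k i * (sqrt (\<phi> k) * (H (Suc s) t * r k t)))"
      by (simp add: distrib_left sum.distrib sum_distrib_left sum_distrib_right mult_ac)
    also have "(\<Sum>t<n. H (Suc s) t) = 0" using H(2)[of "Suc s"] s by simp
    also have "0 * mu i + (\<Sum>t<n. \<Sum>k<p. V k i * (sqrt (\<phi> k) * (H (Suc s) t * r k t))) =
        (\<Sum>k<p. V k i * (sqrt (\<phi> k) * g (k, s)))"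
      by (subst sum.swap) (simp add: g r_def sum_distrib_left)
    also have "\<dots> = sqrt \<sigma>2 * (\<Sum>k<p. V k i * Y k s)"
      unfolding sum_distrib_left by (intro sum.cong refl) (simp add: sY)
    finally show ?thesis .
  qed
  have "sample_cov n x i j = 1 / (real n - 1) * (\<Sum>s<n - 1. dotp n (H (Suc s)) (\<lambda>t. x t i) * dotp n (H (Suc s)) (\<lambda>t. x t j))"
    unfolding sample_cov_def sample_mean_def using n by (subst centred_sum_products[OF H]) auto
  also have "(\<Sum>s<n - 1. dotp n (H (Suc s)) (\<lambda>t. x t i) * dotp n (H (Suc s)) (\<lambda>t. x t j)) =
     (\<Sum>s<n - 1. \<sigma>2 * (\<Sum>k<p. \<Sum>l<p. V k i * V l j * (Y k s * Y l s)))"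
  proof (intro sum.cong refl)
    fix s assume "s \<in> {..<n - 1}"
    then have s: "s < n - 1" by simp
    have "dotp n (H (Suc s)) (\<lambda>t. x t i) * dotp n (H (Suc s)) (\<lambda>t. x t j) =
        (sqrt \<sigma>2 * sqrt \<sigma>2) * ((\<Sum>k<p. V k i * Y k s) * (\<Sum>l<p. V l j * Y l s))"
      unfolding proj[OF ij(1) s] proj[OF ij(2) s] by (simp only: mult_ac)
    also have "\<dots> = \<sigma>2 * (\<Sum>k<p. \<Sum>l<p. V k i * V l j * (Y k s * Y l s))"
      using \<sigma>2 by (simp add: sum_product mult_ac)
    finally show "dotp n (H (Suc s)) (\<lambda>t. x t i) * dotp n (H (Suc s)) (\<lambda>t. x t j) =
        \<sigma>2 * (\<Sum>k<p. \<Sum>l<p. V k i * V l j * (Y k s * Y l s))" .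
  qed
  also have "\<dots> = \<sigma>2 * (\<Sum>k<p. \<Sum>l<p. V k i * V l j * gram_mat (n - 1) Y k l)"
  proof -
    have "(\<Sum>s<n - 1. \<Sum>k<p. \<Sum>l<p. V k i * V l j * (Y k s * Y l s)) = (\<Sum>k<p. \<Sum>s<n - 1. \<Sum>l<p. V k i * V l j * (Y k s * Y l s))"
      by (rule sum.swap)
    also have "\<dots> = (\<Sum>k<p. \<Sum>l<p. \<Sum>s<n - 1. V k i * V l j * (Y k s * Y l s))" by (intro sum.cong refl sum.swap)
    finally show ?thesis by (simp only: gram_mat_def sum_distrib_left[symmetric])
  qed
  finally show ?thesis by (simp add: Y_def)
qed

text \<open>Conjugation by an orthogonal matrix carries eigenvectors of \<open>B\<close> to
  eigenvectors of \<open>S\<close>, and a positive factor preserves the order of the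
  eigenvalues.\<close>

lemma eigs_desc_similar:
  assumes S: "\<And>i j. i < p \<Longrightarrow> j < p \<Longrightarrow> S i j = c * (\<Sum>k<p. \<Sum>l<p. V k i * V l j * B k l)"
    and V: "orthonormal p V" and c: "0 < c" and B: "symmetric_mat p B" and k: "k < p"
  shows "eigs_desc p S ! k = c * eigs_desc p B ! k"
proof -
  obtain U \<phi> where U: "eigensystem p B U \<phi>" using ex_eigensystem[OF B] by blast
  define W where "W k i = (\<Sum>a<p. U k a * V a i)" for k i
  have D: "dotp p (V b) (W k) = U k b" if "b < p" for b k
    unfolding W_def by (rule dotp_orthonormal_sum[OF V that])
  have "orthonormal p W"
  proof -
    have "dotp p (W k) (W l) = dotp p (U k) (U l)" for k l
      unfolding orthonormal_Parseval[OF V, of "W k"] dotp_def[of p "U k"] by (intro sum.cong refl) (simp add: D)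
    then show ?thesis using U by (simp add: eigensystem_def orthonormal_def)
  qed
  moreover have "mulv p S (W k) i = c * \<phi> k * W k i" if ki: "k < p" "i < p" for k i
  proof -
    have "mulv p S (W k) i = (\<Sum>j<p. c * (\<Sum>a<p. \<Sum>b<p. V a i * V b j * B a b) * W k j)"
      unfolding mulv_def using ki by (intro sum.cong refl) (simp add: S)
    also have "\<dots> = c * (\<Sum>j<p. \<Sum>a<p. \<Sum>b<p. V a i * (B a b * (V b j * W k j)))"
      by (simp add: sum_distrib_left sum_distrib_right mult_ac)
    also have "(\<Sum>j<p. \<Sum>a<p. \<Sum>b<p. V a i * (B a b * (V b j * W k j))) = (\<Sum>a<p. \<Sum>j<p. \<Sum>b<p. V a i * (B a b * (V b j * W k j)))"
      by (rule sum.swap)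
    also have "\<dots> = (\<Sum>a<p. \<Sum>b<p. \<Sum>j<p. V a i * (B a b * (V b j * W k j)))"
      by (intro sum.cong refl sum.swap)
    also have "\<dots> = (\<Sum>a<p. V a i * (\<Sum>b<p. B a b * dotp p (V b) (W k)))"
      by (simp only: dotp_def sum_distrib_left)
    also have "\<dots> = (\<Sum>a<p. V a i * mulv p B (U k) a)"
      unfolding mulv_def by (simp add: D)
    also have "\<dots> = (\<Sum>a<p. V a i * (\<phi> k * U k a))"
      using U ki by (simp add: eigensystem_def)
    also have "\<dots> = \<phi> k * W k i" by (simp add: W_def sum_distrib_left mult_ac)
    finally show ?thesis by (simp add: mult_ac)
  qed
  ultimately have "eigensystem p S W (\<lambda>k. c * \<phi> k)"
    using U c by (simp add: eigensystem_def)
  from eigs_desc_nth[OF this k] eigs_desc_nth[OF U k] show ?thesis by simp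
qed

lemma moment_smallest_tail:
  assumes "d < p"
  shows "moment_smallest l (p - d) p S = (\<Sum>k=d..<p. (eigs_desc p S ! k) ^ l) / real (p - d)"
proof -
  \<comment> \<open>The moment counts eigenvalues from \<open>1\<close>, the list from
    \<open>0\<close>.\<close>
  have "{p - (p - d) + 1..p} = {Suc d..<Suc p}" using assms by auto
  then show ?thesis unfolding moment_smallest_def
    by (simp only: sum.shift_bounds_Suc_ivl diff_Suc_1 times_divide_eq_left mult_1)
qed

lemma statistic_eq_spike_stat:
  assumes d: "d < p" "d < n" and c: "0 < c" and e: "\<And>k. k < p \<Longrightarrow> eigs_desc p S ! k = c * eigs_desc p B ! k"
  shows "(real n - real d - 1) * (moment_smallest 2 (p - d) p S / (moment_smallest 1 (p - d) p S)\<^sup>2 - 1) - (real p - real d)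
    = spike_stat d p (n - 1) B"
proof -
  define q where "q = real (p - d)"
  define A1 where "A1 = (\<Sum>k=d..<p. eigs_desc p B ! k)"
  define A2 where "A2 = (\<Sum>k=d..<p. (eigs_desc p B ! k)\<^sup>2)"
  have q: "0 < q" "real p - real d = q" using d by (auto simp: q_def)
  have N: "real n - real d - 1 = real (n - 1 - d)" using d by simp
  have m1: "moment_smallest 1 (p - d) p S = c * A1 / q"
    unfolding moment_smallest_tail[OF d(1)] A1_def q_def sum_distrib_left by (simp add: e)
  have m2: "moment_smallest 2 (p - d) p S = c\<^sup>2 * A2 / q"
    unfolding moment_smallest_tail[OF d(1)] A2_def q_def sum_distrib_left by (simp add: e power_mult_distrib)
  \<comment> \<open>The factor \<open>c\<close> cancels; if \<open>A1 = 0\<close>, both sides are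
    \<open>0\<close> by the convention on division.\<close>
  have "c\<^sup>2 * A2 / q / (c * A1 / q)\<^sup>2 = q * A2 / A1\<^sup>2"
    using c q(1) by (cases "A1 = 0") (auto simp: field_simps power2_eq_square)
  then show ?thesis unfolding m1 m2 q(2) N spike_stat_def A1_def[symmetric] A2_def[symmetric] q_def[symmetric] by simp
qed

theorem theorem1:
  fixes p :: "nat \<Rightarrow> nat"
    and M :: "nat \<Rightarrow> 'a measure"
    and X :: "nat \<Rightarrow> nat \<Rightarrow> 'a \<Rightarrow> nat \<Rightarrow> real"
    and mu :: "nat \<Rightarrow> nat \<Rightarrow> real"
    and Sig :: "nat \<Rightarrow> nat \<Rightarrow> nat \<Rightarrow> real"
    and d :: nat and sigma2 :: real
  assumes p_inf: "filterlim p at_top sequentially"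
    and prob: "\<And>n. prob_space (M n)"
    and posdef: "\<And>n. pos_def_mat (p n) (Sig n)"
    and sample: "\<And>n. normal_sample (M n) n (p n) (mu n) (Sig n) (X n)"
    and d_pos: "d \<ge> 1"
    and sigma2_pos: "sigma2 > 0"
    and spikes: "\<And>n. d < p n \<Longrightarrow>
        (\<forall>k<d. eigs_desc (p n) (Sig n) ! k > sigma2) \<and>
        (\<forall>k. d \<le> k \<and> k < p n \<longrightarrow> eigs_desc (p n) (Sig n) ! k = sigma2)"
    and spikes_inf: "\<And>k. 1 \<le> k \<Longrightarrow> k \<le> d \<Longrightarrow>
        filterlim (\<lambda>n. eigs_desc (p n) (Sig n) ! (k - 1)) at_top sequentially"
    and regime: "((\<lambda>n. real (p n) / real n) \<longlonglongrightarrow> 0) \<or>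
        (filterlim (\<lambda>n. real (p n) / real n) at_top sequentially \<and>
         ((\<lambda>n. real (p n) / (real n * sqrt (eigs_desc (p n) (Sig n) ! (d - 1)))) \<longlonglongrightarrow> 0))"
  shows "weak_conv_m
     (\<lambda>n. distr (M n) borel (\<lambda>\<omega>.
        let S = sample_cov n (\<lambda>t. X n t \<omega>) ;
            T = moment_smallest 2 (p n - d) (p n) S /
                  (moment_smallest 1 (p n - d) (p n) S)\<^sup>2 - 1
        in (real n - real d - 1) * T - (real (p n) - real d)))
     (density lborel (normal_density 1 2))"
proof -
  have "\<exists>V \<phi>. eigensystem (p n) (Sig n) V \<phi>" for n
    using posdef[of n] ex_eigensystem by (auto simp: pos_def_mat_def)
  then obtain V \<phi> where E: "\<And>n. eigensystem (p n) (Sig n) (V n) (\<phi> n)" by metis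
  \<comment> \<open>A Helmert matrix for each \<open>n\<close>: adapted to the single vector of
    ones, so that every row but row \<open>0\<close> is orthogonal to it.\<close>
  have "\<exists>H. orthonormal n H \<and> (\<forall>k<1::nat. \<forall>t. 1 \<le> t \<longrightarrow> t < n \<longrightarrow> dotp n (H t) (\<lambda>_. 1) = 0)" for n
    by (rule ex_orthonormal_adapted)
  then have "\<forall>n. \<exists>H. orthonormal n H \<and> (\<forall>k<1::nat. \<forall>t. 1 \<le> t \<longrightarrow> t < n \<longrightarrow> dotp n (H t) (\<lambda>_. 1) = 0)" by blast
  from choice[OF this] obtain H
    where HH: "\<forall>n. orthonormal n (H n) \<and> (\<forall>k<1::nat. \<forall>t. 1 \<le> t \<longrightarrow> t < n \<longrightarrow> dotp n (H n t) (\<lambda>_. 1) = 0)" ..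
  have H: "orthonormal n (H n)" for n using HH by blast
  have H': "dotp n (H n t) (\<lambda>_. 1) = 0" if "1 \<le> t" "t < n" for n t
    using HH that less_one[THEN iffD2, OF refl] by blast
  have Hsum: "(\<Sum>t<n. H n s t) = 0" if "1 \<le> s" "s < n" for n s using H'[OF that] by (simp add: dotp_def)
  define Z where "Z n = (\<lambda>(k, t) \<omega>. (\<Sum>i<p n. V n k i * (X n t \<omega> i - mu n i)) / sqrt (\<phi> n k))" for n
  \<comment> \<open>The whitened sample rotated by the Helmert rows \<open>1, ..., n - 1\<close>, as
    an array with \<open>n - 1\<close> columns.\<close>
  define g where "g n j \<omega> = (\<Sum>t<n. H n (Suc (snd j)) t * Z n (fst j, t) \<omega>)" for n and j :: "nat \<times> nat" and \<omega>
  define l where "l n k = \<phi> n k / sigma2" for n k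
  define e where "e n = eigs_desc (p n) (Sig n) ! (d - 1)" for n
  define F where "F n \<omega> = (let S = sample_cov n (\<lambda>t. X n t \<omega>);
            T = moment_smallest 2 (p n - d) (p n) S / (moment_smallest 1 (p n - d) (p n) S)\<^sup>2 - 1
        in (real n - real d - 1) * T - (real (p n) - real d))" for n \<omega>
  define G where "G n \<omega> = spike_stat d (p n) (n - 1) (gram_mat (n - 1) (spiked_rows d (l n) (\<lambda>i. g n i \<omega>) (\<lambda>i. g n i \<omega>)))" for n \<omega>
  \<comment> \<open>The factor \<open>2\<close> here and in the next line gives
    \<open>p n \<le> 2 * (p n - d)\<close> and \<open>n \<le> 2 * (n - 1 - d)\<close>, so that
    removing \<open>d\<close> changes the ratios by a bounded factor only.\<close>
  have evp: "\<forall>\<^sub>F n in sequentially. 2 * d < p n" by (rule eventually_compose_filterlim[OF eventually_gt_at_top p_inf])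
  have evn: "\<forall>\<^sub>F n in sequentially. 2 * d + 2 < n" by (rule eventually_gt_at_top)
  have \<phi>tail: "\<phi> n k = sigma2" if "d < p n" "d \<le> k" "k < p n" for n k
    using spikes[OF that(1)] that eigs_desc_nth[OF E that(3)] by auto
  have \<phi>head: "sigma2 < \<phi> n k" if "d < p n" "k < d" for n k
    using spikes[OF that(1)] that eigs_desc_nth[OF E, of k n] by auto
  have \<phi>pos: "0 < \<phi> n k" if "d < p n" "k < p n" for n k
    using \<phi>tail[of n k] \<phi>head[of n k] that sigma2_pos by (cases "k < d") auto
  have Zg: "gauss_family (M n) ({..<p n} \<times> {..<n}) (Z n)" if "d < p n" for n
    unfolding Z_def using prob sample E \<phi>pos[OF that] by (rule whitened_sample_gauss)
  have gg: "gauss_family (M n) ({..<p n} \<times> {..<n - 1}) (g n)" if "d < p n" for n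
    unfolding g_def[abs_def] using H[of n]
    by (intro gauss_family_rotate[OF Zg[OF that], where h="\<lambda>s. H n (Suc s)"]) (auto simp: orthonormal_def)
  have FG: "F n \<omega> = G n \<omega>" if "d < p n" "d < n" "1 < n" for n \<omega>
    unfolding F_def G_def Let_def
  proof (rule statistic_eq_spike_stat[OF that(1,2)])
    show "0 < sigma2 / (real n - 1)" using sigma2_pos that by simp
    show "eigs_desc (p n) (sample_cov n (\<lambda>t. X n t \<omega>)) ! k =
      sigma2 / (real n - 1) * eigs_desc (p n) (gram_mat (n - 1) (spiked_rows d (l n) (\<lambda>i. g n i \<omega>) (\<lambda>i. g n i \<omega>))) ! k" if k: "k < p n" for k
    proof (rule eigs_desc_similar[where V="V n"])
      show V: "orthonormal (p n) (V n)" using E by (simp add: eigensystem_def)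
      show "0 < sigma2 / (real n - 1)" by fact
      show "sample_cov n (\<lambda>t. X n t \<omega>) i j = sigma2 / (real n - 1) *
        (\<Sum>k<p n. \<Sum>m<p n. V n k i * V n m j * gram_mat (n - 1) (spiked_rows d (l n) (\<lambda>i. g n i \<omega>) (\<lambda>i. g n i \<omega>)) k m)"
        if "i < p n" "j < p n" for i j
        unfolding l_def
        by (rule sample_cov_spiked_form[OF \<open>1 < n\<close> H Hsum V \<phi>pos[OF \<open>d < p n\<close>] sigma2_pos \<phi>tail[OF \<open>d < p n\<close>], where mu="mu n"])
          (auto simp: g_def Z_def that)
    qed (rule symmetric_gram_mat, fact)
  qed
  have e_lim: "filterlim e at_top sequentially" unfolding e_def using d_pos by (intro spikes_inf) auto
  have e_pos: "\<forall>\<^sub>F n in sequentially. 0 < e n" using e_lim by (rule eventually_compose_filterlim[OF eventually_gt_at_top])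
  have inv_e: "(\<lambda>n. 1 / e n) \<longlonglongrightarrow> 0" by (rule real_tendsto_divide_at_top[OF tendsto_const e_lim])
  \<comment> \<open>In the first regime this is a product of two null sequences; in the second,
    \<open>1 / e n\<close> is split into two factors \<open>1 / sqrt (e n)\<close>.\<close>
  have pe: "(\<lambda>n. real (p n) / (real n * e n)) \<longlonglongrightarrow> 0"
    using regime
  proof
    assume "(\<lambda>n. real (p n) / real n) \<longlonglongrightarrow> 0"
    from tendsto_mult[OF this inv_e] show ?thesis by simp
  next
    assume "filterlim (\<lambda>n. real (p n) / real n) at_top sequentially \<and>
         ((\<lambda>n. real (p n) / (real n * sqrt (eigs_desc (p n) (Sig n) ! (d - 1)))) \<longlonglongrightarrow> 0)"
    then have A: "(\<lambda>n. real (p n) / (real n * sqrt (e n))) \<longlonglongrightarrow> 0" by (simp add: e_def)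
    have "(\<lambda>n. 1 / sqrt (e n)) \<longlonglongrightarrow> 0"
      by (rule real_tendsto_divide_at_top[OF tendsto_const filterlim_compose[OF sqrt_at_top e_lim]])
    from tendsto_mult[OF A this]
    have B: "(\<lambda>n. real (p n) / (real n * sqrt (e n)) * (1 / sqrt (e n))) \<longlonglongrightarrow> 0" by simp
    have "\<forall>\<^sub>F n in sequentially. real (p n) / (real n * sqrt (e n)) * (1 / sqrt (e n)) = real (p n) / (real n * e n)"
      using e_pos by eventually_elim (simp add: mult.assoc)
    with B show ?thesis by (rule Lim_transform_eventually)
  qed
  \<comment> \<open>The quantity splits into \<open>sigma2 / e n\<close>, small because the spikes
    diverge, and a term bounded by a multiple of \<open>p n / (n * e n)\<close>.\<close>
  have lamN: "(\<lambda>n. (real (n - 1) + real (p n - d)) / (e n / sigma2 * real (n - 1))) \<longlonglongrightarrow> 0"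
  proof (rule tendsto_sandwich[OF _ _ tendsto_const])
    have "(\<lambda>n. sigma2 * (1 / e n) + 2 * sigma2 * (real (p n) / (real n * e n))) \<longlonglongrightarrow> sigma2 * 0 + 2 * sigma2 * 0"
      by (intro tendsto_intros inv_e pe)
    then show "(\<lambda>n. sigma2 * (1 / e n) + 2 * sigma2 * (real (p n) / (real n * e n))) \<longlonglongrightarrow> 0" by simp
    show "\<forall>\<^sub>F n in sequentially. 0 \<le> (real (n - 1) + real (p n - d)) / (e n / sigma2 * real (n - 1))"
      using e_pos by eventually_elim (use sigma2_pos in auto)
    show "\<forall>\<^sub>F n in sequentially. (real (n - 1) + real (p n - d)) / (e n / sigma2 * real (n - 1)) \<le>
        sigma2 * (1 / e n) + 2 * sigma2 * (real (p n) / (real n * e n))"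
      using e_pos evn
    proof eventually_elim
      case (elim n)
      define N q where "N = real (n - 1)" and "q = real (p n - d)"
      have N: "0 < N" "real n \<le> 2 * N" and q: "q \<le> real (p n)" using elim by (auto simp: N_def q_def)
      have n0: "0 < real n" using elim by simp
      have "(N + q) / (e n / sigma2 * N) = sigma2 * (1 / e n) + sigma2 / e n * (q / N)"
        using N elim sigma2_pos by (simp add: field_simps)
      moreover have "sigma2 / e n * (q / N) \<le> sigma2 / e n * (2 * (real (p n) / real n))"
      proof (rule mult_left_mono)
        have "q / N \<le> real (p n) / (real n / 2)" using q N n0 by (intro frac_le) auto
        then show "q / N \<le> 2 * (real (p n) / real n)" by (simp add: mult.commute)
      qed (use elim sigma2_pos in simp)
      ultimately show ?case by (simp add: N_def q_def mult_ac)
    qed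
  qed
  \<comment> \<open>Each regime selects one orientation of the central limit theorem for Gram
    matrices.\<close>
  have reg: "((\<lambda>n. real (p n - d) / real (n - 1 - d)) \<longlonglongrightarrow> 0) \<or> ((\<lambda>n. real (n - 1 - d) / real (p n - d)) \<longlonglongrightarrow> 0)"
    using regime
  proof
    assume "(\<lambda>n. real (p n) / real n) \<longlonglongrightarrow> 0"
    then have A: "(\<lambda>n. 2 * (real (p n) / real n)) \<longlonglongrightarrow> 0" by (rule tendsto_mult_right_zero)
    have "\<forall>\<^sub>F n in sequentially. real (p n - d) / real (n - 1 - d) \<le> 2 * (real (p n) / real n)"
      using evn
    proof eventually_elim
      case (elim n)
      have "real n \<le> 2 * real (n - 1 - d)" using elim by linarith
      then have "real (p n - d) / real (n - 1 - d) \<le> real (p n) / (real n / 2)"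
        using elim by (intro frac_le) (auto simp del: of_nat_diff)
      then show ?case by (simp add: mult.commute)
    qed
    then have "(\<lambda>n. real (p n - d) / real (n - 1 - d)) \<longlonglongrightarrow> 0"
      by (intro tendsto_sandwich[OF _ _ tendsto_const A]) (auto simp del: of_nat_diff)
    then show ?thesis ..
  next
    assume "filterlim (\<lambda>n. real (p n) / real n) at_top sequentially \<and>
         ((\<lambda>n. real (p n) / (real n * sqrt (eigs_desc (p n) (Sig n) ! (d - 1)))) \<longlonglongrightarrow> 0)"
    then have "filterlim (\<lambda>n. real (p n) / real n) at_top sequentially" by (rule conjunct1)
    then have "(\<lambda>n. inverse (real (p n) / real n)) \<longlonglongrightarrow> 0" by (rule tendsto_inverse_0_at_top)
    then have "(\<lambda>n. real n / real (p n)) \<longlonglongrightarrow> 0" by simp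
    then have A: "(\<lambda>n. 2 * (real n / real (p n))) \<longlonglongrightarrow> 0" by (rule tendsto_mult_right_zero)
    have "\<forall>\<^sub>F n in sequentially. real (n - 1 - d) / real (p n - d) \<le> 2 * (real n / real (p n))"
      using evp
    proof eventually_elim
      case (elim n)
      have "real (p n) \<le> 2 * real (p n - d)" using elim by linarith
      then have "real (n - 1 - d) / real (p n - d) \<le> real n / (real (p n) / 2)"
        using elim by (intro frac_le) (auto simp del: of_nat_diff)
      then show ?case by (simp add: mult.commute)
    qed
    then have "(\<lambda>n. real (n - 1 - d) / real (p n - d)) \<longlonglongrightarrow> 0"
      by (intro tendsto_sandwich[OF _ _ tendsto_const A]) (auto simp del: of_nat_diff)
    then show ?thesis ..
  qed
  have Glim: "(\<lambda>n. measure (M n) {\<omega>\<in>space (M n). G n \<omega> \<le> x}) \<longlonglongrightarrow> cdf (density lborel (normal_density 1 2)) x" for x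
    unfolding G_def
  proof (rule spike_stat_limit[where lam="\<lambda>n. e n / sigma2", OF _ _ p_inf _ _ lamN reg])
    show "\<forall>\<^sub>F n in sequentially. gauss_family (M n) ({..<p n} \<times> {..<n - 1}) (g n)"
      using evp by eventually_elim (rule gg, simp)
    show "0 < d" using d_pos by simp
    show "filterlim (\<lambda>n. n - 1) at_top sequentially" by (rule filterlim_minus_const_nat_at_top)
    show "\<forall>\<^sub>F n in sequentially. 0 < e n / sigma2 \<and> (\<forall>k<d. e n / sigma2 \<le> l n k)"
      using e_pos evp
    proof eventually_elim
      case (elim n)
      have "e n = \<phi> n (d - 1)" unfolding e_def using elim d_pos by (intro eigs_desc_nth[OF E]) auto
      moreover have "\<phi> n (d - 1) \<le> \<phi> n k" if "k < d" for k
        using E[of n] that elim unfolding eigensystem_def by auto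
      ultimately show ?case using elim sigma2_pos by (auto simp: l_def divide_right_mono)
    qed
  qed
  \<comment> \<open>\<open>F n\<close> and \<open>G n\<close> are identified, and \<open>G n\<close>
    is known to be measurable, once \<open>n\<close> and \<open>p n\<close> exceed thresholds in
    \<open>d\<close>; this is enough for the limit.\<close>
  have "(\<lambda>n. cdf (distr (M n) borel (F n)) x) \<longlonglongrightarrow> cdf (density lborel (normal_density 1 2)) x" for x
  proof (rule Lim_transform_eventually[OF Glim])
    show "\<forall>\<^sub>F n in sequentially. measure (M n) {\<omega>\<in>space (M n). G n \<omega> \<le> x} = cdf (distr (M n) borel (F n)) x"
      using evp evn
    proof eventually_elim
      case (elim n)
      have "F n = G n" using elim FG[of n] by (auto simp: fun_eq_iff)
      moreover have "G n \<in> borel_measurable (M n)"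
        unfolding G_def[abs_def] using elim by (intro measurable_spike_stat_rows gg) simp
      ultimately show ?case
        unfolding cdf_def by (subst measure_distr) (auto intro!: arg_cong[where f="measure _"])
    qed
  qed
  then have "weak_conv_m (\<lambda>n. distr (M n) borel (F n)) (density lborel (normal_density 1 2))"
    unfolding weak_conv_m_def weak_conv_def by blast
  then show ?thesis unfolding F_def[abs_def] .
qed

end
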